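(* Let $\Bbbk$ be a commutative unital ring and let $(L,[-,-],\delta,P,\rho,\sigma,[[-,-]])$ be a double Lie $L$-bimodule. Then $(W=L\oplus Cyc(P),\{-,-\},\Delta)$, with the bracket $\{-,-\}$ and cobracket $\Delta$ described in the context, is a Lie bialgebra. If moreover $(L,[-,-],\delta,P,\rho,\sigma,[[-,-]])$ is an involutive double Lie $L$-bimodule, then $(W,\{-,-\},\Delta)$ is an involutive Lie bialgebra.
   Context: All modules are over $\Bbbk$ and $\otimes=\otimes_{\Bbbk}$. $\tau_{(12)}$ swaps the first two tensor factors; $\tau_{(123)}(x\otimes y\otimes z)=z\otimes x\otimes y$ and $\tau_{(132)}(x\otimes y\otimes z)=y\otimes z\otimes x$. Sweedler-type notation: $\delta(\alpha)=\delta(\alpha)^1\otimes\delta(\alpha)^2$, $[[m,n]]=[[m,n]]^1\otimes[[m,n]]^2$, etc. (sums implicit). **Lie bialgebras.** A Lie algebra is a module $L$ with $[-,-]:L\otimes L\to L$ satisfying $[-,-]\circ\tau_{(12)}=-[-,-]$ and the Jacobi identity $[-,-]\circ(\mathrm{Id}\otimes[-,-])\circ(\mathrm{Id}+\tau_{(123)}+\tau_{(123)}^2)=0$. A Lie coalgebra is a module with $\delta:L\to L\otimes L$ satisfying $\tau_{(12)}\circ\delta=-\delta$ and $(\mathrm{Id}+\tau_{(123)}+\tau_{(123)}^2)\circ(\mathrm{Id}\otimes\delta)\circ\delta=0$. A Lie bialgebra has both, with $\delta[v,w]=[\delta v,w]+[v,\delta w]$, where $[v,w\otimes u]=-[w\otimes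 u,v]=[v,w]\otimes u+w\otimes[v,u]$; it is involutive if $[-,-]\circ\delta=0$. **Double Lie algebras.** A double Lie bracket on a module $M$ is a linear map $[[-,-]]:M\otimes M\to M\otimes M$ with $[[m,n]]=-\tau_{(12)}[[n,m]]$ and $\langle m,[[n,p]]\rangle+\tau_{(123)}\langle n,[[p,m]]\rangle+\tau_{(132)}\langle p,[[m,n]]\rangle=0$, where $\langle m,n\otimes p\rangle=[[m,n]]^1\otimes[[m,n]]^2\otimes p$. **Quivers.** A $\Bbbk$-quiver $P$ is a set of objects $I$ and a $\Bbbk$-module $P(a,b)$ for each $(a,b)\in I\times I$; $P^{\oplus}=\bigoplus_{(a,b)}P(a,b)$. A double Lie bracket on a $\Bbbk$-quiver $P$ is a collection of maps $[[-,-]]_{a,b,c,d}:P(a,b)\otimes P(c,d)\to P(a,d)\otimes P(c,b)$, for $4$-tuples of pairwise distinct $a,b,c,d\in I$, such that the induced map $[[-,-]]:P^{\oplus}\otimes P^{\oplus}\to P^{\oplus}\otimes P^{\oplus}$ (declared zero when $a,b,c,d$ are not pairwise distinct) is a double Lie bracket. **Double Lie modules.** For a Lie algebra $L$, a left Lie $L$-module structure on $P$ is a collection of maps $\rho_{a,b}:L\otimes P(a,b)\to P(a,b)$ with $\rho_{a,b}([\alpha,\beta],m)=\rho_{a,b}(\alpha,\rho_{a,b}(\beta,m))-\rho_{a,b}(\beta,\rho_{a,b}(\alpha,m))$, inducing $\rho:L\otimes P^{\oplus}\to P^{\oplus}$; put $\overline\rho(m,\alpha)=-\rho(\alpha,m)$.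 If $P$ has a double Lie bracket, $(L,P)$ is a double Lie $L$-module if $[[-,-]]\circ\widetilde\rho=\widetilde\rho\circ(1\otimes[[-,-]])$ on $L\otimes P^{\oplus}\otimes P^{\oplus}$, where $\widetilde\rho=\rho\otimes1+(1\otimes\rho)\circ\tau_{(12)}$. **Double Lie comodules.** For a Lie coalgebra $(L,\delta)$, a left Lie $L$-comodule structure on $P$ is a collection $\sigma_{a,b}:P(a,b)\to L\otimes P(a,b)$ with $(\delta\otimes1)\sigma_{a,b}=(1\otimes\sigma_{a,b})\sigma_{a,b}-(\tau_{(12)}\otimes1)(1\otimes\sigma_{a,b})\sigma_{a,b}$, inducing $\sigma:P^{\oplus}\to L\otimes P^{\oplus}$; put $\overline\sigma=-\tau_{(12)}\circ\sigma:P^{\oplus}\to P^{\oplus}\otimes L$. If $P$ has a double Lie bracket, $(L,P)$ is a double Lie $L$-comodule if $\widetilde\sigma\circ[[-,-]]=(1\otimes[[-,-]])\circ\widetilde\sigma$, where $\widetilde\sigma=\sigma\otimes1+\tau_{(12)}\circ(1\otimes\sigma)$. **Lie bimodules.** For a Lie bialgebra $L$, a Lie $L$-bimodule structure on $P$ is a Lie $L$-module structure $\rho$ and a Lie $L$-comodule structure $\sigma$ with $\sigma(\rho(a,m))=([-,-]\otimes1-1\otimes\overline\rho\circ\tau_{(132)})(1\otimes\sigma)(a,m)+(1\otimes\rho)(\delta\otimes1)(a,m)$. It is involutive if in addition $\rho(\sigma(m))=0$ for all $m$. **Double Lie bimodules.** $(L,[-,-],\delta,P,\rho,\sigma,[[-,-]])$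 is an (involutive) double Lie $L$-bimodule if: (1) $(L,[-,-],\delta)$ is an (involutive) Lie bialgebra; (2) $(P,[[-,-]])$ is a double Lie algebra (double Lie bracket on the quiver $P$); (3) $(L,P)$ is a double Lie $L$-module; (4) $(L,P)$ is a double Lie $L$-comodule; (5) $\rho,\sigma$ form an (involutive) Lie $L$-bimodule structure on $P$; (6) for all $m,n\in P^{\oplus}$, $\big[\big[[[m,n]]^1,[[m,n]]^2\big]\big]=\rho(\sigma(n)^1,m)\otimes\sigma(n)^2+\overline\sigma(m)^1\otimes\overline\rho(n,\overline\sigma(m)^2)$. **The module $W$.** $Cyc(P)=\bigoplus_{n\ge1}\bigoplus_{\{a_1,\dots,a_{2n}\in I\,|\,a_i\ne a_j\}}P(a_1,a_2)\otimes P(a_3,a_4)\otimes\cdots\otimes P(a_{2n-1},a_{2n})/\!\sim$, where $\sim$ is the relation $(f_1,\dots,f_n)\sim(f_n,f_1,\dots,f_{n-1})$. $W=L\oplus Cyc(P)$; $(\alpha;f_1,\dots,f_n)$ denotes $\alpha\in L$ plus the cyclic word $(f_1,\dots,f_n)$. Indices of letters in a word are cyclic, and "$f_{i+1},\dots,f_{i-1}$" lists all letters other than $f_i$ in cyclic order starting after $f_i$. Bracket: $$\{(\alpha;f_1,\dots,f_n),(\beta;g_1,\dots,g_m)\}=([\alpha,\beta];0)+\sum_{j=1}^m(0;g_1,\dots,\rho(\alpha,g_j),\dots,g_m)+\sum_{i=1}^n(0;f_1,\dots,\overline\rho(f_i,\beta),\dots,f_n)$$ $$+\sum_{i=1}^n\sum_{j=1}^m(0;[[f_i,g_j]]^1,g_{j+1},\dots,g_{j-1},[[f_i,g_j]]^2,f_{i+1},\dots,f_{i-1}).$$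 Cobracket: $$\Delta(\alpha;f_1,\dots,f_n)=(\delta(\alpha)^1;0)\otimes(\delta(\alpha)^2;0)$$ $$+\sum_{i=1}^n\Big[(\sigma(f_i)^1;0)\otimes(0;f_1,\dots,\sigma(f_i)^2,\dots,f_n)+(0;f_1,\dots,\overline\sigma(f_i)^1,\dots,f_n)\otimes(\overline\sigma(f_i)^2;0)\Big]$$ $$+\sum_{i<j}^n\Big[(0;[[f_i,f_j]]^2,f_{i+1},\dots,f_{j-1})\otimes(0;[[f_i,f_j]]^1,f_{j+1},\dots,f_{i-1})+(0;[[f_j,f_i]]^2,f_{j+1},\dots,f_{i-1})\otimes(0;[[f_j,f_i]]^1,f_{i+1},\dots,f_{j-1})\Big].$$
   Formalization: In Cyc(P) the condition a_i ≠ a_j is imposed only on cyclically neighbouring objects (a_1≠a_2≠…≠a_2n≠a_1), not on all pairs: with pairwise distinct objects the bracket can leave Cyc(P) and the compatibility of bracket and cobracket fails. *)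

theory Defs
  imports "HOL-Algebra.Module" "HOL-Algebra.AbelCoset"
begin

text \<open>
  Modules over a commutative ring \<open>R\<close> are those of \<^locale>\<open>module\<close>; the multiplicative
  fields \<open>mult\<close> and \<open>one\<close> of the module record play no role and are left \<open>undefined\<close>.
\<close>

section \<open>Linear algebra: linear maps, quotients, direct sums, tensor products\<close>

definition lin ::
  "'k ring \<Rightarrow> ('k, 'a) module \<Rightarrow> ('k, 'b) module \<Rightarrow> ('a \<Rightarrow> 'b) \<Rightarrow> bool" where
  "lin R M N f \<longleftrightarrow>
     f \<in> carrier M \<rightarrow> carrier N \<and>
     (\<forall>x\<in>carrier M. \<forall>y\<in>carrier M. f (x \<oplus>\<^bsub>M\<^esub> y) = f x \<oplus>\<^bsub>N\<^esub> f y) \<and>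
     (\<forall>r\<in>carrier R. \<forall>x\<in>carrier M. f (r \<odot>\<^bsub>M\<^esub> x) = r \<odot>\<^bsub>N\<^esub> f x)"

text \<open>A linear map out of a tensor product \<open>A \<otimes> B\<close> given by a formula on \<open>x \<otimes> y\<close>
  is rendered as a bilinear map.\<close>

definition bilin ::
  "'k ring \<Rightarrow> ('k, 'a) module \<Rightarrow> ('k, 'b) module \<Rightarrow> ('k, 'c) module \<Rightarrow> ('a \<Rightarrow> 'b \<Rightarrow> 'c) \<Rightarrow> bool"
  where
  "bilin R A B X f \<longleftrightarrow>
     (\<forall>x\<in>carrier A. lin R B X (f x)) \<and> (\<forall>y\<in>carrier B. lin R A X (\<lambda>x. f x y))"

definition submod_gen :: "'k ring \<Rightarrow> ('k, 'a) module \<Rightarrow> 'a set \<Rightarrow> 'a set" where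
  "submod_gen R M S = \<Inter>{N. submodule N R M \<and> S \<subseteq> N}"

definition quot_mod :: "('k, 'a) module \<Rightarrow> 'a set \<Rightarrow> ('k, 'a set) module" where
  "quot_mod M N =
     \<lparr>carrier = a_rcosets\<^bsub>M\<^esub> N, mult = undefined, one = undefined, zero = N,
      add = (\<lambda>A B. A <+>\<^bsub>M\<^esub> B), smult = (\<lambda>r A. \<Union>x\<in>A. N +>\<^bsub>M\<^esub> (r \<odot>\<^bsub>M\<^esub> x))\<rparr>"

definition dsum :: "'j set \<Rightarrow> ('j \<Rightarrow> ('k, 'a) module) \<Rightarrow> ('k, 'j \<Rightarrow> 'a) module" where
  "dsum J M =
     \<lparr>carrier = {f \<in> (\<Pi>\<^sub>E j\<in>J. carrier (M j)). finite {j \<in> J. f j \<noteq> \<zero>\<^bsub>M j\<^esub>}},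
      mult = undefined, one = undefined, zero = (\<lambda>j\<in>J. \<zero>\<^bsub>M j\<^esub>),
      add = (\<lambda>f g. \<lambda>j\<in>J. f j \<oplus>\<^bsub>M j\<^esub> g j), smult = (\<lambda>r f. \<lambda>j\<in>J. r \<odot>\<^bsub>M j\<^esub> f j)\<rparr>"

definition dinj :: "'j set \<Rightarrow> ('j \<Rightarrow> ('k, 'a) module) \<Rightarrow> 'j \<Rightarrow> 'a \<Rightarrow> 'j \<Rightarrow> 'a" where
  "dinj J M i x = (\<lambda>j\<in>J. if j = i then x else \<zero>\<^bsub>M j\<^esub>)"

text \<open>The linear map on a direct sum induced by linear maps \<open>h j : M j \<rightarrow> X\<close>.\<close>

definition dlift ::
  "('k, 'b) module \<Rightarrow> 'j set \<Rightarrow> ('j \<Rightarrow> ('k, 'a) module) \<Rightarrow> ('j \<Rightarrow> 'a \<Rightarrow> 'b) \<Rightarrow> ('j \<Rightarrow> 'a) \<Rightarrow> 'b"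
  where
  "dlift X J M h f = (\<Oplus>\<^bsub>X\<^esub>j\<in>{j \<in> J. f j \<noteq> \<zero>\<^bsub>M j\<^esub>}. h j (f j))"

definition free_mod :: "'k ring \<Rightarrow> 'x set \<Rightarrow> ('k, 'x \<Rightarrow> 'k) module" where
  "free_mod R S =
     \<lparr>carrier = {c. c \<in> S \<rightarrow> carrier R \<and> (\<forall>x. x \<notin> S \<longrightarrow> c x = \<zero>\<^bsub>R\<^esub>) \<and> finite {x. c x \<noteq> \<zero>\<^bsub>R\<^esub>}},
      mult = undefined, one = undefined, zero = (\<lambda>_. \<zero>\<^bsub>R\<^esub>),
      add = (\<lambda>c d x. c x \<oplus>\<^bsub>R\<^esub> d x), smult = (\<lambda>r c x. r \<otimes>\<^bsub>R\<^esub> c x)\<rparr>"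

definition free_gen :: "'k ring \<Rightarrow> 'x \<Rightarrow> 'x \<Rightarrow> 'k" where
  "free_gen R x = (\<lambda>y. if y = x then \<one>\<^bsub>R\<^esub> else \<zero>\<^bsub>R\<^esub>)"

definition free_ext ::
  "'k ring \<Rightarrow> ('k, 'a) module \<Rightarrow> ('x \<Rightarrow> 'a) \<Rightarrow> ('x \<Rightarrow> 'k) \<Rightarrow> 'a" where
  "free_ext R X f c = (\<Oplus>\<^bsub>X\<^esub>x\<in>{x. c x \<noteq> \<zero>\<^bsub>R\<^esub>}. c x \<odot>\<^bsub>X\<^esub> f x)"

text \<open>The tensor product \<open>M \<otimes> N\<close>: the free module on \<open>M \<times> N\<close> modulo bilinearity.\<close>

type_synonym ('k, 'a, 'b) tensor = "('a \<times> 'b \<Rightarrow> 'k) set"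

definition tensor_rel ::
  "'k ring \<Rightarrow> ('k, 'a) module \<Rightarrow> ('k, 'b) module \<Rightarrow> ('a \<times> 'b \<Rightarrow> 'k) set" where
  "tensor_rel R M N = (let F = free_mod R (carrier M \<times> carrier N); e = free_gen R in
     {e (x \<oplus>\<^bsub>M\<^esub> x', y) \<ominus>\<^bsub>F\<^esub> (e (x, y) \<oplus>\<^bsub>F\<^esub> e (x', y)) | x x' y.
        x \<in> carrier M \<and> x' \<in> carrier M \<and> y \<in> carrier N} \<union>
     {e (x, y \<oplus>\<^bsub>N\<^esub> y') \<ominus>\<^bsub>F\<^esub> (e (x, y) \<oplus>\<^bsub>F\<^esub> e (x, y')) | x y y'.
        x \<in> carrier M \<and> y \<in> carrier N \<and> y' \<in> carrier N} \<union>
     {e (r \<odot>\<^bsub>M\<^esub> x, y) \<ominus>\<^bsub>F\<^esub> (r \<odot>\<^bsub>F\<^esub> e (x, y)) | r x y.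
        r \<in> carrier R \<and> x \<in> carrier M \<and> y \<in> carrier N} \<union>
     {e (x, r \<odot>\<^bsub>N\<^esub> y) \<ominus>\<^bsub>F\<^esub> (r \<odot>\<^bsub>F\<^esub> e (x, y)) | r x y.
        r \<in> carrier R \<and> x \<in> carrier M \<and> y \<in> carrier N})"

definition tensor_ker ::
  "'k ring \<Rightarrow> ('k, 'a) module \<Rightarrow> ('k, 'b) module \<Rightarrow> ('a \<times> 'b \<Rightarrow> 'k) set" where
  "tensor_ker R M N =
     submod_gen R (free_mod R (carrier M \<times> carrier N)) (tensor_rel R M N)"

definition tensor_mod ::
  "'k ring \<Rightarrow> ('k, 'a) module \<Rightarrow> ('k, 'b) module \<Rightarrow> ('k, ('k, 'a, 'b) tensor) module" where
  "tensor_mod R M N = quot_mod (free_mod R (carrier M \<times> carrier N)) (tensor_ker R M N)"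

definition tens ::
  "'k ring \<Rightarrow> ('k, 'a) module \<Rightarrow> ('k, 'b) module \<Rightarrow> 'a \<Rightarrow> 'b \<Rightarrow> ('k, 'a, 'b) tensor" where
  "tens R M N x y =
     tensor_ker R M N +>\<^bsub>free_mod R (carrier M \<times> carrier N)\<^esub> free_gen R (x, y)"

text \<open>
  \<open>tlift R X f\<close> is the linear map \<open>M \<otimes> N \<rightarrow> X\<close> with \<open>x \<otimes> y \<mapsto> f x y\<close>; it does not depend on
  the chosen representative as soon as \<open>f\<close> is bilinear.  It renders Sweedler notation:
  an expression \<open>f t\<^sup>1 t\<^sup>2\<close> in the components of a tensor \<open>t\<close> (sum implicit) is \<open>tlift R X f t\<close>.
\<close>

definition tlift ::
  "'k ring \<Rightarrow> ('k, 'c) module \<Rightarrow> ('a \<Rightarrow> 'b \<Rightarrow> 'c) \<Rightarrow> ('k, 'a, 'b) tensor \<Rightarrow> 'c" where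
  "tlift R X f t = free_ext R X (\<lambda>(x, y). f x y) (SOME c. c \<in> t)"

text \<open>Triple tensor products are bracketed to the right.\<close>

definition tensor3 ::
  "'k ring \<Rightarrow> ('k, 'a) module \<Rightarrow> ('k, 'b) module \<Rightarrow> ('k, 'c) module \<Rightarrow>
     ('k, ('k, 'a, ('k, 'b, 'c) tensor) tensor) module" where
  "tensor3 R A B C = tensor_mod R A (tensor_mod R B C)"

definition tens3 ::
  "'k ring \<Rightarrow> ('k, 'a) module \<Rightarrow> ('k, 'b) module \<Rightarrow> ('k, 'c) module \<Rightarrow>
     'a \<Rightarrow> 'b \<Rightarrow> 'c \<Rightarrow> ('k, 'a, ('k, 'b, 'c) tensor) tensor" where
  "tens3 R A B C x y z = tens R A (tensor_mod R B C) x (tens R B C y z)"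

definition tlift3 ::
  "'k ring \<Rightarrow> ('k, 'd) module \<Rightarrow> ('a \<Rightarrow> 'b \<Rightarrow> 'c \<Rightarrow> 'd) \<Rightarrow>
     ('k, 'a, ('k, 'b, 'c) tensor) tensor \<Rightarrow> 'd" where
  "tlift3 R X f t = tlift R X (\<lambda>x s. tlift R X (\<lambda>y z. f x y z) s) t"

definition swap ::
  "'k ring \<Rightarrow> ('k, 'a) module \<Rightarrow> ('k, 'b) module \<Rightarrow> ('k, 'a, 'b) tensor \<Rightarrow> ('k, 'b, 'a) tensor"
  where
  "swap R M N t = tlift R (tensor_mod R N M) (\<lambda>x y. tens R N M y x) t"

definition tau123 ::
  "'k ring \<Rightarrow> ('k, 'a) module \<Rightarrow>
     ('k, 'a, ('k, 'a, 'a) tensor) tensor \<Rightarrow> ('k, 'a, ('k, 'a, 'a) tensor) tensor" where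
  "tau123 R M t = tlift3 R (tensor3 R M M M) (\<lambda>x y z. tens3 R M M M z x y) t"

definition tau132 ::
  "'k ring \<Rightarrow> ('k, 'a) module \<Rightarrow>
     ('k, 'a, ('k, 'a, 'a) tensor) tensor \<Rightarrow> ('k, 'a, ('k, 'a, 'a) tensor) tensor" where
  "tau132 R M t = tlift3 R (tensor3 R M M M) (\<lambda>x y z. tens3 R M M M y z x) t"

text \<open>The tensor product of a list of modules: the free module on the words \<open>[f\<^sub>1, \<dots>, f\<^sub>n]\<close>
  with \<open>f\<^sub>i\<close> in the \<open>i\<close>-th module, modulo multilinearity.\<close>

definition ltensor_words :: "('k, 'a) module list \<Rightarrow> 'a list set" where
  "ltensor_words Ms =
     {fs. length fs = length Ms \<and> (\<forall>i<length Ms. fs ! i \<in> carrier (Ms ! i))}"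

definition ltensor_rel :: "'k ring \<Rightarrow> ('k, 'a) module list \<Rightarrow> ('a list \<Rightarrow> 'k) set" where
  "ltensor_rel R Ms = (let F = free_mod R (ltensor_words Ms); e = free_gen R in
     {e (fs[i := x \<oplus>\<^bsub>Ms ! i\<^esub> y]) \<ominus>\<^bsub>F\<^esub> (e (fs[i := x]) \<oplus>\<^bsub>F\<^esub> e (fs[i := y])) | fs i x y.
        fs \<in> ltensor_words Ms \<and> i < length Ms \<and>
        x \<in> carrier (Ms ! i) \<and> y \<in> carrier (Ms ! i)} \<union>
     {e (fs[i := r \<odot>\<^bsub>Ms ! i\<^esub> x]) \<ominus>\<^bsub>F\<^esub> (r \<odot>\<^bsub>F\<^esub> e (fs[i := x])) | fs i r x.
        fs \<in> ltensor_words Ms \<and> i < length Ms \<and> r \<in> carrier R \<and> x \<in> carrier (Ms ! i)})"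

definition ltensor_ker :: "'k ring \<Rightarrow> ('k, 'a) module list \<Rightarrow> ('a list \<Rightarrow> 'k) set" where
  "ltensor_ker R Ms = submod_gen R (free_mod R (ltensor_words Ms)) (ltensor_rel R Ms)"

definition ltensor_mod ::
  "'k ring \<Rightarrow> ('k, 'a) module list \<Rightarrow> ('k, ('a list \<Rightarrow> 'k) set) module" where
  "ltensor_mod R Ms = quot_mod (free_mod R (ltensor_words Ms)) (ltensor_ker R Ms)"

definition ltens :: "'k ring \<Rightarrow> ('k, 'a) module list \<Rightarrow> 'a list \<Rightarrow> ('a list \<Rightarrow> 'k) set" where
  "ltens R Ms fs = ltensor_ker R Ms +>\<^bsub>free_mod R (ltensor_words Ms)\<^esub> free_gen R fs"

definition ltlift ::
  "'k ring \<Rightarrow> ('k, 'c) module \<Rightarrow> ('a list \<Rightarrow> 'c) \<Rightarrow> ('a list \<Rightarrow> 'k) set \<Rightarrow> 'c" where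
  "ltlift R X f t = free_ext R X f (SOME c. c \<in> t)"

definition prod_mod ::
  "('k, 'a) module \<Rightarrow> ('k, 'b) module \<Rightarrow> ('k, 'a \<times> 'b) module" where
  "prod_mod M N =
     \<lparr>carrier = carrier M \<times> carrier N, mult = undefined, one = undefined,
      zero = (\<zero>\<^bsub>M\<^esub>, \<zero>\<^bsub>N\<^esub>),
      add = (\<lambda>(x, y) (x', y'). (x \<oplus>\<^bsub>M\<^esub> x', y \<oplus>\<^bsub>N\<^esub> y')),
      smult = (\<lambda>r (x, y). (r \<odot>\<^bsub>M\<^esub> x, r \<odot>\<^bsub>N\<^esub> y))\<rparr>"


section \<open>Lie bialgebras\<close>

definition lie_algebra ::
  "'k ring \<Rightarrow> ('k, 'l) module \<Rightarrow> ('l \<Rightarrow> 'l \<Rightarrow> 'l) \<Rightarrow> bool" where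
  "lie_algebra R L br \<longleftrightarrow>
     module R L \<and> bilin R L L L br \<and>
     (\<forall>x\<in>carrier L. \<forall>y\<in>carrier L. br y x = \<ominus>\<^bsub>L\<^esub> br x y) \<and>
     (\<forall>x\<in>carrier L. \<forall>y\<in>carrier L. \<forall>z\<in>carrier L.
        br x (br y z) \<oplus>\<^bsub>L\<^esub> br z (br x y) \<oplus>\<^bsub>L\<^esub> br y (br z x) = \<zero>\<^bsub>L\<^esub>)"

text \<open>\<open>(Id \<otimes> \<delta>) \<circ> \<delta>\<close>\<close>

definition cobr2 ::
  "'k ring \<Rightarrow> ('k, 'l) module \<Rightarrow> ('l \<Rightarrow> ('k, 'l, 'l) tensor) \<Rightarrow>
     'l \<Rightarrow> ('k, 'l, ('k, 'l, 'l) tensor) tensor" where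
  "cobr2 R L \<delta> x =
     tlift R (tensor3 R L L L) (\<lambda>u v. tens R L (tensor_mod R L L) u (\<delta> v)) (\<delta> x)"

definition lie_coalgebra ::
  "'k ring \<Rightarrow> ('k, 'l) module \<Rightarrow> ('l \<Rightarrow> ('k, 'l, 'l) tensor) \<Rightarrow> bool" where
  "lie_coalgebra R L \<delta> \<longleftrightarrow>
     module R L \<and> lin R L (tensor_mod R L L) \<delta> \<and>
     (\<forall>x\<in>carrier L. swap R L L (\<delta> x) = \<ominus>\<^bsub>tensor_mod R L L\<^esub> \<delta> x) \<and>
     (\<forall>x\<in>carrier L.
        cobr2 R L \<delta> x \<oplus>\<^bsub>tensor3 R L L L\<^esub> tau123 R L (cobr2 R L \<delta> x)
          \<oplus>\<^bsub>tensor3 R L L L\<^esub> tau123 R L (tau123 R L (cobr2 R L \<delta> x)) = \<zero>\<^bsub>tensor3 R L L L\<^esub>)"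

text \<open>\<open>adj R L br v t\<close> is \<open>[v, t]\<close> for \<open>t \<in> L \<otimes> L\<close>; then \<open>[t, v] = - [v, t]\<close>.\<close>

definition adj ::
  "'k ring \<Rightarrow> ('k, 'l) module \<Rightarrow> ('l \<Rightarrow> 'l \<Rightarrow> 'l) \<Rightarrow> 'l \<Rightarrow> ('k, 'l, 'l) tensor \<Rightarrow> ('k, 'l, 'l) tensor"
  where
  "adj R L br v t =
     tlift R (tensor_mod R L L)
       (\<lambda>w u. tens R L L (br v w) u \<oplus>\<^bsub>tensor_mod R L L\<^esub> tens R L L w (br v u)) t"

definition lie_bialgebra ::
  "'k ring \<Rightarrow> ('k, 'l) module \<Rightarrow> ('l \<Rightarrow> 'l \<Rightarrow> 'l) \<Rightarrow> ('l \<Rightarrow> ('k, 'l, 'l) tensor) \<Rightarrow> bool" where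
  "lie_bialgebra R L br \<delta> \<longleftrightarrow>
     lie_algebra R L br \<and> lie_coalgebra R L \<delta> \<and>
     (\<forall>v\<in>carrier L. \<forall>w\<in>carrier L.
        \<delta> (br v w) =
          (\<ominus>\<^bsub>tensor_mod R L L\<^esub> adj R L br w (\<delta> v)) \<oplus>\<^bsub>tensor_mod R L L\<^esub> adj R L br v (\<delta> w))"

definition involutive_lie_bialgebra ::
  "'k ring \<Rightarrow> ('k, 'l) module \<Rightarrow> ('l \<Rightarrow> 'l \<Rightarrow> 'l) \<Rightarrow> ('l \<Rightarrow> ('k, 'l, 'l) tensor) \<Rightarrow> bool" where
  "involutive_lie_bialgebra R L br \<delta> \<longleftrightarrow>
     lie_bialgebra R L br \<delta> \<and> (\<forall>x\<in>carrier L. tlift R L br (\<delta> x) = \<zero>\<^bsub>L\<^esub>)"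


section \<open>Double Lie brackets on modules and quivers\<close>

definition dbl_angle ::
  "'k ring \<Rightarrow> ('k, 'm) module \<Rightarrow> ('m \<Rightarrow> 'm \<Rightarrow> ('k, 'm, 'm) tensor) \<Rightarrow>
     'm \<Rightarrow> ('k, 'm, 'm) tensor \<Rightarrow> ('k, 'm, ('k, 'm, 'm) tensor) tensor" where
  "dbl_angle R M D m t =
     tlift R (tensor3 R M M M)
       (\<lambda>n p. tlift R (tensor3 R M M M) (\<lambda>u v. tens3 R M M M u v p) (D m n)) t"

definition double_lie_bracket ::
  "'k ring \<Rightarrow> ('k, 'm) module \<Rightarrow> ('m \<Rightarrow> 'm \<Rightarrow> ('k, 'm, 'm) tensor) \<Rightarrow> bool" where
  "double_lie_bracket R M D \<longleftrightarrow>
     module R M \<and> bilin R M M (tensor_mod R M M) D \<and>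
     (\<forall>m\<in>carrier M. \<forall>n\<in>carrier M. D m n = \<ominus>\<^bsub>tensor_mod R M M\<^esub> swap R M M (D n m)) \<and>
     (\<forall>m\<in>carrier M. \<forall>n\<in>carrier M. \<forall>p\<in>carrier M.
        dbl_angle R M D m (D n p)
          \<oplus>\<^bsub>tensor3 R M M M\<^esub> tau123 R M (dbl_angle R M D n (D p m))
          \<oplus>\<^bsub>tensor3 R M M M\<^esub> tau132 R M (dbl_angle R M D p (D m n)) = \<zero>\<^bsub>tensor3 R M M M\<^esub>)"

text \<open>
  A quiver has object set \<open>I\<close> and modules \<open>P (a, b)\<close>.  That all \<open>P (a, b)\<close> share the element type
  \<open>'p\<close> is no restriction: operations and carriers may vary with \<open>(a, b)\<close>.
\<close>

definition quiver :: "'k ring \<Rightarrow> 'i set \<Rightarrow> ('i \<times> 'i \<Rightarrow> ('k, 'p) module) \<Rightarrow> bool" where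
  "quiver R I P \<longleftrightarrow> (\<forall>e\<in>I \<times> I. module R (P e))"

definition qsum :: "'i set \<Rightarrow> ('i \<times> 'i \<Rightarrow> ('k, 'p) module) \<Rightarrow> ('k, 'i \<times> 'i \<Rightarrow> 'p) module" where
  "qsum I P = dsum (I \<times> I) P"

type_synonym ('k, 'i, 'p) dbl = "'i \<Rightarrow> 'i \<Rightarrow> 'i \<Rightarrow> 'i \<Rightarrow> 'p \<Rightarrow> 'p \<Rightarrow> ('k, 'p, 'p) tensor"

definition ind_dbl ::
  "'k ring \<Rightarrow> 'i set \<Rightarrow> ('i \<times> 'i \<Rightarrow> ('k, 'p) module) \<Rightarrow> ('k, 'i, 'p) dbl \<Rightarrow>
     ('i \<times> 'i \<Rightarrow> 'p) \<Rightarrow> ('i \<times> 'i \<Rightarrow> 'p) \<Rightarrow> ('k, 'i \<times> 'i \<Rightarrow> 'p, 'i \<times> 'i \<Rightarrow> 'p) tensor" where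
  "ind_dbl R I P D f g = (let Q = qsum I P; QQ = tensor_mod R Q Q; inj = dinj (I \<times> I) P in
     dlift QQ (I \<times> I) P (\<lambda>(a, b) m.
       dlift QQ (I \<times> I) P (\<lambda>(c, d) n.
         if distinct [a, b, c, d]
         then tlift R QQ (\<lambda>u v. tens R Q Q (inj (a, d) u) (inj (c, b) v)) (D a b c d m n)
         else \<zero>\<^bsub>QQ\<^esub>) g) f)"

definition double_lie_quiver ::
  "'k ring \<Rightarrow> 'i set \<Rightarrow> ('i \<times> 'i \<Rightarrow> ('k, 'p) module) \<Rightarrow> ('k, 'i, 'p) dbl \<Rightarrow> bool" where
  "double_lie_quiver R I P D \<longleftrightarrow>
     quiver R I P \<and>
     (\<forall>a\<in>I. \<forall>b\<in>I. \<forall>c\<in>I. \<forall>d\<in>I. distinct [a, b, c, d] \<longrightarrow>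
        bilin R (P (a, b)) (P (c, d)) (tensor_mod R (P (a, d)) (P (c, b))) (D a b c d)) \<and>
     double_lie_bracket R (qsum I P) (ind_dbl R I P D)"


section \<open>Double Lie modules, comodules and bimodules\<close>

definition lie_module ::
  "'k ring \<Rightarrow> ('k, 'l) module \<Rightarrow> ('l \<Rightarrow> 'l \<Rightarrow> 'l) \<Rightarrow> 'i set \<Rightarrow> ('i \<times> 'i \<Rightarrow> ('k, 'p) module) \<Rightarrow>
     ('i \<times> 'i \<Rightarrow> 'l \<Rightarrow> 'p \<Rightarrow> 'p) \<Rightarrow> bool" where
  "lie_module R L br I P \<rho> \<longleftrightarrow>
     lie_algebra R L br \<and> quiver R I P \<and>
     (\<forall>e\<in>I \<times> I. bilin R L (P e) (P e) (\<rho> e) \<and>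
        (\<forall>\<alpha>\<in>carrier L. \<forall>\<beta>\<in>carrier L. \<forall>m\<in>carrier (P e).
           \<rho> e (br \<alpha> \<beta>) m = \<rho> e \<alpha> (\<rho> e \<beta> m) \<ominus>\<^bsub>P e\<^esub> \<rho> e \<beta> (\<rho> e \<alpha> m)))"

definition ind_act ::
  "'i set \<Rightarrow> ('i \<times> 'i \<Rightarrow> 'l \<Rightarrow> 'p \<Rightarrow> 'p) \<Rightarrow> 'l \<Rightarrow> ('i \<times> 'i \<Rightarrow> 'p) \<Rightarrow> 'i \<times> 'i \<Rightarrow> 'p" where
  "ind_act I \<rho> \<alpha> f = (\<lambda>e\<in>I \<times> I. \<rho> e \<alpha> (f e))"

definition double_lie_module ::
  "'k ring \<Rightarrow> ('k, 'l) module \<Rightarrow> ('l \<Rightarrow> 'l \<Rightarrow> 'l) \<Rightarrow> 'i set \<Rightarrow> ('i \<times> 'i \<Rightarrow> ('k, 'p) module) \<Rightarrow>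
     ('i \<times> 'i \<Rightarrow> 'l \<Rightarrow> 'p \<Rightarrow> 'p) \<Rightarrow> ('k, 'i, 'p) dbl \<Rightarrow> bool" where
  "double_lie_module R L br I P \<rho> D \<longleftrightarrow>
     lie_module R L br I P \<rho> \<and> double_lie_quiver R I P D \<and>
     (let Q = qsum I P; QQ = tensor_mod R Q Q; act = ind_act I \<rho>; DD = ind_dbl R I P D in
      \<forall>\<alpha>\<in>carrier L. \<forall>m\<in>carrier Q. \<forall>n\<in>carrier Q.
        DD (act \<alpha> m) n \<oplus>\<^bsub>QQ\<^esub> DD m (act \<alpha> n) =
        tlift R QQ (\<lambda>u v. tens R Q Q (act \<alpha> u) v \<oplus>\<^bsub>QQ\<^esub> tens R Q Q u (act \<alpha> v)) (DD m n))"

definition lie_comodule ::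
  "'k ring \<Rightarrow> ('k, 'l) module \<Rightarrow> ('l \<Rightarrow> ('k, 'l, 'l) tensor) \<Rightarrow>
     'i set \<Rightarrow> ('i \<times> 'i \<Rightarrow> ('k, 'p) module) \<Rightarrow>
     ('i \<times> 'i \<Rightarrow> 'p \<Rightarrow> ('k, 'l, 'p) tensor) \<Rightarrow> bool" where
  "lie_comodule R L \<delta> I P \<sigma> \<longleftrightarrow>
     lie_coalgebra R L \<delta> \<and> quiver R I P \<and>
     (\<forall>e\<in>I \<times> I. lin R (P e) (tensor_mod R L (P e)) (\<sigma> e) \<and>
        (let T = tensor3 R L L (P e); t3 = tens3 R L L (P e);
             \<sigma>2 = (\<lambda>m. tlift R T (\<lambda>\<alpha> m'. tens R L (tensor_mod R L (P e)) \<alpha> (\<sigma> e m')) (\<sigma> e m))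
         in \<forall>m\<in>carrier (P e).
              tlift R T (\<lambda>\<alpha> m'. tlift R T (\<lambda>\<beta> \<gamma>. t3 \<beta> \<gamma> m') (\<delta> \<alpha>)) (\<sigma> e m) =
              \<sigma>2 m \<ominus>\<^bsub>T\<^esub> tlift3 R T (\<lambda>\<alpha> \<beta> m'. t3 \<beta> \<alpha> m') (\<sigma>2 m)))"

definition ind_coact ::
  "'k ring \<Rightarrow> ('k, 'l) module \<Rightarrow> 'i set \<Rightarrow> ('i \<times> 'i \<Rightarrow> ('k, 'p) module) \<Rightarrow>
     ('i \<times> 'i \<Rightarrow> 'p \<Rightarrow> ('k, 'l, 'p) tensor) \<Rightarrow>
     ('i \<times> 'i \<Rightarrow> 'p) \<Rightarrow> ('k, 'l, 'i \<times> 'i \<Rightarrow> 'p) tensor" where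
  "ind_coact R L I P \<sigma> f = (let Q = qsum I P; LQ = tensor_mod R L Q in
     dlift LQ (I \<times> I) P
       (\<lambda>e m. tlift R LQ (\<lambda>\<alpha> m'. tens R L Q \<alpha> (dinj (I \<times> I) P e m')) (\<sigma> e m)) f)"

definition double_lie_comodule ::
  "'k ring \<Rightarrow> ('k, 'l) module \<Rightarrow> ('l \<Rightarrow> ('k, 'l, 'l) tensor) \<Rightarrow>
     'i set \<Rightarrow> ('i \<times> 'i \<Rightarrow> ('k, 'p) module) \<Rightarrow>
     ('i \<times> 'i \<Rightarrow> 'p \<Rightarrow> ('k, 'l, 'p) tensor) \<Rightarrow> ('k, 'i, 'p) dbl \<Rightarrow> bool" where
  "double_lie_comodule R L \<delta> I P \<sigma> D \<longleftrightarrow>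
     lie_comodule R L \<delta> I P \<sigma> \<and> double_lie_quiver R I P D \<and>
     (let Q = qsum I P; QQ = tensor_mod R Q Q; T = tensor3 R L Q Q; t3 = tens3 R L Q Q;
          coact = ind_coact R L I P \<sigma>; DD = ind_dbl R I P D;
          co = (\<lambda>u v. tlift R T (\<lambda>\<alpha> u'. t3 \<alpha> u' v) (coact u)
                        \<oplus>\<^bsub>T\<^esub> tlift R T (\<lambda>\<alpha> v'. t3 \<alpha> u v') (coact v))
      in \<forall>m\<in>carrier Q. \<forall>n\<in>carrier Q.
           tlift R T co (DD m n) = tlift3 R T (\<lambda>\<alpha> u v. tens R L QQ \<alpha> (DD u v)) (co m n))"

text \<open>Here \<open>act_op\<close> and \<open>coact_op\<close> are the maps written with a bar in the literature.\<close>

definition act_op ::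
  "('k, 'm) module \<Rightarrow> ('l \<Rightarrow> 'm \<Rightarrow> 'm) \<Rightarrow> 'm \<Rightarrow> 'l \<Rightarrow> 'm" where
  "act_op M act m \<alpha> = \<ominus>\<^bsub>M\<^esub> act \<alpha> m"

definition coact_op ::
  "'k ring \<Rightarrow> ('k, 'l) module \<Rightarrow> ('k, 'm) module \<Rightarrow> ('m \<Rightarrow> ('k, 'l, 'm) tensor) \<Rightarrow>
     'm \<Rightarrow> ('k, 'm, 'l) tensor" where
  "coact_op R L M coact m = \<ominus>\<^bsub>tensor_mod R M L\<^esub> swap R L M (coact m)"

definition lie_bimodule ::
  "'k ring \<Rightarrow> ('k, 'l) module \<Rightarrow> ('l \<Rightarrow> 'l \<Rightarrow> 'l) \<Rightarrow> ('l \<Rightarrow> ('k, 'l, 'l) tensor) \<Rightarrow>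
     'i set \<Rightarrow> ('i \<times> 'i \<Rightarrow> ('k, 'p) module) \<Rightarrow>
     ('i \<times> 'i \<Rightarrow> 'l \<Rightarrow> 'p \<Rightarrow> 'p) \<Rightarrow> ('i \<times> 'i \<Rightarrow> 'p \<Rightarrow> ('k, 'l, 'p) tensor) \<Rightarrow> bool" where
  "lie_bimodule R L br \<delta> I P \<rho> \<sigma> \<longleftrightarrow>
     lie_bialgebra R L br \<delta> \<and> lie_module R L br I P \<rho> \<and> lie_comodule R L \<delta> I P \<sigma> \<and>
     (let Q = qsum I P; LQ = tensor_mod R L Q; act = ind_act I \<rho>; coact = ind_coact R L I P \<sigma> in
      \<forall>\<alpha>\<in>carrier L. \<forall>m\<in>carrier Q.
        coact (act \<alpha> m) =
          tlift R LQ (\<lambda>\<beta> m'. tens R L Q (br \<alpha> \<beta>) m' \<ominus>\<^bsub>LQ\<^esub> tens R L Q \<beta> (act_op Q act m' \<alpha>)) (coact m)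
          \<oplus>\<^bsub>LQ\<^esub> tlift R LQ (\<lambda>\<beta> \<gamma>. tens R L Q \<beta> (act \<gamma> m)) (\<delta> \<alpha>))"

definition involutive_lie_bimodule ::
  "'k ring \<Rightarrow> ('k, 'l) module \<Rightarrow> ('l \<Rightarrow> 'l \<Rightarrow> 'l) \<Rightarrow> ('l \<Rightarrow> ('k, 'l, 'l) tensor) \<Rightarrow>
     'i set \<Rightarrow> ('i \<times> 'i \<Rightarrow> ('k, 'p) module) \<Rightarrow>
     ('i \<times> 'i \<Rightarrow> 'l \<Rightarrow> 'p \<Rightarrow> 'p) \<Rightarrow> ('i \<times> 'i \<Rightarrow> 'p \<Rightarrow> ('k, 'l, 'p) tensor) \<Rightarrow> bool" where
  "involutive_lie_bimodule R L br \<delta> I P \<rho> \<sigma> \<longleftrightarrow>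
     lie_bimodule R L br \<delta> I P \<rho> \<sigma> \<and>
     (\<forall>m\<in>carrier (qsum I P).
        tlift R (qsum I P) (ind_act I \<rho>) (ind_coact R L I P \<sigma> m) = \<zero>\<^bsub>qsum I P\<^esub>)"

definition double_lie_bimodule ::
  "'k ring \<Rightarrow> ('k, 'l) module \<Rightarrow> ('l \<Rightarrow> 'l \<Rightarrow> 'l) \<Rightarrow> ('l \<Rightarrow> ('k, 'l, 'l) tensor) \<Rightarrow>
     'i set \<Rightarrow> ('i \<times> 'i \<Rightarrow> ('k, 'p) module) \<Rightarrow>
     ('i \<times> 'i \<Rightarrow> 'l \<Rightarrow> 'p \<Rightarrow> 'p) \<Rightarrow> ('i \<times> 'i \<Rightarrow> 'p \<Rightarrow> ('k, 'l, 'p) tensor) \<Rightarrow>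
     ('k, 'i, 'p) dbl \<Rightarrow> bool" where
  "double_lie_bimodule R L br \<delta> I P \<rho> \<sigma> D \<longleftrightarrow>
     lie_bialgebra R L br \<delta> \<and>
     double_lie_quiver R I P D \<and>
     double_lie_module R L br I P \<rho> D \<and>
     double_lie_comodule R L \<delta> I P \<sigma> D \<and>
     lie_bimodule R L br \<delta> I P \<rho> \<sigma> \<and>
     (let Q = qsum I P; QQ = tensor_mod R Q Q; act = ind_act I \<rho>; coact = ind_coact R L I P \<sigma>;
          DD = ind_dbl R I P D
      in \<forall>m\<in>carrier Q. \<forall>n\<in>carrier Q.
        tlift R QQ DD (DD m n) =
          tlift R QQ (\<lambda>\<alpha> n'. tens R Q Q (act \<alpha> m) n') (coact n)
          \<oplus>\<^bsub>QQ\<^esub> tlift R QQ (\<lambda>m' \<alpha>. tens R Q Q m' (act_op Q act n \<alpha>)) (coact_op R L Q coact m))"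

definition involutive_double_lie_bimodule ::
  "'k ring \<Rightarrow> ('k, 'l) module \<Rightarrow> ('l \<Rightarrow> 'l \<Rightarrow> 'l) \<Rightarrow> ('l \<Rightarrow> ('k, 'l, 'l) tensor) \<Rightarrow>
     'i set \<Rightarrow> ('i \<times> 'i \<Rightarrow> ('k, 'p) module) \<Rightarrow>
     ('i \<times> 'i \<Rightarrow> 'l \<Rightarrow> 'p \<Rightarrow> 'p) \<Rightarrow> ('i \<times> 'i \<Rightarrow> 'p \<Rightarrow> ('k, 'l, 'p) tensor) \<Rightarrow>
     ('k, 'i, 'p) dbl \<Rightarrow> bool" where
  "involutive_double_lie_bimodule R L br \<delta> I P \<rho> \<sigma> D \<longleftrightarrow>
     double_lie_bimodule R L br \<delta> I P \<rho> \<sigma> D \<and>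
     involutive_lie_bialgebra R L br \<delta> \<and>
     involutive_lie_bimodule R L br \<delta> I P \<rho> \<sigma>"


section \<open>Cyclic words and the bialgebra \<open>W = L \<oplus> Cyc(P)\<close>\<close>

text \<open>
  A word is a list of letters \<open>((a, b), f)\<close> with \<open>f \<in> P (a, b)\<close>; its index is the list
  \<open>[(a\<^sub>1, a\<^sub>2), (a\<^sub>3, a\<^sub>4), \<dots>]\<close> of its arrows.

  The side condition \<open>a\<^sub>i \<noteq> a\<^sub>j\<close> on indices is imposed for cyclically neighbouring
  \<open>a\<^sub>i, a\<^sub>j\<close> only, i.e. \<open>a\<^sub>1 \<noteq> a\<^sub>2 \<noteq> a\<^sub>3 \<noteq> \<dots> \<noteq> a\<^sub>2\<^sub>n \<noteq> a\<^sub>1\<close>.  It cannot be imposed for all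
  pairs \<open>i \<noteq> j\<close>: the bracket of two words which share an object has terms with repeated objects,
  and dropping these terms destroys the compatibility of bracket and cobracket.  The condition below
  is preserved by bracket and cobracket, and for infinite \<open>I\<close> the indices satisfying it are exactly
  those generated by the indices with pairwise distinct objects under the two operations.
\<close>

definition cyc_index :: "'i set \<Rightarrow> ('i \<times> 'i) list set" where
  "cyc_index I =
     {es. es \<noteq> [] \<and> set es \<subseteq> I \<times> I \<and>
        (\<forall>k<length es. fst (es ! k) \<noteq> snd (es ! k) \<and>
                       snd (es ! k) \<noteq> fst (es ! (Suc k mod length es)))}"

type_synonym ('i, 'p) letter = "('i \<times> 'i) \<times> 'p"
type_synonym ('k, 'i, 'p) cyc = "(('i \<times> 'i) list \<Rightarrow> ('p list \<Rightarrow> 'k) set) set"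

definition arrow_tensor ::
  "'k ring \<Rightarrow> ('i \<times> 'i \<Rightarrow> ('k, 'p) module) \<Rightarrow> ('i \<times> 'i) list \<Rightarrow>
     ('k, ('p list \<Rightarrow> 'k) set) module" where
  "arrow_tensor R P es = ltensor_mod R (map P es)"

definition word_sum ::
  "'k ring \<Rightarrow> 'i set \<Rightarrow> ('i \<times> 'i \<Rightarrow> ('k, 'p) module) \<Rightarrow>
     ('k, ('i \<times> 'i) list \<Rightarrow> ('p list \<Rightarrow> 'k) set) module" where
  "word_sum R I P = dsum (cyc_index I) (arrow_tensor R P)"

definition words :: "'i set \<Rightarrow> ('i \<times> 'i \<Rightarrow> ('k, 'p) module) \<Rightarrow> ('i, 'p) letter list set" where
  "words I P = {w. map fst w \<in> cyc_index I \<and> (\<forall>(e, f)\<in>set w. f \<in> carrier (P e))}"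

definition word_elt ::
  "'k ring \<Rightarrow> 'i set \<Rightarrow> ('i \<times> 'i \<Rightarrow> ('k, 'p) module) \<Rightarrow> ('i, 'p) letter list \<Rightarrow>
     ('i \<times> 'i) list \<Rightarrow> ('p list \<Rightarrow> 'k) set" where
  "word_elt R I P w =
     dinj (cyc_index I) (arrow_tensor R P) (map fst w) (ltens R (map (P \<circ> fst) w) (map snd w))"

definition cyc_ker ::
  "'k ring \<Rightarrow> 'i set \<Rightarrow> ('i \<times> 'i \<Rightarrow> ('k, 'p) module) \<Rightarrow>
     (('i \<times> 'i) list \<Rightarrow> ('p list \<Rightarrow> 'k) set) set" where
  "cyc_ker R I P =
     submod_gen R (word_sum R I P)
       {word_elt R I P w \<ominus>\<^bsub>word_sum R I P\<^esub> word_elt R I P (last w # butlast w) | w. w \<in> words I P}"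

definition cyc_mod ::
  "'k ring \<Rightarrow> 'i set \<Rightarrow> ('i \<times> 'i \<Rightarrow> ('k, 'p) module) \<Rightarrow> ('k, ('k, 'i, 'p) cyc) module" where
  "cyc_mod R I P = quot_mod (word_sum R I P) (cyc_ker R I P)"

definition cyc_word ::
  "'k ring \<Rightarrow> 'i set \<Rightarrow> ('i \<times> 'i \<Rightarrow> ('k, 'p) module) \<Rightarrow> ('i, 'p) letter list \<Rightarrow> ('k, 'i, 'p) cyc"
  where
  "cyc_word R I P w = cyc_ker R I P +>\<^bsub>word_sum R I P\<^esub> word_elt R I P w"

text \<open>The linear map out of \<open>Cyc(P)\<close> given by a rule \<open>F\<close> on words (multilinear and invariant under
  cyclic rotation).\<close>

definition cyc_lift ::
  "'k ring \<Rightarrow> 'i set \<Rightarrow> ('i \<times> 'i \<Rightarrow> ('k, 'p) module) \<Rightarrow> ('k, 'x) module \<Rightarrow>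
     (('i, 'p) letter list \<Rightarrow> 'x) \<Rightarrow> ('k, 'i, 'p) cyc \<Rightarrow> 'x" where
  "cyc_lift R I P X F x =
     dlift X (cyc_index I) (arrow_tensor R P)
       (\<lambda>es t. ltlift R X (\<lambda>fs. F (zip es fs)) t) (SOME c. c \<in> x)"

text \<open>\<open>between w i j\<close> lists the letters strictly after position \<open>i\<close> and strictly before position
  \<open>j\<close> in cyclic order; for \<open>i = j\<close> these are all letters but the \<open>i\<close>-th, starting after it.\<close>

definition between :: "'x list \<Rightarrow> nat \<Rightarrow> nat \<Rightarrow> 'x list" where
  "between w i j =
     (if i < j then drop (Suc i) (take j w) else drop (Suc i) w @ take j w)"

text \<open>\<open>h l\<^sup>1 l\<^sup>2\<close> in Sweedler notation for the double bracket \<open>l\<^sup>1 \<otimes> l\<^sup>2\<close> of two letters; it is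
  zero if the four objects are not pairwise distinct.\<close>

definition dbl_letters ::
  "'k ring \<Rightarrow> ('k, 'i, 'p) dbl \<Rightarrow> ('k, 'x) module \<Rightarrow>
     (('i, 'p) letter \<Rightarrow> ('i, 'p) letter \<Rightarrow> 'x) \<Rightarrow> ('i, 'p) letter \<Rightarrow> ('i, 'p) letter \<Rightarrow> 'x" where
  "dbl_letters R D X h l l' = (case (l, l') of (((a, b), m), ((c, d), n)) \<Rightarrow>
     if distinct [a, b, c, d]
     then tlift R X (\<lambda>u v. h ((a, d), u) ((c, b), v)) (D a b c d m n)
     else \<zero>\<^bsub>X\<^esub>)"

definition W_mod ::
  "'k ring \<Rightarrow> ('k, 'l) module \<Rightarrow> 'i set \<Rightarrow> ('i \<times> 'i \<Rightarrow> ('k, 'p) module) \<Rightarrow>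
     ('k, 'l \<times> ('k, 'i, 'p) cyc) module" where
  "W_mod R L I P = prod_mod L (cyc_mod R I P)"

definition bracket_words ::
  "'k ring \<Rightarrow> 'i set \<Rightarrow> ('i \<times> 'i \<Rightarrow> ('k, 'p) module) \<Rightarrow> ('k, 'i, 'p) dbl \<Rightarrow>
     ('i, 'p) letter list \<Rightarrow> ('i, 'p) letter list \<Rightarrow> ('k, 'i, 'p) cyc" where
  "bracket_words R I P D f g = (let C = cyc_mod R I P in
     \<Oplus>\<^bsub>C\<^esub>i\<in>{..<length f}. \<Oplus>\<^bsub>C\<^esub>j\<in>{..<length g}.
       dbl_letters R D C
         (\<lambda>u v. cyc_word R I P (u # between g j j @ v # between f i i)) (f ! i) (g ! j))"

definition act_word ::
  "'k ring \<Rightarrow> 'i set \<Rightarrow> ('i \<times> 'i \<Rightarrow> ('k, 'p) module) \<Rightarrow> ('i \<times> 'i \<Rightarrow> 'l \<Rightarrow> 'p \<Rightarrow> 'p) \<Rightarrow>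
     'l \<Rightarrow> ('i, 'p) letter list \<Rightarrow> ('k, 'i, 'p) cyc" where
  "act_word R I P \<rho> \<alpha> g =
     (\<Oplus>\<^bsub>cyc_mod R I P\<^esub>j\<in>{..<length g}.
        case g ! j of (e, x) \<Rightarrow> cyc_word R I P (g[j := (e, \<rho> e \<alpha> x)]))"

definition act_op_word ::
  "'k ring \<Rightarrow> 'i set \<Rightarrow> ('i \<times> 'i \<Rightarrow> ('k, 'p) module) \<Rightarrow> ('i \<times> 'i \<Rightarrow> 'l \<Rightarrow> 'p \<Rightarrow> 'p) \<Rightarrow>
     'l \<Rightarrow> ('i, 'p) letter list \<Rightarrow> ('k, 'i, 'p) cyc" where
  "act_op_word R I P \<rho> \<beta> f =
     (\<Oplus>\<^bsub>cyc_mod R I P\<^esub>i\<in>{..<length f}.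
        case f ! i of (e, x) \<Rightarrow> cyc_word R I P (f[i := (e, act_op (P e) (\<rho> e) x \<beta>)]))"

definition W_bracket ::
  "'k ring \<Rightarrow> ('k, 'l) module \<Rightarrow> ('l \<Rightarrow> 'l \<Rightarrow> 'l) \<Rightarrow> 'i set \<Rightarrow> ('i \<times> 'i \<Rightarrow> ('k, 'p) module) \<Rightarrow>
     ('i \<times> 'i \<Rightarrow> 'l \<Rightarrow> 'p \<Rightarrow> 'p) \<Rightarrow> ('k, 'i, 'p) dbl \<Rightarrow>
     'l \<times> ('k, 'i, 'p) cyc \<Rightarrow> 'l \<times> ('k, 'i, 'p) cyc \<Rightarrow> 'l \<times> ('k, 'i, 'p) cyc" where
  "W_bracket R L br I P \<rho> D = (\<lambda>(\<alpha>, x) (\<beta>, y). let C = cyc_mod R I P in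
     (br \<alpha> \<beta>,
      cyc_lift R I P C (act_word R I P \<rho> \<alpha>) y
      \<oplus>\<^bsub>C\<^esub> cyc_lift R I P C (act_op_word R I P \<rho> \<beta>) x
      \<oplus>\<^bsub>C\<^esub> cyc_lift R I P C (\<lambda>f. cyc_lift R I P C (\<lambda>g. bracket_words R I P D f g) y) x))"

definition cobracket_word ::
  "'k ring \<Rightarrow> ('k, 'l) module \<Rightarrow> 'i set \<Rightarrow> ('i \<times> 'i \<Rightarrow> ('k, 'p) module) \<Rightarrow>
     ('i \<times> 'i \<Rightarrow> 'p \<Rightarrow> ('k, 'l, 'p) tensor) \<Rightarrow> ('k, 'i, 'p) dbl \<Rightarrow> ('i, 'p) letter list \<Rightarrow>
     ('k, 'l \<times> ('k, 'i, 'p) cyc, 'l \<times> ('k, 'i, 'p) cyc) tensor" where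
  "cobracket_word R L I P \<sigma> D f =
     (let W = W_mod R L I P; WW = tensor_mod R W W;
          lie = (\<lambda>\<alpha>. (\<alpha>, \<zero>\<^bsub>cyc_mod R I P\<^esub>));
          word = (\<lambda>w. (\<zero>\<^bsub>L\<^esub>, cyc_word R I P w))
      in
      (\<Oplus>\<^bsub>WW\<^esub>i\<in>{..<length f}. case f ! i of (e, m) \<Rightarrow>
         tlift R WW (\<lambda>\<alpha> m'. tens R W W (lie \<alpha>) (word (f[i := (e, m')]))) (\<sigma> e m)
         \<oplus>\<^bsub>WW\<^esub>
         tlift R WW (\<lambda>m' \<alpha>. tens R W W (word (f[i := (e, m')])) (lie \<alpha>))
           (coact_op R L (P e) (\<sigma> e) m))
      \<oplus>\<^bsub>WW\<^esub>
      (\<Oplus>\<^bsub>WW\<^esub>i\<in>{..<length f}. \<Oplus>\<^bsub>WW\<^esub>j\<in>{i<..<length f}.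
         dbl_letters R D WW
           (\<lambda>u v. tens R W W (word (v # between f i j)) (word (u # between f j i))) (f ! i) (f ! j)
         \<oplus>\<^bsub>WW\<^esub>
         dbl_letters R D WW
           (\<lambda>u v. tens R W W (word (v # between f j i)) (word (u # between f i j))) (f ! j) (f ! i)))"

definition W_cobracket ::
  "'k ring \<Rightarrow> ('k, 'l) module \<Rightarrow> ('l \<Rightarrow> ('k, 'l, 'l) tensor) \<Rightarrow>
     'i set \<Rightarrow> ('i \<times> 'i \<Rightarrow> ('k, 'p) module) \<Rightarrow>
     ('i \<times> 'i \<Rightarrow> 'p \<Rightarrow> ('k, 'l, 'p) tensor) \<Rightarrow> ('k, 'i, 'p) dbl \<Rightarrow> 'l \<times> ('k, 'i, 'p) cyc \<Rightarrow>
     ('k, 'l \<times> ('k, 'i, 'p) cyc, 'l \<times> ('k, 'i, 'p) cyc) tensor" where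
  "W_cobracket R L \<delta> I P \<sigma> D = (\<lambda>(\<alpha>, x).
     let W = W_mod R L I P; WW = tensor_mod R W W; lie = (\<lambda>\<alpha>. (\<alpha>, \<zero>\<^bsub>cyc_mod R I P\<^esub>)) in
     tlift R WW (\<lambda>\<beta> \<gamma>. tens R W W (lie \<beta>) (lie \<gamma>)) (\<delta> \<alpha>)
     \<oplus>\<^bsub>WW\<^esub> cyc_lift R I P WW (cobracket_word R L I P \<sigma> D) x)"

end

theory Submission
 imports "HOL.Rat" "HOL-Library.Function_Algebras" Defs
begin

text \<open>Linear maps to \<open>Hom(R, \<rat>/\<int>)\<close> separate the points of every \<open>R\<close>-module, so an identity in a
tensor power of \<open>W\<close> may be tested on multilinear functions with values there, and these are
determined by their values on elements of \<open>L\<close> and on words of letters.  A word is encoded by a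
permutation \<open>s\<close> of slots having the word's positions as a cycle, and a labelling \<open>x\<close> of the slots by
letters.  A double bracket of the letters in slots \<open>i\<close> and \<open>j\<close> exchanges \<open>s i\<close> and \<open>s j\<close>: this joins
two cycles (the bracket of \<open>W\<close>) or splits one (the cobracket), so that both are instances of one
operation.  Twofold operations at four distinct slots commute up to sign, and those sharing a slot
obey the double Jacobi identity; where both slots coincide, condition (6) of a double Lie
bimodule turns the iterated double bracket into the terms that contain \<open>\<rho>\<close> and \<open>\<sigma>\<close>.  Every axiom for
\<open>W\<close> then reduces to rearranging a finite sum over tuples of slots.\<close>

text \<open>Two obstacles shape the argument. The ring is arbitrary and the modules may have
  torsion, so 2x = 0 or 3x = 0 gives nothing: each cancellation must be an explicit pairing or a sum
  over single cyclic orbits. And tensors are cosets with chosen representatives; their Sweedler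
  components can be handled as an actual list of pure tensors once a test function has moved
  everything into an abelian group. An additive map g from X to Q/Z induces the R-linear map sending
  x to the function s |-> g(s x). Hence it is enough that Q/Z separates the points of abelian
  groups, which follows from divisibility and Zorn's lemma. A word whose index violates the
  condition of \<open>cyc_index\<close> represents 0. The double bracket keeps the sources of its
  two arrows and exchanges their targets, while surgery exchanges the successors of the two slots.
  So the condition holds before a surgery exactly if it holds afterwards, both sides of a slot
  formula vanish together at bad indices, and the formulas are valid for every labelling. Surgery
  repeated at the same two slots restores the permutation; the terms that it produces balance those
  contributed by the L-components.\<close>

abbreviation (input) mzero ("0[_]") where "0[M] == \<zero>\<^bsub>M\<^esub>"
abbreviation (input) madd ("_ +[_] _" [65, 0, 66] 65) where "x +[M] y == x \<oplus>\<^bsub>M\<^esub> y"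
abbreviation (input) mneg ("-[_] _" [0, 81] 80) where "-[M] x == \<ominus>\<^bsub>M\<^esub> x"
abbreviation (input) mminus ("_ -[_] _" [65, 0, 66] 65) where "x -[M] y == x \<ominus>\<^bsub>M\<^esub> y"
abbreviation (input) mscale ("_ *[_] _" [70, 0, 71] 70) where "a *[M] x == a \<odot>\<^bsub>M\<^esub> x"

section \<open>The group Q/Z, and separation of points of abelian groups by maps into it\<close>

definition rat_eqv :: "rat => rat => bool" where
 "rat_eqv x y \<longleftrightarrow> x - y : \<int>"

quotient_type ratz = rat / rat_eqv
proof (rule equivpI)
 show "reflp rat_eqv" by (auto simp: reflp_def rat_eqv_def)
 show "symp rat_eqv"
  unfolding symp_def rat_eqv_def by (metis Ints_minus minus_diff_eq)
 show "transp rat_eqv"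
  unfolding transp_def rat_eqv_def
  using Ints_add by fastforce
qed

instantiation ratz :: ab_group_add
begin

lift_definition zero_ratz :: ratz is 0 .

lift_definition plus_ratz :: "ratz => ratz => ratz" is "(+)"
proof -
 fix a b c d :: rat assume "rat_eqv a b" "rat_eqv c d"
 then have "(a - b) + (c - d) : \<int>" by (auto simp: rat_eqv_def)
 then show "rat_eqv (a + c) (b + d)" by (simp add: rat_eqv_def algebra_simps)
qed

lift_definition uminus_ratz :: "ratz => ratz" is uminus
proof -
 fix a b :: rat assume "rat_eqv a b"
 then have "- (a - b) : \<int>" unfolding rat_eqv_def by (rule Ints_minus)
 then show "rat_eqv (- a) (- b)" by (simp add: rat_eqv_def)
qed

definition minus_ratz :: "ratz => ratz => ratz" where "minus_ratz a b = a + - b"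

instance
proof
 fix a b c :: ratz
 show "a + b + c = a + (b + c)" by transfer (simp add: rat_eqv_def)
 show "a + b = b + a" by transfer (simp add: rat_eqv_def)
 show "0 + a = a" by transfer (simp add: rat_eqv_def)
 show "- a + a = 0" by transfer (simp add: rat_eqv_def)
 show "a - b = a + - b" by (simp add: minus_ratz_def)
qed

end

lift_definition zscale :: "int => ratz => ratz" is "%k x. of_int k * x"
proof -
 fix k :: int and x y :: rat assume "rat_eqv x y"
 then have "of_int k * (x - y) : \<int>" unfolding rat_eqv_def by (intro Ints_mult) auto
 then show "rat_eqv (of_int k * x) (of_int k * y)"
  by (simp add: rat_eqv_def algebra_simps)
qed

lemma zscale_add_left: "zscale (k + l) x = zscale k x + zscale l x"
 by transfer (simp add: rat_eqv_def algebra_simps)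

lemma zscale_add_right: "zscale k (x + y) = zscale k x + zscale k y"
 by transfer (simp add: rat_eqv_def algebra_simps)

lemma zscale_mult: "zscale (k * l) x = zscale k (zscale l x)"
 by transfer (simp add: rat_eqv_def algebra_simps)

lemma zscale_1 [simp]: "zscale 1 x = x"
 by transfer (simp add: rat_eqv_def)

lemma zscale_0 [simp]: "zscale 0 x = 0"
 by transfer (simp add: rat_eqv_def)

lemma zscale_minus: "zscale (- k) x = - zscale k x"
 by transfer (simp add: rat_eqv_def)

text \<open>Divide a rational representative by \<open>m\<close>. Divisibility is the property of
  Q/Z on which the extension of partial characters rests.\<close>

lemma zscale_divisible:
 assumes "m ~= 0"
 shows "EX d. zscale m d = c"
proof -
 have "EX d. zscale m d = abs_ratz q" for q
  by (rule exI[of _ "abs_ratz (q / of_int m)"])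
   (use assms in "simp add: zscale.abs_eq")
 then show ?thesis by (metis Quotient3_abs_rep Quotient3_ratz)
qed

text \<open>The class of \<open>1/m\<close> is killed by \<open>m\<close> and is nonzero because m >
  1. It supplies a nonzero value that is consistent at an element of order \<open>m\<close>.\<close>

lemma zscale_torsion:
 assumes "m > 1"
 shows "EX d. zscale m d = 0 & d ~= 0"
proof (intro exI conjI)
 show "zscale m (abs_ratz (1 / of_int m)) = 0"
  using assms by (simp add: zscale.abs_eq zero_ratz.abs_eq ratz.abs_eq_iff rat_eqv_def)
 have "1 / of_int m ~: (\<int> :: rat set)"
 proof
  assume "1 / of_int m : (\<int> :: rat set)"
  then obtain k where "1 / of_int m = (of_int k :: rat)" by (auto elim: Ints_cases)
  then have "(of_int (k * m) :: rat) = of_int 1" using assms by (simp add: field_simps)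
  then have "k * m = 1" by (simp only: of_int_eq_iff)
  then have "m dvd 1" by (metis dvd_triv_right)
  then show False using assms by simp
 qed
 then show "abs_ratz (1 / of_int m) ~= 0"
  by (simp add: zero_ratz.abs_eq ratz.abs_eq_iff rat_eqv_def)
qed

text \<open>Additive maps from subgroups of \<open>X\<close> to Q/Z, encoded by their graphs: a
  subgroup of the product that is single-valued at 0, hence everywhere. With graphs, extension is
  inclusion and the union of a chain is again a partial character, as Zorn's lemma requires.\<close>

definition pchar :: "('x, 'm) ring_scheme => ('x \<times> ratz) set => bool" where
 "pchar X S \<longleftrightarrow>
  S <= carrier X \<times> UNIV & (0[X], 0) : S &
  (ALL a c b d. (a, c) : S --> (b, d) : S --> (a +[X] b, c + d) : S) &
  (ALL a c. (a, c) : S --> (-[X] a, - c) : S) &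
  (ALL c. (0[X], c) : S --> c = 0)"

lemma pchar_neg: "pchar X S ==> (a, c) : S ==> (-[X] a, - c) : S"
 unfolding pchar_def by blast

lemma pchar_zero: "pchar X S ==> (0[X], c) : S ==> c = 0"
 unfolding pchar_def by blast

context abelian_group
begin

lemma int_mult_0 [simp]: "[(0::int)] \<cdot> a = \<zero>"
 by (simp add: add_pow_def)

lemma pchar_unique:
 assumes S: "pchar G S" and "(a, c) : S" "(a, d) : S"
 shows "c = d"
proof -
 have a: "a : carrier G" using assms unfolding pchar_def by blast
 have "(\<ominus> a, - d) : S" using assms unfolding pchar_def by blast
 then have "(a \<oplus> \<ominus> a, c + - d) : S" using assms unfolding pchar_def by blast
 then have "(\<zero>, c - d) : S" using a by (simp add: r_neg)
 then show ?thesis using S unfolding pchar_def by auto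
qed

lemma pchar_scale:
 assumes S: "pchar G S" and ac: "(a, c) : S"
 shows "([(k::int)] \<cdot> a, zscale k c) : S"
proof (induction k rule: int_induct[where k = 0])
 have a: "a : carrier G" using assms unfolding pchar_def by blast
 { case base then show ?case using S unfolding pchar_def by simp }
 { case (step1 i)
  have "([i] \<cdot> a \<oplus> a, zscale i c + c) : S"
   using S ac step1 unfolding pchar_def by blast
  then show ?case using a by (simp add: add.int_pow_mult zscale_add_left) }
 { case (step2 i)
  have "(\<ominus> a, - c) : S" using S ac unfolding pchar_def by blast
  then have "([i] \<cdot> a \<oplus> \<ominus> a, zscale i c + - c) : S"
   using S step2 unfolding pchar_def by blast
  then show ?case using a
   by (simp add: add.int_pow_diff zscale_add_left zscale_minus add.int_pow_1
     zscale_add_left[of i "-1", simplified]) }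
qed

text \<open>The larger graph consists of the pairs \<open>a + k y\<close> with value
  \<open>c + k d\<close>. The condition on \<open>d\<close> makes it single-valued: if
  \<open>a + k y\<close> is 0, then \<open>k y\<close> is the negative of \<open>a\<close> and lies
  in the old domain, where its value is already fixed.\<close>

lemma pchar_extend:
 assumes S: "pchar G S" and y: "y : carrier G"
  and d: "!!k c. ([(k::int)] \<cdot> y, c) : S ==> zscale k d = c"
 shows "EX S'. pchar G S' & S <= S' & (y, d) : S'"
proof (intro exI conjI)
 let ?S = "{(a \<oplus> [k] \<cdot> y, c + zscale k d) | a c (k::int). (a, c) : S}"
 have car: "a : carrier G" if "(a, c) : S" for a c
  using S that unfolding pchar_def by blast
 show "S <= ?S"
 proof clarify
  fix a c assume ac: "(a, c) : S"
  show "EX a' c' k. (a, c) = (a' \<oplus> [(k::int)] \<cdot> y, c' + zscale k d) & (a', c') : S"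
   by (rule exI[of _ a], rule exI[of _ c], rule exI[of _ 0]) (use ac car in simp)
 qed
 have z: "(\<zero>, 0) : S" using S unfolding pchar_def by blast
 show "(y, d) : ?S"
  by (clarify, rule exI[of _ \<zero>], rule exI[of _ 0], rule exI[of _ 1])
   (use z y in "simp add: add.int_pow_1")
 show "pchar G ?S"
  unfolding pchar_def
 proof (intro conjI allI impI)
  show "?S <= carrier G \<times> UNIV" using car y by auto
  show "(\<zero>, 0) : ?S" using \<open>S <= ?S\<close> z by blast
 next
  fix a c b e assume "(a, c) : ?S" "(b, e) : ?S"
  then obtain a' c' k b' e' l where
   *: "a = a' \<oplus> [(k::int)] \<cdot> y" "c = c' + zscale k d" "(a', c') : S"
   "b = b' \<oplus> [(l::int)] \<cdot> y" "e = e' + zscale l d" "(b', e') : S" by blast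
  have "(a' \<oplus> b', c' + e') : S" using S * unfolding pchar_def by blast
  moreover have "a \<oplus> b = (a' \<oplus> b') \<oplus> [(k + l)] \<cdot> y"
   using * car y by (simp add: add.int_pow_mult a_ac)
  moreover have "c + e = (c' + e') + zscale (k + l) d"
   using * by (simp add: zscale_add_left algebra_simps)
  ultimately show "(a \<oplus> b, c + e) : ?S" by blast
 next
  fix a c assume "(a, c) : ?S"
  then obtain a' c' k where
   *: "a = a' \<oplus> [(k::int)] \<cdot> y" "c = c' + zscale k d" "(a', c') : S" by blast
  have "(\<ominus> a', - c') : S" using S * unfolding pchar_def by blast
  moreover have "\<ominus> a = \<ominus> a' \<oplus> [(- k)] \<cdot> y"
   using * car y by (simp add: add.int_pow_neg minus_add)
  moreover have "- c = - c' + zscale (- k) d" using * by (simp add: zscale_minus)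
  ultimately show "(\<ominus> a, - c) : ?S" by blast
 next
  fix c assume "(\<zero>, c) : ?S"
  then obtain a' c' k where
   *: "\<zero> = a' \<oplus> [(k::int)] \<cdot> y" "c = c' + zscale k d" "(a', c') : S" by blast
  have a': "a' : carrier G" by (rule car) fact
  have "\<ominus> a' = [k] \<cdot> y"
   using *(1) a' y by (metis add.int_pow_closed minus_equality a_comm)
  moreover have "(\<ominus> a', - c') : S" using S * unfolding pchar_def by blast
  ultimately have "zscale k d = - c'" using d by simp
  then show "c = 0" using * by simp
 qed
qed

text \<open>The integers k with \<open>k y\<close> in the domain form an ideal. If it is zero, any
  value is consistent and 0 is taken. Otherwise it is generated by its least positive element
  \<open>m\<close>, and dividing the value at \<open>m y\<close> by \<open>m\<close> gives the
  required \<open>d\<close>.\<close>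

lemma pchar_extend_ex:
 assumes S: "pchar G S" and y: "y : carrier G"
 shows "EX d. ALL k c. ([(k::int)] \<cdot> y, c) : S --> zscale k d = c"
proof (cases "EX k::int. k > 0 & [k] \<cdot> y : fst ` S")
 case False
 have "zscale k 0 = c" if kc: "([(k::int)] \<cdot> y, c) : S" for k c
 proof -
  have "~ k > 0" using False kc by force
  moreover have "~ k < 0"
  proof
   assume "k < 0"
   have "(\<ominus> ([k] \<cdot> y), - c) : S" using S kc unfolding pchar_def by blast
   then have "[(- k)] \<cdot> y : fst ` S" using y by (force simp: add.int_pow_neg)
   then show False using False \<open>k < 0\<close> by (metis neg_0_less_iff_less)
  qed
  ultimately have "k = 0" by linarith
  then show ?thesis using kc S unfolding pchar_def by auto
 qed
 then show ?thesis by blast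
next
 case True
 define P where "P n \<longleftrightarrow> 0 < n & [(int n)] \<cdot> y : fst ` S" for n
 have "EX n. P n" using True unfolding P_def by (metis of_nat_0_less_iff zero_less_imp_eq_int)
 then have L: "P (LEAST n. P n)" by (rule LeastI_ex)
 define m where "m = int (LEAST n. P n)"
 have m: "m > 0" "[m] \<cdot> y : fst ` S" using L unfolding P_def m_def by auto
 then obtain c where c: "([m] \<cdot> y, c) : S" by force
 obtain d where d: "zscale m d = c" using zscale_divisible[of m c] m by auto
 have "zscale k d = e" if ke: "([k] \<cdot> y, e) : S" for k e
 proof -
  have "([(k div m)] \<cdot> ([m] \<cdot> y), zscale (k div m) c) : S"
   by (rule pchar_scale[OF S c])
  then have 1: "([(m * (k div m))] \<cdot> y, zscale (k div m) c) : S"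
   using y by (simp add: add.int_pow_pow)
  then have "(\<ominus> ([(m * (k div m))] \<cdot> y), - zscale (k div m) c) : S"
   using S unfolding pchar_def by blast
  then have "([k] \<cdot> y \<oplus> \<ominus> ([(m * (k div m))] \<cdot> y), e + - zscale (k div m) c) : S"
   using S ke unfolding pchar_def by blast
  moreover have "[k] \<cdot> y \<oplus> \<ominus> ([(m * (k div m))] \<cdot> y) = [(k mod m)] \<cdot> y"
   using y add.int_pow_diff[of y k "m * (k div m)"] by (simp add: minus_mult_div_eq_mod)
  ultimately have mod: "[(k mod m)] \<cdot> y : fst ` S" by force
  have "k mod m = 0"
  proof (rule ccontr)
   assume "k mod m ~= 0"
   then have "0 < k mod m" using pos_mod_sign[OF m(1), of k] by (metis order_less_le)
   then have "P (nat (k mod m))" using mod unfolding P_def by simp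
   then have "(LEAST n. P n) \<le> nat (k mod m)" by (rule Least_le)
   then have "m \<le> k mod m" using \<open>0 < k mod m\<close> m_def by linarith
   then show False using pos_mod_bound[OF m(1), of k] by (metis leD)
  qed
  then have km: "m * (k div m) = k" using mult_div_mod_eq[of m k] by (metis add.right_neutral)
  have "e = zscale (k div m) c"
   by (rule pchar_unique[OF S ke]) (use 1 km in simp)
  also have "... = zscale (k div m * m) d" using d by (simp add: zscale_mult)
  finally show ?thesis using km by (simp add: mult.commute)
 qed
 then show ?thesis by blast
qed

text \<open>A nonzero value at \<open>x\<close> is prescribed on the subgroup generated by
  \<open>x\<close>, compatibly with the order of \<open>x\<close>; a maximal extension of this
  partial character is then defined everywhere.\<close>

lemma char_separates:
 assumes x: "x : carrier G" "x ~= \<zero>"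
 shows "EX g :: 'a => ratz. (ALL a:carrier G. ALL b:carrier G. g (a \<oplus> b) = g a + g b) & g x ~= 0"
proof -
 have triv: "pchar G {(\<zero>, 0)}"
  unfolding pchar_def by auto
 have "EX d. d ~= 0 & (ALL k c. ([(k::int)] \<cdot> x, c) : {(\<zero>, 0)} --> zscale k d = c)"
 proof (cases "EX k::nat. k > 0 & [(int k)] \<cdot> x = \<zero>")
  case False
  \<comment> \<open>For \<open>x\<close> of infinite order every nonzero value is consistent; an
    element of order two is merely a convenient one.\<close>
  obtain d where d: "zscale 2 d = 0" "d ~= 0" using zscale_torsion[of 2] by auto
  have "k = 0" if "[(k::int)] \<cdot> x = \<zero>" for k
  proof (rule ccontr)
   assume k: "k ~= 0"
   have "[(- k)] \<cdot> x = \<zero>" using that x by (simp add: add.int_pow_neg)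
   then have "[(int (nat \<bar>k\<bar>))] \<cdot> x = \<zero>" using that by (simp add: abs_if)
   then show False using False k by (metis zero_less_abs_iff zero_less_nat_eq)
  qed
  then show ?thesis using d by (intro exI[of _ d]) fastforce
 next
  case True
  define P where "P n \<longleftrightarrow> 0 < n & [(int n)] \<cdot> x = \<zero>" for n
  define m where "m = int (LEAST n. P n)"
  have L: "P (LEAST n. P n)" by (rule LeastI_ex) (use True P_def in auto)
  then have m: "m > 0" "[m] \<cdot> x = \<zero>" unfolding P_def m_def by auto
  have "m ~= 1" using m x by (auto simp: add.int_pow_1)
  then obtain d where d: "zscale m d = 0" "d ~= 0" using zscale_torsion[of m] m by force
  have "zscale k d = 0" if k: "[k] \<cdot> x = \<zero>" for k
  proof -
   have "[(m * (k div m))] \<cdot> x = \<zero>"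
    using m(2) x by (metis add.int_pow_pow add.int_pow_one)
   then have "[(k mod m)] \<cdot> x = \<zero>"
    using x k add.int_pow_diff[of x k "m * (k div m)"] by (simp add: minus_mult_div_eq_mod)
   have "k mod m = 0"
   proof (rule ccontr)
    assume "k mod m ~= 0"
    then have "0 < k mod m" using pos_mod_sign[OF m(1), of k] by (metis order_less_le)
    then have "P (nat (k mod m))" using \<open>[(k mod m)] \<cdot> x = \<zero>\<close> unfolding P_def by simp
    then have "(LEAST n. P n) \<le> nat (k mod m)" by (rule Least_le)
    then have "m \<le> k mod m" using \<open>0 < k mod m\<close> m_def by linarith
    then show False using pos_mod_bound[OF m(1), of k] by (metis leD)
   qed
   then have "k = k div m * m" using div_mult_mod_eq[of k m] by (metis add.right_neutral)
   then have "zscale k d = zscale (k div m) (zscale m d)" by (metis zscale_mult)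
   also have "... = 0" using zscale_add_right[of "k div m" 0 0] d by simp
   finally show ?thesis .
  qed
  then show ?thesis using d by (intro exI[of _ d]) auto
 qed
 then obtain d where d: "d ~= 0" "!!k c. ([(k::int)] \<cdot> x, c) : {(\<zero>, 0)} ==> zscale k d = c"
  by blast
 obtain S0 where S0: "pchar G S0" "(x, d) : S0"
  using pchar_extend[OF triv x(1) d(2)] by blast
 let ?A = "{S. pchar G S & S0 <= S}"
 have "EX M:?A. ALL S:?A. M <= S --> S = M"
 proof (rule subset_Zorn_nonempty)
  show "?A ~= {}" using S0 by blast
  fix C assume C: "C ~= {}" "subset.chain ?A C"
  have CA: "C <= ?A" using C(2) unfolding subset.chain_def by blast
  have tot: "S <= T | T <= S" if "S : C" "T : C" for S T
   using C(2) that unfolding subset.chain_def by blast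
  have pc: "pchar G S" if "S : C" for S using CA that by blast
  have "pchar G (\<Union>C)"
   unfolding pchar_def
  proof (intro conjI allI impI)
   show "\<Union>C <= carrier G \<times> UNIV" using pc unfolding pchar_def by blast
   show "(\<zero>, 0) : \<Union>C" using pc C(1) unfolding pchar_def by blast
  next
   fix a c b e assume "(a, c) : \<Union>C" "(b, e) : \<Union>C"
   then obtain S T where "S : C" "T : C" "(a, c) : S" "(b, e) : T" by blast
   then obtain U where "U : C" "(a, c) : U" "(b, e) : U" using tot by blast
   then show "(a \<oplus> b, c + e) : \<Union>C" using pc[of U] unfolding pchar_def by blast
  next
   fix a c assume "(a, c) : \<Union>C"
   then obtain S where "S : C" "(a, c) : S" by blast
   then have "(\<ominus> a, - c) : S" by (intro pchar_neg[OF pc])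
   then show "(\<ominus> a, - c) : \<Union>C" using \<open>S : C\<close> by (rule UnionI[rotated])
  next
   fix c assume "(\<zero>, c) : \<Union>C"
   then obtain S where "S : C" "(\<zero>, c) : S" by blast
   then show "c = 0" by (intro pchar_zero[OF pc])
  qed
  then show "\<Union>C : ?A" using CA C(1) by blast
 qed
 then obtain M where "M : ?A" and max: "ALL S:?A. M <= S --> S = M" ..
 then have M: "pchar G M" "S0 <= M" by simp_all
 have M3: "S = M" if "pchar G S" "M <= S" for S
  using max that M(2) by (metis (mono_tags, lifting) mem_Collect_eq subset_trans)
 \<comment> \<open>A maximal partial character is total, since it could otherwise be extended to
   \<open>y\<close>.\<close>
 have total: "EX c. (y, c) : M" if y: "y : carrier G" for y
 by (metis pchar_extend_ex M(1) y pchar_extend M3)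
 define g where "g y = (THE c. (y, c) : M)" for y
 have g: "g y = c" if "(y, c) : M" for y c
  unfolding g_def using that pchar_unique[OF M(1)] by (intro the_equality)
 show ?thesis
 proof (intro exI[of _ g] conjI ballI)
  show "g x ~= 0" using g S0 M(2) d(1) by blast
  fix a b assume "a : carrier G" "b : carrier G"
  then obtain c e where ce: "(a, c) : M" "(b, e) : M" using total by blast
  then have "(a \<oplus> b, c + e) : M" using M(1) unfolding pchar_def by blast
  then show "g (a \<oplus> b) = g a + g b" using ce by (simp add: g)
 qed
qed

end

section \<open>Linear maps\<close>

lemma moduleD:
 assumes "module R M"
 shows "cring R" "abelian_group M"
 using assms unfolding module_def by auto

lemma linI:
 assumes "!!x. x : carrier M ==> f x : carrier N"
  and "!!x y. x : carrier M ==> y : carrier M ==> f (x +[M] y) = f x +[N] f y"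
  and "!!r x. r : carrier R ==> x : carrier M ==> f (r *[M] x) = r *[N] f x"
 shows "lin R M N f"
 using assms unfolding lin_def by auto

lemma linD:
 assumes "lin R M N f"
 shows linC: "x : carrier M ==> f x : carrier N"
  and lin_add: "x : carrier M ==> y : carrier M ==> f (x +[M] y) = f x +[N] f y"
  and lin_smult: "r : carrier R ==> x : carrier M ==> f (r *[M] x) = r *[N] f x"
 using assms unfolding lin_def by auto

lemma lin_cong:
 assumes "module R M" "!!x. x : carrier M ==> f x = g x" "lin R M N f"
 shows "lin R M N g"
proof -
 interpret module R M by fact
 show ?thesis
  by (rule linI) (use assms linD[OF assms(3)] in "simp_all flip: assms(2)")
qed

lemma lin_zero:
 assumes "module R M" "module R N" "lin R M N f"
 shows "f 0[M] = 0[N]"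
proof -
 interpret M: module R M by fact
 interpret N: module R N by fact
 have "f (0[R] *[M] 0[M]) = 0[R] *[N] f 0[M]"
  by (rule lin_smult[OF assms(3)]) auto
 then show ?thesis using linC[OF assms(3)] by simp
qed

lemma lin_minus:
 assumes "module R M" "module R N" "lin R M N f" "x : carrier M"
 shows "f (-[M] x) = -[N] f x"
proof -
 interpret M: module R M by fact
 interpret N: module R N by fact
 note f = linD[OF assms(3)]
 have "f (-[M] x) +[N] f x = f (-[M] x +[M] x)" using f assms(4) by simp
 also have "... = 0[N]" using assms(4) lin_zero[OF assms(1-3)] by (simp add: M.M.l_neg)
 finally show ?thesis using f assms(4) by (metis M.M.a_inv_closed N.M.minus_equality)
qed

lemma lin_diff:
 assumes "module R M" "module R N" "lin R M N f" "x : carrier M" "y : carrier M"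
 shows "f (x -[M] y) = f x -[N] f y"
proof -
 interpret M: module R M by fact
 show ?thesis
  using assms lin_add[OF assms(3)] lin_minus[OF assms(1-3)]
  by (simp add: a_minus_def)
qed

lemma lin_finsum:
 assumes "module R M" "module R N" "lin R M N f" "finite A" "g : A \<rightarrow> carrier M"
 shows "f (finsum M g A) = finsum N (%i. f (g i)) A"
 using assms(4,5)
proof (induction A)
 interpret M: module R M by fact
 interpret N: module R N by fact
 note f = linD[OF assms(3)]
 { case empty show ?case using lin_zero[OF assms(1-3)] by simp }
 { case (insert a A)
  then have "g a : carrier M" "g : A \<rightarrow> carrier M" "(%i. f (g i)) : A \<rightarrow> carrier N"
   using f by (auto simp: Pi_iff)
  then show ?case using insert f M.M.finsum_closed by simp }
qed

lemma lin_comp: "lin R M N f ==> lin R N Q g ==> lin R M Q (%x. g (f x))"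
 unfolding lin_def by (auto simp: Pi_iff)

lemma lin_id: "lin R M M (%x. x)"
 unfolding lin_def by auto

lemma lin_plus:
 assumes "module R N" "lin R M N f" "lin R M N g"
 shows "lin R M N (%x. f x +[N] g x)"
proof -
 interpret N: module R N by fact
 note fg = linD[OF assms(2)] linD[OF assms(3)]
 show ?thesis
  by (rule linI) (simp_all add: fg N.M.a_ac N.smult_r_distr)
qed

lemma lin_uminus:
 assumes "module R N" "lin R M N f"
 shows "lin R M N (%x. -[N] f x)"
proof -
 interpret N: module R N by fact
 note f = linD[OF assms(2)]
 show ?thesis
  by (rule linI) (simp_all add: f N.M.minus_add N.smult_r_minus N.M.a_comm)
qed

lemma lin_subtract:
 assumes "module R N" "lin R M N f" "lin R M N g"
 shows "lin R M N (%x. f x -[N] g x)"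
 unfolding a_minus_def by (intro lin_plus lin_uminus assms)

lemma lin_const_zero:
 assumes "module R N"
 shows "lin R M N (%x. 0[N])"
proof -
 interpret N: module R N by fact
 show ?thesis by (rule linI) simp_all
qed

lemma lin_kernel_submodule:
 assumes "module R M" "module R N" "lin R M N f"
 shows "submodule {x : carrier M. f x = 0[N]} R M"
proof -
 interpret M: module R M by fact
 interpret N: module R N by fact
 note f = linD[OF assms(3)] lin_zero[OF assms] lin_minus[OF assms]
 show ?thesis by (rule M.submoduleI) (auto simp: f)
qed

section \<open>Submodules, spanning sets and quotients\<close>

lemma submod_gen_submodule:
 assumes "module R M" "S <= carrier M"
 shows "submodule (submod_gen R M S) R M"
proof -
 interpret module R M by fact
 have ex: "carrier M : {N. submodule N R M & S <= N}"
  using assms carrier_is_submodule by auto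
 show ?thesis
  unfolding submod_gen_def
 proof (rule submoduleI)
  show "\<Inter> {N. submodule N R M & S <= N} <= carrier M" using ex by blast
 qed (use submoduleE submodule.smult_closed in
    \<open>auto intro: submodule.smult_closed dest: submoduleE(4,5,6)
      simp: subgroup.one_closed[OF submodule.axioms(1), simplified]\<close>)
qed

lemma submod_gen_incl: "S <= submod_gen R M S"
 unfolding submod_gen_def by auto

lemma submod_gen_minimal: "submodule N R M ==> S <= N ==> submod_gen R M S <= N"
 unfolding submod_gen_def by auto

text \<open>Generation is phrased through submodules instead of linear combinations. An identity
  then extends from generators to the whole module as soon as the elements satisfying it form a
  submodule.\<close>

definition spans :: "'k ring => ('k, 'a) module => 'a set => bool" where
 "spans R M S \<longleftrightarrow> S <= carrier M & (ALL N. submodule N R M --> S <= N --> carrier M <= N)"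

lemma spans_eqI:
 assumes "module R M" "module R N" "spans R M S" "lin R M N f" "lin R M N g"
  and "!!x. x : S ==> f x = g x" "x : carrier M"
 shows "f x = g x"
proof -
 interpret M: module R M by fact
 interpret N: module R N by fact
 note f = linD[OF assms(4)] and g = linD[OF assms(5)]
 let ?K = "{x : carrier M. f x -[N] g x = 0[N]}"
 have "submodule ?K R M"
  by (rule lin_kernel_submodule[OF assms(1,2) lin_subtract[OF assms(2,4,5)]])
 moreover have "S <= ?K" using assms(3,6) f g unfolding spans_def
  by (auto simp: a_minus_def N.M.r_neg)
 ultimately have "x : ?K" using assms(3,7) unfolding spans_def by blast
 then have 0: "f x -[N] g x = 0[N]" by simp
 have "f x = (f x -[N] g x) +[N] g x"
  using f g assms(7) by (simp add: a_minus_def N.M.a_assoc N.M.l_neg)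
 then show ?thesis using f g assms(7) unfolding 0 by simp
qed

lemma submodule_quot_abelian_subgroup:
 assumes "module R M" "submodule N R M"
 shows "abelian_subgroup N M"
proof -
 interpret module R M by fact
 show ?thesis
  by (rule abelian_subgroupI3[OF additive_subgroupI M.abelian_group_axioms])
   (rule submodule.axioms(1)[OF assms(2)])
qed

lemma quot_carrier: "carrier (quot_mod M N) = (%x. N +>\<^bsub>M\<^esub> x) ` carrier M"
 unfolding quot_mod_def by (auto simp: A_RCOSETS_def')

context
 fixes R :: "'k ring" and M :: "('k, 'a) module" and N
 assumes M: "module R M" and N: "submodule N R M"
begin

interpretation M: module R M by (rule M)
interpretation N: abelian_subgroup N M by (rule submodule_quot_abelian_subgroup[OF M N])

lemma quot_add:
 "x : carrier M ==> y : carrier M ==>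
  (N +>\<^bsub>M\<^esub> x) +[quot_mod M N] (N +>\<^bsub>M\<^esub> y) = N +>\<^bsub>M\<^esub> (x +[M] y)"
 unfolding quot_mod_def by (simp add: N.a_rcos_sum)

lemma quot_eq_iff:
 assumes "x : carrier M" "y : carrier M"
 shows "N +>\<^bsub>M\<^esub> x = N +>\<^bsub>M\<^esub> y \<longleftrightarrow> x -[M] y : N"
by (metis assms N.a_repr_independence' N.a_rcos_self N.a_rcos_module a_minus_def)

end

context
 fixes R :: "'k ring" and M :: "('k, 'a) module" and N
 assumes M: "module R M" and N: "submodule N R M"
begin

interpretation M: module R M by (rule M)
interpretation N: abelian_subgroup N M by (rule submodule_quot_abelian_subgroup[OF M N])

text \<open>The scalar multiple in \<open>quot_mod\<close> is a union over all representatives of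
  the coset. They all yield the same coset, so the union collapses to it.\<close>

lemma quot_smult:
 assumes r: "r : carrier R" and x: "x : carrier M"
 shows "r *[quot_mod M N] (N +>\<^bsub>M\<^esub> x) = N +>\<^bsub>M\<^esub> (r *[M] x)"
proof -
 have "N +>\<^bsub>M\<^esub> (r *[M] y) = N +>\<^bsub>M\<^esub> (r *[M] x)" if y: "y : N +>\<^bsub>M\<^esub> x" for y
 proof -
  have yM: "y : carrier M" using N.a_elemrcos_carrier x y by blast
  have "y +[M] -[M] x : N" using N.a_rcos_module_imp x y by blast
  then have "r *[M] (y +[M] -[M] x) : N" using submodule.smult_closed[OF N] r by blast
  then show ?thesis using r x yM
   by (simp add: quot_eq_iff[OF M N] M.smult_r_distr M.smult_r_minus a_minus_def)
 qed
 then have "(\<Union>y\<in>N +>\<^bsub>M\<^esub> x. N +>\<^bsub>M\<^esub> (r *[M] y)) = (\<Union>y\<in>N +>\<^bsub>M\<^esub> x. N +>\<^bsub>M\<^esub> (r *[M] x))"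
  by (intro SUP_cong refl)
 also have "... = N +>\<^bsub>M\<^esub> (r *[M] x)" using N.a_rcos_self[OF x] by (intro UN_constant_eq) auto
 finally show ?thesis by (simp add: quot_mod_def)
qed

lemma quot_zero: "0[quot_mod M N] = N +>\<^bsub>M\<^esub> 0[M]"
 unfolding quot_mod_def by (simp add: M.M.a_coset_add_zero[OF N.a_subset])

lemma quot_module: "module R (quot_mod M N)"
proof (rule moduleI)
 show "cring R" by (rule M.R.cring_axioms)
 note [simp] = quot_add[OF M N] quot_smult
 show "abelian_group (quot_mod M N)"
 proof (rule abelian_groupI)
  fix x assume "x : carrier (quot_mod M N)"
  then obtain a where a: "a : carrier M" "x = N +>\<^bsub>M\<^esub> a" by (auto simp: quot_carrier)
  show "EX y:carrier (quot_mod M N). y +[quot_mod M N] x = 0[quot_mod M N]"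
   by (rule bexI[of _ "N +>\<^bsub>M\<^esub> (-[M] a)"])
    (use a in "auto simp: quot_carrier quot_zero M.M.l_neg")
 qed (auto simp: quot_carrier quot_zero M.M.a_ac)
qed (auto simp: quot_carrier quot_add[OF M N] quot_smult M.smult_l_distr M.smult_r_distr M.smult_assoc1)

lemma quot_proj_lin: "lin R M (quot_mod M N) (%x. N +>\<^bsub>M\<^esub> x)"
 by (rule linI) (auto simp: quot_carrier quot_add[OF M N] quot_smult)

text \<open>Any two representatives differ by an element of \<open>N\<close>, which \<open>F\<close>
  kills. This is what makes the lifts based on \<open>SOME\<close> independent of the
  choice.\<close>

lemma quot_choice:
 assumes X: "module R X" and F: "lin R M X F" "!!n. n : N ==> F n = 0[X]"
  and x: "x : carrier M"
 shows "F (SOME c. c : N +>\<^bsub>M\<^esub> x) = F x"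
proof -
 interpret X: module R X by fact
 let ?c = "SOME c. c : N +>\<^bsub>M\<^esub> x"
 have c: "?c : N +>\<^bsub>M\<^esub> x" by (rule someI[of _ x]) (rule N.a_rcos_self[OF x])
 have cM: "?c : carrier M" using N.a_elemrcos_carrier x c by blast
 have "F (?c +[M] -[M] x) = 0[X]" using N.a_rcos_module_imp[OF x c] F(2) by blast
 then have "F ?c -[X] F x = 0[X]"
  using lin_diff[OF M X F(1) cM x] by (simp add: a_minus_def)
 moreover have "F ?c : carrier X" "F x : carrier X" using linC[OF F(1)] cM x by auto
 ultimately show ?thesis
  by (metis X.M.minus_minus X.M.a_inv_closed a_minus_def X.M.minus_equality)
qed

lemma quot_lift:
 assumes X: "module R X" and F: "lin R M X F" "!!n. n : N ==> F n = 0[X]"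
 shows "lin R (quot_mod M N) X (%t. F (SOME c. c : t))"
proof (rule linI)
 note [simp] = quot_add[OF M N] quot_smult quot_choice[OF X F] linD[OF F(1)]
 fix x assume "x : carrier (quot_mod M N)"
 then show "F (SOME c. c : x) : carrier X" by (auto simp: quot_carrier)
next
 note [simp] = quot_add[OF M N] quot_smult quot_choice[OF X F] linD[OF F(1)]
 fix x y assume "x : carrier (quot_mod M N)" "y : carrier (quot_mod M N)"
 then show "F (SOME c. c : x +[quot_mod M N] y) = F (SOME c. c : x) +[X] F (SOME c. c : y)"
  by (auto simp: quot_carrier)
next
 note [simp] = quot_add[OF M N] quot_smult quot_choice[OF X F] linD[OF F(1)]
 fix r x assume "r : carrier R" "x : carrier (quot_mod M N)"
 then show "F (SOME c. c : r *[quot_mod M N] x) = r *[X] F (SOME c. c : x)"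
  by (auto simp: quot_carrier)
qed

lemma quot_spans:
 assumes "spans R M S"
 shows "spans R (quot_mod M N) ((%x. N +>\<^bsub>M\<^esub> x) ` S)"
 unfolding spans_def
proof (intro conjI allI impI)
 show "(%x. N +>\<^bsub>M\<^esub> x) ` S <= carrier (quot_mod M N)"
  using assms unfolding spans_def by (auto simp: quot_carrier)
 fix K assume K: "submodule K R (quot_mod M N)" "(%x. N +>\<^bsub>M\<^esub> x) ` S <= K"
 interpret Q: module R "quot_mod M N" by (rule quot_module)
 note Kc = Q.submoduleE[OF K(1)] submodule.smult_closed[OF K(1)]
 have z: "0[quot_mod M N] : K"
  using subgroup.one_closed[OF submodule.axioms(1)[OF K(1)]] by simp
 let ?K = "{x : carrier M. N +>\<^bsub>M\<^esub> x : K}"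
 note neg = lin_minus[OF M quot_module quot_proj_lin]
 have "submodule ?K R M"
  by (rule M.submoduleI)
   (use Kc z in "auto simp: neg simp flip: quot_zero quot_add[OF M N] quot_smult")
 moreover have "S <= ?K" using K(2) assms unfolding spans_def by auto
 ultimately have "carrier M <= ?K" using assms unfolding spans_def by blast
 then show "carrier (quot_mod M N) <= K" by (auto simp: quot_carrier)
qed

end

section \<open>Free modules and modules given by generators and relations\<close>

lemma free_mod_simps:
 "0[free_mod R S] = (%_. 0[R])"
 "c +[free_mod R S] d = (%x. c x +[R] d x)"
 "r *[free_mod R S] c = (%x. r \<otimes>\<^bsub>R\<^esub> c x)"
 by (simp_all add: free_mod_def)

lemma free_carrier_iff:
 "c : carrier (free_mod R S) \<longleftrightarrow>
  (ALL x:S. c x : carrier R) & (ALL x. x ~: S --> c x = 0[R]) & finite {x. c x ~= 0[R]}"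
 by (auto simp: free_mod_def)

lemma free_carrier_apply:
 "cring R ==> c : carrier (free_mod R S) ==> c x : carrier R"
 unfolding free_carrier_iff by (metis cring.cring_simprules(2))

lemma free_module:
 assumes "cring R"
 shows "module R (free_mod R S)"
proof (rule moduleI)
 interpret R: cring R by fact
 note ap = free_carrier_apply[OF assms]
 show "cring R" by fact
 have add: "c +[free_mod R S] d : carrier (free_mod R S)"
  if "c : carrier (free_mod R S)" "d : carrier (free_mod R S)" for c d
 proof -
  have "finite ({x. c x ~= 0[R]} Un {x. d x ~= 0[R]})" using that by (simp add: free_carrier_iff)
  then have "finite {x. c x +[R] d x ~= 0[R]}" by (rule rev_finite_subset) auto
  then show ?thesis using that by (simp add: free_carrier_iff free_mod_simps)
 qed
 show smult: "r *[free_mod R S] c : carrier (free_mod R S)"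
  if "r : carrier R" "c : carrier (free_mod R S)" for r c
 proof -
  have "finite {x. c x ~= 0[R]}" using that by (simp add: free_carrier_iff)
  then have "finite {x. r \<otimes>\<^bsub>R\<^esub> c x ~= 0[R]}" by (rule rev_finite_subset) (use that in auto)
  then show ?thesis using that by (simp add: free_carrier_iff free_mod_simps)
 qed
 show "abelian_group (free_mod R S)"
 proof (rule abelian_groupI)
  show "0[free_mod R S] : carrier (free_mod R S)" by (simp add: free_carrier_iff free_mod_simps)
  fix c assume c: "c : carrier (free_mod R S)"
  show "EX d:carrier (free_mod R S). d +[free_mod R S] c = 0[free_mod R S]"
  proof (rule bexI)
   show "(-[R] \<one>\<^bsub>R\<^esub>) *[free_mod R S] c : carrier (free_mod R S)" using c by (intro smult) auto
   show "(-[R] \<one>\<^bsub>R\<^esub>) *[free_mod R S] c +[free_mod R S] c = 0[free_mod R S]"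
    using ap[OF c] by (simp add: free_mod_simps R.l_minus R.l_neg)
  qed
 qed (auto simp: add[unfolded free_mod_simps] free_mod_simps ap R.a_ac)
next
 interpret R: cring R by fact
 note ap [simp] = free_carrier_apply[OF assms]
 let ?F = "free_mod R S"
 { fix a b c assume "a : carrier R" "b : carrier R" "c : carrier ?F"
  then show "(a +[R] b) *[?F] c = a *[?F] c +[?F] b *[?F] c"
   "(a \<otimes>\<^bsub>R\<^esub> b) *[?F] c = a *[?F] (b *[?F] c)"
   by (simp_all add: free_mod_simps R.l_distr R.m_assoc) }
 { fix a c d assume "a : carrier R" "c : carrier ?F" "d : carrier ?F"
  then show "a *[?F] (c +[?F] d) = a *[?F] c +[?F] a *[?F] d"
   by (simp add: free_mod_simps R.r_distr) }
 { fix c assume "c : carrier ?F"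
  then show "\<one>\<^bsub>R\<^esub> *[?F] c = c" by (simp add: free_mod_simps) }
qed

lemma free_gen_carrier:
 assumes "cring R" "x : S"
 shows "free_gen R x : carrier (free_mod R S)"
proof -
 interpret R: cring R by fact
 have "finite {y. free_gen R x y ~= 0[R]}"
  by (rule finite_subset[of _ "{x}"]) (auto simp: free_gen_def)
 then show ?thesis using assms(2) by (auto simp: free_carrier_iff free_gen_def)
qed

lemma free_spans:
 assumes "cring R"
 shows "spans R (free_mod R S) (free_gen R ` S)"
 unfolding spans_def
proof (intro conjI allI impI subsetI)
 interpret R: cring R by fact
 interpret F: module R "free_mod R S" by (rule free_module) fact
 show "c : carrier (free_mod R S)" if "c : free_gen R ` S" for c
  using that by (auto intro: free_gen_carrier[OF assms])
 fix K c assume K: "submodule K R (free_mod R S)" "free_gen R ` S <= K"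
  and c: "c : carrier (free_mod R S)"
 note Kc = F.submoduleE[OF K(1)]
 have z: "0[free_mod R S] : K"
  using subgroup.one_closed[OF submodule.axioms(1)[OF K(1)]] by simp
 have "!!c. c : carrier (free_mod R S) ==> {x. c x ~= 0[R]} <= A ==> c : K" if "finite A" for A
  using that
 proof (induction A)
  case empty
  then have "c = 0[free_mod R S]" by (auto simp: free_mod_simps)
  then show ?case using z by simp
 next
  case (insert a A)
  show ?case
  proof (cases "a : S")
   case False
   then have "c a = 0[R]" using insert.prems(1) by (simp add: free_carrier_iff)
   then have "{x. c x ~= 0[R]} <= A" using insert.prems(2) by auto
   then show ?thesis using insert by blast
  next
   case True
   note ap = free_carrier_apply[OF assms insert.prems(1)]
   have "finite {x. (c(a := 0[R])) x ~= 0[R]}"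
    by (rule finite_subset[of _ "{x. c x ~= 0[R]}"])
     (use insert.prems(1) in "auto simp: free_carrier_iff")
   then have "c(a := 0[R]) : carrier (free_mod R S)"
    using insert.prems(1) by (simp add: free_carrier_iff)
   moreover have "{x. (c(a := 0[R])) x ~= 0[R]} <= A" using insert.prems(2) by auto
   ultimately have "c(a := 0[R]) : K" using insert.IH by blast
   moreover have "c a *[free_mod R S] free_gen R a : K"
    using Kc(4) K(2) True ap by blast
   moreover have "c = c(a := 0[R]) +[free_mod R S] c a *[free_mod R S] free_gen R a"
    using ap by (auto simp: free_mod_simps free_gen_def)
   ultimately show ?thesis using Kc(5) by metis
  qed
 qed
 then show "c : K" using c unfolding free_carrier_iff by blast
qed

lemma finsum_superset:
 assumes "abelian_monoid X" "finite B" "A <= B" "!!x. x : B - A ==> g x = 0[X]"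
  "g : A \<rightarrow> carrier X"
 shows "finsum X g A = finsum X g B"
proof -
 interpret X: abelian_monoid X by fact
 show ?thesis
  by (rule X.add.finprod_mono_neutral_cong_left) (use assms in auto)
qed

text \<open>The sum defining \<open>free_ext\<close> runs over the support, which changes with the
  argument. Passing to one finite set containing all supports involved makes additivity a property
  of finite sums.\<close>

lemma free_ext_superset:
 assumes "module R X" "f : S \<rightarrow> carrier X" "c : carrier (free_mod R S)"
  "finite A" "{x. c x ~= 0[R]} <= A" "A <= S"
 shows "free_ext R X f c = finsum X (%x. c x *[X] f x) A"
proof -
 interpret X: module R X by fact
 show ?thesis
  unfolding free_ext_def
  by (rule finsum_superset[OF X.M.abelian_monoid_axioms])
   (use assms free_carrier_apply[OF X.R.cring_axioms assms(3)] in "auto simp: subset_iff Pi_iff")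
qed

lemma free_ext_lin:
 assumes X: "module R X" and f: "f : S \<rightarrow> carrier X"
 shows "lin R (free_mod R S) X (free_ext R X f)"
proof -
 interpret X: module R X by fact
 interpret F: module R "free_mod R S" by (rule free_module) (rule X.R.cring_axioms)
 have supp: "{x. c x ~= 0[R]} <= S" "finite {x. c x ~= 0[R]}" if "c : carrier (free_mod R S)" for c
  using that by (auto simp: free_carrier_iff)
 note ap = free_carrier_apply[OF X.R.cring_axioms]
 have fc: "f x : carrier X" if "x : S" for x using f that by auto
 show ?thesis
 proof (rule linI)
  fix c assume c: "c : carrier (free_mod R S)"
  show "free_ext R X f c : carrier X"
   unfolding free_ext_def by (rule X.M.finsum_closed) (use supp[OF c] ap[OF c] fc in auto)
 next
  fix c d assume cd: "c : carrier (free_mod R S)" "d : carrier (free_mod R S)"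
  let ?A = "{x. c x ~= 0[R]} Un {x. d x ~= 0[R]}"
  have A: "finite ?A" "?A <= S" using supp cd by auto
  have e: "c +[free_mod R S] d : carrier (free_mod R S)" using cd by simp
  have "free_ext R X f (c +[free_mod R S] d)
    = finsum X (%x. (c +[free_mod R S] d) x *[X] f x) ?A"
   by (rule free_ext_superset[OF X f e A(1) _ A(2)]) (auto simp: free_mod_simps)
  also have "... = finsum X (%x. c x *[X] f x +[X] d x *[X] f x) ?A"
   by (rule X.M.finsum_cong')
    (use A ap[OF cd(1)] ap[OF cd(2)] fc in "auto simp: free_mod_simps X.smult_l_distr subset_iff")
  also have "... = finsum X (%x. c x *[X] f x) ?A +[X] finsum X (%x. d x *[X] f x) ?A"
   by (rule X.M.finsum_addf) (use A ap[OF cd(1)] ap[OF cd(2)] fc in auto)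
  also have "... = free_ext R X f c +[X] free_ext R X f d"
   using free_ext_superset[OF X f cd(1) A(1) _ A(2)] free_ext_superset[OF X f cd(2) A(1) _ A(2)]
   by simp
  finally show "free_ext R X f (c +[free_mod R S] d)
   = free_ext R X f c +[X] free_ext R X f d" .
 next
  fix r c assume rc: "r : carrier R" "c : carrier (free_mod R S)"
  let ?A = "{x. c x ~= 0[R]}"
  have A: "finite ?A" "?A <= S" using supp rc by auto
  have e: "r *[free_mod R S] c : carrier (free_mod R S)" using rc by simp
  have "free_ext R X f (r *[free_mod R S] c)
    = finsum X (%x. (r *[free_mod R S] c) x *[X] f x) ?A"
   by (rule free_ext_superset[OF X f e A(1) _ A(2)]) (use rc in "auto simp: free_mod_simps")
  also have "... = finsum X (%x. r *[X] (c x *[X] f x)) ?A"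
   by (rule X.M.finsum_cong')
    (use A rc ap[OF rc(2)] fc in "auto simp: free_mod_simps X.smult_assoc1 subset_iff")
  also have "... = r *[X] free_ext R X f c"
   unfolding free_ext_def
   by (rule X.finsum_smult_ldistr[symmetric]) (use A rc ap[OF rc(2)] fc in auto)
  finally show "free_ext R X f (r *[free_mod R S] c) = r *[X] free_ext R X f c" .
 qed
qed

lemma free_ext_gen:
 assumes "module R X" "f : S \<rightarrow> carrier X" "x : S"
 shows "free_ext R X f (free_gen R x) = f x"
proof -
 interpret X: module R X by fact
 have fx: "f x : carrier X" using assms by auto
 have "free_ext R X f (free_gen R x) = finsum X (%y. free_gen R x y *[X] f y) {x}"
  by (rule free_ext_superset[OF assms(1,2) free_gen_carrier[OF X.R.cring_axioms assms(3)]])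
   (use assms(3) in "auto simp: free_gen_def")
 also have "... = f x" using fx by (simp add: free_gen_def)
 finally show ?thesis .
qed

context
 fixes R :: "'k ring" and S :: "'x set" and Rel :: "('x => 'k) set"
 assumes R: "cring R" and Rel: "Rel <= carrier (free_mod R S)"
begin

text \<open>Tensor products of two modules and of lists of modules are both given by generators and
  relations; spanning and lifting are proved once for such quotients.\<close>

abbreviation (input) "pres_ker == submod_gen R (free_mod R S) Rel"
abbreviation (input) "pres_mod == quot_mod (free_mod R S) pres_ker"
abbreviation (input) "pres_gen == %x. pres_ker +>\<^bsub>free_mod R S\<^esub> free_gen R x"

lemmas pres_submodule = submod_gen_submodule[OF free_module[OF R] Rel]

lemma pres_module: "module R pres_mod"
 by (rule quot_module[OF free_module[OF R] pres_submodule])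

lemma pres_spans: "spans R pres_mod (pres_gen ` S)"
 using quot_spans[OF free_module[OF R] pres_submodule free_spans[OF R]] by (simp add: image_image)

lemma pres_kills:
 assumes X: "module R X" and f: "f : S \<rightarrow> carrier X"
  and rel: "!!c. c : Rel ==> free_ext R X f c = 0[X]" and n: "n : pres_ker"
 shows "free_ext R X f n = 0[X]"
proof -
 have "pres_ker <= {c : carrier (free_mod R S). free_ext R X f c = 0[X]}"
  by (rule submod_gen_minimal[OF lin_kernel_submodule[OF free_module[OF R] X free_ext_lin[OF X f]]])
   (use rel Rel in auto)
 then show ?thesis using n by blast
qed

lemma pres_lift_lin:
 assumes X: "module R X" and f: "f : S \<rightarrow> carrier X"
  and rel: "!!c. c : Rel ==> free_ext R X f c = 0[X]"
 shows "lin R pres_mod X (%t. free_ext R X f (SOME c. c : t))"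
 by (rule quot_lift[OF free_module[OF R] pres_submodule X free_ext_lin[OF X f] pres_kills[OF assms]])

lemma pres_lift_gen:
 assumes X: "module R X" and f: "f : S \<rightarrow> carrier X"
  and rel: "!!c. c : Rel ==> free_ext R X f c = 0[X]" and x: "x : S"
 shows "free_ext R X f (SOME c. c : pres_gen x) = f x"
 using quot_choice[OF free_module[OF R] pres_submodule X free_ext_lin[OF X f] pres_kills[OF assms(1-3)]
   free_gen_carrier[OF R x]] free_ext_gen[OF X f x] by simp

end

section \<open>Tensor products\<close>

lemma bilinD:
 assumes "bilin R A B X f"
 shows bilinR: "x : carrier A ==> lin R B X (f x)"
  and bilinL: "y : carrier B ==> lin R A X (%x. f x y)"
  and bilinC: "x : carrier A ==> y : carrier B ==> f x y : carrier X"
 using assms unfolding bilin_def lin_def by auto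

lemma bilinI:
 assumes "!!x. x : carrier A ==> lin R B X (f x)"
  and "!!y. y : carrier B ==> lin R A X (%x. f x y)"
 shows "bilin R A B X f"
 using assms unfolding bilin_def by auto

lemma bilin_comp: "bilin R A B X f ==> lin R X Y g ==> bilin R A B Y (%x y. g (f x y))"
 unfolding bilin_def by (auto intro: lin_comp)

lemma bilin_swap: "bilin R A B X f ==> bilin R B A X (%y x. f x y)"
 unfolding bilin_def by auto

lemma bilin_comp2:
 assumes "bilin R A B X f" "lin R A' A g" "lin R B' B h"
 shows "bilin R A' B' X (%x y. f (g x) (h y))"
 by (rule bilinI)
  (auto intro: lin_comp[OF assms(3) bilinR[OF assms(1)]] linC[OF assms(2)]
   lin_comp[OF assms(2) bilinL[OF assms(1)]] linC[OF assms(3)])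

lemma bilin_plus:
 "module R X ==> bilin R A B X f ==> bilin R A B X g ==> bilin R A B X (%x y. f x y +[X] g x y)"
 unfolding bilin_def by (auto intro: lin_plus)

lemma bilin_subtract:
 "module R X ==> bilin R A B X f ==> bilin R A B X g ==> bilin R A B X (%x y. f x y -[X] g x y)"
 unfolding bilin_def by (auto intro: lin_subtract)

lemma lin_diff_eq_zero:
 assumes "module R M" "module R X" "lin R M X F" "x : carrier M" "y : carrier M" "F x = F y"
 shows "F (x -[M] y) = 0[X]"
proof -
 interpret X: module R X by fact
 show ?thesis using assms lin_diff[OF assms(1-5)] linC[OF assms(3)]
  by (simp add: a_minus_def X.M.r_neg)
qed

context
 fixes R :: "'k ring" and A :: "('k, 'a) module" and B :: "('k, 'b) module"
 assumes A: "module R A" and B: "module R B"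
begin

interpretation A: module R A by (rule A)
interpretation B: module R B by (rule B)

private abbreviation (input) "FF == free_mod R (carrier A \<times> carrier B)"

lemma tensor_rel_subset: "tensor_rel R A B <= carrier FF"
proof -
 interpret F: module R FF by (rule free_module[OF A.R.cring_axioms])
 have [simp]: "free_gen R (x, y) : carrier FF" if "x : carrier A" "y : carrier B" for x y
  using that by (auto intro!: free_gen_carrier[OF A.R.cring_axioms])
 show ?thesis unfolding tensor_rel_def Let_def by auto
qed

lemma tens_mod: "module R (tensor_mod R A B)"
 unfolding tensor_mod_def tensor_ker_def
 by (rule pres_module[OF A.R.cring_axioms tensor_rel_subset])

lemma tensor_spans: "spans R (tensor_mod R A B) ((%(x, y). tens R A B x y) ` (carrier A \<times> carrier B))"
by (simp add: tens_def pres_spans A.R.cring_axioms tensor_rel_subset tensor_mod_def tensor_ker_def)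

lemma tens_closed: "x : carrier A ==> y : carrier B ==> tens R A B x y : carrier (tensor_mod R A B)"
 using tensor_spans unfolding spans_def by auto

lemma tens_bilin: "bilin R A B (tensor_mod R A B) (tens R A B)"
proof -
 note RR = A.R.cring_axioms
 interpret F: module R FF by (rule free_module[OF RR])
 let ?e = "free_gen R"
 have e: "?e (x, y) : carrier FF" if "x : carrier A" "y : carrier B" for x y
  using that by (auto intro!: free_gen_carrier[OF RR])
 note sub = submod_gen_submodule[OF free_module[OF RR] tensor_rel_subset]
 note ker = submod_gen_incl[THEN subsetD, of _ "tensor_rel R A B" R FF]
 have eq: "tensor_ker R A B +>\<^bsub>FF\<^esub> c = tensor_ker R A B +>\<^bsub>FF\<^esub> d"
  if "c -[FF] d : tensor_rel R A B" "c : carrier FF" "d : carrier FF" for c d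
  using quot_eq_iff[OF free_module[OF RR] sub that(2,3)] ker[OF that(1)]
  by (simp add: tensor_ker_def)
 note add = quot_add[OF free_module[OF RR] sub, folded tensor_ker_def tensor_mod_def]
 note smult = quot_smult[OF free_module[OF RR] sub, folded tensor_ker_def tensor_mod_def]
 have eq_add: "tensor_ker R A B +>\<^bsub>FF\<^esub> c = (tensor_ker R A B +>\<^bsub>FF\<^esub> d) +[tensor_mod R A B] (tensor_ker R A B +>\<^bsub>FF\<^esub> d')"
  if "c -[FF] (d +[FF] d') : tensor_rel R A B" "c : carrier FF" "d : carrier FF" "d' : carrier FF" for c d d'
  using eq[OF that(1)] that by (simp add: add)
 have eq_smult: "tensor_ker R A B +>\<^bsub>FF\<^esub> c = r *[tensor_mod R A B] (tensor_ker R A B +>\<^bsub>FF\<^esub> d)"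
  if "c -[FF] (r *[FF] d) : tensor_rel R A B" "c : carrier FF" "d : carrier FF" "r : carrier R" for c d r
  using eq[OF that(1)] that by (simp add: smult)
 show ?thesis
 proof (intro bilinI linI)
  fix x y y' assume "x : carrier A" "y : carrier B" "y' : carrier B"
  then show "tens R A B x (y +[B] y') = tens R A B x y +[tensor_mod R A B] tens R A B x y'"
   unfolding tens_def
   by (intro eq_add e B.M.a_closed) (simp_all add: tensor_rel_def Let_def, blast)
 next
  fix x x' y assume "x : carrier A" "x' : carrier A" "y : carrier B"
  then show "tens R A B (x +[A] x') y = tens R A B x y +[tensor_mod R A B] tens R A B x' y"
   unfolding tens_def
   by (intro eq_add e A.M.a_closed) (simp_all add: tensor_rel_def Let_def, blast)
 next
  fix x y r assume "x : carrier A" "y : carrier B" "r : carrier R"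
  then show "tens R A B x (r *[B] y) = r *[tensor_mod R A B] tens R A B x y"
   unfolding tens_def
   by (intro eq_smult e B.smult_closed) (simp_all add: tensor_rel_def Let_def, blast)
 next
  fix x y r assume "y : carrier B" "r : carrier R" "x : carrier A"
  then show "tens R A B (r *[A] x) y = r *[tensor_mod R A B] tens R A B x y"
   unfolding tens_def
   by (intro eq_smult e A.smult_closed) (simp_all add: tensor_rel_def Let_def, blast)
 qed (auto intro: tens_closed)
qed

context
 fixes X :: "('k, 'c) module" and f :: "'a => 'b => 'c"
 assumes X: "module R X" and f: "bilin R A B X f"
begin

lemma tensor_rel_killed:
 assumes "c : tensor_rel R A B"
 shows "free_ext R X (%(x, y). f x y) c = 0[X]"
proof -
 note RR = A.R.cring_axioms
 interpret F: module R FF by (rule free_module[OF RR])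
 interpret X: module R X by (rule X)
 have fc: "(%(x, y). f x y) : carrier A \<times> carrier B \<rightarrow> carrier X"
  using bilinC[OF f] by auto
 note L = free_ext_lin[OF X fc]
 have e: "free_gen R (x, y) : carrier FF" if "x : carrier A" "y : carrier B" for x y
  using that by (auto intro!: free_gen_carrier[OF RR])
 have g: "free_ext R X (%(x, y). f x y) (free_gen R (x, y)) = f x y"
  if "x : carrier A" "y : carrier B" for x y
  using free_ext_gen[OF X fc, of "(x, y)"] that by simp
 note [simp] = e g lin_add[OF L] lin_smult[OF L]
  linD(2,3)[OF bilinR[OF f]] linD(2,3)[OF bilinL[OF f]]
 show ?thesis
  using assms unfolding tensor_rel_def Let_def
  by (elim UnE CollectE exE conjE) (simp_all add: lin_diff_eq_zero[OF free_module[OF RR] X L])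
qed

lemma tlift_lin: "lin R (tensor_mod R A B) X (tlift R X f)"
 unfolding tlift_def tensor_mod_def tensor_ker_def
 by (rule pres_lift_lin[OF A.R.cring_axioms tensor_rel_subset X _ tensor_rel_killed])
  (use bilinC[OF f] in auto)

lemma tlift_tens:
 assumes "x : carrier A" "y : carrier B"
 shows "tlift R X f (tens R A B x y) = f x y"
proof -
 have "free_ext R X (%(x, y). f x y) (SOME c. c : tens R A B x y) = (%(x, y). f x y) (x, y)"
  unfolding tens_def tensor_ker_def
  by (rule pres_lift_gen[OF A.R.cring_axioms tensor_rel_subset X _ tensor_rel_killed])
   (use bilinC[OF f] assms in auto)
 then show ?thesis by (simp add: tlift_def)
qed

end

end

section \<open>Tensor products of lists of modules\<close>

definition multilin :: "'k ring => ('k, 'a) module list => ('k, 'c) module => ('a list => 'c) => bool" where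
 "multilin R Ms X f \<longleftrightarrow>
  (ALL fs:ltensor_words Ms. f fs : carrier X) &
  (ALL fs:ltensor_words Ms. ALL i<length Ms. lin R (Ms ! i) X (%x. f (fs[i := x])))"

lemma ltensor_words_update:
 "fs : ltensor_words Ms ==> i < length Ms ==> x : carrier (Ms ! i) ==> fs[i := x] : ltensor_words Ms"
 unfolding ltensor_words_def by (auto simp: nth_list_update)

context
 fixes R :: "'k ring" and Ms :: "('k, 'a) module list"
 assumes R: "cring R" and Ms: "!!M. M : set Ms ==> module R M"
begin

private abbreviation (input) "FL == free_mod R (ltensor_words Ms)"

interpretation F: module R FL by (rule free_module[OF R])

lemma ltensor_closed:
 assumes "i < length Ms"
 shows "x : carrier (Ms ! i) ==> y : carrier (Ms ! i) ==> x +[Ms ! i] y : carrier (Ms ! i)"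
  "r : carrier R ==> x : carrier (Ms ! i) ==> r *[Ms ! i] x : carrier (Ms ! i)"
proof -
 interpret module R "Ms ! i" by (rule Ms) (use assms in simp)
 show "x : carrier (Ms ! i) ==> y : carrier (Ms ! i) ==> x +[Ms ! i] y : carrier (Ms ! i)"
  "r : carrier R ==> x : carrier (Ms ! i) ==> r *[Ms ! i] x : carrier (Ms ! i)" by auto
qed

lemma ltensor_rel_sub: "ltensor_rel R Ms <= carrier FL"
by (auto simp: free_gen_carrier R ltensor_rel_def Let_def ltensor_words_update ltensor_closed)

lemma ltensor_module: "module R (ltensor_mod R Ms)"
 unfolding ltensor_mod_def ltensor_ker_def by (rule pres_module[OF R ltensor_rel_sub])

lemma ltensor_spans: "spans R (ltensor_mod R Ms) (ltens R Ms ` ltensor_words Ms)"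
 using pres_spans[OF R ltensor_rel_sub]
 unfolding ltensor_mod_def ltensor_ker_def ltens_def by simp

lemma ltens_multilin: "multilin R Ms (ltensor_mod R Ms) (ltens R Ms)"
proof -
 let ?e = "free_gen R"
 have e: "?e w : carrier FL" if "w : ltensor_words Ms" for w
  using that by (auto intro!: free_gen_carrier[OF R])
 note sub = submod_gen_submodule[OF free_module[OF R] ltensor_rel_sub]
 note ker = submod_gen_incl[THEN subsetD, of _ "ltensor_rel R Ms" R FL]
 have eq: "ltensor_ker R Ms +>\<^bsub>FL\<^esub> c = ltensor_ker R Ms +>\<^bsub>FL\<^esub> d"
  if "c -[FL] d : ltensor_rel R Ms" "c : carrier FL" "d : carrier FL" for c d
  using quot_eq_iff[OF free_module[OF R] sub that(2,3)] ker[OF that(1)]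
  by (simp add: ltensor_ker_def)
 note add = quot_add[OF free_module[OF R] sub, folded ltensor_ker_def ltensor_mod_def]
 note smult = quot_smult[OF free_module[OF R] sub, folded ltensor_ker_def ltensor_mod_def]
 have eq_add: "ltensor_ker R Ms +>\<^bsub>FL\<^esub> c = (ltensor_ker R Ms +>\<^bsub>FL\<^esub> d) +[ltensor_mod R Ms] (ltensor_ker R Ms +>\<^bsub>FL\<^esub> d')"
  if "c -[FL] (d +[FL] d') : ltensor_rel R Ms" "c : carrier FL" "d : carrier FL" "d' : carrier FL" for c d d'
  using eq[OF that(1)] that by (simp add: add)
 have eq_smult: "ltensor_ker R Ms +>\<^bsub>FL\<^esub> c = r *[ltensor_mod R Ms] (ltensor_ker R Ms +>\<^bsub>FL\<^esub> d)"
  if "c -[FL] (r *[FL] d) : ltensor_rel R Ms" "c : carrier FL" "d : carrier FL" "r : carrier R" for c d r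
  using eq[OF that(1)] that by (simp add: smult)
 note upd = ltensor_words_update
 have cl: "ltens R Ms fs : carrier (ltensor_mod R Ms)" if "fs : ltensor_words Ms" for fs
  using ltensor_spans that unfolding spans_def by auto
 show ?thesis
  unfolding multilin_def
 proof (intro conjI ballI allI impI linI)
  fix fs i x y
  assume "fs : ltensor_words Ms" "i < length Ms" "x : carrier (Ms ! i)" "y : carrier (Ms ! i)"
  then show "ltens R Ms (fs[i := x +[Ms ! i] y])
    = ltens R Ms (fs[i := x]) +[ltensor_mod R Ms] ltens R Ms (fs[i := y])"
   unfolding ltens_def
   by (intro eq_add e upd ltensor_closed) (simp_all add: ltensor_rel_def Let_def, blast)
 next
  fix fs i r x
  assume "fs : ltensor_words Ms" "i < length Ms" "r : carrier R" "x : carrier (Ms ! i)"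
  then show "ltens R Ms (fs[i := r *[Ms ! i] x])
    = r *[ltensor_mod R Ms] ltens R Ms (fs[i := x])"
   unfolding ltens_def
   by (intro eq_smult e upd ltensor_closed) (simp_all add: ltensor_rel_def Let_def, blast)
 qed (auto intro: cl upd)
qed

context
 fixes X :: "('k, 'c) module" and f :: "'a list => 'c"
 assumes X: "module R X" and f: "multilin R Ms X f"
begin

lemma ltensor_rel_killed:
 assumes "c : ltensor_rel R Ms"
 shows "free_ext R X f c = 0[X]"
proof -
 interpret X: module R X by (rule X)
 have fc: "f : ltensor_words Ms \<rightarrow> carrier X"
  using f unfolding multilin_def by auto
 note L = free_ext_lin[OF X fc]
 have e: "free_gen R w : carrier FL" if "w : ltensor_words Ms" for w
  using that by (auto intro!: free_gen_carrier[OF R])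
 have fl: "lin R (Ms ! i) X (%x. f (fs[i := x]))" if "fs : ltensor_words Ms" "i < length Ms" for fs i
  using f that unfolding multilin_def by auto
 note [simp] = e free_ext_gen[OF X fc] lin_add[OF L] lin_smult[OF L] ltensor_closed
  linD(2,3)[OF fl] ltensor_words_update
 show ?thesis
  using assms unfolding ltensor_rel_def Let_def
  by (elim UnE CollectE exE conjE) (simp_all add: lin_diff_eq_zero[OF free_module[OF R] X L])
qed

lemma ltlift_lin: "lin R (ltensor_mod R Ms) X (ltlift R X f)"
 unfolding ltlift_def ltensor_mod_def ltensor_ker_def
 by (rule pres_lift_lin[OF R ltensor_rel_sub X _ ltensor_rel_killed])
  (use f in "auto simp: multilin_def")

lemma ltlift_ltens:
 assumes "fs : ltensor_words Ms"
 shows "ltlift R X f (ltens R Ms fs) = f fs"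
 unfolding ltlift_def ltens_def ltensor_ker_def
 by (rule pres_lift_gen[OF R ltensor_rel_sub X _ ltensor_rel_killed])
  (use f assms in "auto simp: multilin_def")

end

end

section \<open>Direct sums\<close>

lemma dsum_simps:
 "0[dsum J M] = (\<lambda>j\<in>J. 0[M j])"
 "f +[dsum J M] g = (\<lambda>j\<in>J. f j +[M j] g j)"
 "r *[dsum J M] f = (\<lambda>j\<in>J. r *[M j] f j)"
 "f : carrier (dsum J M) \<longleftrightarrow> f : (\<Pi>\<^sub>E j\<in>J. carrier (M j)) & finite {j : J. f j ~= 0[M j]}"
 by (simp_all add: dsum_def)

lemma dsum_apply: "f : carrier (dsum J M) ==> j : J ==> f j : carrier (M j)"
 by (auto simp: dsum_simps)

context
 fixes R :: "'k ring" and J :: "'j set" and M :: "'j => ('k, 'a) module"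
 assumes R: "cring R" and M: "!!j. j : J ==> module R (M j)"
begin

lemma dsum_module: "module R (dsum J M)"
proof -
 have ag: "abelian_group (M j)" if "j : J" for j using moduleD[OF M[OF that]] by simp
 note simps = abelian_groupE[OF ag] module.smult_closed[OF M] module.smult_l_distr[OF M]
  module.smult_r_distr[OF M] module.smult_assoc1[OF M] module.smult_one[OF M]
 have add: "f +[dsum J M] g : carrier (dsum J M)"
  if "f : carrier (dsum J M)" "g : carrier (dsum J M)" for f g
 proof -
  have "finite ({j : J. f j ~= 0[M j]} Un {j : J. g j ~= 0[M j]})" using that by (simp add: dsum_simps)
  then have "finite {j : J. f j +[M j] g j ~= 0[M j]}" by (rule rev_finite_subset) (auto simp: simps)
  then have "finite {j : J. (f +[dsum J M] g) j ~= 0[M j]}"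
   by (rule rev_finite_subset) (auto simp: dsum_simps)
  then show ?thesis using that by (auto simp: dsum_simps PiE_iff simps)
 qed
 have smult: "r *[dsum J M] f : carrier (dsum J M)"
  if "r : carrier R" "f : carrier (dsum J M)" for r f
 proof -
  have "finite {j : J. f j ~= 0[M j]}" using that by (simp add: dsum_simps)
  then have "finite {j : J. (r *[dsum J M] f) j ~= 0[M j]}"
   by (rule rev_finite_subset) (use that in "auto simp: dsum_simps module.smult_r_null[OF M]")
  then show ?thesis using that by (auto simp: dsum_simps PiE_iff simps)
 qed
 have ext: "f = g" if "f : extensional J" "g : extensional J" "!!j. j : J ==> f j = g j"
  for f g :: "'j => 'a" using extensionalityI that by blast
 have ext': "f : extensional J" if "f : carrier (dsum J M)" for f
  using that by (auto simp: dsum_simps PiE_def)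
 note ext'' = ext'[OF add] ext'[OF smult] ext'
 show ?thesis
 proof (rule moduleI[OF R])
  show "abelian_group (dsum J M)"
  proof (rule abelian_groupI)
   show z: "0[dsum J M] : carrier (dsum J M)" by (auto simp: dsum_simps simps)
   { fix f assume f: "f : carrier (dsum J M)"
    show "EX g:carrier (dsum J M). g +[dsum J M] f = 0[dsum J M]"
    proof (rule bexI)
     have m: "-[R] \<one>\<^bsub>R\<^esub> : carrier R" using R by (simp add: cring.cring_simprules)
     show g: "(-[R] \<one>\<^bsub>R\<^esub>) *[dsum J M] f : carrier (dsum J M)" by (rule smult[OF m f])
     show "(-[R] \<one>\<^bsub>R\<^esub>) *[dsum J M] f +[dsum J M] f = 0[dsum J M]"
     proof (rule ext)
      fix j assume j: "j : J"
      interpret Mj: module R "M j" by (rule M[OF j])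
      show "((-[R] \<one>\<^bsub>R\<^esub>) *[dsum J M] f +[dsum J M] f) j = 0[dsum J M] j"
       using j dsum_apply[OF f j] by (simp add: dsum_simps Mj.smult_l_minus Mj.M.l_neg)
     qed (use ext''(1)[OF g f] ext''(3)[OF z] in auto)
    qed }
   { fix f g h assume fgh: "f : carrier (dsum J M)" "g : carrier (dsum J M)" "h : carrier (dsum J M)"
    note ap = dsum_apply[OF fgh(1)] dsum_apply[OF fgh(2)] dsum_apply[OF fgh(3)]
    show "f +[dsum J M] g +[dsum J M] h = f +[dsum J M] (g +[dsum J M] h)"
     by (simp add: dsum_simps ap simps(3) cong: restrict_cong) }
   { fix f g assume fg: "f : carrier (dsum J M)" "g : carrier (dsum J M)"
    note ap = dsum_apply[OF fg(1)] dsum_apply[OF fg(2)]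
    show "f +[dsum J M] g = g +[dsum J M] f"
     unfolding dsum_simps by (rule restrict_ext) (metis ap abelian_groupE(4)[OF ag]) }
   { fix f assume f: "f : carrier (dsum J M)"
    show "0[dsum J M] +[dsum J M] f = f"
     by (rule ext) (use ext''(1)[OF z f] ext''(3)[OF f] dsum_apply[OF f]
       in "auto simp: dsum_simps abelian_groupE(5)[OF ag]") }
  qed (rule add)
  { fix f assume f: "f : carrier (dsum J M)"
   show "\<one>\<^bsub>R\<^esub> *[dsum J M] f = f"
    by (rule ext) (use ext''(2)[OF _ f] ext''(3)[OF f] dsum_apply[OF f] R
       in "auto simp: dsum_simps simps") }
  { fix a b f g assume ab: "a : carrier R" "b : carrier R"
   assume f: "f : carrier (dsum J M)"
   note ap = dsum_apply[OF f]
   show "(a +[R] b) *[dsum J M] f = a *[dsum J M] f +[dsum J M] b *[dsum J M] f"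
    "(a \<otimes>\<^bsub>R\<^esub> b) *[dsum J M] f = a *[dsum J M] (b *[dsum J M] f)"
    using ab ap by (simp_all add: dsum_simps simps cong: restrict_cong) }
  { fix a f g assume a: "a : carrier R"
   assume f: "f : carrier (dsum J M)" and g: "g : carrier (dsum J M)"
   note ap = dsum_apply[OF f] dsum_apply[OF g]
   show "a *[dsum J M] (f +[dsum J M] g) = a *[dsum J M] f +[dsum J M] a *[dsum J M] g"
    using a ap by (simp_all add: dsum_simps simps cong: restrict_cong) }
 qed (rule smult)
qed

lemma dinj_closed:
 assumes "x : carrier (M i)"
 shows "dinj J M i x : carrier (dsum J M)"
proof -
 have "0[M j] : carrier (M j)" if "j : J" for j
  using abelian_groupE(2)[OF moduleD(2)[OF M[OF that]]] .
 moreover have "finite {j : J. dinj J M i x j ~= 0[M j]}"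
  by (rule finite_subset[of _ "{i}"]) (auto simp: dinj_def)
 ultimately show ?thesis using assms by (auto simp: dsum_simps dinj_def)
qed

lemma dinj_lin: "lin R (M i) (dsum J M) (dinj J M i)"
proof (rule linI)
 have ag: "abelian_group (M j)" if "j : J" for j using moduleD[OF M[OF that]] by simp
 fix x y assume "x : carrier (M i)" "y : carrier (M i)"
 then show "dinj J M i (x +[M i] y) = dinj J M i x +[dsum J M] dinj J M i y"
  using abelian_groupE[OF ag] by (auto simp: dsum_simps dinj_def fun_eq_iff)
next
 fix r x assume "r : carrier R" "x : carrier (M i)"
 then show "dinj J M i (r *[M i] x) = r *[dsum J M] dinj J M i x"
  using module.smult_r_null[OF M] by (auto simp: dsum_simps dinj_def fun_eq_iff)
qed (rule dinj_closed)

lemma dsum_spans: "spans R (dsum J M) (\<Union>i\<in>J. dinj J M i ` carrier (M i))"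
 unfolding spans_def
proof (intro conjI allI impI subsetI)
 interpret D: module R "dsum J M" by (rule dsum_module)
 show "f : carrier (dsum J M)" if "f : (\<Union>i\<in>J. dinj J M i ` carrier (M i))" for f
  using that by (auto intro: dinj_closed)
 have ag: "abelian_group (M j)" if "j : J" for j using moduleD[OF M[OF that]] by simp
 note zc = abelian_groupE(2)[OF ag]
 fix K f assume K: "submodule K R (dsum J M)" "(\<Union>i\<in>J. dinj J M i ` carrier (M i)) <= K"
  and f: "f : carrier (dsum J M)"
 note Kc = D.submoduleE[OF K(1)]
 have z: "0[dsum J M] : K"
  using subgroup.one_closed[OF submodule.axioms(1)[OF K(1)]] by simp
 have "!!f. f : carrier (dsum J M) ==> {j\<in>J. f j ~= 0[M j]} <= A ==> f : K" if "finite A" for A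
  using that
 proof (induction A)
  case empty
  then have "f = 0[dsum J M]" by (auto simp: dsum_simps fun_eq_iff PiE_def extensional_def)
  then show ?case using z by simp
 next
  case (insert a A)
  note fin = insert.prems(1)[unfolded dsum_simps]
  show ?case
  proof (cases "a : J")
   case False
   then have "{j\<in>J. f j ~= 0[M j]} <= A" using insert.prems(2) by auto
   then show ?thesis using insert by blast
  next
   case True
   note ap = dsum_apply[OF insert.prems(1)]
   let ?f = "f(a := 0[M a])"
   have "finite {j\<in>J. ?f j ~= 0[M j]}"
    by (rule finite_subset[of _ "{j\<in>J. f j ~= 0[M j]}"]) (use fin in auto)
   then have "?f : carrier (dsum J M)"
    using fin True zc by (auto simp: dsum_simps PiE_def extensional_def)
   moreover have "{j\<in>J. ?f j ~= 0[M j]} <= A" using insert.prems(2) by auto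
   ultimately have "?f : K" using insert.IH by blast
   moreover have "dinj J M a (f a) : K" using K(2) True ap by auto
   moreover have "f = ?f +[dsum J M] dinj J M a (f a)"
   proof
    fix j
    show "f j = (?f +[dsum J M] dinj J M a (f a)) j"
    proof (cases "j : J")
     case j: True
     interpret Mj: abelian_group "M j" by (rule ag[OF j])
     show ?thesis using j ap[OF j] abelian_groupE(5)[OF ag] by (auto simp: dsum_simps dinj_def)
    next
     case False
     then show ?thesis using fin by (auto simp: dsum_simps PiE_def extensional_def)
    qed
   qed
   ultimately show ?thesis using Kc(5) by metis
  qed
 qed
 then show "f : K" using f unfolding dsum_simps by blast
qed

context
 fixes X :: "('k, 'b) module" and h :: "'j => 'a => 'b"
 assumes X: "module R X" and h: "!!j. j : J ==> lin R (M j) X (h j)"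
begin

interpretation X: module R X by (rule X)

lemma dlift_superset:
 assumes "f : carrier (dsum J M)" "finite A" "{j : J. f j ~= 0[M j]} <= A" "A <= J"
 shows "dlift X J M h f = finsum X (%j. h j (f j)) A"
 unfolding dlift_def
 by (rule finsum_superset[OF X.M.abelian_monoid_axioms])
  (use assms dsum_apply[OF assms(1)] lin_zero[OF M X h] linC[OF h] in "auto simp: subset_iff")

lemma dlift_lin: "lin R (dsum J M) X (dlift X J M h)"
proof -
 interpret D: module R "dsum J M" by (rule dsum_module)
 have supp: "{j : J. f j ~= 0[M j]} <= J" "finite {j : J. f j ~= 0[M j]}"
  if "f : carrier (dsum J M)" for f using that by (auto simp: dsum_simps)
 show ?thesis
 proof (rule linI)
  fix f assume f: "f : carrier (dsum J M)"
  show "dlift X J M h f : carrier X"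
   unfolding dlift_def by (rule X.M.finsum_closed) (use dsum_apply[OF f] linC[OF h] in auto)
 next
  fix f g assume fg: "f : carrier (dsum J M)" "g : carrier (dsum J M)"
  let ?A = "{j : J. f j ~= 0[M j]} Un {j : J. g j ~= 0[M j]}"
  have A: "finite ?A" "?A <= J" using supp fg by auto
  note ap = dsum_apply[OF fg(1)] dsum_apply[OF fg(2)]
  have z: "0[M j] +[M j] 0[M j] = 0[M j]" if "j : J" for j
   using abelian_groupE(2,5)[OF moduleD(2)[OF M[OF that]]] by auto
  have "dlift X J M h (f +[dsum J M] g) = finsum X (%j. h j ((f +[dsum J M] g) j)) ?A"
   by (rule dlift_superset[OF D.M.a_closed[OF fg] A(1) _ A(2)]) (use fg z in "auto simp: dsum_simps(2)")
  also have "... = finsum X (%j. h j (f j) +[X] h j (g j)) ?A"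
   by (rule X.M.finsum_cong')
    (use A ap in "auto simp: dsum_simps(2) lin_add[OF h] linC[OF h]")
  also have "... = finsum X (%j. h j (f j)) ?A +[X] finsum X (%j. h j (g j)) ?A"
   by (rule X.M.finsum_addf) (use A ap in "auto simp: linC[OF h]")
  also have "... = dlift X J M h f +[X] dlift X J M h g"
   using dlift_superset[OF fg(1) A(1) _ A(2)] dlift_superset[OF fg(2) A(1) _ A(2)] by simp
  finally show "dlift X J M h (f +[dsum J M] g) = dlift X J M h f +[X] dlift X J M h g" .
 next
  fix r f assume rf: "r : carrier R" "f : carrier (dsum J M)"
  let ?A = "{j : J. f j ~= 0[M j]}"
  note ap = dsum_apply[OF rf(2)]
  have "dlift X J M h (r *[dsum J M] f) = finsum X (%j. h j ((r *[dsum J M] f) j)) ?A"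
   by (rule dlift_superset[OF D.smult_closed[OF rf]])
    (use supp[OF rf(2)] rf in "auto simp: dsum_simps(3) module.smult_r_null[OF M]")
  also have "... = finsum X (%j. r *[X] h j (f j)) ?A"
   by (rule X.M.finsum_cong')
    (use rf ap in "auto simp: dsum_simps(3) lin_smult[OF h] linC[OF h]")
  also have "... = r *[X] dlift X J M h f"
   unfolding dlift_def
   by (rule X.finsum_smult_ldistr[symmetric]) (use supp[OF rf(2)] rf ap linC[OF h] in auto)
  finally show "dlift X J M h (r *[dsum J M] f) = r *[X] dlift X J M h f" .
 qed
qed

lemma dlift_dinj:
 assumes "i : J" "x : carrier (M i)"
 shows "dlift X J M h (dinj J M i x) = h i x"
proof -
 have "dlift X J M h (dinj J M i x) = finsum X (%j. h j (dinj J M i x j)) {i}"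
  by (rule dlift_superset[OF dinj_closed[OF assms(2)]])
   (use assms in "auto simp: dinj_def split: if_splits")
 then show ?thesis using assms linC[OF h] by (simp add: dinj_def)
qed

end

end

text \<open>For fixed parameters, both sides of additivity and homogeneity are linear in the tensor,
  so they need only be compared on pure tensors.\<close>

lemma tlift_param_lin:
 assumes A: "module R A" and B: "module R B" and C: "module R C" and X: "module R X"
  and bl: "!!p. p : carrier C ==> bilin R A B X (f p)"
  and fl: "!!x y. x : carrier A ==> y : carrier B ==> lin R C X (%p. f p x y)"
  and s: "s : carrier (tensor_mod R A B)"
 shows "lin R C X (%p. tlift R X (f p) s)"
proof -
 interpret X: module R X by fact
 interpret C: module R C by fact
 note AB = tens_mod[OF A B]
 note L = tlift_lin[OF A B X bl]
 note T = tlift_tens[OF A B X bl]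
 show ?thesis
 proof (rule linI)
  fix p assume "p : carrier C"
  then show "tlift R X (f p) s : carrier X" using linC[OF L] s by blast
 next
  fix p q assume p: "p : carrier C" "q : carrier C"
  show "tlift R X (f (p +[C] q)) s = tlift R X (f p) s +[X] tlift R X (f q) s"
   by (rule spans_eqI[OF AB X tensor_spans[OF A B] L lin_plus[OF X L L] _ s])
    (use p in "auto simp: T lin_add[OF fl]")
 next
  fix r p assume rp: "r : carrier R" "p : carrier C"
  have "lin R X X (%y. r *[X] y)"
   by (rule linI) (use rp in "auto simp: X.smult_r_distr X.smult_assoc1[symmetric] X.R.m_comm")
  from lin_comp[OF L[OF rp(2)] this]
  show "tlift R X (f (r *[C] p)) s = r *[X] tlift R X (f p) s"
   by (intro spans_eqI[OF AB X tensor_spans[OF A B] L _ _ s])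
    (use rp in "auto simp: T lin_smult[OF fl]")
 qed
qed

section \<open>The character module\<close>

text \<open>This is Hom(R, Q/Z), with \<open>R\<close> acting through the argument. Functions are
  extended by 0 off the carrier, so zero and addition are the pointwise ones of the function type
  and calculations can take place in the class \<open>ab_group_add\<close>.\<close>

definition dual_mod :: "'k ring => ('k, 'k => ratz) module" where
 "dual_mod R =
  \<lparr>carrier = {F. (ALL s. s ~: carrier R --> F s = 0) &
    (ALL s:carrier R. ALL t:carrier R. F (s +[R] t) = F s + F t)},
   mult = undefined, one = undefined, zero = 0, add = (+),
   smult = (%r F s. if s : carrier R then F (s \<otimes>\<^bsub>R\<^esub> r) else 0)\<rparr>"

lemma dual_mod_simps [simp]:
 "0[dual_mod R] = 0" "x +[dual_mod R] y = x + y"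
 by (simp_all add: dual_mod_def)

lemma dual_module:
 assumes "cring R"
 shows "module R (dual_mod R)"
proof (rule moduleI[OF assms])
 interpret R: cring R by fact
 have neg: "EX y:carrier (dual_mod R). y +[dual_mod R] x = 0[dual_mod R]"
  if "x : carrier (dual_mod R)" for x
  by (rule bexI[of _ "- x"]) (use that in "auto simp: dual_mod_def")
 show "abelian_group (dual_mod R)"
  by (rule abelian_groupI) (use neg in "auto simp: dual_mod_def algebra_simps fun_eq_iff")
next
 interpret R: cring R by fact
 let ?D = "dual_mod R"
 note [simp] = R.r_distr R.l_distr R.m_assoc
 { fix a b x assume "a : carrier R" "b : carrier R" "x : carrier ?D"
  then show "(a +[R] b) *[?D] x = a *[?D] x +[?D] b *[?D] x"
   "(a \<otimes>\<^bsub>R\<^esub> b) *[?D] x = a *[?D] (b *[?D] x)"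
   by (auto simp: dual_mod_def fun_eq_iff) }
 { fix a x assume "a : carrier R" "x : carrier ?D"
  then show "a *[?D] x : carrier ?D" by (auto simp: dual_mod_def) }
 { fix a x y assume "a : carrier R" "x : carrier ?D" "y : carrier ?D"
  then show "a *[?D] (x +[?D] y) = a *[?D] x +[?D] a *[?D] y"
   by (auto simp: dual_mod_def fun_eq_iff) }
 { fix x assume "x : carrier ?D"
  then show "\<one>\<^bsub>R\<^esub> *[?D] x = x" by (auto simp: dual_mod_def fun_eq_iff) }
qed

lemma dual_a_inv:
 assumes "cring R" "x : carrier (dual_mod R)"
 shows "-[dual_mod R] x = - x"
proof -
 interpret D: module R "dual_mod R" by (rule dual_module) fact
 have "- x : carrier (dual_mod R)" using assms(2) by (auto simp: dual_mod_def)
 then show ?thesis using assms(2) by (intro D.M.minus_equality) auto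
qed

lemma dual_a_minus:
 assumes "cring R" "y : carrier (dual_mod R)"
 shows "x -[dual_mod R] y = x - y"
 using dual_a_inv[OF assms] by (simp add: a_minus_def)

lemma dual_finsum:
 assumes "cring R" "f : A \<rightarrow> carrier (dual_mod R)"
 shows "finsum (dual_mod R) f A = sum f A"
proof -
 interpret D: module R "dual_mod R" by (rule dual_module) fact
 show ?thesis
 proof (cases "finite A")
  case True
  then show ?thesis using assms(2)
   by (induction A) (auto simp: D.M.finsum_insert)
 qed (simp add: D.M.finsum_infinite)
qed

abbreviation character :: "'k ring => ('k, 'a) module => ('a => 'k => ratz) => bool" where
 "character R X \<Phi> == lin R X (dual_mod R) \<Phi>"

text \<open>Since \<open>\<rat>/\<int>\<close> is injective, characters with values in \<open>Hom(R, \<rat>/\<int>)\<close> separate the points of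
 every module.  They turn identities in carrier-based modules into identities in a type of class
 \<^class>\<open>ab_group_add\<close>.\<close>

lemma character_sep:
 assumes X: "module R X" and xy: "x : carrier X" "y : carrier X"
  and eq: "!!\<Phi>. character R X \<Phi> ==> \<Phi> x = \<Phi> y"
 shows "x = y"
proof (rule ccontr)
 interpret X: module R X by fact
 assume ne: "x ~= y"
 have "x -[X] y ~= 0[X]"
 proof
  assume 0: "x -[X] y = 0[X]"
  have "x = (x -[X] y) +[X] y" using xy by (simp add: a_minus_def X.M.a_assoc X.M.l_neg)
  then show False using ne xy unfolding 0 by simp
 qed
 then obtain g :: "_ => ratz" where
  add: "!!a b. a : carrier X ==> b : carrier X ==> g (a +[X] b) = g a + g b" and
  nz: "g (x -[X] y) ~= 0"
  using X.M.char_separates[of "x -[X] y"] xy by auto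
 \<comment> \<open>Coinduction turns the additive \<open>g\<close> into an \<open>R\<close>-linear
   map; evaluation at the unit of \<open>R\<close> recovers \<open>g\<close>.\<close>
 define \<Phi> where "\<Phi> z = (%s. if s : carrier R then g (s *[X] z) else 0)" for z
 have \<Phi>: "character R X \<Phi>"
  by (rule linI)
   (auto simp: \<Phi>_def dual_mod_def add X.smult_l_distr X.smult_r_distr X.smult_assoc1 fun_eq_iff)
 have "\<Phi> (x -[X] y) = \<Phi> x - \<Phi> y"
  using lin_diff[OF X dual_module[OF X.R.cring_axioms] \<Phi> xy]
   dual_a_minus[OF X.R.cring_axioms linC[OF \<Phi> xy(2)]] by simp
 also have "... = 0" using eq[OF \<Phi>] by simp
 finally have "\<Phi> (x -[X] y) \<one>\<^bsub>R\<^esub> = 0" by simp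
 then show False using nz xy by (simp add: \<Phi>_def)
qed

context
 fixes R :: "'k ring" and X :: "('k, 'x) module" and \<Phi>
 assumes X: "module R X" and \<Phi>: "character R X \<Phi>"
begin

interpretation X: module R X by (rule X)

lemma character_add: "x : carrier X ==> y : carrier X ==> \<Phi> (x +[X] y) = \<Phi> x + \<Phi> y"
 using lin_add[OF \<Phi>] by simp

lemma character_zero: "\<Phi> 0[X] = 0"
 using lin_zero[OF X dual_module[OF X.R.cring_axioms] \<Phi>] by simp

lemma character_minus: "x : carrier X ==> \<Phi> (-[X] x) = - \<Phi> x"
 using lin_minus[OF X dual_module[OF X.R.cring_axioms] \<Phi>]
  dual_a_inv[OF X.R.cring_axioms linC[OF \<Phi>]] by simp

lemma character_diff: "x : carrier X ==> y : carrier X ==> \<Phi> (x -[X] y) = \<Phi> x - \<Phi> y"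
 by (simp add: a_minus_def character_add character_minus)

lemma character_finsum:
 assumes "g : A \<rightarrow> carrier X"
 shows "\<Phi> (finsum X g A) = (SUM i:A. \<Phi> (g i))"
proof (cases "finite A")
 case True
 have "\<Phi> (finsum X g A) = finsum (dual_mod R) (%i. \<Phi> (g i)) A"
  by (rule lin_finsum[OF X dual_module[OF X.R.cring_axioms] \<Phi> True assms])
 also have "... = (SUM i:A. \<Phi> (g i))"
  by (rule dual_finsum[OF X.R.cring_axioms]) (use assms linC[OF \<Phi>] in auto)
 finally show ?thesis .
qed (simp add: X.M.finsum_infinite character_zero)

end

lemma character_lin_plus:
 assumes "cring R" "character R M f" "character R M g"
 shows "character R M (%x. f x + g x)"
 using lin_plus[OF dual_module[OF assms(1)] assms(2,3)] by simp

lemma character_lin_uminus: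
 assumes "cring R" "module R M" "character R M f"
 shows "character R M (%x. - f x)"
 by (rule lin_cong[OF assms(2) _ lin_uminus[OF dual_module[OF assms(1)] assms(3)]])
  (use dual_a_inv[OF assms(1) linC[OF assms(3)]] in auto)

lemma character_lin_diff:
 assumes "cring R" "module R M" "character R M f" "character R M g"
 shows "character R M (%x. f x - g x)"
 using character_lin_plus[OF assms(1,3) character_lin_uminus[OF assms(1,2,4)]] by simp

lemma character_lin_zero:
 assumes "cring R"
 shows "character R M (%x. 0)"
 using lin_const_zero[OF dual_module[OF assms(1)]] by simp

lemma character_lin_sum:
 assumes "cring R" "!!i. i : A ==> character R M (f i)"
 shows "character R M (%x. SUM i:A. f i x)"
 using assms(2)
 by (induction A rule: infinite_finite_induct)
  (auto intro: character_lin_plus character_lin_zero assms(1))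

section \<open>Tensors as lists of pure tensors\<close>

text \<open>Since \<open>S\<close> is stable under scalars, coefficients are absorbed into the
  generators, and plain sums of elements of \<open>S\<close> already form a submodule; negatives
  come from the scalar -1.\<close>

lemma spans_sum_list:
 assumes M: "module R M" and S: "spans R M S"
  and smult: "!!r s. r : carrier R ==> s : S ==> r *[M] s : S"
  and x: "x : carrier M"
 shows "EX l. set l <= S & x = foldr (add M) l 0[M]"
proof -
 interpret M: module R M by fact
 let ?sum = "%l. foldr (add M) l 0[M]"
 let ?K = "{?sum l | l. set l <= S}"
 have SM: "S <= carrier M" using S unfolding spans_def by blast
 have c: "?sum l : carrier M" if "set l <= S" for l
  using that SM by (induction l) auto
 have app: "?sum (l @ k) = ?sum l +[M] ?sum k" if "set l <= S" "set k <= S" for l k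
  using that(1)
 proof (induction l)
  case (Cons a l)
  then show ?case using c[of l] c[OF that(2)] SM by (auto simp: M.M.a_assoc)
 qed (use c[OF that(2)] in simp)
 have sm: "r *[M] ?sum l = ?sum (map (smult M r) l)" if "set l <= S" "r : carrier R" for r l
  using that(1)
 proof (induction l)
  case (Cons a l)
  then show ?case using c[of l] SM that(2) by (auto simp: M.smult_r_distr)
 qed (use that(2) in simp)
 have smK: "r *[M] y : ?K" if r: "r : carrier R" and y: "y : ?K" for r y
 using y smult r sm by fastforce
 have "submodule ?K R M"
 proof (rule M.submoduleI)
  show "?K <= carrier M" using c by blast
  show "0[M] : ?K" by (rule CollectI, rule exI[of _ "[]"]) simp
  fix a b assume ab: "a : ?K" "b : ?K"
  then obtain l k where lk: "set l <= S" "a = ?sum l" "set k <= S" "b = ?sum k" by blast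
  show "a +[M] b : ?K"
   by (rule CollectI, rule exI[of _ "l @ k"]) (use lk app[OF lk(1,3)] in simp)
 next
  fix a assume a: "a : ?K"
  then have "a : carrier M" using c by blast
  then have "-[M] a = (-[R] \<one>\<^bsub>R\<^esub>) *[M] a" by (simp add: M.smult_l_minus)
  moreover have "(-[R] \<one>\<^bsub>R\<^esub>) *[M] a : ?K" by (rule smK[OF _ a]) simp
  ultimately show "-[M] a : ?K" by simp
 qed (rule smK)
 moreover have "S <= ?K"
 proof
  fix s assume "s : S"
  then show "s : ?K" by (intro CollectI exI[of _ "[s]"]) (use SM in auto)
 qed
 ultimately have "carrier M <= ?K" using S unfolding spans_def by blast
 then show ?thesis using x by blast
qed

lemma character_foldr:
 assumes X: "module R X" and \<Phi>: "character R X \<Phi>" and "set l <= carrier X"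
 shows "\<Phi> (foldr (add X) l 0[X]) = (\<Sum>x\<leftarrow>l. \<Phi> x)"
proof -
 interpret X: module R X by fact
 have c: "foldr (add X) l 0[X] : carrier X" if "set l <= carrier X" for l
  using that by (induction l) auto
 show ?thesis using assms(3)
  by (induction l) (auto simp: character_zero[OF X \<Phi>] character_add[OF X \<Phi>] c)
qed

text \<open>Sweedler components made concrete: one chosen list of pure tensors with sum
  \<open>t\<close>. The list depends on the choice, but the sum of a bilinear function over it
  depends on \<open>t\<close> alone, see \<open>psum_tlift_dual\<close>.\<close>

definition tlist :: "'k ring => ('k, 'a) module => ('k, 'b) module => ('k, 'a, 'b) tensor => ('a \<times> 'b) list"
 where "tlist R A B t = (SOME ps. set ps <= carrier A \<times> carrier B &
  t = foldr (add (tensor_mod R A B)) (map (%(x, y). tens R A B x y) ps) 0[tensor_mod R A B])"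

definition psum :: "('a \<times> 'b) list => ('a => 'b => 'g::ab_group_add) => 'g" where
 "psum ps h = (\<Sum>(x, y)\<leftarrow>ps. h x y)"

lemma psum_Nil [simp]: "psum [] h = 0"
 by (simp add: psum_def)

lemma psum_Cons [simp]: "psum (p # ps) h = h (fst p) (snd p) + psum ps h"
 by (simp add: psum_def case_prod_beta)

lemma psum_add: "psum ps (%x y. f x y + g x y) = psum ps f + psum ps g"
 by (induction ps) (auto simp: algebra_simps)

lemma psum_minus: "psum ps (%x y. - f x y) = - psum ps f"
 by (induction ps) auto

lemma psum_diff: "psum ps (%x y. f x y - g x y) = psum ps f - psum ps g"
 by (induction ps) (auto simp: algebra_simps)

lemma psum_zero [simp]: "psum ps (%x y. 0) = 0"
 by (induction ps) auto

lemma psum_sum: "psum ps (%x y. SUM i:A. f i x y) = (SUM i:A. psum ps (f i))"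
 by (induction ps) (auto simp: sum.distrib)

lemma psum_swap: "psum ps (%x y. psum qs (h x y)) = psum qs (%u v. psum ps (%x y. h x y u v))"
 by (induction ps) (auto simp: psum_add)

lemma psum_cong: "(!!x y. (x, y) : set ps ==> f x y = g x y) ==> psum ps f = psum ps g"
 by (induction ps) auto

lemma psum_map: "psum (map (%(x, y). (f x y, g x y)) ps) h = psum ps (%x y. h (f x y) (g x y))"
 by (induction ps) auto

lemma character_psum:
 assumes "cring R" "!!u v. (u, v) : set ps ==> character R M (%x. h x u v)"
 shows "character R M (%x. psum ps (h x))"
 using assms(2)
 by (induction ps) (auto intro!: character_lin_plus character_lin_zero assms(1))

context
 fixes R :: "'k ring" and A :: "('k, 'a) module" and B :: "('k, 'b) module"
 assumes A: "module R A" and B: "module R B"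
begin

interpretation A: module R A by (rule A)
interpretation B: module R B by (rule B)

lemma tlist_spec:
 assumes t: "t : carrier (tensor_mod R A B)"
 shows "set (tlist R A B t) <= carrier A \<times> carrier B"
  "t = foldr (add (tensor_mod R A B)) (map (%(x, y). tens R A B x y) (tlist R A B t)) 0[tensor_mod R A B]"
proof -
 let ?S = "(%(x, y). tens R A B x y) ` (carrier A \<times> carrier B)"
 have "EX l. set l <= ?S & t = foldr (add (tensor_mod R A B)) l 0[tensor_mod R A B]"
 proof (rule spans_sum_list[OF tens_mod[OF A B] tensor_spans[OF A B] _ t])
  fix r s assume r: "r : carrier R" and "s : ?S"
  then obtain x y where xy: "x : carrier A" "y : carrier B" "s = tens R A B x y" by auto
  then have "r *[tensor_mod R A B] s = tens R A B (r *[A] x) y"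
   using lin_smult[OF bilinL[OF tens_bilin[OF A B]]] r by simp
  then show "r *[tensor_mod R A B] s : ?S" using xy r by force
 qed
 then obtain l where l: "set l <= ?S" "t = foldr (add (tensor_mod R A B)) l 0[tensor_mod R A B]" by blast
 have "EX ps. set ps <= carrier A \<times> carrier B & l = map (%(x, y). tens R A B x y) ps"
  using l(1)
 proof (induction l)
  case (Cons a l)
  then obtain ps x y where "set ps <= carrier A \<times> carrier B" "l = map (%(x, y). tens R A B x y) ps"
   "x : carrier A" "y : carrier B" "a = tens R A B x y" by auto
  then show ?case by (intro exI[of _ "(x, y) # ps"]) auto
 qed simp
 then have "EX ps. set ps <= carrier A \<times> carrier B &
  t = foldr (add (tensor_mod R A B)) (map (%(x, y). tens R A B x y) ps) 0[tensor_mod R A B]"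
  using l(2) by blast
 from someI_ex[OF this]
 show "set (tlist R A B t) <= carrier A \<times> carrier B"
  "t = foldr (add (tensor_mod R A B)) (map (%(x, y). tens R A B x y) (tlist R A B t)) 0[tensor_mod R A B]"
  unfolding tlist_def by auto
qed

lemma tlist_mem:
 assumes "t : carrier (tensor_mod R A B)" "(x, y) : set (tlist R A B t)"
 shows "x : carrier A" "y : carrier B"
 using tlist_spec(1)[OF assms(1)] assms(2) by auto

text \<open>The listed pure tensors add up to \<open>t\<close> and \<open>\<Phi>\<close> is
  additive. Conversely, every test function of this kind can be taken apart into its values on pure
  tensors.\<close>

lemma psumt:
 assumes t: "t : carrier (tensor_mod R A B)" and \<Phi>: "character R (tensor_mod R A B) \<Phi>"
 shows "psum (tlist R A B t) (%x y. \<Phi> (tens R A B x y)) = \<Phi> t"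
proof -
 have "set (map (%(x, y). tens R A B x y) (tlist R A B t)) <= carrier (tensor_mod R A B)"
  using tlist_spec(1)[OF t] tens_closed[OF A B] by auto
 from character_foldr[OF tens_mod[OF A B] \<Phi> this]
 have "\<Phi> t = (\<Sum>s\<leftarrow>map (%(x, y). tens R A B x y) (tlist R A B t). \<Phi> s)"
  by (simp only: tlist_spec(2)[OF t, symmetric])
 then show ?thesis by (simp add: psum_def case_prod_unfold comp_def)
qed

text \<open>The translation rule from the definitions to calculations: under a character an
  expression in Sweedler notation becomes an honest finite sum.\<close>

lemma character_tlift:
 assumes X: "module R X" and \<Phi>: "character R X \<Phi>" and h: "bilin R A B X h"
  and t: "t : carrier (tensor_mod R A B)"
 shows "\<Phi> (tlift R X h t) = psum (tlist R A B t) (%x y. \<Phi> (h x y))"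
proof -
 have "psum (tlist R A B t) (%x y. \<Phi> (tlift R X h (tens R A B x y))) = \<Phi> (tlift R X h t)"
  by (rule psumt[OF t lin_comp[OF tlift_lin[OF A B X h] \<Phi>]])
 then show ?thesis
  using tlift_tens[OF A B X h] tlist_mem[OF t] by (simp cong: psum_cong)
qed

lemma psum_tlift_dual:
 assumes h: "bilin R A B (dual_mod R) h" and t: "t : carrier (tensor_mod R A B)"
 shows "psum (tlist R A B t) h = tlift R (dual_mod R) h t"
 using character_tlift[OF dual_module[OF A.R.cring_axioms] lin_id h t] by simp

lemma psumt_lin:
 assumes h: "bilin R A B (dual_mod R) h"
 shows "character R (tensor_mod R A B) (%t. psum (tlist R A B t) h)"
 by (rule lin_cong[OF tens_mod[OF A B] _ tlift_lin[OF A B dual_module[OF A.R.cring_axioms] h]])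
  (rule psum_tlift_dual[OF h, symmetric])

lemma psumt_tens:
 assumes h: "bilin R A B (dual_mod R) h" and "x : carrier A" "y : carrier B"
 shows "psum (tlist R A B (tens R A B x y)) h = h x y"
 using psum_tlift_dual[OF h tens_closed[OF A B]] assms
  tlift_tens[OF A B dual_module[OF A.R.cring_axioms] h] by simp

lemmas psumt_add = character_add[OF tens_mod[OF A B] psumt_lin]
lemmas psumt_zero = character_zero[OF tens_mod[OF A B] psumt_lin]
lemmas psumt_minus = character_minus[OF tens_mod[OF A B] psumt_lin]
lemmas psumt_diff = character_diff[OF tens_mod[OF A B] psumt_lin]

end

lemma psumt_tlift:
 assumes A: "module R A" and B: "module R B" and C: "module R C" and D: "module R D"
  and h: "bilin R A B (dual_mod R) h" and k: "bilin R C D (tensor_mod R A B) k"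
  and t: "t : carrier (tensor_mod R C D)"
 shows "psum (tlist R A B (tlift R (tensor_mod R A B) k t)) h =
  psum (tlist R C D t) (%x y. psum (tlist R A B (k x y)) h)"
 by (rule character_tlift[OF C D tens_mod[OF A B] psumt_lin[OF A B h] k t])

lemma psumt_swap:
 assumes A: "module R A" and B: "module R B" and h: "bilin R B A (dual_mod R) h"
  and t: "t : carrier (tensor_mod R A B)"
 shows "psum (tlist R B A (swap R A B t)) h = psum (tlist R A B t) (%x y. h y x)"
proof -
 have "psum (tlist R B A (swap R A B t)) h =
   psum (tlist R A B t) (%x y. psum (tlist R B A (tens R B A y x)) h)"
  unfolding swap_def
  by (rule psumt_tlift[OF B A A B h bilin_swap[OF tens_bilin[OF B A]] t])
 also have "... = psum (tlist R A B t) (%x y. h y x)"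
  by (rule psum_cong) (use psumt_tens[OF B A h] tlist_mem[OF A B t] in auto)
 finally show ?thesis .
qed

lemma swap_closed:
 "module R A ==> module R B ==> t : carrier (tensor_mod R A B) ==> swap R A B t : carrier (tensor_mod R B A)"
 unfolding swap_def using linC[OF tlift_lin[OF _ _ tens_mod bilin_swap[OF tens_bilin]]] by blast

section \<open>Threefold tensor products\<close>

definition trilin ::
 "'k ring => ('k, 'a) module => ('k, 'b) module => ('k, 'c) module => ('k, 'x) module =>
  ('a => 'b => 'c => 'x) => bool" where
 "trilin R A B C X H \<longleftrightarrow>
  (ALL x:carrier A. bilin R B C X (H x)) &
  (ALL y:carrier B. ALL z:carrier C. lin R A X (%x. H x y z))"

text \<open>Triple tensors are bracketed to the right, so the second list depends on the entry taken
  from the first.\<close>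

definition tsum3 ::
 "'k ring => ('k, 'a) module => ('k, 'b) module => ('k, 'c) module =>
  ('k, 'a, ('k, 'b, 'c) tensor) tensor => ('a => 'b => 'c => 'g::ab_group_add) => 'g" where
 "tsum3 R A B C t H = psum (tlist R A (tensor_mod R B C) t) (%x s. psum (tlist R B C s) (H x))"

context
 fixes R :: "'k ring" and A :: "('k, 'a) module" and B :: "('k, 'b) module" and C :: "('k, 'c) module"
 assumes A: "module R A" and B: "module R B" and C: "module R C"
begin

interpretation A: module R A by (rule A)

lemmas BC = tens_mod[OF B C]

lemma trilin_tlist:
 assumes H: "trilin R A B C (dual_mod R) H"
 shows "bilin R A (tensor_mod R B C) (dual_mod R) (%x s. psum (tlist R B C s) (H x))"
proof (rule bilinI)
 show "character R (tensor_mod R B C) (%s. psum (tlist R B C s) (H x))" if "x : carrier A" for x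
  by (rule psumt_lin[OF B C]) (use H that in "auto simp: trilin_def")
 show "character R A (%x. psum (tlist R B C s) (H x))" if "s : carrier (tensor_mod R B C)" for s
  by (rule character_psum[OF A.R.cring_axioms])
   (use H tlist_mem[OF B C that] in "auto simp: trilin_def")
qed

lemma tsum3_lin:
 assumes H: "trilin R A B C (dual_mod R) H"
 shows "character R (tensor3 R A B C) (%t. tsum3 R A B C t H)"
 unfolding tsum3_def tensor3_def by (rule psumt_lin[OF A BC trilin_tlist[OF H]])

lemma tensor3_module: "module R (tensor3 R A B C)"
 unfolding tensor3_def by (rule tens_mod[OF A BC])

lemma tens_tens_bilin: "bilin R A (tensor_mod R B C) (tensor3 R A B C) (tens R A (tensor_mod R B C))"
 unfolding tensor3_def by (rule tens_bilin[OF A BC])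

lemma tens3_trilin: "trilin R A B C (tensor3 R A B C) (tens3 R A B C)"
 unfolding trilin_def tens3_def
by (metis bilin_comp tens_bilin B C bilinR tens_tens_bilin bilinL tens_closed)

lemma tsum3_tens:
 assumes H: "trilin R A B C (dual_mod R) H" and "x : carrier A" "s : carrier (tensor_mod R B C)"
 shows "tsum3 R A B C (tens R A (tensor_mod R B C) x s) H = psum (tlist R B C s) (H x)"
 unfolding tsum3_def by (rule psumt_tens[OF A BC trilin_tlist[OF H] assms(2,3)])

lemma tsum3_tens3:
 assumes H: "trilin R A B C (dual_mod R) H"
  and "x : carrier A" "y : carrier B" "z : carrier C"
 shows "tsum3 R A B C (tens3 R A B C x y z) H = H x y z"
 unfolding tens3_def using assms tsum3_tens[OF H assms(2) tens_closed[OF B C assms(3,4)]]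
  psumt_tens[OF B C, of "H x"] by (simp add: trilin_def)

lemma character_tlift3:
 assumes X: "module R X" and \<Phi>: "character R X \<Phi>" and f: "trilin R A B C X f"
  and t: "t : carrier (tensor3 R A B C)"
 shows "\<Phi> (tlift3 R X f t) = tsum3 R A B C t (%x y z. \<Phi> (f x y z))"
  "tlift3 R X f t : carrier X"
proof -
 have bl: "bilin R A (tensor_mod R B C) X (%x s. tlift R X (f x) s)"
 proof (rule bilinI)
  show L: "lin R (tensor_mod R B C) X (tlift R X (f x))" if "x : carrier A" for x
   by (rule tlift_lin[OF B C X]) (use f that in "auto simp: trilin_def")
  show "lin R A X (%x. tlift R X (f x) s)" if "s : carrier (tensor_mod R B C)" for s
   by (rule tlift_param_lin[OF B C A X _ _ that]) (use f in "auto simp: trilin_def")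
 qed
 show "tlift3 R X f t : carrier X"
  unfolding tlift3_def
  by (rule linC[OF tlift_lin[OF A BC X bl]]) (use t in "simp add: tensor3_def")
 have "\<Phi> (tlift3 R X f t) =
   psum (tlist R A (tensor_mod R B C) t) (%x s. \<Phi> (tlift R X (f x) s))"
  unfolding tlift3_def
  by (rule character_tlift[OF A BC X \<Phi> bl]) (use t in "simp add: tensor3_def")
 also have "... = tsum3 R A B C t (%x y z. \<Phi> (f x y z))"
  unfolding tsum3_def
  by (rule psum_cong, rule character_tlift[OF B C X \<Phi>])
   (use tlist_mem[OF A BC t[unfolded tensor3_def]] f in "auto simp: trilin_def")
 finally show "\<Phi> (tlift3 R X f t) = tsum3 R A B C t (%x y z. \<Phi> (f x y z))" .
qed

lemmas tsum3_add = character_add[OF tensor3_module tsum3_lin]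
lemmas tsum3_zero = character_zero[OF tensor3_module tsum3_lin]
lemmas tsum3_diff = character_diff[OF tensor3_module tsum3_lin]

lemma tsum3_tlift:
 assumes H: "trilin R A B C (dual_mod R) H" and D: "module R D" and E: "module R E"
  and k: "bilin R D E (tensor3 R A B C) k" and t: "t : carrier (tensor_mod R D E)"
 shows "tsum3 R A B C (tlift R (tensor3 R A B C) k t) H =
  psum (tlist R D E t) (%x y. tsum3 R A B C (k x y) H)"
 by (rule character_tlift[OF D E tensor3_module tsum3_lin[OF H] k t])

lemma tlist3_mem:
 assumes "t : carrier (tensor3 R A B C)" "(x, s) : set (tlist R A (tensor_mod R B C) t)"
 shows "x : carrier A" "s : carrier (tensor_mod R B C)"
 using tlist_mem[OF A BC] assms unfolding tensor3_def by auto

lemma tsum3_cong: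
 assumes t: "t : carrier (tensor3 R A B C)"
  and "!!x y z. x : carrier A ==> y : carrier B ==> z : carrier C ==> H x y z = H' x y z"
 shows "tsum3 R A B C t H = tsum3 R A B C t H'"
 unfolding tsum3_def
 by (intro psum_cong assms(2)) (auto dest: tlist3_mem[OF t] intro: tlist_mem[OF B C])

end

lemma trilin_rotate1:
 "trilin R A B C X H ==> trilin R B C A X (%y z x. H x y z)"
 unfolding trilin_def bilin_def by auto

lemma trilin_rotate2:
 "trilin R A B C X H ==> trilin R C A B X (%z x y. H x y z)"
 unfolding trilin_def bilin_def by auto

context
 fixes R :: "'k ring" and M :: "('k, 'a) module" and H :: "'a => 'a => 'a => 'k => ratz"
 assumes M: "module R M" and H: "trilin R M M M (dual_mod R) H"
begin

lemma tau123_closed: "t : carrier (tensor3 R M M M) ==> tau123 R M t : carrier (tensor3 R M M M)"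
 unfolding tau123_def
 by (rule character_tlift3(2)[OF M M M tensor3_module[OF M M M] tsum3_lin[OF M M M H]
    trilin_rotate1[OF tens3_trilin[OF M M M]]])

lemma tau132_closed: "t : carrier (tensor3 R M M M) ==> tau132 R M t : carrier (tensor3 R M M M)"
 unfolding tau132_def
 by (rule character_tlift3(2)[OF M M M tensor3_module[OF M M M] tsum3_lin[OF M M M H]
    trilin_rotate2[OF tens3_trilin[OF M M M]]])

lemma tsum3_tau123:
 assumes t: "t : carrier (tensor3 R M M M)"
 shows "tsum3 R M M M (tau123 R M t) H = tsum3 R M M M t (%x y z. H z x y)"
 unfolding tau123_def
  character_tlift3(1)[OF M M M tensor3_module[OF M M M] tsum3_lin[OF M M M H]
   trilin_rotate1[OF tens3_trilin[OF M M M]] t]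
 by (rule tsum3_cong[OF M M M t]) (rule tsum3_tens3[OF M M M H])

lemma tsum3_tau132:
 assumes t: "t : carrier (tensor3 R M M M)"
 shows "tsum3 R M M M (tau132 R M t) H = tsum3 R M M M t (%x y z. H y z x)"
 unfolding tau132_def
  character_tlift3(1)[OF M M M tensor3_module[OF M M M] tsum3_lin[OF M M M H]
   trilin_rotate2[OF tens3_trilin[OF M M M]] t]
 by (rule tsum3_cong[OF M M M t]) (rule tsum3_tens3[OF M M M H])

end

section \<open>The hypotheses, and linear functionals described by their values on letters\<close>

locale double_lie_data =
 fixes R :: "'k ring"
  and L :: "('k, 'l) module"
  and br :: "'l => 'l => 'l"
  and \<delta> :: "'l => ('k, 'l, 'l) tensor"
  and I :: "'i set"
  and P :: "'i \<times> 'i => ('k, 'p) module"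
  and \<rho> :: "'i \<times> 'i => 'l => 'p => 'p"
  and \<sigma> :: "'i \<times> 'i => 'p => ('k, 'l, 'p) tensor"
  and D :: "('k, 'i, 'p) dbl"
 assumes R: "cring R"
  and dlb: "double_lie_bimodule R L br \<delta> I P \<rho> \<sigma> D"
begin

abbreviation "Q == qsum I P"
abbreviation "QQ == tensor_mod R Q Q"
abbreviation "DD == ind_dbl R I P D"
abbreviation "act == ind_act I \<rho>"
abbreviation "coact == ind_coact R L I P \<sigma>"
abbreviation "G == dual_mod R"

lemmas G_mod = dual_module[OF R]

lemma bialg: "lie_bialgebra R L br \<delta>" using dlb unfolding double_lie_bimodule_def by blast
lemma dquiver: "double_lie_quiver R I P D" using dlb unfolding double_lie_bimodule_def by blast
lemma dmodule: "double_lie_module R L br I P \<rho> D" using dlb unfolding double_lie_bimodule_def by blast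
lemma dcomodule: "double_lie_comodule R L \<delta> I P \<sigma> D" using dlb unfolding double_lie_bimodule_def by blast
lemma bimodule: "lie_bimodule R L br \<delta> I P \<rho> \<sigma>" using dlb unfolding double_lie_bimodule_def by blast

lemma LM: "module R L" and br_bilin: "bilin R L L L br"
 and br_antisym: "!!x y. x : carrier L ==> y : carrier L ==> br y x = -[L] br x y"
 and br_jacobi: "!!x y z. x : carrier L ==> y : carrier L ==> z : carrier L ==>
  br x (br y z) +[L] br z (br x y) +[L] br y (br z x) = 0[L]"
 using bialg unfolding lie_bialgebra_def lie_algebra_def by blast+

lemma \<delta>_lin: "lin R L (tensor_mod R L L) \<delta>"
 and \<delta>_swap: "!!x. x : carrier L ==> swap R L L (\<delta> x) = -[tensor_mod R L L] \<delta> x"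
 and \<delta>_cojacobi: "!!x. x : carrier L ==>
    cobr2 R L \<delta> x +[tensor3 R L L L] tau123 R L (cobr2 R L \<delta> x)
     +[tensor3 R L L L] tau123 R L (tau123 R L (cobr2 R L \<delta> x)) = 0[tensor3 R L L L]"
 and \<delta>_br: "!!v w. v : carrier L ==> w : carrier L ==> \<delta> (br v w) =
     (-[tensor_mod R L L] adj R L br w (\<delta> v)) +[tensor_mod R L L] adj R L br v (\<delta> w)"
 using bialg unfolding lie_bialgebra_def lie_coalgebra_def by blast+

lemma PM: "e : I \<times> I ==> module R (P e)"
 and D_bilin: "a : I ==> b : I ==> c : I ==> d : I ==> distinct [a, b, c, d] ==>
    bilin R (P (a, b)) (P (c, d)) (tensor_mod R (P (a, d)) (P (c, b))) (D a b c d)"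
 and DD_bracket: "double_lie_bracket R Q DD"
 using dquiver unfolding double_lie_quiver_def quiver_def by blast+

lemma QM: "module R Q" and DD_bilin: "bilin R Q Q QQ DD"
 using DD_bracket unfolding double_lie_bracket_def by blast+

lemmas QQ_mod = tens_mod[OF QM QM]

lemma \<rho>_bilin: "e : I \<times> I ==> bilin R L (P e) (P e) (\<rho> e)"
 and \<rho>_br: "e : I \<times> I ==> g : carrier L ==> d : carrier L ==> m : carrier (P e) ==>
     \<rho> e (br g d) m = \<rho> e g (\<rho> e d m) -[P e] \<rho> e d (\<rho> e g m)"
 using dmodule unfolding double_lie_module_def lie_module_def by blast+

lemma \<sigma>_lin: "e : I \<times> I ==> lin R (P e) (tensor_mod R L (P e)) (\<sigma> e)"
 using dcomodule unfolding double_lie_comodule_def lie_comodule_def by blast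

definition letters :: "('i, 'p) letter set" where
 "letters = {l. fst l : I \<times> I & snd l : carrier (P (fst l))}"

text \<open>Such functions are the linear functionals on the direct sum \<open>Q\<close>, seen on
  homogeneous elements; \<open>ext\<close> passes back to \<open>Q\<close>. The hypotheses speak
  about \<open>Q\<close>, words are made of letters, and these two directions connect them.\<close>

definition llin :: "(('i, 'p) letter => 'k => ratz) => bool" where
 "llin h \<longleftrightarrow> (ALL e:I \<times> I. character R (P e) (%x. h (e, x)))"

definition llin2 :: "(('i, 'p) letter => ('i, 'p) letter => 'k => ratz) => bool" where
 "llin2 H \<longleftrightarrow> (ALL l:letters. llin (H l)) & (ALL l:letters. llin (%l'. H l' l))"

definition llin3 ::
 "(('i, 'p) letter => ('i, 'p) letter => ('i, 'p) letter => 'k => ratz) => bool" where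
 "llin3 H \<longleftrightarrow> (ALL l:letters. llin2 (H l)) &
  (ALL l:letters. ALL l':letters. llin (%x. H x l l'))"

definition mlin :: "('l => ('i, 'p) letter => 'k => ratz) => bool" where
 "mlin H \<longleftrightarrow> (ALL g:carrier L. llin (H g)) & (ALL l:letters. character R L (%g. H g l))"

definition inj :: "('i, 'p) letter => 'i \<times> 'i => 'p" where
 "inj l = dinj (I \<times> I) P (fst l) (snd l)"

lemma letters_iff: "(e, x) : letters \<longleftrightarrow> e : I \<times> I & x : carrier (P e)"
 by (simp add: letters_def)

lemma letter_linD: "llin h ==> e : I \<times> I ==> character R (P e) (%x. h (e, x))"
 by (auto simp: llin_def)

lemma inj_closed: "l : letters ==> inj l : carrier Q"
 unfolding inj_def qsum_def letters_def by (auto intro!: dinj_closed[OF R PM])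

lemma inj_lin: "e : I \<times> I ==> lin R (P e) Q (%x. inj (e, x))"
 unfolding inj_def qsum_def by (simp add: dinj_lin[of R "I \<times> I" P, OF R PM])

text \<open>A sum in the ambient type instead of \<open>dlift\<close>, so that it can be manipulated
  by the rules for \<open>sum\<close>; \<open>ext_eq\<close> identifies the two.\<close>

definition ext :: "(('i, 'p) letter => 'k => ratz) => ('i \<times> 'i => 'p) => 'k => ratz" where
 "ext h q = (SUM e:{e : I \<times> I. q e ~= 0[P e]}. h (e, q e))"

lemma Q_apply: "q : carrier Q ==> e : I \<times> I ==> (e, q e) : letters"
 unfolding letters_iff qsum_def by (auto intro: dsum_apply)

lemma ext_eq:
 assumes "llin h" "q : carrier Q"
 shows "dlift G (I \<times> I) P (%e x. h (e, x)) q = ext h q"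
 unfolding dlift_def ext_def
 by (rule dual_finsum[OF R])
  (use Q_apply[OF assms(2)] linC[OF letter_linD[OF assms(1)]] in "auto simp: letters_iff")

lemma ext_lin:
 assumes "llin h"
 shows "character R Q (ext h)"
 by (rule lin_cong[OF QM ext_eq[OF assms]], assumption)
  (unfold qsum_def, rule dlift_lin[OF R PM G_mod letter_linD[OF assms]])

lemma ext_inj:
 assumes "llin h" "l : letters"
 shows "ext h (inj l) = h l"
 using ext_eq[OF assms(1) inj_closed[OF assms(2)]] assms(2)
  dlift_dinj[of R "I \<times> I" P G "%e x. h (e, x)" "fst l" "snd l", OF R PM G_mod letter_linD[OF assms(1)]]
 by (auto simp: inj_def letters_def)

definition "ext2 H q q' = ext (%l. ext (H l) q') q"
definition "ext3 H q q' q'' = ext (%l. ext2 (H l) q' q'') q"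

lemma ext_param_lin:
 assumes "!!l. l : letters ==> character R X (%x. H x l)" "q : carrier Q"
 shows "character R X (%x. ext (H x) q)"
 unfolding ext_def by (rule character_lin_sum[OF R]) (use assms Q_apply in auto)

lemma llin_ext:
 assumes "!!l. l : letters ==> llin (%x. H x l)" "q : carrier Q"
 shows "llin (%x. ext (H x) q)"
 unfolding llin_def
using ext_param_lin letter_linD assms by fastforce

lemma ext2_bilin:
 assumes "llin2 H"
 shows "bilin R Q Q G (ext2 H)"
proof (rule bilinI)
 fix q assume q: "q : carrier Q"
 show "character R Q (ext2 H q)"
  unfolding ext2_def by (rule ext_param_lin[OF ext_lin q]) (use assms in "auto simp: llin2_def")
 show "character R Q (%q'. ext2 H q' q)"
  unfolding ext2_def by (rule ext_lin[OF llin_ext[OF _ q]]) (use assms in "auto simp: llin2_def")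
qed

lemma ext2_inj:
 assumes "llin2 H" "l : letters" "l' : letters"
 shows "ext2 H (inj l) (inj l') = H l l'"
using ext2_def ext_inj llin_ext inj_closed assms llin2_def by simp

lemma ext2_param_lin:
 assumes "!!l l'. l : letters ==> l' : letters ==> character R X (%x. H x l l')"
  "q : carrier Q" "q' : carrier Q"
 shows "character R X (%x. ext2 (H x) q q')"
 unfolding ext2_def by (intro ext_param_lin assms)

lemma ext3_trilin:
 assumes "llin3 H"
 shows "trilin R Q Q Q G (ext3 H)"
 unfolding trilin_def
proof (intro conjI ballI)
 fix q assume q: "q : carrier Q"
 have 2: "llin2 (H l)" if "l : letters" for l using assms that by (auto simp: llin3_def)
 show "bilin R Q Q G (ext3 H q)"
  unfolding ext3_def
  by (intro bilinI ext_param_lin[OF _ q]) (auto intro: bilinD[OF ext2_bilin[OF 2]])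
 fix q' assume q': "q' : carrier Q"
 have "llin (%l. ext2 (H l) q q')"
  unfolding ext2_def by (intro llin_ext q q') (use assms in "auto simp: llin3_def")
 then show "character R Q (%x. ext3 H x q q')"
  unfolding ext3_def by (rule ext_lin)
qed

lemma ext3_inj:
 assumes "llin3 H" "l : letters" "l' : letters" "l'' : letters"
 shows "ext3 H (inj l) (inj l') (inj l'') = H l l' l''"
using ext2_def llin_ext inj_closed assms llin3_def ext3_def ext_inj ext2_inj
 by simp

lemma ext_mixed_bilin:
 assumes "mlin H"
 shows "bilin R L Q G (%g. ext (H g))"
 by (rule bilinI) (use assms in "auto simp: mlin_def intro!: ext_lin ext_param_lin")

section \<open>The structure maps on letters\<close>

text \<open>A list of letter pairs that stands for the double bracket in Sweedler notation. The
  empty list renders the convention that the bracket vanishes unless the four objects are pairwise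
  distinct.\<close>

definition dd :: "('i, 'p) letter => ('i, 'p) letter => (('i, 'p) letter \<times> ('i, 'p) letter) list" where
 "dd l l' = (case (l, l') of (((a, b), m), ((c, d), n)) =>
  if distinct [a, b, c, d]
  then map (%(u, v). (((a, d), u), ((c, b), v))) (tlist R (P (a, d)) (P (c, b)) (D a b c d m n))
  else [])"

definition co :: "('i, 'p) letter => ('l \<times> ('i, 'p) letter) list" where
 "co l = map (%(g, m). (g, (fst l, m))) (tlist R L (P (fst l)) (\<sigma> (fst l) (snd l)))"

definition ac :: "'l => ('i, 'p) letter => ('i, 'p) letter" where
 "ac g l = (fst l, \<rho> (fst l) g (snd l))"

definition dl :: "'l => ('l \<times> 'l) list" where
 "dl g = tlist R L L (\<delta> g)"

lemma D_closed:
 assumes "((a, b), m) : letters" "((c, d), n) : letters" "distinct [a, b, c, d]"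
 shows "D a b c d m n : carrier (tensor_mod R (P (a, d)) (P (c, b)))"
  "module R (P (a, d))" "module R (P (c, b))" "(a, d) : I \<times> I" "(c, b) : I \<times> I"
 using assms PM by (auto simp: letters_iff intro!: bilinC[OF D_bilin])

lemma dd_mem:
 assumes "l : letters" "l' : letters" "(u, v) : set (dd l l')"
 shows "u : letters" "v : letters"
  "fst u = (fst (fst l), snd (fst l'))" "fst v = (fst (fst l'), snd (fst l))"
  "distinct [fst (fst l), snd (fst l), fst (fst l'), snd (fst l')]"
proof -
 obtain a b m where l: "l = ((a, b), m)" by (metis surj_pair)
 obtain c d n where l': "l' = ((c, d), n)" by (metis surj_pair)
 have dist: "distinct [a, b, c, d]"
  using assms(3) unfolding dd_def l l' by (auto split: if_splits)
 note * = D_closed[OF assms(1)[unfolded l] assms(2)[unfolded l'] dist]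
 have "(u, v) : (%(u, v). (((a, d), u), ((c, b), v))) ` set (tlist R (P (a, d)) (P (c, b)) (D a b c d m n))"
  using assms(3) dist unfolding dd_def l l' by simp
 then show "u : letters" "v : letters"
  "fst u = (fst (fst l), snd (fst l'))" "fst v = (fst (fst l'), snd (fst l))"
  "distinct [fst (fst l), snd (fst l), fst (fst l'), snd (fst l')]"
  using *(4,5) tlist_mem[OF *(2,3,1)] dist by (auto simp: letters_iff l l')
qed

lemma co_mem:
 assumes "l : letters" "(g, u) : set (co l)"
 shows "g : carrier L" "u : letters" "fst u = fst l"
proof -
 have e: "fst l : I \<times> I" "snd l : carrier (P (fst l))" using assms(1) by (auto simp: letters_def)
 show "g : carrier L" "u : letters" "fst u = fst l"
  using assms(2) tlist_mem[OF LM PM[OF e(1)] linC[OF \<sigma>_lin[OF e(1)] e(2)]] e(1)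
  unfolding co_def letters_def by auto
qed

lemma ac_mem: "g : carrier L ==> l : letters ==> ac g l : letters"
 unfolding ac_def letters_def using bilinC[OF \<rho>_bilin] by auto

lemma fst_ac [simp]: "fst (ac g l) = fst l"
 by (simp add: ac_def)

lemma dl_mem:
 assumes "g : carrier L" "(d, t) : set (dl g)"
 shows "d : carrier L" "t : carrier L"
 using tlist_mem[OF LM LM linC[OF \<delta>_lin assms(1)]] assms(2) unfolding dl_def by auto

lemma ac_mlin:
 assumes "llin h"
 shows "mlin (%g l. h (ac g l))"
 unfolding mlin_def llin_def
using lin_comp[OF bilinR[OF \<rho>_bilin] letter_linD[OF assms]] ac_def lin_comp[OF bilinL[OF \<rho>_bilin] letter_linD[OF assms]] letters_def
 by simp

lemma co_lin:
 assumes "mlin H"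
 shows "llin (%l. psum (co l) H)"
 unfolding llin_def
proof
 fix e assume e: "e : I \<times> I"
 have "bilin R L (P e) G (%g m. H g (e, m))"
  by (rule bilinI) (use assms e in "auto simp: mlin_def llin_def letters_iff")
 from lin_comp[OF \<sigma>_lin[OF e] psumt_lin[OF LM PM[OF e] this]]
 show "character R (P e) (%x. psum (co (e, x)) H)"
  by (simp add: co_def psum_map)
qed

lemma dd_lin2:
 assumes "llin2 H"
 shows "llin2 (%l l'. psum (dd l l') H)"
proof -
 have key: "bilin R (P (a, b)) (P (c, d)) G (%m n. psum (dd ((a, b), m) ((c, d), n)) H)"
  if "(a, b) : I \<times> I" "(c, d) : I \<times> I" for a b c d
 proof (cases "distinct [a, b, c, d]")
  case True
  have "bilin R (P (a, d)) (P (c, b)) G (%u v. H ((a, d), u) ((c, b), v))"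
   by (rule bilinI) (use assms that in "auto simp: llin2_def llin_def letters_iff")
  from psumt_lin[OF PM PM this] that
  have "character R (tensor_mod R (P (a, d)) (P (c, b)))
    (%t. psum (tlist R (P (a, d)) (P (c, b)) t) (%u v. H ((a, d), u) ((c, b), v)))" by simp
  from bilin_comp[OF D_bilin this] that True show ?thesis
   by (simp add: dd_def psum_map)
 next
  case False
  then show ?thesis by (auto simp: dd_def bilin_def intro: character_lin_zero[OF R])
 qed
 show ?thesis
  unfolding llin2_def llin_def
  by (auto simp: letters_def intro: bilinR[OF key] bilinL[OF key])
qed

lemma inj_ac: "g : carrier L ==> l : letters ==> act g (inj l) = inj (ac g l)"
 unfolding inj_def ind_act_def dinj_def ac_def
 by (rule ext) (use lin_zero[OF PM PM bilinR[OF \<rho>_bilin]] in auto)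

lemma act_bilin: "bilin R L Q Q act"
proof -
 have z: "\<rho> e g 0[P e] = 0[P e]" if "e : I \<times> I" "g : carrier L" for e g
  using lin_zero[OF PM PM bilinR[OF \<rho>_bilin]] that by blast
 have c: "act g q : carrier Q" if "g : carrier L" "q : carrier Q" for g q
 proof -
  have "finite {e : I \<times> I. q e ~= 0[P e]}" using that by (simp add: qsum_def dsum_simps)
  then have "finite {e : I \<times> I. \<rho> e g (q e) ~= 0[P e]}"
   by (rule rev_finite_subset) (use z that in auto)
  then have "finite {e : I \<times> I. act g q e ~= 0[P e]}"
   by (rule rev_finite_subset) (auto simp: ind_act_def)
  then show ?thesis using that bilinC[OF \<rho>_bilin] Q_apply
   by (auto simp: qsum_def dsum_simps ind_act_def letters_iff)
 qed
 have q: "q e : carrier (P e)" if "q : carrier Q" "e : I \<times> I" for q e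
  using Q_apply that by (simp add: letters_iff)
 note simps = q lin_add[OF bilinR[OF \<rho>_bilin]] lin_add[OF bilinL[OF \<rho>_bilin]]
  lin_smult[OF bilinR[OF \<rho>_bilin]] lin_smult[OF bilinL[OF \<rho>_bilin]]
 show ?thesis
 proof (intro bilinI linI c)
  fix g q q' assume "g : carrier L" "q : carrier Q" "q' : carrier Q"
  then show "act g (q +[Q] q') = act g q +[Q] act g q'"
   unfolding qsum_def dsum_simps(2) ind_act_def by (intro restrict_ext) (simp add: simps qsum_def)
 next
  fix g r q assume "g : carrier L" "r : carrier R" "q : carrier Q"
  then show "act g (r *[Q] q) = r *[Q] act g q"
   unfolding qsum_def dsum_simps(3) ind_act_def by (intro restrict_ext) (simp add: simps qsum_def)
 next
  fix q g d assume "q : carrier Q" "g : carrier L" "d : carrier L"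
  then show "act (g +[L] d) q = act g q +[Q] act d q"
   unfolding qsum_def dsum_simps(2) ind_act_def by (intro restrict_ext) (simp add: simps qsum_def)
 next
  fix q r g assume "q : carrier Q" "r : carrier R" "g : carrier L"
  then show "act (r *[L] g) q = r *[Q] act g q"
   unfolding qsum_def dsum_simps(3) ind_act_def by (intro restrict_ext) (simp add: simps qsum_def)
 qed
qed

end

context
 fixes R :: "'k ring" and M :: "('k, 'a) module"
 assumes M: "module R M"
begin

interpretation M: module R M by (rule M)

lemmas MM = tens_mod[OF M M]

lemma cobr2_closed:
 assumes d: "lin R M (tensor_mod R M M) d" and x: "x : carrier M"
 shows "cobr2 R M d x : carrier (tensor3 R M M M)"
 unfolding cobr2_def
 by (rule linC[OF tlift_lin[OF M M tensor3_module[OF M M M]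
    bilin_comp2[OF tens_tens_bilin[OF M M M] lin_id d]] linC[OF d x]])

lemma tsum3_cobr2:
 assumes d: "lin R M (tensor_mod R M M) d" and x: "x : carrier M"
  and H: "trilin R M M M (dual_mod R) H"
 shows "tsum3 R M M M (cobr2 R M d x) H =
  psum (tlist R M M (d x)) (%u v. psum (tlist R M M (d v)) (H u))"
 unfolding cobr2_def
  tsum3_tlift[OF M M M H M M bilin_comp2[OF tens_tens_bilin[OF M M M] lin_id d] linC[OF d x]]
 by (rule psum_cong, rule tsum3_tens[OF M M M H])
  (use tlist_mem[OF M M linC[OF d x]] linC[OF d] in auto)

context
 fixes br assumes br: "bilin R M M M br"
begin

lemma adj_bilin:
 assumes v: "v : carrier M"
 shows "bilin R M M (tensor_mod R M M)
  (%w u. tens R M M (br v w) u +[tensor_mod R M M] tens R M M w (br v u))"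
 by (rule bilin_plus[OF MM bilin_comp2[OF tens_bilin[OF M M] bilinR[OF br v] lin_id]
    bilin_comp2[OF tens_bilin[OF M M] lin_id bilinR[OF br v]]])

lemma adj_closed:
 assumes "v : carrier M" "t : carrier (tensor_mod R M M)"
 shows "adj R M br v t : carrier (tensor_mod R M M)"
 unfolding adj_def by (rule linC[OF tlift_lin[OF M M MM adj_bilin[OF assms(1)]] assms(2)])

lemma psum_adj:
 assumes v: "v : carrier M" and t: "t : carrier (tensor_mod R M M)"
  and h: "bilin R M M (dual_mod R) h"
 shows "psum (tlist R M M (adj R M br v t)) h =
  psum (tlist R M M t) (%w u. h (br v w) u + h w (br v u))"
 unfolding adj_def psumt_tlift[OF M M M M h adj_bilin[OF v] t]
 by (rule psum_cong)
  (use tlist_mem[OF M M t] bilinC[OF br v] tens_closed[OF M M] in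
   \<open>simp add: psumt_add[OF M M h] psumt_tens[OF M M h]\<close>)

end

end

context double_lie_data
begin

section \<open>The hypotheses in terms of letters\<close>

abbreviation "LQ == tensor_mod R L Q"
lemmas LQ_mod = tens_mod[OF LM QM]

lemma tens_inj_bilin:
 assumes "e : I \<times> I" "e' : I \<times> I"
 shows "bilin R (P e) (P e') QQ (%u v. tens R Q Q (inj (e, u)) (inj (e', v)))"
 by (rule bilin_comp2[OF tens_bilin[OF QM QM] inj_lin[OF assms(1)] inj_lin[OF assms(2)]])

lemma DD_inj:
 assumes l: "((a, b), m) : letters" and l': "((c, d), n) : letters"
 shows "DD (inj ((a, b), m)) (inj ((c, d), n)) =
  (if distinct [a, b, c, d]
  then tlift R QQ (%u v. tens R Q Q (inj ((a, d), u)) (inj ((c, b), v))) (D a b c d m n)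
  else 0[QQ])"
proof -
 define B where "B = (%(a, b) m (c, d) n. if distinct [a, b, c, d]
   then tlift R QQ (%u v. tens R Q Q (inj ((a, d), u)) (inj ((c, b), v))) (D a b c d m n)
   else 0[QQ])"
 have B: "bilin R (P e) (P e') QQ (%m. B e m e')" if "e : I \<times> I" "e' : I \<times> I" for e e'
 proof -
  obtain a b c d where e: "e = (a, b)" "e' = (c, d)" by (metis surj_pair)
  show ?thesis
  proof (cases "distinct [a, b, c, d]")
   case True
   have "(a, d) : I \<times> I" "(c, b) : I \<times> I" using that e by auto
   note t = tlift_lin[OF PM[OF this(1)] PM[OF this(2)] QQ_mod tens_inj_bilin[OF this]]
   have "bilin R (P (a, b)) (P (c, d)) (tensor_mod R (P (a, d)) (P (c, b))) (D a b c d)"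
    by (rule D_bilin) (use that True in "auto simp: e")
   from bilin_comp[OF this t] show ?thesis using True by (simp add: B_def e)
  next
   case False
   then show ?thesis
    by (auto simp: B_def e bilin_def intro: lin_const_zero[OF QQ_mod])
  qed
 qed
 have DD: "DD f g = dlift QQ (I \<times> I) P (%e m. dlift QQ (I \<times> I) P (B e m) g) f" for f g
  unfolding ind_dbl_def Let_def B_def inj_def fst_conv snd_conv by (simp add: case_prod_unfold)
 have lr: "(a, b) : I \<times> I" "m : carrier (P (a, b))" "(c, d) : I \<times> I" "n : carrier (P (c, d))"
  using l l' by (auto simp: letters_iff)
 have inner: "dlift QQ (I \<times> I) P (B e x) (inj ((c, d), n)) = B e x (c, d) n"
  if "e : I \<times> I" "x : carrier (P e)" for e x
  unfolding inj_def fst_conv snd_conv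
  by (rule dlift_dinj[of R "I \<times> I" P QQ, OF R PM QQ_mod bilinR[OF B] lr(3,4)]) (use that in auto)
 have outer: "lin R (P e) QQ (%m. dlift QQ (I \<times> I) P (B e m) (inj ((c, d), n)))" if "e : I \<times> I" for e
  by (rule lin_cong[OF PM[OF that] inner[OF that, symmetric] bilinL[OF B[OF that lr(3)] lr(4)]])
 have "DD (inj ((a, b), m)) (inj ((c, d), n)) = dlift QQ (I \<times> I) P (B (a, b) m) (inj ((c, d), n))"
  unfolding DD inj_def[of "((a, b), m)"] fst_conv snd_conv
  by (rule dlift_dinj[of R "I \<times> I" P QQ, OF R PM QQ_mod outer lr(1,2)])
 then show ?thesis using inner[OF lr(1,2)] by (simp add: B_def)
qed

lemma DD_closed: "q : carrier Q ==> q' : carrier Q ==> DD q q' : carrier QQ"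
 by (rule bilinC[OF DD_bilin])

lemma psum_DD:
 assumes K: "bilin R Q Q G K" and l: "l : letters" and l': "l' : letters"
 shows "psum (tlist R Q Q (DD (inj l) (inj l'))) K = psum (dd l l') (%u v. K (inj u) (inj v))"
proof -
 obtain a b m where e: "l = ((a, b), m)" by (metis surj_pair)
 obtain c d n where e': "l' = ((c, d), n)" by (metis surj_pair)
 show ?thesis
 proof (cases "distinct [a, b, c, d]")
  case True
  note c = D_closed[OF l[unfolded e] l'[unfolded e'] True]
  have "psum (tlist R Q Q (DD (inj l) (inj l'))) K =
    psum (tlist R (P (a, d)) (P (c, b)) (D a b c d m n))
     (%u v. psum (tlist R Q Q (tens R Q Q (inj ((a, d), u)) (inj ((c, b), v)))) K)"
   using psumt_tlift[OF QM QM c(2,3) K tens_inj_bilin[OF c(4,5)] c(1)]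
    DD_inj[OF l[unfolded e] l'[unfolded e']] True by (simp add: e e')
  also have "... = psum (tlist R (P (a, d)) (P (c, b)) (D a b c d m n))
     (%u v. K (inj ((a, d), u)) (inj ((c, b), v)))"
   by (rule psum_cong, rule psumt_tens[OF QM QM K])
    (use tlist_mem[OF c(2,3,1)] c(4,5) in "auto intro!: inj_closed simp: letters_iff")
  finally show ?thesis using True by (simp add: dd_def e e' psum_map)
 next
  case False
  then show ?thesis
   using DD_inj[OF l[unfolded e] l'[unfolded e']] psumt_zero[OF QM QM K]
   by (auto simp: dd_def e e')
 qed
qed

lemma psum_DD_ext2:
 assumes H: "llin2 H" and l: "l : letters" and l': "l' : letters"
 shows "psum (tlist R Q Q (DD (inj l) (inj l'))) (ext2 H) = psum (dd l l') H"
 unfolding psum_DD[OF ext2_bilin[OF H] l l']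
 by (rule psum_cong) (rule ext2_inj[OF H dd_mem(1,2)[OF l l']])

lemma tens_L_inj_bilin: "e : I \<times> I ==> bilin R L (P e) LQ (%g m. tens R L Q g (inj (e, m)))"
 by (rule bilin_comp2[OF tens_bilin[OF LM QM] lin_id inj_lin])

lemma coact_eq:
 "coact q = dlift LQ (I \<times> I) P (%e m. tlift R LQ (%g m'. tens R L Q g (inj (e, m'))) (\<sigma> e m)) q"
 unfolding ind_coact_def Let_def inj_def by simp

lemma coact_component_lin:
 assumes "e : I \<times> I"
 shows "lin R (P e) LQ (%m. tlift R LQ (%g m'. tens R L Q g (inj (e, m'))) (\<sigma> e m))"
 by (rule lin_comp[OF \<sigma>_lin[OF assms] tlift_lin[OF LM PM[OF assms] LQ_mod tens_L_inj_bilin[OF assms]]])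

lemma coact_lin: "lin R Q LQ coact"
 by (rule lin_cong[OF QM coact_eq[symmetric]])
  (unfold qsum_def[of I P], rule dlift_lin[OF R PM LQ_mod[unfolded qsum_def]
   coact_component_lin[unfolded qsum_def]])

lemma coact_closed: "q : carrier Q ==> coact q : carrier LQ"
 by (rule linC[OF coact_lin])

lemma psum_coact:
 assumes K: "bilin R L Q G K" and l: "l : letters"
 shows "psum (tlist R L Q (coact (inj l))) K = psum (co l) (%g u. K g (inj u))"
proof -
 obtain e m where e: "l = (e, m)" by (metis surj_pair)
 have em: "e : I \<times> I" "m : carrier (P e)" using l by (auto simp: e letters_iff)
 note Pe = PM[OF em(1)] and s = linC[OF \<sigma>_lin[OF em(1)] em(2)]
 have "coact (inj l) = tlift R LQ (%g m'. tens R L Q g (inj (e, m'))) (\<sigma> e m)"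
  unfolding coact_eq e inj_def[of "(e, m)"] fst_conv snd_conv
  by (rule dlift_dinj[of R "I \<times> I" P LQ "%e m. tlift R LQ (%g m'. tens R L Q g (inj (e, m'))) (\<sigma> e m)" e m,
     OF R PM LQ_mod coact_component_lin em])
 then have "psum (tlist R L Q (coact (inj l))) K =
   psum (tlist R L (P e) (\<sigma> e m)) (%g m'. psum (tlist R L Q (tens R L Q g (inj (e, m')))) K)"
  using psumt_tlift[OF LM QM LM Pe K tens_L_inj_bilin[OF em(1)] s] by simp
 also have "... = psum (tlist R L (P e) (\<sigma> e m)) (%g m'. K g (inj (e, m')))"
  by (rule psum_cong, rule psumt_tens[OF LM QM K])
   (use tlist_mem[OF LM Pe s] em in "auto intro!: inj_closed simp: letters_iff")
 finally show ?thesis by (simp add: co_def e psum_map)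
qed

lemma psum_coact_ext:
 assumes H: "mlin H" and l: "l : letters"
 shows "psum (tlist R L Q (coact (inj l))) (%g. ext (H g)) = psum (co l) H"
 unfolding psum_coact[OF ext_mixed_bilin[OF H] l]
 by (rule psum_cong, rule ext_inj) (use H co_mem[OF l] in "auto simp: mlin_def")

text \<open>The hypothesis on \<open>Q\<close> is tested with the functional \<open>ext2 H\<close>
  at homogeneous elements, where every \<open>ext\<close> can be evaluated again. The letter
  versions of the other hypotheses are obtained in the same way.\<close>

theorem dd_antisym:
 assumes H: "llin2 H" and l: "l : letters" "l' : letters"
 shows "psum (dd l l') H = - psum (dd l' l) (%u v. H v u)"
proof -
 note K = ext2_bilin[OF H]
 have c: "DD (inj l') (inj l) : carrier QQ" by (intro DD_closed inj_closed l)
 have "DD (inj l) (inj l') = -[QQ] swap R Q Q (DD (inj l') (inj l))"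
  using DD_bracket inj_closed l unfolding double_lie_bracket_def by blast
 then have "psum (dd l l') H = - psum (tlist R Q Q (DD (inj l') (inj l))) (%u v. ext2 H v u)"
  using psum_DD_ext2[OF H l] psumt_minus[OF QM QM K swap_closed[OF QM QM c]]
   psumt_swap[OF QM QM K c] by simp
 also have "psum (tlist R Q Q (DD (inj l') (inj l))) (%u v. ext2 H v u) = psum (dd l' l) (%u v. H v u)"
  unfolding psum_DD[OF bilin_swap[OF K] l(2,1)]
  by (rule psum_cong) (intro ext2_inj[OF H] dd_mem[OF l(2,1)])
 finally show ?thesis .
qed

lemma DD_angle_bilin:
 assumes m: "m : carrier Q"
 shows "bilin R Q Q (tensor3 R Q Q Q)
  (%n p. tlift R (tensor3 R Q Q Q) (%u v. tens3 R Q Q Q u v p) (DD m n))"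
proof (rule bilinI)
 note T = tens3_trilin[OF QM QM QM] and T_mod = tensor3_module[OF QM QM QM]
 have b: "bilin R Q Q (tensor3 R Q Q Q) (%u v. tens3 R Q Q Q u v p)" if "p : carrier Q" for p
  using T that by (auto simp: trilin_def bilin_def)
 show "lin R Q (tensor3 R Q Q Q)
   (%n. tlift R (tensor3 R Q Q Q) (%u v. tens3 R Q Q Q u v p) (DD m n))" if "p : carrier Q" for p
  by (rule lin_comp[OF bilinR[OF DD_bilin m] tlift_lin[OF QM QM T_mod b[OF that]]])
 show "lin R Q (tensor3 R Q Q Q)
   (%p. tlift R (tensor3 R Q Q Q) (%u v. tens3 R Q Q Q u v p) (DD m n))" if "n : carrier Q" for n
  by (rule tlift_param_lin[OF QM QM QM T_mod b _ DD_closed[OF m that]])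
   (use T in "auto simp: trilin_def bilin_def")
qed

lemma dbl_angle_closed:
 "m : carrier Q ==> t : carrier QQ ==> dbl_angle R Q DD m t : carrier (tensor3 R Q Q Q)"
 unfolding dbl_angle_def
 by (rule linC[OF tlift_lin[OF QM QM tensor3_module[OF QM QM QM] DD_angle_bilin]])

lemma tsum3_dbl_angle:
 assumes K: "trilin R Q Q Q G K" and l: "x : letters" "y : letters" "z : letters"
 shows "tsum3 R Q Q Q (dbl_angle R Q DD (inj x) (DD (inj y) (inj z))) K =
  psum (dd y z) (%n p. psum (dd x n) (%u v. K (inj u) (inj v) (inj p)))"
proof -
 note QQQ = QM QM QM
 note T = tens3_trilin[OF QQQ]
 have b: "bilin R Q Q (tensor3 R Q Q Q) (%u v. tens3 R Q Q Q u v p)" if "p : carrier Q" for p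
  using T that by (auto simp: trilin_def bilin_def)
 have Kb: "bilin R Q Q G (%u v. K u v p)" if "p : carrier Q" for p
  using K that by (auto simp: trilin_def bilin_def)
 note xc = inj_closed[OF l(1)] and yz = DD_closed[OF inj_closed[OF l(2)] inj_closed[OF l(3)]]
 have val: "tsum3 R Q Q Q (tlift R (tensor3 R Q Q Q) (%u v. tens3 R Q Q Q u v p) (DD m n)) K =
   psum (tlist R Q Q (DD m n)) (%u v. K u v p)"
  if "m : carrier Q" "n : carrier Q" "p : carrier Q" for m n p
  unfolding tsum3_tlift[OF QQQ K QM QM b[OF that(3)] DD_closed[OF that(1,2)]]
  by (rule psum_cong, rule tsum3_tens3[OF QQQ K])
   (use tlist_mem[OF QM QM DD_closed[OF that(1,2)]] that in auto)
 have "bilin R Q Q G (%n p. tsum3 R Q Q Q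
   (tlift R (tensor3 R Q Q Q) (%u v. tens3 R Q Q Q u v p) (DD (inj x) n)) K)"
  by (rule bilin_comp[OF DD_angle_bilin[OF xc] tsum3_lin[OF QQQ K]])
 note outer = psum_DD[OF this l(2,3)]
 have "tsum3 R Q Q Q (dbl_angle R Q DD (inj x) (DD (inj y) (inj z))) K =
  psum (dd y z) (%n p. tsum3 R Q Q Q
   (tlift R (tensor3 R Q Q Q) (%u v. tens3 R Q Q Q u v (inj p)) (DD (inj x) (inj n))) K)"
  unfolding dbl_angle_def tsum3_tlift[OF QQQ K QM QM DD_angle_bilin[OF xc] yz] by (rule outer)
 also have "... = psum (dd y z) (%n p. psum (dd x n) (%u v. K (inj u) (inj v) (inj p)))"
 proof (rule psum_cong)
  fix n p assume np: "(n, p) : set (dd y z)"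
  note m = dd_mem(1,2)[OF l(2,3) np]
  show "tsum3 R Q Q Q
   (tlift R (tensor3 R Q Q Q) (%u v. tens3 R Q Q Q u v (inj p)) (DD (inj x) (inj n))) K =
   psum (dd x n) (%u v. K (inj u) (inj v) (inj p))"
   using val[OF xc inj_closed[OF m(1)] inj_closed[OF m(2)]]
    psum_DD[OF Kb[OF inj_closed[OF m(2)]] l(1) m(1)] by simp
 qed
 finally show ?thesis .
qed

text \<open>The two rotations of tensor factors are absorbed into the order of the arguments of
  \<open>H\<close>. After that, in all three sums the first argument is what has become of
  \<open>x\<close>, the second of \<open>y\<close> and the third of \<open>z\<close>, so the
  identity can be read slot by slot.\<close>

theorem dd_jacobi:
 assumes H: "llin3 H" and l: "x : letters" "y : letters" "z : letters"
 shows "psum (dd y z) (%n p. psum (dd x n) (%u v. H u v p)) +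
  psum (dd z x) (%n p. psum (dd y n) (%u v. H p u v)) +
  psum (dd x y) (%n p. psum (dd z n) (%u v. H v p u)) = 0"
proof -
 note QQQ = QM QM QM and K = ext3_trilin[OF H]
 let ?A = "%x y z. dbl_angle R Q DD (inj x) (DD (inj y) (inj z))"
 let ?T = "tensor3 R Q Q Q"
 interpret T: module R ?T by (rule tensor3_module[OF QQQ])
 have c: "?A x y z : carrier ?T" if "x : letters" "y : letters" "z : letters" for x y z
  by (intro dbl_angle_closed DD_closed inj_closed that)
 have mem: "n : letters" "p : letters" if "(n, p) : set (dd y z)" "y : letters" "z : letters" for n p y z
  using dd_mem that by blast+
 have "?A x y z +[?T] tau123 R Q (?A y z x) +[?T] tau132 R Q (?A z x y) = 0[?T]"
  using DD_bracket inj_closed l unfolding double_lie_bracket_def by blast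
 then have "tsum3 R Q Q Q (?A x y z +[?T] tau123 R Q (?A y z x) +[?T] tau132 R Q (?A z x y)) (ext3 H) = 0"
  by (simp add: tsum3_zero[OF QQQ K])
 then have "tsum3 R Q Q Q (?A x y z) (ext3 H) +
   tsum3 R Q Q Q (?A y z x) (%x y z. ext3 H z x y) +
   tsum3 R Q Q Q (?A z x y) (%x y z. ext3 H y z x) = 0"
  using l by (simp add: tsum3_add[OF QQQ K] c tau123_closed[OF QM K] tau132_closed[OF QM K]
    tsum3_tau123[OF QM K] tsum3_tau132[OF QM K])
 also have "tsum3 R Q Q Q (?A x y z) (ext3 H) =
   psum (dd y z) (%n p. psum (dd x n) (%u v. H u v p))"
  unfolding tsum3_dbl_angle[OF K l]
  by (intro psum_cong ext3_inj[OF H]) (use l in "auto dest: mem")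
 also have "tsum3 R Q Q Q (?A y z x) (%x y z. ext3 H z x y) =
   psum (dd z x) (%n p. psum (dd y n) (%u v. H p u v))"
  unfolding tsum3_dbl_angle[OF trilin_rotate1[OF K] l(2,3,1)]
  by (intro psum_cong ext3_inj[OF H]) (use l in "auto dest: mem")
 also have "tsum3 R Q Q Q (?A z x y) (%x y z. ext3 H y z x) =
   psum (dd x y) (%n p. psum (dd z n) (%u v. H v p u))"
  unfolding tsum3_dbl_angle[OF trilin_rotate2[OF K] l(3,1,2)]
  by (intro psum_cong ext3_inj[OF H]) (use l in "auto dest: mem")
 finally show ?thesis .
qed

lemma ac_br:
 assumes h: "llin h" and m: "g : carrier L" "d : carrier L" "l : letters"
 shows "h (ac (br g d) l) = h (ac g (ac d l)) - h (ac d (ac g l))"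
proof -
 obtain e x where l: "l = (e, x)" by (metis surj_pair)
 have e: "e : I \<times> I" "x : carrier (P e)" using m by (auto simp: l letters_iff)
 have c: "\<rho> e g y : carrier (P e)" if "g : carrier L" "y : carrier (P e)" for g y
  by (rule bilinC[OF \<rho>_bilin[OF e(1)] that])
 show ?thesis
  using \<rho>_br[OF e(1) m(1,2) e(2)] character_diff[OF PM[OF e(1)] letter_linD[OF h e(1)]] c m e
  by (simp add: ac_def l)
qed

theorem dd_ac:
 assumes H: "llin2 H" and m: "g : carrier L" "x : letters" "y : letters"
 shows "psum (dd (ac g x) y) H + psum (dd x (ac g y)) H =
  psum (dd x y) (%u v. H (ac g u) v + H u (ac g v))"
proof -
 note K = ext2_bilin[OF H] and TB = tens_bilin[OF QM QM]
 note aL = bilinR[OF act_bilin m(1)]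
 note ca = linC[OF aL] and xc = inj_closed[OF m(2)] and yc = inj_closed[OF m(3)]
 note dc = DD_closed[OF xc yc]
 let ?k = "%u v. tens R Q Q (act g u) v +[QQ] tens R Q Q u (act g v)"
 have k: "bilin R Q Q QQ ?k"
  by (rule bilin_plus[OF QQ_mod bilin_comp2[OF TB aL lin_id] bilin_comp2[OF TB lin_id aL]])
 have hyp: "DD (act g (inj x)) (inj y) +[QQ] DD (inj x) (act g (inj y)) = tlift R QQ ?k (DD (inj x) (inj y))"
  using dmodule xc yc m(1) unfolding double_lie_module_def Let_def by blast
 have "psum (dd (ac g x) y) H + psum (dd x (ac g y)) H =
   psum (tlist R Q Q (DD (act g (inj x)) (inj y) +[QQ] DD (inj x) (act g (inj y)))) (ext2 H)"
  using m by (simp add: psumt_add[OF QM QM K] DD_closed xc yc ca inj_ac ac_mem inj_closed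
    psum_DD_ext2[OF H])
 also have "... = psum (tlist R Q Q (DD (inj x) (inj y))) (%u v. psum (tlist R Q Q (?k u v)) (ext2 H))"
  unfolding hyp by (rule psumt_tlift[OF QM QM QM QM K k dc])
 also have "... = psum (dd x y) (%u v. psum (tlist R Q Q (?k (inj u) (inj v))) (ext2 H))"
  by (rule psum_DD[OF bilin_comp[OF k psumt_lin[OF QM QM K]] m(2,3)])
 also have "... = psum (dd x y) (%u v. H (ac g u) v + H u (ac g v))"
 proof (rule psum_cong)
  fix u v assume "(u, v) : set (dd x y)"
  from dd_mem(1,2)[OF m(2,3) this] m(1)
  show "psum (tlist R Q Q (?k (inj u) (inj v))) (ext2 H) = H (ac g u) v + H u (ac g v)"
   by (simp add: psumt_add[OF QM QM K] psumt_tens[OF QM QM K]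
     tens_closed[OF QM QM] inj_ac inj_closed ac_mem ext2_inj[OF H])
 qed
 finally show ?thesis .
qed

definition mlin3 :: "('l => 'l => ('i, 'p) letter => 'k => ratz) => bool" where
 "mlin3 H \<longleftrightarrow> (ALL g:carrier L. mlin (H g)) &
  (ALL g:carrier L. ALL l:letters. character R L (%d. H d g l))"

theorem co_comodule:
 assumes H: "mlin3 H" and l: "l : letters"
 shows "psum (co l) (%g u. psum (dl g) (%d t. H d t u)) =
  psum (co l) (%g u. psum (co u) (%d v. H g d v - H d g v))"
proof -
 obtain e m where le: "l = (e, m)" by (metis surj_pair)
 have e: "e : I \<times> I" and m: "m : carrier (P e)" using l by (auto simp: le letters_iff)
 note Pe = PM[OF e] and sl = \<sigma>_lin[OF e]
 note LLP = LM LM Pe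
 let ?T = "tensor3 R L L (P e)" and ?t3 = "tens3 R L L (P e)" and ?LP = "tensor_mod R L (P e)"
 let ?s2 = "%m. tlift R ?T (%g m'. tens R L ?LP g (\<sigma> e m')) (\<sigma> e m)"
 define K where "K g d x = H g d (e, x)" for g d x
 have K: "trilin R L L (P e) G K"
  using H e unfolding K_def trilin_def mlin3_def mlin_def llin_def bilin_def
  by (auto simp: letters_iff)
 have K': "trilin R L L (P e) G (%g d. K d g)" using K unfolding trilin_def bilin_def by auto
 have t3': "trilin R L L (P e) ?T (%g d. ?t3 d g)"
  using tens3_trilin[OF LLP] unfolding trilin_def bilin_def by auto
 note Tm = tensor3_module[OF LLP] and sc = linC[OF sl m]
 have smem: "g : carrier L" "x : carrier (P e)"
  if "(g, x) : set (tlist R L (P e) (\<sigma> e m))" "m : carrier (P e)" for g x m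
  using tlist_mem[OF LM Pe linC[OF sl that(2)] that(1)] by auto
 have hyp: "tlift R ?T (%g m'. tlift R ?T (%d t. ?t3 d t m') (\<delta> g)) (\<sigma> e m) =
   ?s2 m -[?T] tlift3 R ?T (%g d m'. ?t3 d g m') (?s2 m)"
  using dcomodule e m unfolding double_lie_comodule_def lie_comodule_def Let_def by blast
 have s2b: "bilin R L (P e) ?T (%g m'. tens R L ?LP g (\<sigma> e m'))"
  by (rule bilin_comp2[OF tens_tens_bilin[OF LLP] lin_id sl])
 have s2c: "?s2 m : carrier ?T" by (rule linC[OF tlift_lin[OF LM Pe Tm s2b] sc])
 have s2: "tsum3 R L L (P e) (?s2 m) K =
   psum (tlist R L (P e) (\<sigma> e m)) (%g x. psum (tlist R L (P e) (\<sigma> e x)) (K g))"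
  if K: "trilin R L L (P e) G K" for K
  unfolding tsum3_tlift[OF LLP K LM Pe s2b sc]
  by (rule psum_cong, rule tsum3_tens[OF LLP K]) (use smem m linC[OF sl] in auto)
 have b: "bilin R L L ?T (%d t. ?t3 d t x)" if "x : carrier (P e)" for x
  using tens3_trilin[OF LLP] that unfolding trilin_def bilin_def by auto
 have lb: "bilin R L (P e) ?T (%g m'. tlift R ?T (%d t. ?t3 d t m') (\<delta> g))"
 proof (rule bilinI)
  show "lin R L ?T (%g. tlift R ?T (%d t. ?t3 d t x) (\<delta> g))" if "x : carrier (P e)" for x
   by (rule lin_comp[OF \<delta>_lin tlift_lin[OF LM LM Tm b[OF that]]])
  show "lin R (P e) ?T (%x. tlift R ?T (%d t. ?t3 d t x) (\<delta> g))" if "g : carrier L" for g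
   by (rule tlift_param_lin[OF LM LM Pe Tm b _ linC[OF \<delta>_lin that]])
    (use tens3_trilin[OF LLP] in "auto simp: trilin_def bilin_def")
 qed
 have "tsum3 R L L (P e) (tlift R ?T (%g m'. tlift R ?T (%d t. ?t3 d t m') (\<delta> g)) (\<sigma> e m)) K =
   psum (tlist R L (P e) (\<sigma> e m)) (%g x. psum (tlist R L L (\<delta> g)) (%d t. K d t x))"
  unfolding tsum3_tlift[OF LLP K LM Pe lb sc]
 proof (rule psum_cong)
  fix g x assume "(g, x) : set (tlist R L (P e) (\<sigma> e m))"
  note mem = smem[OF this m]
  note dc = linC[OF \<delta>_lin mem(1)]
  show "tsum3 R L L (P e) (tlift R ?T (%d t. ?t3 d t x) (\<delta> g)) K =
    psum (tlist R L L (\<delta> g)) (%d t. K d t x)"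
   unfolding tsum3_tlift[OF LLP K LM LM b[OF mem(2)] dc]
   by (rule psum_cong, rule tsum3_tens3[OF LLP K]) (use tlist_mem[OF LM LM dc] mem in auto)
 qed
 moreover have "tsum3 R L L (P e) (tlift3 R ?T (%g d m'. ?t3 d g m') (?s2 m)) K =
   tsum3 R L L (P e) (?s2 m) (%g d. K d g)"
  unfolding character_tlift3(1)[OF LLP Tm tsum3_lin[OF LLP K] t3' s2c]
  by (rule tsum3_cong[OF LLP s2c]) (rule tsum3_tens3[OF LLP K])
 moreover have "tlift3 R ?T (%g d m'. ?t3 d g m') (?s2 m) : carrier ?T"
  by (rule character_tlift3(2)[OF LLP Tm tsum3_lin[OF LLP K] t3' s2c])
 ultimately have "psum (tlist R L (P e) (\<sigma> e m)) (%g x. psum (tlist R L L (\<delta> g)) (%d t. K d t x)) =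
   psum (tlist R L (P e) (\<sigma> e m)) (%g x. psum (tlist R L (P e) (\<sigma> e x)) (K g)) -
   psum (tlist R L (P e) (\<sigma> e m)) (%g x. psum (tlist R L (P e) (\<sigma> e x)) (%d. K d g))"
  unfolding hyp s2[OF K, symmetric] s2[OF K', symmetric] using tsum3_diff[OF LLP K s2c] by simp
 then show ?thesis
  by (simp add: le co_def dl_def psum_map psum_diff K_def[abs_def])
qed

definition mlin2 :: "('l => ('i, 'p) letter => ('i, 'p) letter => 'k => ratz) => bool" where
 "mlin2 H \<longleftrightarrow> (ALL g:carrier L. llin2 (H g)) &
  (ALL l:letters. ALL l':letters. character R L (%g. H g l l'))"

lemma ext_mixed2_trilin:
 assumes "mlin2 H"
 shows "trilin R L Q Q G (%g. ext2 (H g))"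
 unfolding trilin_def
 by (intro conjI ballI ext2_bilin ext2_param_lin) (use assms in "auto simp: mlin2_def")

context
 fixes T :: "('k, ('k, 'l, ('k, 'i \<times> 'i => 'p, 'i \<times> 'i => 'p) tensor) tensor) module" and t3 and cc
 defines "T == tensor3 R L Q Q" and "t3 == tens3 R L Q Q"
  and "cc == (%u v. tlift R T (%g u'. t3 g u' v) (coact u) +[T] tlift R T (%g v'. t3 g u v') (coact v))"
begin

lemma t3_bilin:
 "v : carrier Q ==> bilin R L Q T (%g u. t3 g u v)"
 "u : carrier Q ==> bilin R L Q T (%g v. t3 g u v)"
 "g : carrier L ==> u : carrier Q ==> lin R Q T (%v. t3 g u v)"
 "g : carrier L ==> v : carrier Q ==> lin R Q T (%u. t3 g u v)"
 using tens3_trilin[OF LM QM QM] unfolding T_def t3_def trilin_def bilin_def by auto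

lemma T_mod: "module R T"
 unfolding T_def by (rule tensor3_module[OF LM QM QM])

lemma cc_bilin: "bilin R Q Q T cc"
 unfolding cc_def
by (simp add: bilin_plus T_mod bilinI tlift_param_lin[OF LM QM QM T_mod] coact_closed lin_comp[OF coact_lin tlift_lin[OF LM QM T_mod]] t3_bilin)

lemma tsum3_cc:
 assumes K: "trilin R L Q Q G K" and uv: "u : carrier Q" "v : carrier Q"
 shows "tsum3 R L Q Q (cc u v) K =
  psum (tlist R L Q (coact u)) (%g u'. K g u' v) + psum (tlist R L Q (coact v)) (%g v'. K g u v')"
proof -
 note LQQ = LM QM QM
 have 1: "tsum3 R L Q Q (tlift R T (%g u'. t3 g u' v) (coact u)) K =
   psum (tlist R L Q (coact u)) (%g u'. K g u' v)"
  unfolding T_def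
   tsum3_tlift[OF LQQ K LM QM t3_bilin(1)[OF uv(2), unfolded T_def] coact_closed[OF uv(1)]]
  unfolding t3_def
  by (rule psum_cong, rule tsum3_tens3[OF LQQ K])
   (use tlist_mem[OF LM QM coact_closed[OF uv(1)]] uv in auto)
 have 2: "tsum3 R L Q Q (tlift R T (%g v'. t3 g u v') (coact v)) K =
   psum (tlist R L Q (coact v)) (%g v'. K g u v')"
  unfolding T_def
   tsum3_tlift[OF LQQ K LM QM t3_bilin(2)[OF uv(1), unfolded T_def] coact_closed[OF uv(2)]]
  unfolding t3_def
  by (rule psum_cong, rule tsum3_tens3[OF LQQ K])
   (use tlist_mem[OF LM QM coact_closed[OF uv(2)]] uv in auto)
 show ?thesis
  unfolding cc_def 1[symmetric] 2[symmetric] T_def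
  by (rule tsum3_add[OF LQQ K])
   (auto intro!: linC[OF tlift_lin[OF LM QM T_mod[unfolded T_def]]] coact_closed
    t3_bilin[unfolded T_def] uv)
qed

theorem dd_co:
 assumes H: "mlin2 H" and l: "x : letters" "y : letters"
 shows "psum (dd x y) (%u v. psum (co u) (%g u'. H g u' v) + psum (co v) (%g v'. H g u v')) =
  psum (co x) (%g x'. psum (dd x' y) (H g)) + psum (co y) (%g y'. psum (dd x y') (H g))"
proof -
 note LQQ = LM QM QM
 note K = ext_mixed2_trilin[OF H]
 note xc = inj_closed[OF l(1)] and yc = inj_closed[OF l(2)]
 note dc = DD_closed[OF xc yc]
 have H2: "llin2 (H g)" if "g : carrier L" for g using H that unfolding mlin2_def by auto
 have hyp: "tlift R T cc (DD (inj x) (inj y)) =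
   tlift3 R T (%g u v. tens R L QQ g (DD u v)) (cc (inj x) (inj y))"
  using dcomodule xc yc unfolding double_lie_comodule_def Let_def T_def t3_def cc_def by blast
 have "tsum3 R L Q Q (tlift R T cc (DD (inj x) (inj y))) (%g. ext2 (H g)) =
   psum (tlist R Q Q (DD (inj x) (inj y))) (%u v. tsum3 R L Q Q (cc u v) (%g. ext2 (H g)))"
  using tsum3_tlift[OF LQQ K QM QM _ dc] cc_bilin unfolding T_def by blast
 also have "... = psum (dd x y) (%u v. tsum3 R L Q Q (cc (inj u) (inj v)) (%g. ext2 (H g)))"
  by (rule psum_DD[OF bilin_comp[OF cc_bilin tsum3_lin[OF LQQ K, folded T_def]] l])
 also have "... = psum (dd x y) (%u v. psum (co u) (%g u'. H g u' v) + psum (co v) (%g v'. H g u v'))"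
 proof (rule psum_cong)
  fix u v assume "(u, v) : set (dd x y)"
  note m = dd_mem(1,2)[OF l this]
  note uc = inj_closed[OF m(1)] and vc = inj_closed[OF m(2)]
  have "psum (tlist R L Q (coact (inj u))) (%g u'. ext2 (H g) u' (inj v)) = psum (co u) (%g u'. H g u' v)"
   using psum_coact[of "%g u'. ext2 (H g) u' (inj v)" u] K vc m
   by (simp add: trilin_def bilin_def ext2_inj[OF H2] co_mem cong: psum_cong)
  moreover have "psum (tlist R L Q (coact (inj v))) (%g v'. ext2 (H g) (inj u) v') = psum (co v) (%g v'. H g u v')"
   using psum_coact[of "%g v'. ext2 (H g) (inj u) v'" v] K uc m
   by (simp add: trilin_def bilin_def ext2_inj[OF H2] co_mem cong: psum_cong)
  ultimately show "tsum3 R L Q Q (cc (inj u) (inj v)) (%g. ext2 (H g)) =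
    psum (co u) (%g u'. H g u' v) + psum (co v) (%g v'. H g u v')"
   using tsum3_cc[OF K uc vc] by simp
 qed
 finally have lhs: "tsum3 R L Q Q (tlift R T cc (DD (inj x) (inj y))) (%g. ext2 (H g)) = ..." .
 define K' where "K' g u v = psum (tlist R Q Q (DD u v)) (ext2 (H g))" for g u v
 have K': "trilin R L Q Q G K'"
  unfolding K'_def trilin_def
  using K by (auto simp: trilin_def intro!: bilin_comp[OF DD_bilin psumt_lin[OF QM QM]]
    character_psum[OF R] dest: tlist_mem[OF QM QM DD_closed])
 have K'b: "bilin R L Q G (%g u'. K' g u' (inj y))" "bilin R L Q G (%g v'. K' g (inj x) v')"
  using K' xc yc by (auto simp: trilin_def bilin_def)
 have tt: "trilin R L Q Q T (%g u v. tens R L QQ g (DD u v))"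
  unfolding trilin_def T_def
  by (auto intro: bilin_comp[OF DD_bilin bilinR[OF tens_tens_bilin[OF LQQ]]]
    bilinL[OF tens_tens_bilin[OF LQQ]] DD_closed)
 note ccc = bilinC[OF cc_bilin xc yc, unfolded T_def]
 have "tsum3 R L Q Q (tlift3 R T (%g u v. tens R L QQ g (DD u v)) (cc (inj x) (inj y))) (%g. ext2 (H g)) =
   tsum3 R L Q Q (cc (inj x) (inj y)) (%g u v. tsum3 R L Q Q (tens R L QQ g (DD u v)) (%g. ext2 (H g)))"
  unfolding T_def
  by (rule character_tlift3(1)[OF LQQ T_mod[unfolded T_def] tsum3_lin[OF LQQ K] tt[unfolded T_def] ccc])
 also have "... = tsum3 R L Q Q (cc (inj x) (inj y)) K'"
  unfolding K'_def
  by (rule tsum3_cong[OF LQQ ccc]) (rule tsum3_tens[OF LQQ K _ DD_closed])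
 also have "... = psum (tlist R L Q (coact (inj x))) (%g u'. K' g u' (inj y)) +
   psum (tlist R L Q (coact (inj y))) (%g v'. K' g (inj x) v')"
  by (rule tsum3_cc[OF K' xc yc])
 also have "psum (tlist R L Q (coact (inj x))) (%g u'. K' g u' (inj y)) =
   psum (co x) (%g x'. psum (dd x' y) (H g))"
  unfolding psum_coact[OF K'b(1) l(1)] unfolding K'_def
  by (intro psum_cong psum_DD_ext2 H2 l(2) co_mem[OF l(1)])
 also have "psum (tlist R L Q (coact (inj y))) (%g v'. K' g (inj x) v') =
   psum (co y) (%g y'. psum (dd x y') (H g))"
  unfolding psum_coact[OF K'b(2) l(2)] unfolding K'_def
  by (intro psum_cong psum_DD_ext2 H2 l(1) co_mem[OF l(2)])
 finally show ?thesis using lhs hyp by (simp add: plus_fun_def)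
qed

end

end

context double_lie_data
begin

text \<open>The minus sign hidden in \<open>act_op\<close> turns the difference in the bimodule
  axiom into a sum.\<close>

theorem co_ac:
 assumes H: "mlin H" and m: "g : carrier L" "x : letters"
 shows "psum (co (ac g x)) H =
  psum (co x) (%d u. H (br g d) u + H d (ac g u)) + psum (dl g) (%d t. H d (ac t x))"
proof -
 note K = ext_mixed_bilin[OF H] and TB = tens_bilin[OF LM QM]
 note aL = bilinR[OF act_bilin m(1)] and xc = inj_closed[OF m(2)]
 note dc = linC[OF \<delta>_lin m(1)]
 let ?h = "%d. ext (H d)"
 let ?k = "%d u. tens R L Q (br g d) u -[LQ] tens R L Q d (act_op Q act u g)"
 let ?j = "%d t. tens R L Q d (act t (inj x))"
 have ao: "lin R Q Q (%u. act_op Q act u g)"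
  unfolding act_op_def by (rule lin_uminus[OF QM aL])
 have k: "bilin R L Q LQ ?k"
  by (rule bilin_subtract[OF LQ_mod bilin_comp2[OF TB bilinR[OF br_bilin m(1)] lin_id]
     bilin_comp2[OF TB lin_id ao]])
 have j: "bilin R L L LQ ?j"
  by (rule bilin_comp2[OF TB lin_id bilinL[OF act_bilin xc]])
 have hyp: "coact (act g (inj x)) = tlift R LQ ?k (coact (inj x)) +[LQ] tlift R LQ ?j (\<delta> g)"
  using bimodule m(1) xc unfolding lie_bimodule_def Let_def by blast
 have "psum (co (ac g x)) H = psum (tlist R L Q (coact (act g (inj x)))) ?h"
  by (simp add: inj_ac[OF m] psum_coact_ext[OF H ac_mem[OF m]])
 also have "... = psum (tlist R L Q (tlift R LQ ?k (coact (inj x)))) ?h + psum (tlist R L Q (tlift R LQ ?j (\<delta> g))) ?h"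
  unfolding hyp
  by (rule psumt_add[OF LM QM K])
   (intro linC[OF tlift_lin[OF LM QM LQ_mod k]] coact_closed xc
    linC[OF tlift_lin[OF LM LM LQ_mod j]] dc)+
 also have "psum (tlist R L Q (tlift R LQ ?k (coact (inj x)))) ?h =
   psum (co x) (%d u. psum (tlist R L Q (?k d (inj u))) ?h)"
  unfolding psumt_tlift[OF LM QM LM QM K k coact_closed[OF xc]]
  by (rule psum_coact[OF bilin_comp[OF k psumt_lin[OF LM QM K]] m(2)])
 also have "... = psum (co x) (%d u. H (br g d) u + H d (ac g u))"
 proof (rule psum_cong)
  fix d u assume "(d, u) : set (co x)"
  note bu = co_mem(1,2)[OF m(2) this]
  have brc: "br g d : carrier L" by (rule bilinC[OF br_bilin m(1) bu(1)])
  note uc = inj_closed[OF bu(2)]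
  have lH: "llin (H d)" if "d : carrier L" for d using H that by (auto simp: mlin_def)
  have "psum (tlist R L Q (?k d (inj u))) ?h =
    ext (H (br g d)) (inj u) - ext (H d) (-[Q] inj (ac g u))"
   using psumt_diff[OF LM QM K tens_closed[OF LM QM brc uc]
     tens_closed[OF LM QM bu(1) linC[OF ao uc]]] linC[OF ao uc]
    psumt_tens[OF LM QM K] brc uc bu
   by (simp add: act_op_def inj_ac[OF m(1) bu(2)])
  then show "psum (tlist R L Q (?k d (inj u))) ?h = H (br g d) u + H d (ac g u)"
   using character_minus[OF QM ext_lin[OF lH[OF bu(1)]] inj_closed[OF ac_mem[OF m(1) bu(2)]]]
    ext_inj[OF lH] brc bu ac_mem[OF m(1) bu(2)] by simp
 qed
 also have "psum (tlist R L Q (tlift R LQ ?j (\<delta> g))) ?h = psum (dl g) (%d t. H d (ac t x))"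
  unfolding psumt_tlift[OF LM QM LM LM K j dc] dl_def[symmetric]
 proof (rule psum_cong)
  fix d t assume "(d, t) : set (dl g)"
  note bg = dl_mem[OF m(1) this]
  show "psum (tlist R L Q (?j d t)) ?h = H d (ac t x)"
   using psumt_tens[OF LM QM K bg(1) inj_closed[OF ac_mem[OF bg(2) m(2)]]]
    ext_inj[of "H d"] H bg m by (simp add: inj_ac ac_mem mlin_def)
 qed
 finally show ?thesis .
qed

text \<open>This is condition (6) of a double Lie bimodule. The barred coaction and the barred
  action contribute one minus sign each, and the two cancel.\<close>

theorem dd_dd:
 assumes H: "llin2 H" and l: "x : letters" "y : letters"
 shows "psum (dd x y) (%u v. psum (dd u v) H) =
  psum (co y) (%g v. H (ac g x) v) + psum (co x) (%g u. H u (ac g y))"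
proof -
 note K = ext2_bilin[OF H] and TB = tens_bilin[OF QM QM]
 note xc = inj_closed[OF l(1)] and yc = inj_closed[OF l(2)]
 note dc = DD_closed[OF xc yc]
 let ?h = "ext2 H"
 let ?QL = "tensor_mod R Q L"
 note QL_mod = tens_mod[OF QM LM]
 let ?k = "%g v. tens R Q Q (act g (inj x)) v"
 let ?j = "%u g. tens R Q Q u (act_op Q act (inj y) g)"
 let ?s = "swap R L Q (coact (inj x))"
 have ao: "lin R L Q (%g. act_op Q act (inj y) g)"
  unfolding act_op_def by (rule lin_uminus[OF QM bilinL[OF act_bilin yc]])
 have k: "bilin R L Q QQ ?k" by (rule bilin_comp2[OF TB bilinL[OF act_bilin xc] lin_id])
 have j: "bilin R Q L QQ ?j" by (rule bilin_comp2[OF TB lin_id ao])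
 note sc = swap_closed[OF LM QM coact_closed[OF xc]]
 interpret QL: module R ?QL by (rule QL_mod)
 have hyp: "tlift R QQ DD (DD (inj x) (inj y)) =
   tlift R QQ ?k (coact (inj y)) +[QQ] tlift R QQ ?j (-[?QL] ?s)"
  using dlb xc yc unfolding double_lie_bimodule_def Let_def coact_op_def by blast
 have jb: "bilin R Q L G (%u g. psum (tlist R Q Q (?j u g)) ?h)"
  by (rule bilin_comp[OF j psumt_lin[OF QM QM K]])
 have "psum (dd x y) (%u v. psum (dd u v) H) =
   psum (dd x y) (%u v. psum (tlist R Q Q (DD (inj u) (inj v))) ?h)"
  by (rule psum_cong) (rule psum_DD_ext2[OF H dd_mem(1,2)[OF l], symmetric])
 also have "... = psum (tlist R Q Q (tlift R QQ DD (DD (inj x) (inj y)))) ?h"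
  unfolding psumt_tlift[OF QM QM QM QM K DD_bilin dc]
  by (rule psum_DD[OF bilin_comp[OF DD_bilin psumt_lin[OF QM QM K]] l, symmetric])
 also have "... = psum (tlist R Q Q (tlift R QQ ?k (coact (inj y)))) ?h +
   psum (tlist R Q Q (tlift R QQ ?j (-[?QL] ?s))) ?h"
  unfolding hyp
  by (rule psumt_add[OF QM QM K])
   (intro linC[OF tlift_lin[OF LM QM QQ_mod k]] coact_closed yc
    linC[OF tlift_lin[OF QM LM QQ_mod j]] QL.M.a_inv_closed sc)+
 also have "psum (tlist R Q Q (tlift R QQ ?k (coact (inj y)))) ?h = psum (co y) (%g v. H (ac g x) v)"
  unfolding psumt_tlift[OF QM QM LM QM K k coact_closed[OF yc]]
   psum_coact[OF bilin_comp[OF k psumt_lin[OF QM QM K]] l(2)]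
 proof (rule psum_cong)
  fix g v assume "(g, v) : set (co y)"
  note m = co_mem(1,2)[OF l(2) this]
  show "psum (tlist R Q Q (?k g (inj v))) ?h = H (ac g x) v"
   using psumt_tens[OF QM QM K inj_closed[OF ac_mem[OF m(1) l(1)]] inj_closed[OF m(2)]]
    ext2_inj[OF H ac_mem[OF m(1) l(1)] m(2)] by (simp add: inj_ac[OF m(1) l(1)])
 qed
 also have "psum (tlist R Q Q (tlift R QQ ?j (-[?QL] ?s))) ?h = psum (co x) (%g u. H u (ac g y))"
 proof -
  have "psum (tlist R Q Q (tlift R QQ ?j (-[?QL] ?s))) ?h =
    - psum (tlist R L Q (coact (inj x))) (%g u. psum (tlist R Q Q (?j u g)) ?h)"
   using psumt_tlift[OF QM QM QM LM K j QL.M.a_inv_closed[OF sc]]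
    psumt_minus[OF QM LM jb sc] psumt_swap[OF LM QM jb coact_closed[OF xc]]
   by simp
  also have "... = - psum (co x) (%g u. psum (tlist R Q Q (?j (inj u) g)) ?h)"
   by (simp only: psum_coact[OF bilin_swap[OF jb] l(1)])
  also have "... = - psum (co x) (%g u. - H u (ac g y))"
  proof (intro arg_cong[of _ _ uminus] psum_cong)
   fix g u assume "(g, u) : set (co x)"
   note m = co_mem(1,2)[OF l(1) this]
   note acy = ac_mem[OF m(1) l(2)]
   interpret Q: module R Q by (rule QM)
   have "psum (tlist R Q Q (?j (inj u) g)) ?h = ext2 H (inj u) (-[Q] inj (ac g y))"
    unfolding act_op_def inj_ac[OF m(1) l(2)]
    by (rule psumt_tens[OF QM QM K inj_closed[OF m(2)]])
     (intro Q.M.a_inv_closed inj_closed acy)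
   also have "... = - H u (ac g y)"
    using character_minus[OF QM bilinR[OF K inj_closed[OF m(2)]] inj_closed[OF acy]]
     ext2_inj[OF H m(2) acy] by simp
   finally show "psum (tlist R Q Q (?j (inj u) g)) ?h = - H u (ac g y)" .
  qed
  finally show ?thesis by (simp add: psum_minus)
 qed
 finally show ?thesis .
qed

lemma dl_antisym:
 assumes h: "bilin R L L G h" and a: "g : carrier L"
 shows "psum (dl g) (%d t. h t d) = - psum (dl g) h"
 unfolding dl_def
 using psumt_swap[OF LM LM h linC[OF \<delta>_lin a]]
  psumt_minus[OF LM LM h linC[OF \<delta>_lin a]] \<delta>_swap[OF a] by simp

lemma dl_cojacobi:
 assumes H: "trilin R L L L G H" and a: "g : carrier L"
 shows "psum (dl g) (%u v. psum (dl v) (%w z. H u w z + H z u w + H w z u)) = 0"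
proof -
 let ?T = "tensor3 R L L L" and ?c = "cobr2 R L \<delta> g"
 note LLL = LM LM LM
 note c = cobr2_closed[OF LM \<delta>_lin a]
 note H1 = trilin_rotate1[OF H] and H2 = trilin_rotate2[OF H]
 interpret T: module R ?T by (rule tensor3_module[OF LLL])
 have "tsum3 R L L L (?c +[?T] tau123 R L ?c +[?T] tau123 R L (tau123 R L ?c)) H = 0"
  unfolding \<delta>_cojacobi[OF a] by (rule tsum3_zero[OF LLL H])
 then have "tsum3 R L L L ?c H + tsum3 R L L L ?c (%x y z. H z x y) + tsum3 R L L L ?c (%x y z. H y z x) = 0"
  by (simp add: tsum3_add[OF LLL H] c tau123_closed[OF LM H] tsum3_tau123[OF LM H]
    tsum3_tau123[OF LM H1])
 then show ?thesis
  by (simp add: tsum3_cobr2[OF LM \<delta>_lin a H] tsum3_cobr2[OF LM \<delta>_lin a H1]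
    tsum3_cobr2[OF LM \<delta>_lin a H2] psum_add dl_def)
qed

lemma dl_br:
 assumes h: "bilin R L L G h" and ab: "g : carrier L" "d : carrier L"
 shows "psum (dl (br g d)) h =
  psum (dl d) (%w u. h (br g w) u + h w (br g u)) - psum (dl g) (%w u. h (br d w) u + h w (br d u))"
proof -
 interpret LL: module R "tensor_mod R L L" by (rule tens_mod[OF LM LM])
 note c = adj_closed[OF LM br_bilin]
 note d = linC[OF \<delta>_lin ab(1)] linC[OF \<delta>_lin ab(2)]
 show ?thesis
  unfolding dl_def \<delta>_br[OF ab]
  using ab d c by (simp add: psumt_add[OF LM LM h] psumt_minus[OF LM LM h]
    psum_adj[OF LM br_bilin _ _ h])
qed

lemma dl_br_involutive:
 assumes inv: "involutive_double_lie_bimodule R L br \<delta> I P \<rho> \<sigma> D"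
  and h: "character R L h" and a: "g : carrier L"
 shows "psum (dl g) (%d t. h (br d t)) = 0"
by (metis inv a involutive_double_lie_bimodule_def involutive_lie_bialgebra_def character_tlift[OF LM LM LM h br_bilin linC[OF \<delta>_lin a]] character_zero[OF LM h] dl_def)

lemma co_ac_involutive:
 assumes inv: "involutive_double_lie_bimodule R L br \<delta> I P \<rho> \<sigma> D"
  and h: "llin h" and l: "x : letters"
 shows "psum (co x) (%g u. h (ac g u)) = 0"
proof -
 note xc = inj_closed[OF l] and eh = ext_lin[OF h]
 have "tlift R Q act (coact (inj x)) = 0[Q]"
  using inv xc unfolding involutive_double_lie_bimodule_def involutive_lie_bimodule_def by blast
 then have "psum (tlist R L Q (coact (inj x))) (%g q. ext h (act g q)) = 0"
  using character_tlift[OF LM QM QM eh act_bilin coact_closed[OF xc]]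
   character_zero[OF QM eh] by simp
 then have "psum (co x) (%g u. ext h (act g (inj u))) = 0"
  by (simp add: psum_coact[OF bilin_comp[OF act_bilin eh] l])
 then show ?thesis
  using co_mem(1,2)[OF l] by (simp add: inj_ac ext_inj[OF h] ac_mem cong: psum_cong)
qed

end

section \<open>Cycles of permutations and surgery\<close>

text \<open>Listing a cycle constrains \<open>s\<close> only on the entries of the list. Several
  words can therefore be carried by one function \<open>s\<close>, provided that their slots are
  disjoint.\<close>

definition cycle :: "('n => 'n) => 'n list => bool" where
 "cycle s l \<longleftrightarrow> distinct l & l ~= [] & map s l = rotate1 l"

text \<open>This is \<open>s\<close> composed with the transposition of \<open>i\<close> and
  \<open>j\<close>, applied first. The equations for repeated cuts below are therefore relations
  between transpositions in a symmetric group.\<close>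

definition cut :: "('n => 'n) => 'n => 'n => 'n => 'n" where
 "cut s i j = s(i := s j, j := s i)"

lemma cut_cut [simp]: "cut (cut s i j) i j = s"
 by (auto simp: cut_def fun_eq_iff)

lemma cut_sym: "cut s j i = cut s i j"
 by (auto simp: cut_def fun_eq_iff)

lemma cut_commute: "distinct [i, j, k, l] ==> cut (cut s i j) k l = cut (cut s k l) i j"
 by (auto simp: cut_def fun_eq_iff)

text \<open>The products (k i)(j k), (j k)(i j) and (i j)(k i) of transpositions are one and the
  same 3-cycle. So the three terms of the double Jacobi identity end at the same
  permutation.\<close>

lemma cut_three:
 assumes "distinct [i, j, k]"
 shows "cut (cut s k i) j k = cut (cut s j k) i j" "cut (cut s i j) k i = cut (cut s j k) i j"
 using assms by (auto simp: cut_def fun_eq_iff)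

lemma map_cut: "i ~: set l ==> j ~: set l ==> map (cut s i j) l = map s l"
 by (auto simp: cut_def)

lemma cycle_rotate1: "cycle s l ==> cycle s (rotate1 l)"
 unfolding cycle_def by (metis distinct1_rotate rotate1_is_Nil_conv rotate1_map)

lemma cycle_rotate: "cycle s l ==> cycle s (rotate n l)"
 by (induction n) (auto intro: cycle_rotate1)

lemma cycle_cut_other:
 "cycle s l ==> i ~: set l ==> j ~: set l ==> cycle (cut s i j) l"
 by (simp add: cycle_def map_cut)

lemma cut_at:
 assumes "i ~= j"
 shows "cut s i j i = s j" "cut s i j j = s i"
 using assms by (auto simp: cut_def)

text \<open>After the cut, \<open>i\<close> is followed by what used to follow \<open>j\<close>, so
  the second cycle is traversed up to \<open>j\<close>, and from there the rest of the first
  one.\<close>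

lemma cycle_join:
 assumes "cycle s (i # A)" "cycle s (j # B)" "set (i # A) Int set (j # B) = {}"
 shows "cycle (cut s i j) (i # B @ j # A)"
proof -
 have "i ~= j" using assms(3) by auto
 have "s i # map s A = A @ [i]" "s j # map s B = B @ [j]"
  using assms(1,2) by (simp_all add: cycle_def)
 then have "s j # map s B @ s i # map s A = B @ j # A @ [i]" by simp
 then show ?thesis
  using assms \<open>i ~= j\<close> by (auto simp: cycle_def map_cut cut_at)
qed

lemma cycle_split:
 assumes "cycle s (i # A @ j # B)"
 shows "cycle (cut s i j) (i # B)" "cycle (cut s i j) (j # A)"
proof -
 have d: "distinct (i # A @ j # B)" using assms by (simp add: cycle_def)
 then have "i ~= j" by auto
 have "(s i # map s A) @ (s j # map s B) = (A @ [j]) @ (B @ [i])"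
  using assms by (simp add: cycle_def)
 moreover have "length (s i # map s A) = length (A @ [j])" by simp
 ultimately have "s i # map s A = A @ [j]" "s j # map s B = B @ [i]"
  using append_eq_append_conv by blast+
 then show "cycle (cut s i j) (i # B)" "cycle (cut s i j) (j # A)"
  using d \<open>i ~= j\<close> by (auto simp: cycle_def map_cut cut_at)
qed

lemma cycle_nth:
 assumes "cycle s l" "k < length l"
 shows "s (l ! k) = l ! (Suc k mod length l)"
 using assms by (metis cycle_def nth_map nth_rotate1)

lemma cycle_funpow:
 assumes "cycle s l"
 shows "(s ^^ k) (hd l) = l ! (k mod length l)"
proof (induction k)
 case 0
 then show ?case using assms by (simp add: cycle_def hd_conv_nth)
next
 case (Suc k)
 have "l ~= []" using assms by (simp add: cycle_def)
 then show ?case using Suc cycle_nth[OF assms, of "k mod length l"] by (simp add: mod_Suc_eq)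
qed

text \<open>Both lists enumerate the iterates of \<open>s\<close> at the common head. If one were
  longer, its head would recur at the position given by the length of the other, against
  distinctness.\<close>

lemma cycle_unique:
 assumes l: "cycle s l" and l': "cycle s l'" and hd: "hd l = hd l'"
 shows "l = l'"
proof -
 have le: "length l' \<le> length l" if l: "cycle s l" and l': "cycle s l'" and hd: "hd l = hd l'"
  for l l'
 proof (rule ccontr)
  assume "~ length l' \<le> length l"
  then have lt: "length l < length l'" by simp
  have "l ~= []" "l' ~= []" "distinct l'" using l l' by (simp_all add: cycle_def)
  have "l' ! length l = l ! 0"
   using cycle_funpow[OF l, of "length l"] cycle_funpow[OF l', of "length l"] hd lt by simp
  also have "... = l' ! 0" using hd \<open>l ~= []\<close> \<open>l' ~= []\<close> by (simp add: hd_conv_nth)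
  finally show False
   using \<open>distinct l'\<close> lt \<open>l ~= []\<close> \<open>l' ~= []\<close> by (simp add: nth_eq_iff_index_eq)
 qed
 have len: "length l = length l'" using le[OF l l' hd] le[OF l' l hd[symmetric]] by simp
 show ?thesis
 proof (rule nth_equalityI[OF len])
  fix k assume "k < length l"
  then show "l ! k = l' ! k"
   using cycle_funpow[OF l, of k] cycle_funpow[OF l', of k] hd len by simp
 qed
qed

lemma cycle_at:
 assumes "cycle s l" "k : set l"
 shows "EX n A. rotate n l = k # A & cycle s (k # A) & set (k # A) = set l"
proof -
 obtain n where n: "n < length l" "l ! n = k" using assms(2) by (auto simp: in_set_conv_nth)
 then have "l ~= []" by auto
 then have "hd (rotate n l) = k" using n by (simp add: hd_rotate_conv_nth)
 then obtain A where A: "rotate n l = k # A" using \<open>l ~= []\<close> by (cases "rotate n l") auto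
 then show ?thesis using cycle_rotate[OF assms(1), of n] set_rotate[of n l] by metis
qed

definition cyc_at :: "('n => 'n) => 'n => 'n list" where
 "cyc_at s i = (THE l. cycle s l & hd l = i)"

abbreviation cset :: "('n => 'n) => 'n => 'n set" where
 "cset s i == set (cyc_at s i)"

lemma cyc_at_eq: "cycle s (i # A) ==> cyc_at s i = i # A"
 unfolding cyc_at_def by (rule the_equality) (auto dest: cycle_unique)

text \<open>The decomposition into cycles is what the surgeries use, so it is taken as the
  definition in place of bijectivity on \<open>N\<close>.\<close>

definition permutes_on :: "('n => 'n) => 'n set => bool" where
 "permutes_on s N \<longleftrightarrow> finite N & (ALL i:N. EX A. cycle s (i # A) & set A <= N)"

lemma permutes_onD:
 assumes "permutes_on s N" "i : N"
 obtains A where "cycle s (i # A)" "cyc_at s i = i # A" "set A <= N"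
 using assms cyc_at_eq unfolding permutes_on_def by metis

lemma cycle_cyc_at:
 assumes "permutes_on s N" "i : N"
 shows "cycle s (cyc_at s i)" "i : cset s i" "cset s i <= N" "distinct (cyc_at s i)"
proof -
 obtain A where A: "cycle s (i # A)" "cyc_at s i = i # A" "set A <= N" by (rule permutes_onD[OF assms])
 then show "cycle s (cyc_at s i)" "i : cset s i" "cset s i <= N"
  using assms(2) by auto
 then show "distinct (cyc_at s i)" by (simp only: cycle_def)
qed

lemma cyc_at_member:
 assumes "permutes_on s N" "i : N" "k : cset s i"
 shows "EX n. cyc_at s k = rotate n (cyc_at s i)" "cset s k = cset s i"
proof -
 obtain n A where "rotate n (cyc_at s i) = k # A" "cycle s (k # A)" "set (k # A) = cset s i"
  using cycle_at[OF cycle_cyc_at(1)[OF assms(1,2)] assms(3)] by blast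
 then show "EX n. cyc_at s k = rotate n (cyc_at s i)" "cset s k = cset s i"
  using cyc_at_eq by metis+
qed

lemma cset_disjoint:
 assumes "permutes_on s N" "i : N" "j : N" "j ~: cset s i"
 shows "cset s i Int cset s j = {}"
proof (rule ccontr)
 assume "cset s i Int cset s j ~= {}"
 then obtain k where k: "k : cset s i" "k : cset s j" by blast
 then have "cset s i = cset s j"
  using cyc_at_member(2)[OF assms(1,2) k(1)] cyc_at_member(2)[OF assms(1,3) k(2)] by simp
 then show False using assms(4) cycle_cyc_at(2)[OF assms(1,3)] by simp
qed

lemma cycle_permutes_on:
 assumes "cycle s l"
 shows "permutes_on s (set l)" "i : set l ==> cset s i = set l"
  "i : set l ==> EX n. cyc_at s i = rotate n l"
proof -
 show "permutes_on s (set l)"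
  unfolding permutes_on_def using cycle_at assms by fastforce
 show "cset s i = set l" "EX n. cyc_at s i = rotate n l" if "i : set l"
  using cycle_at[OF assms that] cyc_at_eq by metis+
qed

lemma permutes_on_Un:
 "permutes_on s M ==> permutes_on s N ==> permutes_on s (M Un N)"
 unfolding permutes_on_def by (auto intro: le_supI1 le_supI2 dest!: bspec)

context
 fixes s :: "'n => 'n" and N i j
 assumes p: "permutes_on s N" and ij: "i : N" "j : N" "i ~= j"
begin

lemma cset_join:
 assumes "j ~: cset s i" "k : cset s i Un cset s j"
 shows "cset (cut s i j) k = cset s i Un cset s j"
proof -
 obtain A where A: "cycle s (i # A)" "cyc_at s i = i # A" by (rule permutes_onD[OF p ij(1)])
 obtain B where B: "cycle s (j # B)" "cyc_at s j = j # B" by (rule permutes_onD[OF p ij(2)])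
 have "cycle (cut s i j) (i # B @ j # A)"
  by (rule cycle_join[OF A(1) B(1)]) (use cset_disjoint[OF p ij(1,2) assms(1)] A B in auto)
 then show ?thesis
  using cycle_permutes_on(2)[of "cut s i j" "i # B @ j # A" k] assms(2) A(2) B(2) by auto
qed

lemma cyc_at_split:
 assumes "j : cset s i"
 shows "EX A B. cyc_at s i = i # A @ j # B & cycle (cut s i j) (i # B) & cycle (cut s i j) (j # A)
  & cyc_at (cut s i j) i = i # B & cyc_at (cut s i j) j = j # A"
proof -
 obtain C where C: "cycle s (i # C)" "cyc_at s i = i # C" by (rule permutes_onD[OF p ij(1)])
 then obtain A B where AB: "C = A @ j # B" using assms ij(3) by (auto dest: split_list)
 have "cycle (cut s i j) (i # B)" "cycle (cut s i j) (j # A)"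
  using cycle_split C(1) unfolding AB by metis+
 then show ?thesis using C(2) AB cyc_at_eq by metis
qed

lemma cset_split:
 assumes "j : cset s i"
 shows "j ~: cset (cut s i j) i" "cset (cut s i j) i Un cset (cut s i j) j = cset s i"
proof -
 obtain A B where AB: "cyc_at s i = i # A @ j # B" "cyc_at (cut s i j) i = i # B"
  "cyc_at (cut s i j) j = j # A" using cyc_at_split[OF assms] by blast
 have "distinct (i # A @ j # B)" using cycle_cyc_at(4)[OF p ij(1)] AB by simp
 then show "j ~: cset (cut s i j) i" "cset (cut s i j) i Un cset (cut s i j) j = cset s i"
  using AB ij(3) by auto
qed

text \<open>Slots outside the two affected cycles keep their cycle. The others lie on the joined
  cycle, or on one of the two parts of the split one.\<close>

lemma permutes_on_cut: "permutes_on (cut s i j) N"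
 unfolding permutes_on_def
proof (intro conjI ballI)
 show "finite N" using p by (simp add: permutes_on_def)
 fix k assume k: "k : N"
 have from_cycle: "EX A. cycle (cut s i j) (k # A) & set A <= N"
  if l: "cycle (cut s i j) l" "k : set l" "set l <= N" for l
 using cycle_at l(1,2) l(3) by fastforce
 obtain A where A: "cycle s (i # A)" "cyc_at s i = i # A" "set A <= N"
  by (rule permutes_onD[OF p ij(1)])
 obtain B where B: "cycle s (j # B)" "cyc_at s j = j # B" "set B <= N"
  by (rule permutes_onD[OF p ij(2)])
 show "EX A. cycle (cut s i j) (k # A) & set A <= N"
 proof (cases "k : cset s i Un cset s j")
  case False
  obtain C where C: "cycle s (k # C)" "cyc_at s k = k # C" "set C <= N"
   by (rule permutes_onD[OF p k])
  have "i ~: set (k # C)" "j ~: set (k # C)"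
   using cyc_at_member(2)[OF p k, of i] cyc_at_member(2)[OF p k, of j] C(2) False
    cycle_cyc_at(2)[OF p k] by auto
  then show ?thesis using cycle_cut_other[OF C(1)] C(3) by blast
 next
  case True
  show ?thesis
  proof (cases "j : cset s i")
   case False
   have "cycle (cut s i j) (i # B @ j # A)"
    by (rule cycle_join[OF A(1) B(1)]) (use cset_disjoint[OF p ij(1,2) False] A B in auto)
   then show ?thesis by (rule from_cycle) (use True A B ij in auto)
  next
   case split: True
   obtain A' B' where AB: "cyc_at s i = i # A' @ j # B'" "cycle (cut s i j) (i # B')"
    "cycle (cut s i j) (j # A')" using cyc_at_split[OF split] by blast
   have "cset s j = cset s i" by (rule cyc_at_member(2)[OF p ij(1) split])
   then have "k : set (i # B') | k : set (j # A')" using True AB(1) by auto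
   moreover have "set (i # B') <= N" "set (j # A') <= N"
    using cycle_cyc_at(3)[OF p ij(1)] AB(1) by auto
   ultimately show ?thesis using from_cycle AB(2,3) by blast
  qed
 qed
qed

end

section \<open>Operators on labelled slots\<close>

context double_lie_data
begin

text \<open>All slots carry letters, including those outside the words under consideration, which
  spares any bookkeeping about the domain.\<close>

definition labelling :: "(nat => ('i, 'p) letter) => bool" where
 "labelling x \<longleftrightarrow> range x <= letters"

lemma labellingD [simp]: "labelling x ==> x i : letters"
 by (auto simp: labelling_def)

lemma labelling_upd [simp]: "labelling x ==> u : letters ==> labelling (x(i := u))"
 by (auto simp: labelling_def)

definition slin :: "nat set => ((nat => ('i, 'p) letter) => 'k => ratz) => bool" where
 "slin N F \<longleftrightarrow> (ALL x i. labelling x --> i : N --> llin (%u. F (x(i := u))))"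

definition slinL :: "nat set => ('l => (nat => ('i, 'p) letter) => 'k => ratz) => bool" where
 "slinL N F \<longleftrightarrow> (ALL g:carrier L. slin N (F g)) & (ALL x. labelling x --> character R L (%g. F g x))"

text \<open>The operators act on functions of the labelling. Consequently
  \<open>Bop i j (Bop k m F)\<close> performs the bracket at \<open>i\<close>, \<open>j\<close>
  first and that at \<open>k\<close>, \<open>m\<close> afterwards.\<close>

definition Bop :: "nat => nat => ((nat => ('i, 'p) letter) => 'g::ab_group_add) => (nat => ('i, 'p) letter) => 'g"
 where "Bop i j F x = psum (dd (x i) (x j)) (%u v. F (x(i := u, j := v)))"

definition Cop :: "nat => ('l => (nat => ('i, 'p) letter) => 'g::ab_group_add) => (nat => ('i, 'p) letter) => 'g"
 where "Cop i F x = psum (co (x i)) (%d u. F d (x(i := u)))"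

text \<open>An action has a single result, so it can be applied to the labelling itself; brackets
  and coactions yield sums and have to act on functions.\<close>

definition Aop :: "'l => nat => (nat => ('i, 'p) letter) => nat => ('i, 'p) letter" where
 "Aop g i x = x(i := ac g (x i))"

lemma labelling_Aop [simp]: "labelling x ==> g : carrier L ==> labelling (Aop g i x)"
 by (simp add: Aop_def ac_mem)

lemma Aop_simps [simp]: "Aop g i x i = ac g (x i)" "k ~= i ==> Aop g i x k = x k"
 by (simp_all add: Aop_def)

lemma slin_mono: "slin N F ==> M <= N ==> slin M F"
 unfolding slin_def by auto

lemma slot_linD: "slin N F ==> labelling x ==> i : N ==> llin (%u. F (x(i := u)))"
 by (auto simp: slin_def)

lemma slin_llin2:
 assumes F: "slin {i, j} F" and x: "labelling x" and ij: "i ~= j"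
 shows "llin2 (%u v. F (x(i := u, j := v)))"
 unfolding llin2_def
proof (intro conjI ballI)
 fix l assume l: "l : letters"
 show "llin (%v. F (x(i := l, j := v)))" by (rule slot_linD[OF F]) (use x l in auto)
 have "llin (%u. F (x(j := l, i := u)))" by (rule slot_linD[OF F]) (use x l in auto)
 then show "llin (%u. F (x(i := u, j := l)))" using ij by (simp add: fun_upd_twist)
qed

lemma slin_llin3:
 assumes F: "slin {i, j, k} F" and x: "labelling x" and ij: "distinct [i, j, k]"
 shows "llin3 (%u v w. F (x(i := u, j := v, k := w)))"
 unfolding llin3_def
proof (intro conjI ballI)
 fix l assume l: "l : letters"
 show "llin2 (%v w. F (x(i := l, j := v, k := w)))"
  by (rule slin_llin2[OF slin_mono[OF F]]) (use x l ij in auto)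
 fix l' assume l': "l' : letters"
 have "llin (%u. F (x(j := l, k := l', i := u)))" by (rule slot_linD[OF F]) (use x l l' in auto)
 moreover have "x(j := l, k := l', i := u) = x(i := u, j := l, k := l')" for u using ij by auto
 ultimately show "llin (%u. F (x(i := u, j := l, k := l')))" by simp
qed

lemma Bop_cong:
 assumes "labelling x" "!!y. labelling y ==> F y = F' y"
 shows "Bop i j F x = Bop i j F' x"
 unfolding Bop_def by (intro psum_cong assms(2)) (auto intro!: labelling_upd assms(1) dest: dd_mem(1,2)[OF labellingD[OF assms(1)] labellingD[OF assms(1)]])

lemma Cop_cong:
 assumes "labelling x" "!!g y. g : carrier L ==> labelling y ==> F g y = F' g y"
 shows "Cop i F x = Cop i F' x"
 unfolding Cop_def by (intro psum_cong assms(2)) (auto intro!: labelling_upd assms(1) dest: co_mem(1,2)[OF labellingD[OF assms(1)]])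

lemma Bop_add: "Bop i j (%y. F y + F' y) x = Bop i j F x + Bop i j F' x"
 by (simp add: Bop_def psum_add)

lemma Bop_diff: "Bop i j (%y. F y - F' y) x = Bop i j F x - Bop i j F' x"
 by (simp add: Bop_def psum_diff)

lemma Bop_minus: "Bop i j (%y. - F y) x = - Bop i j F x"
 by (simp add: Bop_def psum_minus)

lemma Bop_sum: "Bop i j (%y. SUM a:A. F a y) x = (SUM a:A. Bop i j (F a) x)"
 by (simp add: Bop_def psum_sum)

lemma Cop_add: "Cop i (%g y. F g y + F' g y) x = Cop i F x + Cop i F' x"
 by (simp add: Cop_def psum_add)

lemma Cop_diff: "Cop i (%g y. F g y - F' g y) x = Cop i F x - Cop i F' x"
 by (simp add: Cop_def psum_diff)

lemma Cop_minus: "Cop i (%g y. - F g y) x = - Cop i F x"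
 by (simp add: Cop_def psum_minus)

lemma Cop_sum: "Cop i (%g y. SUM a:A. F a g y) x = (SUM a:A. Cop i (F a) x)"
 by (simp add: Cop_def psum_sum)

lemma llin_psum:
 assumes "!!u v. (u, v) : set ps ==> llin (%l. h l u v)"
 shows "llin (%l. psum ps (h l))"
 unfolding llin_def by (intro ballI character_psum[OF R] letter_linD assms)

lemma slin_Bop:
 assumes F: "slin N F" and ij: "i : N" "j : N" "i ~= j"
 shows "slin N (Bop i j F)"
 unfolding slin_def
proof (intro allI impI)
 fix x k assume x: "labelling x" and k: "k : N"
 note 2 = dd_lin2[OF slin_llin2[OF slin_mono[OF F] x ij(3)]]
 have sub: "{i, j} <= N" using ij by auto
 consider "k = i" | "k = j" | "k ~= i" "k ~= j" by blast
 then show "llin (%u. Bop i j F (x(k := u)))"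
 proof cases
  case 1
  then show ?thesis using 2[OF sub] x ij(3) by (simp add: Bop_def llin2_def)
 next
  case 2
  have "Bop i j F (x(k := u)) = psum (dd (x i) u) (%u v. F (x(i := u, j := v)))" for u
   using 2 ij(3) by (simp add: Bop_def fun_upd_twist)
  then show ?thesis using dd_lin2[OF slin_llin2[OF slin_mono[OF F sub] x ij(3)]] x
   by (simp add: llin2_def)
 next
  case 3
  have "x(k := l, i := u, j := v) = x(i := u, j := v, k := l)" for l u v using 3 by auto
  then have "Bop i j F (x(k := l)) = psum (dd (x i) (x j)) (%u v. F (x(i := u, j := v, k := l)))" for l
   using 3 by (simp add: Bop_def)
  moreover have "llin (%l. psum (dd (x i) (x j)) (%u v. F (x(i := u, j := v, k := l))))"
   by (intro llin_psum slot_linD[OF F]) (use k dd_mem[OF labellingD[OF x] labellingD[OF x]] x in auto)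
  ultimately show ?thesis by simp
 qed
qed

lemma slin_Aop:
 assumes F: "slin N F" and a: "g : carrier L"
 shows "slin N (%x. F (Aop g i x))"
 unfolding slin_def
proof (intro allI impI)
 fix x k assume x: "labelling x" and k: "k : N"
 show "llin (%u. F (Aop g i (x(k := u))))"
 proof (cases "k = i")
  case True
  have "llin (%u. F (x(k := ac g u)))"
   using ac_mlin[OF slot_linD[OF F x k]] a by (simp add: mlin_def)
  then show ?thesis using True by (simp add: Aop_def)
 next
  case False
  have "llin (%u. F ((Aop g i x)(k := u)))" by (rule slot_linD[OF F]) (use x a k in auto)
  then show ?thesis using False by (simp add: Aop_def fun_upd_twist)
 qed
qed

lemma slinL_mixed:
 assumes F: "slinL N F" and x: "labelling x" and k: "k : N"
 shows "mlin (%g u. F g (x(k := u)))"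
 unfolding mlin_def using F x k by (auto simp: slinL_def intro: slot_linD)

lemma slin_Cop:
 assumes F: "slinL N F" and i: "i : N"
 shows "slin N (Cop i F)"
 unfolding slin_def
proof (intro allI impI)
 fix x k assume x: "labelling x" and k: "k : N"
 show "llin (%u. Cop i F (x(k := u)))"
 proof (cases "k = i")
  case True
  then show ?thesis using co_lin[OF slinL_mixed[OF F x k]] by (simp add: Cop_def)
 next
  case False
  have "Cop i F (x(k := l)) = psum (co (x i)) (%g u. F g (x(i := u, k := l)))" for l
   using False by (simp add: Cop_def fun_upd_twist)
  moreover have "llin (%l. psum (co (x i)) (%g u. F g (x(i := u, k := l))))"
  proof (rule llin_psum)
   fix g u assume "(g, u) : set (co (x i))"
   note m = co_mem(1,2)[OF labellingD[OF x] this]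
   show "llin (%l. F g (x(i := u, k := l)))"
    by (rule slot_linD[OF _ labelling_upd[OF x m(2)] k]) (use F m in "auto simp: slinL_def")
  qed
  ultimately show ?thesis by simp
 qed
qed

lemma Bop_antisym:
 assumes F: "slin {i, j} F" and x: "labelling x" and ij: "i ~= j"
 shows "Bop j i F x = - Bop i j F x"
proof -
 have "psum (dd (x i) (x j)) (%u v. F (x(i := u, j := v))) =
   - psum (dd (x j) (x i)) (%u v. F (x(i := v, j := u)))"
  by (rule dd_antisym[OF slin_llin2[OF F x ij]]) (use x in auto)
 then show ?thesis using ij by (simp add: Bop_def fun_upd_twist)
qed

lemma Bop_commute:
 assumes "distinct [i, j, k, l]"
 shows "Bop i j (Bop k l F) x = Bop k l (Bop i j F) x"
proof -
 have "x(i := u, j := v, k := u', l := v') = x(k := u', l := v', i := u, j := v)" for u v u' v'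
  using assms by auto
 then show ?thesis
  using assms psum_swap[of "dd (x i) (x j)" "dd (x k) (x l)"] by (simp add: Bop_def)
qed

lemma Bop_jacobi:
 assumes F: "slin {i, j, k} F" and x: "labelling x" and d: "distinct [i, j, k]"
 shows "Bop j k (Bop i j F) x + Bop k i (Bop j k F) x + Bop i j (Bop k i F) x = 0"
proof -
 let ?H = "%u v w. F (x(i := u, j := v, k := w))"
 have "x(j := n, k := p, i := u, j := v) = x(i := u, j := v, k := p)"
  "x(k := n, i := p, j := u, k := v) = x(i := p, j := u, k := v)"
  "x(i := n, j := p, k := u, i := v) = x(i := v, j := p, k := u)"
  "x(i := n, k := p, j := u) = x(i := n, j := u, k := p)" for n p u v using d by auto
 then show ?thesis
  using dd_jacobi[OF slin_llin3[OF F x d], of "x i" "x j" "x k"] x d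
  by (simp add: Bop_def)
qed

lemma Bop_Bop:
 assumes F: "slin {i, j} F" and x: "labelling x" and ij: "i ~= j"
 shows "Bop i j (Bop i j F) x = Cop j (%g y. F (Aop g i y)) x + Cop i (%g y. F (Aop g j y)) x"
proof -
 have "x(i := u, j := v, i := u', j := v') = x(i := u', j := v')" for u v u' v' by auto
 then show ?thesis
  using dd_dd[OF slin_llin2[OF F x ij], of "x i" "x j"] x ij
  by (simp add: Bop_def Cop_def Aop_def fun_upd_twist)
qed

lemma Bop_Aop:
 assumes F: "slin {i, j} F" and x: "labelling x" and ij: "i ~= j" and a: "g : carrier L"
 shows "Bop i j F (Aop g i x) + Bop i j F (Aop g j x) = Bop i j (%y. F (Aop g i y) + F (Aop g j y)) x"
 using dd_ac[OF slin_llin2[OF F x ij] a, of "x i" "x j"] x ij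
 by (simp add: Bop_def Aop_def fun_upd_twist)

lemma Bop_Aop_other:
 assumes "k ~= i" "k ~= j"
 shows "Bop i j F (Aop g k x) = Bop i j (%y. F (Aop g k y)) x"
proof -
 have "x(k := w, i := u, j := v) = x(i := u, j := v, k := w)" for u v w using assms by auto
 then show ?thesis using assms by (simp add: Bop_def Aop_def)
qed

lemma slinL_mixed2:
 assumes F: "slinL {i, j} F" and x: "labelling x" and ij: "i ~= j"
 shows "mlin2 (%g u v. F g (x(i := u, j := v)))"
 unfolding mlin2_def
 using F x ij by (auto simp: slinL_def intro: slin_llin2)

text \<open>The comodule condition controls the coactions at the two bracketed slots only jointly;
  one of them alone need not commute with the bracket.\<close>

lemma Bop_Cop:
 assumes F: "slinL {i, j} F" and x: "labelling x" and ij: "i ~= j"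
 shows "Bop i j (%y. Cop i F y + Cop j F y) x =
  Cop i (%g. Bop i j (F g)) x + Cop j (%g. Bop i j (F g)) x"
proof -
 have "x(i := u, j := v, i := u') = x(i := u', j := v)" "x(i := u, j := v, j := u') = x(i := u, j := u')"
  "x(j := w, i := u, j := v) = x(i := u, j := v)" for u v u' w
  using ij by auto
 then show ?thesis
  using dd_co[OF slinL_mixed2[OF F x ij], of "x i" "x j"] x ij
  by (simp add: Bop_def Cop_def)
qed

lemma Bop_Cop_other:
 assumes "k ~= i" "k ~= j"
 shows "Bop i j (Cop k F) x = Cop k (%g. Bop i j (F g)) x"
proof -
 have "x(i := u, j := v, k := w) = x(k := w, i := u, j := v)" for u v w using assms by auto
 then show ?thesis using assms psum_swap[of "dd (x i) (x j)" "co (x k)"] by (simp add: Bop_def Cop_def)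
qed

lemma Cop_Cop_commute:
 assumes "i ~= j"
 shows "Cop i (%g. Cop j (F g)) x = Cop j (%d. Cop i (%g. F g d)) x"
proof -
 have "x(i := u, j := v) = x(j := v, i := u)" for u v using assms by auto
 then show ?thesis using assms psum_swap[of "co (x i)" "co (x j)"] by (simp add: Cop_def)
qed

lemma Cop_Cop:
 assumes F: "!!g. g : carrier L ==> slinL {i} (F g)"
  "!!d. d : carrier L ==> slinL {i} (%g. F g d)" and x: "labelling x"
 shows "Cop i (%g. Cop i (%d y. F g d y - F d g y)) x = Cop i (%g y. psum (dl g) (%d t. F d t y)) x"
proof -
 have "mlin3 (%g d u. F g d (x(i := u)))"
  unfolding mlin3_def using F x slinL_mixed[OF F(1) x] by (auto simp: slinL_def)
 from co_comodule[OF this, of "x i"] x show ?thesis by (simp add: Cop_def)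
qed

lemma Cop_Aop:
 assumes F: "slinL {i} F" and x: "labelling x" and a: "g : carrier L"
 shows "Cop i F (Aop g i x) =
  Cop i (%d y. F (br g d) y + F d (Aop g i y)) x + psum (dl g) (%d t. F d (Aop t i x))"
 using co_ac[OF slinL_mixed[OF F x] a, of i "x i"] x by (simp add: Cop_def Aop_def)

lemma Cop_Aop_other:
 assumes "k ~= i"
 shows "Cop i F (Aop g k x) = Cop i (%d y. F d (Aop g k y)) x"
 using assms by (simp add: Cop_def Aop_def fun_upd_twist)

end

section \<open>Cyclic words\<close>

lemma cyc_index_rotate1:
 assumes "es : cyc_index I"
 shows "rotate1 es : cyc_index I"
proof -
 have "fst (rotate1 es ! k) ~= snd (rotate1 es ! k) &
   snd (rotate1 es ! k) ~= fst (rotate1 es ! (Suc k mod length es))" if "k < length es" for k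
 proof -
  let ?k = "Suc k mod length es"
  have "es ~= []" using that by auto
  then have "?k < length es" by simp
  then show ?thesis using assms that \<open>es ~= []\<close> by (auto simp: cyc_index_def nth_rotate1)
 qed
 then show ?thesis using assms by (auto simp: cyc_index_def)
qed

lemma cyc_index_rotate1_iff: "rotate1 es : cyc_index I \<longleftrightarrow> es : cyc_index I"
proof
 assume *: "rotate1 es : cyc_index I"
 have "rotate n (rotate1 es) : cyc_index I" for n
  by (induction n) (auto intro: cyc_index_rotate1 *)
 from this[of "length es - 1"] have "rotate (Suc (length es - 1)) es : cyc_index I"
  by (simp add: rotate1_rotate_swap)
 moreover have "es ~= []" using * by (auto simp: cyc_index_def)
 ultimately show "es : cyc_index I" by simp
qed (rule cyc_index_rotate1)

lemma lin_into_spans: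
 assumes M: "module R M" and N: "module R N" and f: "lin R M N f" and S: "spans R M S"
  and K: "submodule K R N" "f ` S <= K"
 shows "f ` carrier M <= K"
proof -
 interpret M: module R M by (rule M)
 interpret N: module R N by (rule N)
 note Kc = N.submoduleE[OF K(1)]
 have z: "0[N] : K" using subgroup.one_closed[OF submodule.axioms(1)[OF K(1)]] by simp
 let ?K = "{x : carrier M. f x : K}"
 have "submodule ?K R M"
  by (rule M.submoduleI)
   (use Kc z in "auto simp: lin_zero[OF M N f] lin_minus[OF M N f] lin_add[OF f] lin_smult[OF f]")
 moreover have "S <= ?K" using S K(2) unfolding spans_def by auto
 ultimately show ?thesis using S unfolding spans_def by blast
qed

lemma spans_superset: "spans R M S ==> S <= T ==> T <= carrier M ==> spans R M T"
 unfolding spans_def by (meson subset_trans)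

lemma dsum_spans_Union:
 assumes R: "cring R" and M: "!!j. j : J ==> module R (M j)"
  and S: "!!j. j : J ==> spans R (M j) (S j)"
 shows "spans R (dsum J M) (\<Union>j\<in>J. dinj J M j ` S j)"
 unfolding spans_def
proof (intro conjI allI impI)
 have "S j <= carrier (M j)" if "j : J" for j using S[OF that] by (simp add: spans_def)
 then show "(\<Union>j\<in>J. dinj J M j ` S j) <= carrier (dsum J M)"
  using dinj_closed[of R J M, OF R M] by blast
 fix K assume K: "submodule K R (dsum J M)" "(\<Union>j\<in>J. dinj J M j ` S j) <= K"
 have "dinj J M j ` carrier (M j) <= K" if "j : J" for j
  by (rule lin_into_spans[OF M[OF that] dsum_module[of R J M, OF R M] dinj_lin[of R J M, OF R M] S[OF that] K(1)])
   (use K(2) that in auto)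
 then have "(\<Union>j\<in>J. dinj J M j ` carrier (M j)) <= K" by blast
 then show "carrier (dsum J M) <= K"
  using dsum_spans[of R J M, OF R M] K(1) unfolding spans_def by blast
qed

context double_lie_data
begin

abbreviation "AT == arrow_tensor R P"
abbreviation "WS == word_sum R I P"
abbreviation "C == cyc_mod R I P"
abbreviation "cw == cyc_word R I P"

definition wlin :: "('k, 'x) module => (('i, 'p) letter list => 'x) => bool" where
 "wlin X F \<longleftrightarrow> (ALL w1 w2. ALL e:I \<times> I. set w1 <= letters --> set w2 <= letters -->
  lin R (P e) X (%x. F (w1 @ (e, x) # w2)))"

definition rot_inv :: "(('i, 'p) letter list => 'x) => bool" where
 "rot_inv F \<longleftrightarrow> (ALL l w. l : letters --> set w <= letters --> F (w @ [l]) = F (l # w))"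

lemma rotation_invariantD: "rot_inv F ==> l : letters ==> set w <= letters ==> F (w @ [l]) = F (l # w)"
 unfolding rot_inv_def by blast

lemma word_linD:
 "wlin X F ==> e : I \<times> I ==> set w1 <= letters ==> set w2 <= letters ==>
  lin R (P e) X (%x. F (w1 @ (e, x) # w2))"
 unfolding wlin_def by blast

lemma word_linC:
 assumes "wlin X F" "set w <= letters" "w ~= []"
 shows "F w : carrier X"
proof -
 obtain e x w' where w: "w = (e, x) # w'" using assms(3) by (metis neq_Nil_conv surj_pair)
 then have "(e, x) : letters" "set w' <= letters" using assms(2) by auto
 then show ?thesis
  using linC[OF word_linD[OF assms(1), of e "[]" w']] by (simp add: w letters_iff)
qed

lemma index_modules: "es : cyc_index I ==> M : set (map P es) ==> module R M"
 using PM by (auto simp: cyc_index_def)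

lemma AT_mod: "es : cyc_index I ==> module R (AT es)"
 unfolding arrow_tensor_def by (rule ltensor_module[OF R index_modules])

lemma WS_mod: "module R WS"
 unfolding word_sum_def by (rule dsum_module[of R "cyc_index I" AT, OF R AT_mod])

lemma ltensor_words_zip:
 assumes "fs : ltensor_words (map P es)" "set es <= I \<times> I"
 shows "set (zip es fs) <= letters" "length fs = length es"
proof -
 show "length fs = length es" using assms by (auto simp: ltensor_words_def)
 show "set (zip es fs) <= letters"
 proof
  fix l assume "l : set (zip es fs)"
  then obtain i where "i < length es" "l = (es ! i, fs ! i)" by (auto simp: set_zip)
  then show "l : letters"
   using assms nth_mem[of i es] by (auto simp: ltensor_words_def letters_iff)
 qed
qed

lemma ltensor_words_snd:
 assumes "set w <= letters"
 shows "map snd w : ltensor_words (map P (map fst w))"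
proof -
 have "w ! i : letters" if "i < length w" for i using assms that nth_mem by blast
 then show ?thesis by (simp add: ltensor_words_def letters_def)
qed

lemma words_iff: "w : words I P \<longleftrightarrow> map fst w : cyc_index I & set w <= letters"
proof -
 have "set (map fst w) <= I \<times> I" if "map fst w : cyc_index I" using that by (simp add: cyc_index_def)
 then show ?thesis by (fastforce simp: words_def letters_def)
qed

text \<open>\<open>dinj\<close> at an index outside \<open>cyc_index I\<close> meets no summand.
  Because of this default \<open>cw\<close> is a total function on words of letters, and
  multilinearity and rotation invariance can be stated for all of them.\<close>

lemma word_elt_zero: "map fst w ~: cyc_index I ==> word_elt R I P w = 0[WS]"
 unfolding word_elt_def word_sum_def dsum_simps dinj_def by (auto simp: fun_eq_iff)

lemma word_elt_closed:
 assumes "set w <= letters"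
 shows "word_elt R I P w : carrier WS"
proof (cases "map fst w : cyc_index I")
 case True
 have "ltens R (map P (map fst w)) (map snd w) : carrier (AT (map fst w))"
  using ltens_multilin[OF R index_modules[OF True]] ltensor_words_snd[OF assms]
  unfolding multilin_def arrow_tensor_def by blast
 then show ?thesis
  unfolding word_elt_def word_sum_def
  using dinj_closed[of R "cyc_index I" AT, OF R AT_mod] by simp
next
 case False
 interpret WS: module R WS by (rule WS_mod)
 show ?thesis using word_elt_zero[OF False] by simp
qed

lemma word_elt_lin: "wlin WS (word_elt R I P)"
 unfolding wlin_def
proof (intro allI ballI impI)
 fix w1 w2 e assume e: "e : I \<times> I" and w: "set w1 <= letters" "set w2 <= letters"
 interpret Pe: module R "P e" by (rule PM[OF e])
 let ?es = "map fst w1 @ e # map fst w2"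
 let ?n = "length w1"
 show "lin R (P e) WS (%x. word_elt R I P (w1 @ (e, x) # w2))"
 proof (cases "?es : cyc_index I")
  case True
  let ?fs = "%x. map snd w1 @ x # map snd w2"
  \<comment> \<open>The word with 0 in the varied position serves as the base point for the list
    updates in \<open>multilin\<close>.\<close>
  have fs: "?fs 0[P e] : ltensor_words (map P ?es)"
   using ltensor_words_snd[of "w1 @ (e, 0[P e]) # w2"] w e by (auto simp: letters_iff)
  have "lin R (map P ?es ! ?n) (ltensor_mod R (map P ?es))
    (%x. ltens R (map P ?es) ((?fs 0[P e])[?n := x]))"
  proof -
   have "multilin R (map P ?es) (ltensor_mod R (map P ?es)) (ltens R (map P ?es))"
    by (rule ltens_multilin[OF R index_modules[OF True]])
   from conjunct2[OF this[unfolded multilin_def], rule_format, OF fs]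
   show ?thesis by (simp del: map_append map_map list.map)
  qed
  moreover have "map P ?es ! ?n = P e" by (simp add: nth_append)
  moreover have "(?fs 0[P e])[?n := x] = ?fs x" for x by (simp add: list_update_append)
  ultimately have "lin R (P e) (AT ?es) (%x. ltens R (map P ?es) (?fs x))"
   by (simp add: arrow_tensor_def)
  from lin_comp[OF this dinj_lin[of R "cyc_index I" AT, OF R AT_mod]]
  show ?thesis by (simp add: word_elt_def word_sum_def)
 next
  case False
  then have "word_elt R I P (w1 @ (e, x) # w2) = 0[WS]" for x
   using word_elt_zero[of "w1 @ (e, x) # w2"] by simp
  then show ?thesis using lin_const_zero[OF WS_mod] by simp
 qed
qed

lemma cyc_ker_gens:
 "{word_elt R I P w -[WS] word_elt R I P (last w # butlast w) | w. w : words I P} <= carrier WS"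
proof -
 interpret WS: module R WS by (rule WS_mod)
 have "set (last w # butlast w) <= letters" if "w : words I P" for w
 proof -
  have "w ~= []" using that by (auto simp: words_iff cyc_index_def)
  then have "last w : set w" "set (butlast w) <= set w" by (auto dest: in_set_butlastD)
  then show ?thesis using that by (auto simp: words_iff)
 qed
 then show ?thesis
  by (intro subsetI, elim CollectE exE conjE, simp only:)
   (intro WS.M.minus_closed word_elt_closed, simp_all only: words_iff)
qed

lemmas cyc_ker_submodule = submod_gen_submodule[OF WS_mod cyc_ker_gens, folded cyc_ker_def]

lemma CM: "module R C"
 unfolding cyc_mod_def by (rule quot_module[OF WS_mod cyc_ker_submodule])

lemma cw_lin: "wlin C cw"
 unfolding wlin_def cyc_word_def cyc_mod_def
 by (intro allI ballI impI lin_comp[OF word_linD[OF word_elt_lin] quot_proj_lin[OF WS_mod cyc_ker_submodule]])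

lemma cw_zero: "map fst w ~: cyc_index I ==> cw w = 0[C]"
 unfolding cyc_word_def cyc_mod_def by (simp add: word_elt_zero quot_zero[OF WS_mod cyc_ker_submodule])

lemma cw_closed: "set w <= letters ==> cw w : carrier C"
 using word_elt_closed unfolding cyc_word_def cyc_mod_def quot_carrier by blast

lemma cw_rotate: "rot_inv cw"
 unfolding rot_inv_def
proof (intro allI impI)
 fix l w assume l: "l : letters" and w: "set w <= letters"
 have iff: "map fst (w @ [l]) : cyc_index I \<longleftrightarrow> map fst (l # w) : cyc_index I"
  using cyc_index_rotate1_iff[of "map fst (l # w)"] by simp
 show "cw (w @ [l]) = cw (l # w)"
 proof (cases "map fst (w @ [l]) : cyc_index I")
  case True
  then have "w @ [l] : words I P" using l w by (auto simp: words_iff)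
  then have "word_elt R I P (w @ [l]) -[WS] word_elt R I P (l # w) : cyc_ker R I P"
   unfolding cyc_ker_def by (intro subsetD[OF submod_gen_incl]) force
  then show ?thesis
   unfolding cyc_word_def using l w
   by (subst quot_eq_iff[OF WS_mod cyc_ker_submodule]) (auto intro!: word_elt_closed)
 next
  case False
  then show ?thesis using iff cw_zero by metis
 qed
qed

lemma cw_spans: "spans R C (cw ` words I P)"
proof -
 let ?S = "%es. ltens R (map P es) ` ltensor_words (map P es)"
 have S: "spans R (AT es) (?S es)" if "es : cyc_index I" for es
  unfolding arrow_tensor_def by (rule ltensor_spans[OF R index_modules[OF that]])
 have "spans R WS (\<Union>es\<in>cyc_index I. dinj (cyc_index I) AT es ` ?S es)"
  unfolding word_sum_def by (rule dsum_spans_Union[OF R AT_mod S])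
 moreover have "(\<Union>es\<in>cyc_index I. dinj (cyc_index I) AT es ` ?S es) <= word_elt R I P ` words I P"
 proof clarify
  fix es fs assume es: "es : cyc_index I" and fs: "fs : ltensor_words (map P es)"
  have sub: "set es <= I \<times> I" using es by (auto simp: cyc_index_def)
  note z = ltensor_words_zip[OF fs sub]
  then have "zip es fs : words I P" using es by (simp add: words_iff)
  moreover have "word_elt R I P (zip es fs) = dinj (cyc_index I) AT es (ltens R (map P es) fs)"
   using z by (simp add: word_elt_def flip: map_map)
  ultimately show "dinj (cyc_index I) AT es (ltens R (map P es) fs) : word_elt R I P ` words I P"
   by (metis imageI)
 qed
 moreover have "word_elt R I P ` words I P <= carrier WS" using word_elt_closed by (auto simp: words_iff)
 ultimately have "spans R WS (word_elt R I P ` words I P)" by (rule spans_superset)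
 from quot_spans[OF WS_mod cyc_ker_submodule this]
 show ?thesis by (simp add: cyc_mod_def cyc_word_def image_image)
qed

context
 fixes X :: "('k, 'x) module" and F :: "('i, 'p) letter list => 'x"
 assumes X: "module R X" and F: "wlin X F" and rot: "rot_inv F"
begin

interpretation X: module R X by (rule X)

lemma cyc_lift_multilin:
 assumes "es : cyc_index I"
 shows "multilin R (map P es) X (%fs. F (zip es fs))"
 unfolding multilin_def
proof (intro conjI ballI allI impI)
 have sub: "set es <= I \<times> I" and ne: "es ~= []" using assms by (auto simp: cyc_index_def)
 fix fs assume fs: "fs : ltensor_words (map P es)"
 note z = ltensor_words_zip[OF fs sub]
 show "F (zip es fs) : carrier X"
  by (rule word_linC[OF F z(1)]) (use z ne in auto)
 fix i assume i: "i < length (map P es)"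
 then have e: "es ! i : I \<times> I" using sub by auto
 have "lin R (P (es ! i)) X (%x. F (take i (zip es fs) @ (es ! i, x) # drop (Suc i) (zip es fs)))"
  by (rule word_linD[OF F e]) (use z(1) set_take_subset set_drop_subset in fast)+
 moreover have "zip es (fs[i := x]) = take i (zip es fs) @ (es ! i, x) # drop (Suc i) (zip es fs)" for x
 proof -
  have "zip es (fs[i := x]) = zip (es[i := es ! i]) (fs[i := x])" by simp
  also have "... = (zip es fs)[i := (es ! i, x)]" using update_zip[of es fs i "(es ! i, x)"] by simp
  also have "... = take i (zip es fs) @ (es ! i, x) # drop (Suc i) (zip es fs)"
   by (rule upd_conv_take_nth_drop) (use i z in simp)
  finally show ?thesis .
 qed
 ultimately show "lin R (map P es ! i) X (%x. F (zip es (fs[i := x])))" using i by simp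
qed

lemma cyc_lift_component_lin:
 "es : cyc_index I ==> lin R (AT es) X (%t. ltlift R X (%fs. F (zip es fs)) t)"
 unfolding arrow_tensor_def by (rule ltlift_lin[OF R index_modules X cyc_lift_multilin])

lemma cyc_dlift_lin: "lin R WS X (dlift X (cyc_index I) AT (%es t. ltlift R X (%fs. F (zip es fs)) t))"
 unfolding word_sum_def by (rule dlift_lin[of R "cyc_index I" AT, OF R AT_mod X cyc_lift_component_lin])

lemma cyc_dlift_word:
 assumes "w : words I P"
 shows "dlift X (cyc_index I) AT (%es t. ltlift R X (%fs. F (zip es fs)) t) (word_elt R I P w) = F w"
proof -
 have w: "map fst w : cyc_index I" "set w <= letters" using assms by (auto simp: words_iff)
 have c: "ltens R (map P (map fst w)) (map snd w) : carrier (AT (map fst w))"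
  using ltens_multilin[OF R index_modules[OF w(1)]] ltensor_words_snd[OF w(2)]
  unfolding multilin_def arrow_tensor_def by blast
 have "dlift X (cyc_index I) AT (%es t. ltlift R X (%fs. F (zip es fs)) t) (word_elt R I P w) =
   ltlift R X (%fs. F (zip (map fst w) fs)) (ltens R (map P (map fst w)) (map snd w))"
  unfolding word_elt_def map_map[symmetric]
  by (rule dlift_dinj[of R "cyc_index I" AT X "%es t. ltlift R X (%fs. F (zip es fs)) t",
     OF R AT_mod X cyc_lift_component_lin w(1) c])
 also have "... = F (zip (map fst w) (map snd w))"
  by (rule ltlift_ltens[OF R index_modules[OF w(1)] X cyc_lift_multilin[OF w(1)] ltensor_words_snd[OF w(2)]])
 finally show ?thesis by (simp add: zip_map_fst_snd)
qed

lemma cyc_dlift_kills: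
 assumes "n : cyc_ker R I P"
 shows "dlift X (cyc_index I) AT (%es t. ltlift R X (%fs. F (zip es fs)) t) n = 0[X]"
proof -
 let ?f = "dlift X (cyc_index I) AT (%es t. ltlift R X (%fs. F (zip es fs)) t)"
 have key: "word_elt R I P w -[WS] word_elt R I P (last w # butlast w) : {c : carrier WS. ?f c = 0[X]}"
  if w: "w : words I P" for w
 proof (rule CollectI, rule conjI)
  show "word_elt R I P w -[WS] word_elt R I P (last w # butlast w) : carrier WS"
   using cyc_ker_gens w by blast
  have ne: "w ~= []" using w by (auto simp: words_iff cyc_index_def)
  then obtain l w' where w': "w = w' @ [l]" by (metis rev_exhaust)
  have r: "l # w' : words I P"
   using w cyc_index_rotate1_iff[of "map fst (l # w')" I] by (auto simp: words_iff w')
  have "F (w' @ [l]) = F (l # w')" using w by (intro rotation_invariantD[OF rot]) (simp_all add: w' words_iff)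
  then have "?f (word_elt R I P (w' @ [l])) = ?f (word_elt R I P (l # w'))"
   using cyc_dlift_word[OF w] cyc_dlift_word[OF r] by (simp add: w')
  then show "?f (word_elt R I P w -[WS] word_elt R I P (last w # butlast w)) = 0[X]"
   using lin_diff_eq_zero[OF WS_mod X cyc_dlift_lin word_elt_closed word_elt_closed, of w "l # w'"] w r
   by (simp add: w' words_iff)
 qed
 have "cyc_ker R I P <= {c : carrier WS. ?f c = 0[X]}"
  unfolding cyc_ker_def
 proof (rule submod_gen_minimal[OF lin_kernel_submodule[OF WS_mod X cyc_dlift_lin]], rule subsetI)
  fix y assume "y : {word_elt R I P w -[WS] word_elt R I P (last w # butlast w) | w. w : words I P}"
  then obtain w where "y = word_elt R I P w -[WS] word_elt R I P (last w # butlast w)" "w : words I P"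
   by (elim CollectE exE conjE)
  then show "y : {c : carrier WS. ?f c = 0[X]}" using key by (simp only:)
 qed
 then show ?thesis using assms by blast
qed

lemma cyc_lift_lin: "lin R C X (cyc_lift R I P X F)"
 unfolding cyc_mod_def cyc_lift_def
 by (rule quot_lift[OF WS_mod cyc_ker_submodule X cyc_dlift_lin cyc_dlift_kills])

lemma cyc_lift_word:
 assumes "w : words I P"
 shows "cyc_lift R I P X F (cw w) = F w"
proof -
 have "word_elt R I P w : carrier WS" using assms word_elt_closed by (simp add: words_iff)
 then show ?thesis
  unfolding cyc_word_def cyc_lift_def
  using quot_choice[OF WS_mod cyc_ker_submodule X cyc_dlift_lin cyc_dlift_kills]
   cyc_dlift_word[OF assms] by simp
qed

lemma cyc_lift_word_zero: "map fst w ~: cyc_index I ==> cyc_lift R I P X F (cw w) = 0[X]"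
 using cw_zero lin_zero[OF CM X cyc_lift_lin] by simp

end

end

section \<open>Placing words in slots; brackets of words and actions on words as slot
  operators\<close>

lemma sum_positions:
 assumes "distinct l"
 shows "(\<Sum>p<length l. f (l ! p)) = (SUM i:set l. f i)"
 using sum.reindex_bij_betw[OF bij_betw_nth[OF assms refl refl]] .

lemma sum_positions2:
 assumes "distinct l" "distinct l'"
 shows "(\<Sum>p<length l. \<Sum>q<length l'. G (l ! p) (l' ! q)) = (SUM i:set l. SUM j:set l'. G i j)"
proof -
 have "(\<Sum>q<length l'. G (l ! p) (l' ! q)) = (SUM j:set l'. G (l ! p) j)" for p
  by (rule sum_positions[OF assms(2)])
 then show ?thesis using sum_positions[OF assms(1), of "%i. SUM j:set l'. G i j"] by simp
qed

lemma rotate_position: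
 "p < length l ==> rotate p l = l ! p # drop (Suc p) l @ take p l"
 by (simp add: rotate_drop_take Cons_nth_drop_Suc[symmetric])

lemma cycle_position:
 "cycle s l ==> p < length l ==> cycle s (l ! p # drop (Suc p) l @ take p l)"
 using cycle_rotate[of s l p] by (simp add: rotate_position)

lemma position_set:
 "p < length l ==> set (l ! p # drop (Suc p) l @ take p l) = set l"
 using set_rotate[of p l] by (simp only: rotate_position)

lemma lin_by_characters:
 assumes M: "module R M" and X: "module R X"
  and c: "!!x. x : carrier M ==> F x : carrier X"
  and ch: "!!\<Phi>. character R X \<Phi> ==> character R M (%x. \<Phi> (F x))"
 shows "lin R M X F"
proof (rule linI)
 interpret M: module R M by (rule M)
 interpret X: module R X by (rule X)
 fix x y assume xy: "x : carrier M" "y : carrier M"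
 show "F (x +[M] y) = F x +[X] F y"
  by (rule character_sep[OF X])
   (use xy c in "simp_all add: character_add[OF X] character_add[OF M ch]")
next
 interpret M: module R M by (rule M)
 interpret X: module R X by (rule X)
 fix r x assume rx: "r : carrier R" "x : carrier M"
 show "F (r *[M] x) = r *[X] F x"
  by (rule character_sep[OF X])
   (use rx c in "simp_all add: lin_smult lin_smult[OF ch]")
qed (rule c)

lemma exists_cycle:
 assumes l: "distinct l" "l ~= []"
 shows "EX s. cycle s l & (ALL k. k ~: set l --> s k = s0 k)"
proof -
 define s where "s k = (case map_of (zip l (rotate1 l)) k of None => s0 k | Some v => v)" for k
 have "map s l = rotate1 l"
 proof (rule nth_equalityI)
  fix k assume "k < length (map s l)"
  then have "map_of (zip l (rotate1 l)) (l ! k) = Some (rotate1 l ! k)"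
   using l(1) by (intro map_of_zip_nth) auto
  then show "map s l ! k = rotate1 l ! k" using \<open>k < length (map s l)\<close> by (simp add: s_def)
 qed simp
 moreover have "s k = s0 k" if "k ~: set l" for k
 proof -
  have "map_of (zip l (rotate1 l)) k = None" using that by (auto simp: map_of_eq_None_iff dest: set_zip_leftD)
  then show ?thesis unfolding s_def by (metis option.simps(4))
 qed
 ultimately show ?thesis using l by (auto simp: cycle_def)
qed

lemma cycle_agree:
 assumes "cycle s l" "!!k. k : set l ==> s' k = s k"
 shows "cycle s' l"
proof -
 have "map s' l = map s l" using assms(2) by simp
 then show ?thesis using assms(1) unfolding cycle_def by metis
qed

context double_lie_data
begin

lemma labelling_map: "labelling x ==> set (map x l) <= letters"
 by auto

text \<open>Consecutive fresh slots above all of \<open>N\<close> receive the letters of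
  \<open>w\<close>. As labels and successors on \<open>N\<close> are kept, words placed earlier
  survive, and any number of words can be put side by side on disjoint cycles.\<close>

lemma exists_slots:
 assumes w: "set w <= letters" "w ~= []" and N: "finite N" and x0: "ALL k:N. x0 k : letters"
 shows "EX x s l. labelling x & cycle s l & set l Int N = {} & w = map x l &
  (ALL k:N. x k = x0 k & s k = s0 k)"
proof -
 obtain m where m: "ALL k:N. k < m" using N by (metis finite_nat_set_iff_bounded)
 let ?l = "[m..<m + length w]"
 obtain s where s: "cycle s ?l" "ALL k. k ~: set ?l --> s k = s0 k"
  using exists_cycle[of ?l s0] w(2) by auto
 define x where "x k = (if k : N then x0 k else if m \<le> k & k < m + length w then w ! (k - m) else hd w)" for k
 have "hd w : letters" using w by auto
 moreover have "w ! (k - m) : letters" if "m \<le> k" "k < m + length w" for k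
  using w(1) that nth_mem[of "k - m" w] by auto
 ultimately have "x k : letters" for k using x0 by (simp add: x_def)
 then have "labelling x" by (auto simp: labelling_def)
 moreover have "w = map x ?l"
  by (rule nth_equalityI) (use m in "auto simp: x_def")
 moreover have "set ?l Int N = {}" "ALL k:N. x k = x0 k & s k = s0 k"
  using m s(2) by (auto simp: x_def)
 ultimately show ?thesis using s(1) by blast
qed

lemma exists_slots1:
 assumes w: "set w <= letters" "w ~= []"
 obtains x s l where "labelling x" "cycle s l" "w = map x l"
 using exists_slots[OF w, of "{}"] by auto

lemma exists_slots2:
 assumes w: "set w <= letters" "w ~= []" and w': "set w' <= letters" "w' ~= []"
 obtains x s l l' where "labelling x" "cycle s l" "cycle s l'" "set l Int set l' = {}"
  "w = map x l" "w' = map x l'"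
proof -
 obtain x0 s0 l where 1: "labelling x0" "cycle s0 l" "w = map x0 l" by (rule exists_slots1[OF w])
 obtain x s l' where 2: "labelling x" "cycle s l'" "set l' Int set l = {}" "w' = map x l'"
  "ALL k:set l. x k = x0 k & s k = s0 k"
  using exists_slots[OF w', of "set l" x0 s0] 1(1) by auto
 have "cycle s l" by (rule cycle_agree[OF 1(2)]) (use 2(5) in simp)
 moreover have "w = map x l" using 1(3) 2(5) by simp
 ultimately show ?thesis using that 2 by blast
qed

lemma exists_slots3:
 assumes w: "set w <= letters" "w ~= []" and w': "set w' <= letters" "w' ~= []"
  and w'': "set w'' <= letters" "w'' ~= []"
 obtains x s l l' l'' where "labelling x" "cycle s l" "cycle s l'" "cycle s l''"
  "set l Int set l' = {}" "set l Int set l'' = {}" "set l' Int set l'' = {}"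
  "w = map x l" "w' = map x l'" "w'' = map x l''"
proof -
 obtain x0 s0 l l' where 1: "labelling x0" "cycle s0 l" "cycle s0 l'" "set l Int set l' = {}"
  "w = map x0 l" "w' = map x0 l'" by (rule exists_slots2[OF w w'])
 obtain x s l'' where 2: "labelling x" "cycle s l''" "set l'' Int (set l Un set l') = {}" "w'' = map x l''"
  "ALL k:set l Un set l'. x k = x0 k & s k = s0 k"
  using exists_slots[OF w'', of "set l Un set l'" x0 s0] 1(1) by auto
 have "cycle s l" "cycle s l'"
  by (rule cycle_agree[OF 1(2)], use 2(5) in simp, rule cycle_agree[OF 1(3)], use 2(5) in simp)
 moreover have "w = map x l" "w' = map x l'" using 1(5,6) 2(5) by simp_all
 moreover have "set l Int set l'' = {}" "set l' Int set l'' = {}" using 2(3) by auto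
 ultimately show ?thesis using that 1(4) 2(1,2,4) by blast
qed

lemma slin_word:
 assumes c: "wlin G c" and l: "distinct l"
 shows "slin (set l) (%x. c (map x l))"
 unfolding slin_def llin_def
proof (intro allI impI ballI)
 fix x i e assume x: "labelling x" and i: "i : set l" and e: "e : I \<times> I"
 obtain A B where AB: "l = A @ i # B" using i by (auto dest: split_list)
 have "map (x(i := u)) l = map x A @ u # map x B" for u using l by (simp add: AB)
 then show "character R (P e) (%m. c (map (x(i := (e, m))) l))"
  using word_linD[OF c e labelling_map[OF x] labelling_map[OF x]] by simp
qed

lemma rot_inv_rotate:
 assumes c: "rot_inv c" and w: "set w <= letters"
 shows "c (rotate n w) = c w"
proof (induction n)
 case (Suc n)
 show ?case
 proof (cases "rotate n w")
  case (Cons l w')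
  have "set (l # w') <= letters" using w set_rotate[of n w] Cons by simp
  then show ?thesis using Suc rotation_invariantD[OF c, of l w'] Cons by simp
 qed (use Suc in simp)
qed simp

lemma cyc_at_rotation:
 assumes c: "rot_inv c" and y: "labelling y"
  and s: "permutes_on s N" "i : N" "k : cset s i"
 shows "c (map y (cyc_at s k)) = c (map y (cyc_at s i))"
proof -
 obtain n where "cyc_at s k = rotate n (cyc_at s i)" using cyc_at_member(1)[OF s] by blast
 then show ?thesis
  using rot_inv_rotate[OF c labelling_map[OF y]] by (simp add: rotate_map)
qed

text \<open>The condition of \<open>cyc_index\<close> in terms of slots. It mentions only
  \<open>s\<close> and a set, so it makes sense for several cycles at once and can be followed
  through a surgery.\<close>

definition admissible :: "(nat => ('i, 'p) letter) => (nat => nat) => nat set => bool" where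
 "admissible x s N \<longleftrightarrow> (ALL k:N. fst (fst (x k)) ~= snd (fst (x k)) & snd (fst (x k)) ~= fst (fst (x (s k))))"

lemma cyc_index_admissible:
 assumes s: "cycle s l" and x: "labelling x"
 shows "map fst (map x l) : cyc_index I \<longleftrightarrow> admissible x s (set l)"
proof -
 have ne: "l ~= []" using s by (simp add: cycle_def)
 have sub: "set (map fst (map x l)) <= I \<times> I"
 proof -
  have "fst (x k) : I \<times> I" for k using labellingD[OF x, of k] by (simp add: letters_def)
  then show ?thesis by (simp add: image_subset_iff)
 qed
 have "map fst (map x l) ! (Suc k mod length l) = fst (x (s (l ! k)))" if "k < length l" for k
  using cycle_nth[OF s that] ne by (simp add: mod_less_divisor)
 then show ?thesis
  using sub ne unfolding cyc_index_def admissible_def by (simp add: all_set_conv_all_nth)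
qed

text \<open>Sources stay, while targets and successors are exchanged together: slot \<open>i\<close>
  now has the old target of \<open>j\<close> and the old successor of \<open>j\<close>, and vice
  versa. So the conditions on neighbours are merely permuted. The conditions within the letters at
  \<open>i\<close> and \<open>j\<close> hold before and after, because a nonzero double bracket
  involves four distinct objects.\<close>

lemma admissible_cut:
 assumes x: "labelling x" and ij: "i : N" "j : N" "i ~= j" and uv: "(u, v) : set (dd (x i) (x j))"
 shows "admissible (x(i := u, j := v)) (cut s i j) N \<longleftrightarrow> admissible x s N"
proof -
 note m = dd_mem(3-5)[OF labellingD[OF x] labellingD[OF x] uv]
 let ?y = "x(i := u, j := v)"
 have src: "fst (fst (?y k)) = fst (fst (x k))" for k using m by auto
 have N: "N = insert i (insert j (N - {i, j}))" using ij by auto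
 have rest: "(ALL k:N - {i, j}. fst (fst (?y k)) ~= snd (fst (?y k)) & snd (fst (?y k)) ~= fst (fst (?y (cut s i j k)))) \<longleftrightarrow>
   (ALL k:N - {i, j}. fst (fst (x k)) ~= snd (fst (x k)) & snd (fst (x k)) ~= fst (fst (x (s k))))"
  unfolding src by (intro ball_cong) (auto simp: cut_def)
 show ?thesis
  unfolding admissible_def
  apply (subst N, subst (2) N)
  unfolding ball_simps(7) rest
  unfolding src using m ij(3) by (auto simp: cut_at)
qed

lemma character_dbl_letters:
 assumes X: "module R X" and l: "l : letters" "l' : letters"
  and h: "!!e e'. e : I \<times> I ==> e' : I \<times> I ==> bilin R (P e) (P e') X (%u v. h (e, u) (e', v))"
 shows "dbl_letters R D X h l l' : carrier X"
  "character R X \<Phi> ==> \<Phi> (dbl_letters R D X h l l') = psum (dd l l') (%u v. \<Phi> (h u v))"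
proof -
 obtain a b m where e: "l = ((a, b), m)" by (metis surj_pair)
 obtain c d n where e': "l' = ((c, d), n)" by (metis surj_pair)
 interpret X: module R X by (rule X)
 show "dbl_letters R D X h l l' : carrier X"
 proof (cases "distinct [a, b, c, d]")
  case True
  note cl = D_closed[OF l[unfolded e e'] True]
  show ?thesis using linC[OF tlift_lin[OF cl(2,3) X h[OF cl(4,5)]] cl(1)] True
   by (simp add: dbl_letters_def e e')
 next
  case False
  then show ?thesis by (auto simp: dbl_letters_def e e')
 qed
 assume \<Phi>: "character R X \<Phi>"
 show "\<Phi> (dbl_letters R D X h l l') = psum (dd l l') (%u v. \<Phi> (h u v))"
 proof (cases "distinct [a, b, c, d]")
  case True
  note cl = D_closed[OF l[unfolded e e'] True]
  show ?thesis using character_tlift[OF cl(2,3) X \<Phi> h[OF cl(4,5)] cl(1)] True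
   by (simp add: dbl_letters_def dd_def e e' psum_map)
 next
  case False
  then show ?thesis by (auto simp: dbl_letters_def dd_def e e' character_zero[OF X \<Phi>])
 qed
qed

lemma cw_bilin_letters:
 assumes e: "e : I \<times> I" "e' : I \<times> I" and AB: "set A <= letters" "set B <= letters"
 shows "bilin R (P e) (P e') C (%u v. cw ((e, u) # B @ (e', v) # A))"
proof (rule bilinI)
 show "lin R (P e') C (%v. cw ((e, u) # B @ (e', v) # A))" if "u : carrier (P e)" for u
  using word_linD[OF cw_lin e(2), of "(e, u) # B" A] that AB e by (simp add: letters_iff)
 show "lin R (P e) C (%u. cw ((e, u) # B @ (e', v) # A))" if "v : carrier (P e')" for v
  using word_linD[OF cw_lin e(1), of "[]" "B @ (e', v) # A"] that AB e by (simp add: letters_iff)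
qed

lemma between_letters: "set w <= letters ==> set (between w i j) <= letters"
 unfolding between_def by (auto dest!: in_set_dropD in_set_takeD)

lemma bracket_words_closed:
 assumes "set f <= letters" "set g <= letters"
 shows "bracket_words R I P D f g : carrier C"
  "i < length f ==> j < length g ==> dbl_letters R D C
    (%u v. cw (u # between g j j @ v # between f i i)) (f ! i) (g ! j) : carrier C"
proof -
 interpret C: module R C by (rule CM)
 show *: "dbl_letters R D C (%u v. cw (u # between g j j @ v # between f i i)) (f ! i) (g ! j) : carrier C"
  if "i < length f" "j < length g" for i j
  by (rule character_dbl_letters(1)[OF CM _ _ cw_bilin_letters])
   (use assms that nth_mem between_letters in "blast+")
 show "bracket_words R I P D f g : carrier C"
  unfolding bracket_words_def Let_def
  by (intro C.M.finsum_closed Pi_I) (simp add: *)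
qed

lemma map_two_slots:
 assumes "distinct (i # B @ j # A)"
 shows "map (x(i := u, j := v)) (i # B @ j # A) = u # map x B @ v # map x A"
 using assms by auto

text \<open>With \<open>u\<close> left in slot \<open>i\<close> and \<open>v\<close> in slot
  \<open>j\<close>, the word in each term of the definition is the joined cycle read from
  \<open>i\<close>. Summation over positions thereby becomes summation over slots.\<close>

lemma character_bracket_words:
 assumes \<Phi>: "character R C \<Phi>" and x: "labelling x"
  and s: "cycle s l" "cycle s l'" "set l Int set l' = {}"
 shows "\<Phi> (bracket_words R I P D (map x l) (map x l')) =
  (SUM i:set l. SUM j:set l'. Bop i j (%y. \<Phi> (cw (map y (cyc_at (cut s i j) i)))) x)"
proof -
 interpret C: module R C by (rule CM)
 let ?f = "map x l" and ?g = "map x l'"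
 let ?t = "%i j. dbl_letters R D C (%u v. cw (u # between ?g j j @ v # between ?f i i)) (?f ! i) (?g ! j)"
 note fg = labelling_map[OF x, of l] labelling_map[OF x, of l']
 note cl = bracket_words_closed(2)[OF fg]
 have step: "\<Phi> (?t p q) = Bop (l ! p) (l' ! q) (%y. \<Phi> (cw (map y (cyc_at (cut s (l ! p) (l' ! q)) (l ! p))))) x"
  if pq: "p < length l" "q < length l'" for p q
 proof -
  let ?i = "l ! p" and ?j = "l' ! q"
  let ?A = "drop (Suc p) l @ take p l" and ?B = "drop (Suc q) l' @ take q l'"
  have "set (?i # ?A) Int set (?j # ?B) = {}"
   using position_set[OF pq(1)] position_set[OF pq(2)] s(3) by auto
  from cycle_join[OF cycle_position[OF s(1) pq(1)] cycle_position[OF s(2) pq(2)] this]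
  have j: "cycle (cut s ?i ?j) (?i # ?B @ ?j # ?A)" .
  have d: "distinct (?i # ?B @ ?j # ?A)" using j by (simp add: cycle_def)
  have "\<Phi> (?t p q) = psum (dd (?f ! p) (?g ! q)) (%u v. \<Phi> (cw (u # between ?g q q @ v # between ?f p p)))"
   by (rule character_dbl_letters(2)[OF CM _ _ cw_bilin_letters \<Phi>])
    (use x pq between_letters[OF fg(1)] between_letters[OF fg(2)] in auto)
  also have "... = Bop ?i ?j (%y. \<Phi> (cw (map y (?i # ?B @ ?j # ?A)))) x"
   unfolding Bop_def map_two_slots[OF d] using pq by (simp add: between_def drop_map take_map)
  finally show ?thesis using cyc_at_eq[OF j] by simp
 qed
 have "\<Phi> (bracket_words R I P D ?f ?g) = (\<Sum>p<length l. \<Sum>q<length l'. \<Phi> (?t p q))"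
 proof -
  have "\<Phi> (bracket_words R I P D ?f ?g) =
    (\<Sum>p<length ?f. \<Phi> (\<Oplus>\<^bsub>C\<^esub>q\<in>{..<length ?g}. ?t p q))"
   unfolding bracket_words_def Let_def
   by (rule character_finsum[OF CM \<Phi>]) (use cl in "intro Pi_I C.M.finsum_closed, simp")
  also have "... = (\<Sum>p<length ?f. \<Sum>q<length ?g. \<Phi> (?t p q))"
   by (rule sum.cong[OF refl], rule character_finsum[OF CM \<Phi>]) (use cl in "intro Pi_I, simp")
  finally show ?thesis by simp
 qed
 also have "... = (\<Sum>p<length l. \<Sum>q<length l'.
   Bop (l ! p) (l' ! q) (%y. \<Phi> (cw (map y (cyc_at (cut s (l ! p) (l' ! q)) (l ! p))))) x)"
  by (intro sum.cong refl step) auto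
 also have "... = (SUM i:set l. SUM j:set l'. Bop i j (%y. \<Phi> (cw (map y (cyc_at (cut s i j) i)))) x)"
  by (rule sum_positions2[where G = "%i j. Bop i j (%y. \<Phi> (cw (map y (cyc_at (cut s i j) i)))) x"])
   (use s in "simp_all add: cycle_def")
 finally show ?thesis .
qed

text \<open>Under each character, \<open>F\<close> becomes a slot function \<open>E\<close>;
  linearity of \<open>E\<close> in a slot is linearity of \<open>F\<close> in a letter, and
  separation of points removes the character. Only labellings that agree with \<open>x\<close> off
  \<open>l\<close> are compared, since another word on which \<open>F\<close> depends may be stored
  in the remaining slots.\<close>

lemma slot_eval:
 assumes X: "module R X"
  and closed: "!!w. set w <= letters ==> w ~= [] ==> F w : carrier X"
  and ev: "!!\<Phi> w. character R X \<Phi> ==> set w <= letters ==> w ~= [] ==>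
   EX x s l E. labelling x & cycle s l & w = map x l & slin (set l) E &
    (ALL y. labelling y --> (ALL k. k ~: set l --> y k = x k) --> \<Phi> (F (map y l)) = E y) &
    \<Phi> (F (map x (rotate1 l))) = E x"
 shows "wlin X F" "rot_inv F"
proof -
 show "wlin X F"
  unfolding wlin_def
 proof (intro allI ballI impI)
  fix w1 w2 e assume e: "e : I \<times> I" and w: "set w1 <= letters" "set w2 <= letters"
  interpret Pe: module R "P e" by (rule PM[OF e])
  let ?w = "%m. w1 @ (e, m) # w2"
  have wl: "set (?w m) <= letters" if "m : carrier (P e)" for m using w e that by (auto simp: letters_iff)
  show "lin R (P e) X (%m. F (?w m))"
  proof (rule lin_by_characters[OF PM[OF e] X])
   show "F (?w m) : carrier X" if "m : carrier (P e)" for m by (rule closed[OF wl[OF that]]) simp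
   fix \<Phi> assume \<Phi>: "character R X \<Phi>"
   have "?w 0[P e] ~= []" by simp
   from ev[OF \<Phi> wl this] obtain x s l E where
    x: "labelling x" and l: "cycle s l" "?w 0[P e] = map x l" and E: "slin (set l) E"
    and eq: "!!y. labelling y ==> (ALL k. k ~: set l --> y k = x k) ==> \<Phi> (F (map y l)) = E y"
    by auto
   from l(2) obtain A i B where l': "l = A @ i # B" "w1 = map x A" "w2 = map x B"
    by (auto simp: map_eq_append_conv append_eq_map_conv Cons_eq_map_conv)
   have d: "distinct l" using l(1) by (simp add: cycle_def)
   have "\<Phi> (F (?w m)) = E (x(i := (e, m)))" if "m : carrier (P e)" for m
   proof -
    have "?w m = map (x(i := (e, m))) l" using d l' by auto
    moreover have "\<Phi> (F (map (x(i := (e, m))) l)) = E (x(i := (e, m)))"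
     by (rule eq) (use x that e in "auto simp: l' letters_iff simp del: fun_upd_apply", simp)
    ultimately show ?thesis by (simp only:)
   qed
   moreover have "character R (P e) (%m. E (x(i := (e, m))))"
    using letter_linD[OF slot_linD[OF E x, of i] e] by (simp add: l')
   ultimately show "character R (P e) (%m. \<Phi> (F (?w m)))"
    using lin_cong[OF PM[OF e], of "%m. E (x(i := (e, m)))"] by simp
  qed
 qed
 show "rot_inv F"
  unfolding rot_inv_def
 proof (intro allI impI)
  fix l0 w assume l0: "l0 : letters" and w: "set w <= letters"
  show "F (w @ [l0]) = F (l0 # w)"
  proof (rule character_sep[OF X closed closed])
   fix \<Phi> assume \<Phi>: "character R X \<Phi>"
   have "set (l0 # w) <= letters" "l0 # w ~= []" using l0 w by auto
   from ev[OF \<Phi> this] obtain x s l E where x: "labelling x" and l: "l0 # w = map x l"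
    and E: "ALL y. labelling y --> (ALL k. k ~: set l --> y k = x k) --> \<Phi> (F (map y l)) = E y"
    and eq2: "\<Phi> (F (map x (rotate1 l))) = E x" by (elim exE conjE) (rule that)
   have eq: "\<Phi> (F (map x l)) = E x" "\<Phi> (F (map x (rotate1 l))) = E x" using E x eq2 by blast+
   have "w @ [l0] = map x (rotate1 l)" unfolding rotate1_map[symmetric] l[symmetric] by simp
   then show "\<Phi> (F (w @ [l0])) = \<Phi> (F (l0 # w))" using eq l by simp
  qed (use l0 w in auto)
 qed
qed

lemma wlin_comp: "wlin X F ==> lin R X Y g ==> wlin Y (%w. g (F w))"
 unfolding wlin_def by (intro allI ballI impI) (rule lin_comp, auto)

lemma rot_inv_comp: "rot_inv F ==> rot_inv (%w. g (F w))"
 unfolding rot_inv_def by auto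

lemma slin_sum: "(!!a. a : A ==> slin N (F a)) ==> slin N (%x. SUM a:A. F a x)"
 unfolding slin_def llin_def by (auto intro!: character_lin_sum[OF R])

lemma slin_minus: "slin N F ==> slin N (%x. - F x)"
 unfolding slin_def llin_def by (auto intro!: character_lin_uminus[OF R] PM)

lemma slin_add: "slin N F ==> slin N F' ==> slin N (%x. F x + F' x)"
 unfolding slin_def llin_def by (auto intro!: character_lin_plus[OF R])

lemma slin_cyc_at:
 assumes c: "wlin G c" and s: "permutes_on s N" "i : N"
 shows "slin (cset s i) (%x. c (map x (cyc_at s i)))"
 by (rule slin_word[OF c cycle_cyc_at(4)[OF s]])

lemma cset_cut_two:
 assumes s: "cycle s l" "cycle s l'" "set l Int set l' = {}" and ij: "i : set l" "j : set l'"
 shows "cset (cut s i j) i = set l Un set l'" "permutes_on s (set l Un set l')"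
  "permutes_on (cut s i j) (set l Un set l')" "i ~= j"
proof -
 show p: "permutes_on s (set l Un set l')"
  by (intro permutes_on_Un cycle_permutes_on(1) s)
 show ne: "i ~= j" using s(3) ij by auto
 have c: "cset s i = set l" "cset s j = set l'" by (rule cycle_permutes_on(2)[OF s(1) ij(1)], rule cycle_permutes_on(2)[OF s(2) ij(2)])
 have "j ~: cset s i" using c(1) s(3) ij by auto
 then show "cset (cut s i j) i = set l Un set l'"
  using cset_join[OF p, of i j i] ij ne c by auto
 show "permutes_on (cut s i j) (set l Un set l')" by (rule permutes_on_cut[OF p]) (use ij ne in auto)
qed

lemma bracket_words_slin:
 assumes \<Phi>: "character R C \<Phi>" and s: "cycle s l" "cycle s l'" "set l Int set l' = {}"
 shows "slin (set l Un set l')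
  (%x. SUM i:set l. SUM j:set l'. Bop i j (%y. \<Phi> (cw (map y (cyc_at (cut s i j) i)))) x)"
proof (intro slin_sum slin_Bop)
 fix i j assume ij: "i : set l" "j : set l'"
 note c = cset_cut_two[OF s ij]
 show "slin (set l Un set l') (%y. \<Phi> (cw (map y (cyc_at (cut s i j) i))))"
  using slin_cyc_at[OF wlin_comp[OF cw_lin \<Phi>] c(3), of i] ij(1) unfolding c(1) by simp
 show "i ~= j" by (rule c(4))
qed auto

lemma bracket_words_cyclic:
 assumes g: "set g <= letters" "g ~= []"
 shows "wlin C (%f. bracket_words R I P D f g)" "rot_inv (%f. bracket_words R I P D f g)"
  "wlin C (%f. bracket_words R I P D g f)" "rot_inv (%f. bracket_words R I P D g f)"
proof -
 have e1: "EX x s l E. labelling x & cycle s l & w = map x l & slin (set l) E &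
    (ALL y. labelling y --> (ALL k. k ~: set l --> y k = x k) --> \<Phi> (bracket_words R I P D (map y l) g) = E y) &
    \<Phi> (bracket_words R I P D (map x (rotate1 l)) g) = E x"
  if \<Phi>: "character R C \<Phi>" and w: "set w <= letters" "w ~= []" for \<Phi> w
 proof -
  obtain x s l l' where s: "labelling x" "cycle s l" "cycle s l'" "set l Int set l' = {}"
   "w = map x l" "g = map x l'" by (rule exists_slots2[OF w g])
  let ?E = "%x. SUM i:set l. SUM j:set l'. Bop i j (%y. \<Phi> (cw (map y (cyc_at (cut s i j) i)))) x"
  have "slin (set l) ?E"
   by (rule slin_mono[OF bracket_words_slin[OF \<Phi> s(2-4)]]) simp
  moreover have "\<Phi> (bracket_words R I P D (map y l) g) = ?E y"
   if "labelling y" "ALL k. k ~: set l --> y k = x k" for y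
  proof -
   have "g = map y l'" using that(2) s(4,6) by auto
   then show ?thesis using character_bracket_words[OF \<Phi> that(1) s(2-4)] by simp
  qed
  moreover have "\<Phi> (bracket_words R I P D (map x (rotate1 l)) g) = ?E x"
   using character_bracket_words[OF \<Phi> s(1) cycle_rotate1[OF s(2)] s(3)] s(4,6) by simp
  ultimately show ?thesis using s(1,2,5) by blast
 qed
 have e2: "EX x s l E. labelling x & cycle s l & w = map x l & slin (set l) E &
    (ALL y. labelling y --> (ALL k. k ~: set l --> y k = x k) --> \<Phi> (bracket_words R I P D g (map y l)) = E y) &
    \<Phi> (bracket_words R I P D g (map x (rotate1 l))) = E x"
  if \<Phi>: "character R C \<Phi>" and w: "set w <= letters" "w ~= []" for \<Phi> w
 proof -
  obtain x s l' l where s: "labelling x" "cycle s l'" "cycle s l" "set l' Int set l = {}"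
   "g = map x l'" "w = map x l" by (rule exists_slots2[OF g w])
  let ?E = "%x. SUM i:set l'. SUM j:set l. Bop i j (%y. \<Phi> (cw (map y (cyc_at (cut s i j) i)))) x"
  have "slin (set l) ?E"
   by (rule slin_mono[OF bracket_words_slin[OF \<Phi> s(2-4)]]) simp
  moreover have "\<Phi> (bracket_words R I P D g (map y l)) = ?E y"
   if "labelling y" "ALL k. k ~: set l --> y k = x k" for y
  proof -
   have "g = map y l'" using that(2) s(4,5) by auto
   then show ?thesis using character_bracket_words[OF \<Phi> that(1) s(2-4)] by simp
  qed
  moreover have "\<Phi> (bracket_words R I P D g (map x (rotate1 l))) = ?E x"
   using character_bracket_words[OF \<Phi> s(1,2) cycle_rotate1[OF s(3)]] s(4,5) by simp
  ultimately show ?thesis using s(1,3,6) by blast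
 qed
 show "wlin C (%f. bracket_words R I P D f g)" "rot_inv (%f. bracket_words R I P D f g)"
  by (rule slot_eval[where X = C and F = "%f. bracket_words R I P D f g"], rule CM,
    rule bracket_words_closed(1)[OF _ g(1)], assumption, rule e1, assumption+)+
 show "wlin C (%f. bracket_words R I P D g f)" "rot_inv (%f. bracket_words R I P D g f)"
  by (rule slot_eval[where X = C and F = "%f. bracket_words R I P D g f"], rule CM,
    rule bracket_words_closed(1)[OF g(1)], assumption, rule e2, assumption+)+
qed

lemma act_word_closed:
 assumes "d : carrier L" "set g <= letters"
 shows "act_word R I P \<rho> d g : carrier C"
  "j < length g ==> (case g ! j of (e, x) => cw (g[j := (e, \<rho> e d x)])) = cw (g[j := ac d (g ! j)])"
  "j < length g ==> cw (g[j := ac d (g ! j)]) : carrier C"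
proof -
 interpret C: module R C by (rule CM)
 show 2: "(case g ! j of (e, x) => cw (g[j := (e, \<rho> e d x)])) = cw (g[j := ac d (g ! j)])" for j
  by (simp add: ac_def split: prod.split)
 show 3: "cw (g[j := ac d (g ! j)]) : carrier C" if "j < length g" for j
 proof (rule cw_closed)
  have "g ! j : letters" using assms(2) nth_mem[OF that] by auto
  then have "insert (ac d (g ! j)) (set g) <= letters" using assms(2) ac_mem[OF assms(1)] by blast
  then show "set (g[j := ac d (g ! j)]) <= letters" by (rule subset_trans[OF set_update_subset_insert])
 qed
 show "act_word R I P \<rho> d g : carrier C"
  unfolding act_word_def 2 by (intro C.M.finsum_closed Pi_I) (simp add: 3)
qed

lemma map_Aop_position:
 assumes "distinct l" "p < length l"
 shows "(map x l)[p := ac g (map x l ! p)] = map (Aop g (l ! p) x) l"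
 by (rule nth_equalityI)
  (use assms in "auto simp: Aop_def nth_list_update nth_eq_iff_index_eq")

lemma character_act_word:
 assumes \<Phi>: "character R C \<Phi>" and a: "g : carrier L" and x: "labelling x" and l: "distinct l"
 shows "\<Phi> (act_word R I P \<rho> g (map x l)) = (SUM i:set l. \<Phi> (cw (map (Aop g i x) l)))"
proof -
 note cl = act_word_closed[OF a labelling_map[OF x, of l]]
 have "\<Phi> (act_word R I P \<rho> g (map x l)) =
   (\<Sum>p<length (map x l). \<Phi> (cw ((map x l)[p := ac g (map x l ! p)])))"
 proof -
  have "act_word R I P \<rho> g (map x l) =
    (\<Oplus>\<^bsub>C\<^esub>p\<in>{..<length (map x l)}. cw ((map x l)[p := ac g (map x l ! p)]))"
   unfolding act_word_def
   by (rule abelian_monoid.finsum_cong')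
    (use cl CM in "auto simp: module_def abelian_group_def")
  then show ?thesis using character_finsum[OF CM \<Phi>, of _ "{..<length (map x l)}"] cl(3) by simp
 qed
 also have "... = (\<Sum>p<length l. \<Phi> (cw (map (Aop g (l ! p) x) l)))"
  using map_Aop_position[OF l] by (intro sum.cong) auto
 finally show ?thesis using sum_positions[OF l] by simp
qed

lemma act_word_cyclic:
 assumes a: "g : carrier L"
 shows "wlin C (act_word R I P \<rho> g)" "rot_inv (act_word R I P \<rho> g)"
proof -
 have ev: "EX x s l E. labelling x & cycle s l & w = map x l & slin (set l) E &
    (ALL y. labelling y --> (ALL k. k ~: set l --> y k = x k) --> \<Phi> (act_word R I P \<rho> g (map y l)) = E y) &
    \<Phi> (act_word R I P \<rho> g (map x (rotate1 l))) = E x"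
  if \<Phi>: "character R C \<Phi>" and w: "set w <= letters" "w ~= []" for \<Phi> w
 proof -
  obtain x s l where s: "labelling x" "cycle s l" "w = map x l" by (rule exists_slots1[OF w])
  have d: "distinct l" using s(2) by (simp add: cycle_def)
  let ?E = "%x. SUM i:set l. \<Phi> (cw (map (Aop g i x) l))"
  have "slin (set l) ?E"
   by (intro slin_sum slin_Aop[OF slin_word[OF wlin_comp[OF cw_lin \<Phi>] d] a])
  moreover have "\<Phi> (act_word R I P \<rho> g (map y l)) = ?E y" if "labelling y" for y
   by (rule character_act_word[OF \<Phi> a that d])
  moreover have "\<Phi> (act_word R I P \<rho> g (map x (rotate1 l))) = ?E x"
  proof -
   have "cw (map (Aop g i x) (rotate1 l)) = cw (map (Aop g i x) l)" for i
    using rot_inv_rotate[OF cw_rotate labelling_map, of "Aop g i x" 1 l] s(1) a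
    by (simp add: rotate1_map)
   then show ?thesis using character_act_word[OF \<Phi> a s(1), of "rotate1 l"] d by simp
  qed
  ultimately show ?thesis using s by blast
 qed
 show "wlin C (act_word R I P \<rho> g)" "rot_inv (act_word R I P \<rho> g)"
  by (rule slot_eval[where X = C and F = "act_word R I P \<rho> g"], rule CM,
    rule act_word_closed(1)[OF a], assumption, rule ev, assumption+)+
qed

lemma act_op_word_eq:
 assumes a: "d : carrier L" and g: "set g <= letters"
 shows "act_op_word R I P \<rho> d g = -[C] act_word R I P \<rho> d g"
proof -
 interpret C: module R C by (rule CM)
 note cl = act_word_closed[OF a g]
 have "(case g ! j of (e, x) => cw (g[j := (e, act_op (P e) (\<rho> e) x d)])) = -[C] cw (g[j := ac d (g ! j)])"
  if j: "j < length g" for j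
 proof -
  obtain e x where ex: "g ! j = (e, x)" by (metis surj_pair)
  have "(e, x) : letters" using g j ex nth_mem[OF j] by auto
  then have e: "e : I \<times> I" "\<rho> e d x : carrier (P e)"
   using bilinC[OF \<rho>_bilin a] by (auto simp: letters_iff)
  have "lin R (P e) C (%y. cw (take j g @ (e, y) # drop (Suc j) g))"
   by (rule word_linD[OF cw_lin e(1)]) (use g set_take_subset set_drop_subset in fast)+
  from lin_minus[OF PM[OF e(1)] CM this e(2)]
  show ?thesis using ex j by (simp add: act_op_def ac_def upd_conv_take_nth_drop)
 qed
 then have "act_op_word R I P \<rho> d g = (\<Oplus>\<^bsub>C\<^esub>j\<in>{..<length g}. -[C] cw (g[j := ac d (g ! j)]))"
  unfolding act_op_word_def by (intro C.M.finsum_cong') (auto simp: cl(3))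
 also have "... = -[C] (\<Oplus>\<^bsub>C\<^esub>j\<in>{..<length g}. cw (g[j := ac d (g ! j)]))"
  by (rule lin_finsum[OF CM CM lin_uminus[OF CM lin_id], symmetric]) (auto simp: cl(3))
 also have "(\<Oplus>\<^bsub>C\<^esub>j\<in>{..<length g}. cw (g[j := ac d (g ! j)])) = act_word R I P \<rho> d g"
  unfolding act_word_def by (rule C.M.finsum_cong') (auto simp: cl(2,3))
 finally show ?thesis .
qed

end

lemma spans_param_lin:
 assumes M: "module R M" and N: "module R N" and X: "module R X" and S: "spans R M S"
  and f: "!!p. p : carrier N ==> lin R M X (f p)"
  and fs: "!!s. s : S ==> lin R N X (%p. f p s)" and x: "x : carrier M"
 shows "lin R N X (%p. f p x)"
proof (rule linI)
 show "f p x : carrier X" if "p : carrier N" for p using linC[OF f[OF that] x] .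
next
 interpret X: module R X by (rule X)
 interpret N: module R N by (rule N)
 fix p q assume p: "p : carrier N" "q : carrier N"
 show "f (p +[N] q) x = f p x +[X] f q x"
  by (rule spans_eqI[OF M X S f lin_plus[OF X f f] _ x]) (use p in "auto simp: lin_add[OF fs]")
next
 interpret X: module R X by (rule X)
 interpret N: module R N by (rule N)
 fix r p assume rp: "r : carrier R" "p : carrier N"
 have "lin R X X (%y. r *[X] y)"
  by (rule linI) (use rp in "auto simp: X.smult_r_distr X.smult_assoc1[symmetric] X.R.m_comm")
 from lin_comp[OF f[OF rp(2)] this]
 show "f (r *[N] p) x = r *[X] f p x"
  by (intro spans_eqI[OF M X S f _ _ x]) (use rp in "auto simp: lin_smult[OF fs]")
qed

section \<open>The direct sum \<open>L \<oplus> Cyc(P)\<close>\<close>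

lemma prod_mod_simps:
 "carrier (prod_mod M N) = carrier M \<times> carrier N"
 "0[prod_mod M N] = (0[M], 0[N])"
 "p +[prod_mod M N] q = (fst p +[M] fst q, snd p +[N] snd q)"
 "r *[prod_mod M N] p = (r *[M] fst p, r *[N] snd p)"
 by (simp_all add: prod_mod_def case_prod_unfold)

lemma prod_module:
 assumes M: "module R M" and N: "module R N"
 shows "module R (prod_mod M N)"
proof -
 interpret M: module R M by (rule M)
 interpret N: module R N by (rule N)
 show ?thesis
 proof (rule moduleI[OF M.R.cring_axioms])
  show "abelian_group (prod_mod M N)"
  proof (rule abelian_groupI)
   fix p assume "p : carrier (prod_mod M N)"
   then show "EX q:carrier (prod_mod M N). q +[prod_mod M N] p = 0[prod_mod M N]"
    by (intro bexI[of _ "(-[M] fst p, -[N] snd p)"])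
     (auto simp: prod_mod_simps M.M.l_neg N.M.l_neg)
  qed (auto simp: prod_mod_simps M.M.a_ac N.M.a_ac)
 qed (auto simp: prod_mod_simps M.smult_l_distr N.smult_l_distr M.smult_r_distr N.smult_r_distr
   M.smult_assoc1 N.smult_assoc1)
qed

lemma prod_mod_lin:
 "lin R X M f ==> lin R X N g ==> lin R X (prod_mod M N) (%x. (f x, g x))"
 "lin R (prod_mod M N) M fst" "lin R (prod_mod M N) N snd"
 unfolding lin_def by (auto simp: prod_mod_simps)

context double_lie_data
begin

abbreviation "W == W_mod R L I P"
abbreviation "WW == tensor_mod R W W"
abbreviation "lie g == (g, 0[C])"
abbreviation "word w == (0[L], cw w)"
abbreviation "Wbr == W_bracket R L br I P \<rho> D"
abbreviation "Wcobr == W_cobracket R L \<delta> I P \<sigma> D"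

lemma W_mod: "module R W"
 unfolding W_mod_def by (rule prod_module[OF LM CM])

lemmas WWM = tens_mod[OF W_mod W_mod]

lemma lie_lin: "lin R L W (%g. lie g)"
 unfolding W_mod_def by (rule prod_mod_lin(1)[OF lin_id lin_const_zero[OF CM]])

lemma cyc_inj_lin: "lin R C W (%x. (0[L], x))"
 unfolding W_mod_def by (rule prod_mod_lin(1)[OF lin_const_zero[OF LM] lin_id])

lemmas W_fst_lin = prod_mod_lin(2)[of R L C, folded W_mod_def]
lemmas W_snd_lin = prod_mod_lin(3)[of R L C, folded W_mod_def]

lemma word_wlin: "wlin W (%w. word w)"
 by (rule wlin_comp[OF cw_lin cyc_inj_lin])

lemma word_rotate: "rot_inv (%w. word w)"
 by (rule rot_inv_comp[OF cw_rotate])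

lemma W_closed: "g : carrier L ==> lie g : carrier W" "set w <= letters ==> word w : carrier W"
 using linC[OF lie_lin] linC[OF cyc_inj_lin] cw_closed by auto

lemma word_zero: "map fst w ~: cyc_index I ==> word w = 0[W]"
 by (simp add: cw_zero W_mod_def prod_mod_simps)

lemma words_letters: "w : words I P ==> set w <= letters" "w : words I P ==> w ~= []"
 by (auto simp: words_iff cyc_index_def)

lemma W_spans: "spans R W ((%g. lie g) ` carrier L Un (%w. word w) ` words I P)"
 unfolding spans_def
proof (intro conjI allI impI)
 show "(%g. lie g) ` carrier L Un (%w. word w) ` words I P <= carrier W"
  using W_closed words_letters by (intro Un_least image_subsetI) auto
 fix K assume K: "submodule K R W" "(%g. lie g) ` carrier L Un (%w. word w) ` words I P <= K"
 interpret W: module R W by (rule W_mod)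
 interpret L: module R L by (rule LM)
 interpret C: module R C by (rule CM)
 have cyc: "(%x. (0[L], x)) ` carrier C <= K"
  by (rule lin_into_spans[OF CM W_mod cyc_inj_lin cw_spans K(1)]) (use K(2) in "simp add: image_image")
 show "carrier W <= K"
 proof
  fix p assume "p : carrier W"
  then obtain g x where p: "p = (g, x)" "g : carrier L" "x : carrier C"
   by (auto simp: W_mod_def prod_mod_simps)
  then have "p = lie g +[W] (0[L], x)" by (simp add: W_mod_def prod_mod_simps)
  moreover have "lie g : K" "(0[L], x) : K" using K(2) cyc p by auto
  ultimately show "p : K" using W.submoduleE(5)[OF K(1)] by simp
 qed
qed

lemma act_op_word_cyclic:
 assumes a: "g : carrier L"
 shows "wlin C (act_op_word R I P \<rho> g)" "rot_inv (act_op_word R I P \<rho> g)"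
proof -
 note eq = act_op_word_eq[OF a]
 show "rot_inv (act_op_word R I P \<rho> g)"
  unfolding rot_inv_def
  using rotation_invariantD[OF act_word_cyclic(2)[OF a]] by (simp add: eq)
 show "wlin C (act_op_word R I P \<rho> g)"
  unfolding wlin_def
 proof (intro allI ballI impI)
  fix w1 w2 e assume e: "e : I \<times> I" and w: "set w1 <= letters" "set w2 <= letters"
  show "lin R (P e) C (%x. act_op_word R I P \<rho> g (w1 @ (e, x) # w2))"
   by (rule lin_cong[OF PM[OF e] _ lin_uminus[OF CM word_linD[OF act_word_cyclic(1)[OF a] e w]]])
    (use eq e w in "simp add: letters_iff")
 qed
qed

abbreviation "actC g == cyc_lift R I P C (act_word R I P \<rho> g)"
abbreviation "actC_op g == cyc_lift R I P C (act_op_word R I P \<rho> g)"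
abbreviation "brC x y == cyc_lift R I P C (%f. cyc_lift R I P C (%g. bracket_words R I P D f g) y) x"

lemma actC_op_eq:
 assumes a: "g : carrier L" and x: "x : carrier C"
 shows "actC_op g x = -[C] actC g x"
 by (rule spans_eqI[OF CM CM cw_spans cyc_lift_lin[OF CM act_op_word_cyclic[OF a]]
    lin_uminus[OF CM cyc_lift_lin[OF CM act_word_cyclic[OF a]]] _ x])
  (auto simp: cyc_lift_word[OF CM act_op_word_cyclic[OF a]] cyc_lift_word[OF CM act_word_cyclic[OF a]]
   act_op_word_eq[OF a] words_letters)

lemma word_exists_slots:
 assumes "w : words I P"
 obtains x s l where "labelling x" "cycle s l" "w = map x l" "distinct l"
proof -
 obtain x s l where "labelling x" "cycle s l" "w = map x l"
  by (rule exists_slots1[OF words_letters[OF assms]])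
 then show ?thesis using that unfolding cycle_def by blast
qed

lemma actC_bilin: "bilin R L C C (%g. actC g)"
proof (rule bilinI)
 show "lin R C C (actC g)" if "g : carrier L" for g
  by (rule cyc_lift_lin[OF CM act_word_cyclic[OF that]])
 show "lin R L C (%g. actC g x)" if "x : carrier C" for x
 proof (rule spans_param_lin[OF CM LM CM cw_spans _ _ that])
  show "lin R C C (actC g)" if "g : carrier L" for g
   by (rule cyc_lift_lin[OF CM act_word_cyclic[OF that]])
  fix c assume "c : cw ` words I P"
  then obtain w where w: "w : words I P" "c = cw w" by blast
  obtain x s l where s: "labelling x" "cycle s l" "w = map x l" "distinct l"
   by (rule word_exists_slots[OF w(1)])
  show "lin R L C (%g. actC g c)"
  proof (rule lin_by_characters[OF LM CM])
   have val: "actC g c = act_word R I P \<rho> g w" if "g : carrier L" for g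
    using cyc_lift_word[OF CM act_word_cyclic[OF that] w(1)] w(2) by simp
   show "actC g c : carrier C" if "g : carrier L" for g
    using val[OF that] act_word_closed(1)[OF that words_letters(1)[OF w(1)]] by simp
   fix \<Phi> assume \<Phi>: "character R C \<Phi>"
   have "character R L (%g. SUM i:set l. \<Phi> (cw (map (Aop g i x) l)))"
   proof (rule character_lin_sum[OF R])
    fix i assume i: "i : set l"
    have "llin (%u. \<Phi> (cw (map (x(i := u)) l)))"
     by (rule slot_linD[OF slin_word[OF wlin_comp[OF cw_lin \<Phi>] s(4)] s(1) i])
    from ac_mlin[OF this] show "character R L (%g. \<Phi> (cw (map (Aop g i x) l)))"
     using s(1) by (simp add: mlin_def Aop_def)
   qed
   then show "character R L (%g. \<Phi> (actC g c))"
    by (rule lin_cong[OF LM, rotated])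
     (simp add: val s(3) character_act_word[OF \<Phi> _ s(1,4)])
  qed
 qed
qed

text \<open>\<open>brC\<close> nests one lift inside another. For the outer lift to make sense, the
  inner one must be multilinear and rotation invariant in \<open>f\<close> at every class
  \<open>y\<close>, which is checked on the spanning words.\<close>

lemma brC_cyclic:
 assumes y: "y : carrier C"
 shows "wlin C (%f. cyc_lift R I P C (%g. bracket_words R I P D f g) y)"
  "rot_inv (%f. cyc_lift R I P C (%g. bracket_words R I P D f g) y)"
proof -
 have bl: "lin R C C (cyc_lift R I P C (%g. bracket_words R I P D f g))"
  if "set f <= letters" "f ~= []" for f
  by (rule cyc_lift_lin[OF CM bracket_words_cyclic(3,4)[OF that]])
 have bw: "cyc_lift R I P C (%g. bracket_words R I P D f g) (cw g) = bracket_words R I P D f g"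
  if "set f <= letters" "f ~= []" "g : words I P" for f g
  by (rule cyc_lift_word[OF CM bracket_words_cyclic(3,4)[OF that(1,2)] that(3)])
 show "wlin C (%f. cyc_lift R I P C (%g. bracket_words R I P D f g) y)"
  unfolding wlin_def
 proof (intro allI ballI impI)
  fix w1 w2 e assume e: "e : I \<times> I" and w: "set w1 <= letters" "set w2 <= letters"
  have f: "set (w1 @ (e, m) # w2) <= letters" "w1 @ (e, m) # w2 ~= []" if "m : carrier (P e)" for m
   using w e that by (auto simp: letters_iff)
  show "lin R (P e) C (%m. cyc_lift R I P C (%g. bracket_words R I P D (w1 @ (e, m) # w2) g) y)"
  proof (rule spans_param_lin[OF CM PM[OF e] CM cw_spans bl[OF f] _ y], assumption+)
   fix c assume "c : cw ` words I P"
   then obtain g where g: "g : words I P" "c = cw g" by blast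
   show "lin R (P e) C (%m. cyc_lift R I P C (%g. bracket_words R I P D (w1 @ (e, m) # w2) g) c)"
    by (rule lin_cong[OF PM[OF e] _ word_linD[OF bracket_words_cyclic(1)[OF words_letters[OF g(1)]] e w]])
     (simp add: g(2) bw[OF f g(1)])
  qed
 qed
 show "rot_inv (%f. cyc_lift R I P C (%g. bracket_words R I P D f g) y)"
  unfolding rot_inv_def
 proof (intro allI impI)
  fix l w assume l: "l : letters" and w: "set w <= letters"
  have v: "set (w @ [l]) <= letters" "w @ [l] ~= []" "set (l # w) <= letters" "l # w ~= []"
   using l w by auto
  show "cyc_lift R I P C (%g. bracket_words R I P D (w @ [l]) g) y =
    cyc_lift R I P C (%g. bracket_words R I P D (l # w) g) y"
  proof (rule spans_eqI[OF CM CM cw_spans bl[OF v(1,2)] bl[OF v(3,4)] _ y])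
   fix c assume "c : cw ` words I P"
   then obtain g where g: "g : words I P" "c = cw g" by blast
   show "cyc_lift R I P C (%g. bracket_words R I P D (w @ [l]) g) c =
     cyc_lift R I P C (%g. bracket_words R I P D (l # w) g) c"
    unfolding g(2) bw[OF v(1,2) g(1)] bw[OF v(3,4) g(1)]
    by (rule rotation_invariantD[OF bracket_words_cyclic(2)[OF words_letters[OF g(1)]] l w])
  qed
 qed
qed

lemma brC_bilin: "bilin R C C C (%x y. brC x y)"
proof (rule bilinI)
 show *: "lin R C C (%x. brC x y)" if "y : carrier C" for y
  by (rule cyc_lift_lin[OF CM brC_cyclic[OF that]])
 show "lin R C C (%y. brC x y)" if "x : carrier C" for x
 proof (rule spans_param_lin[OF CM CM CM cw_spans * _ that], assumption)
  fix c assume "c : cw ` words I P"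
  then obtain f where f: "f : words I P" "c = cw f" by blast
  show "lin R C C (%y. brC c y)"
   by (rule lin_cong[OF CM _ cyc_lift_lin[OF CM bracket_words_cyclic(3,4)[OF words_letters[OF f(1)]]]])
    (simp add: f(2) cyc_lift_word[OF CM brC_cyclic f(1)])
 qed
qed

lemma brC_words:
 assumes "f : words I P" "g : words I P"
 shows "brC (cw f) (cw g) = bracket_words R I P D f g"
 using cyc_lift_word[OF CM brC_cyclic[OF cw_closed[OF words_letters(1)[OF assms(2)]]] assms(1)]
  cyc_lift_word[OF CM bracket_words_cyclic(3,4)[OF words_letters[OF assms(1)]] assms(2)] by simp

lemma Wbr_eq:
 "Wbr p q = (br (fst p) (fst q),
  actC (fst p) (snd q) +[C] actC_op (fst q) (snd p) +[C] brC (snd p) (snd q))"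
 unfolding W_bracket_def Let_def by (simp add: case_prod_unfold)

lemma W_fst_snd: "p : carrier W ==> fst p : carrier L" "p : carrier W ==> snd p : carrier C"
 by (rule linC[OF W_fst_lin], assumption) (rule linC[OF W_snd_lin])

lemma actC_op_bilin: "bilin R L C C (%g. actC_op g)"
proof (rule bilinI)
 show "lin R C C (actC_op g)" if "g : carrier L" for g
  by (rule cyc_lift_lin[OF CM act_op_word_cyclic[OF that]])
 show "lin R L C (%g. actC_op g x)" if "x : carrier C" for x
  by (rule lin_cong[OF LM _ lin_uminus[OF CM bilinL[OF actC_bilin that]]])
   (rule actC_op_eq[OF _ that, symmetric])
qed

lemma Wbr_bilin: "bilin R W W W Wbr"
 unfolding bilin_def Wbr_eq
proof (intro conjI ballI)
 fix p assume p: "p : carrier W"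
 note c = W_fst_snd[OF p]
 show "lin R W W (%q. (br (fst p) (fst q),
  actC (fst p) (snd q) +[C] actC_op (fst q) (snd p) +[C] brC (snd p) (snd q)))"
  unfolding W_mod_def[of R L I P]
  by (intro prod_mod_lin(1) lin_plus[OF CM])
   (fold W_mod_def, (rule lin_comp[OF W_fst_lin bilinR[OF br_bilin c(1)]]
    lin_comp[OF W_snd_lin bilinR[OF actC_bilin c(1)]]
    lin_comp[OF W_fst_lin bilinL[OF actC_op_bilin c(2)]]
    lin_comp[OF W_snd_lin bilinR[OF brC_bilin c(2)]])+)
 show "lin R W W (%q. (br (fst q) (fst p),
  actC (fst q) (snd p) +[C] actC_op (fst p) (snd q) +[C] brC (snd q) (snd p)))"
  unfolding W_mod_def[of R L I P]
  by (intro prod_mod_lin(1) lin_plus[OF CM])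
   (fold W_mod_def, (rule lin_comp[OF W_fst_lin bilinL[OF br_bilin c(1)]]
    lin_comp[OF W_fst_lin bilinL[OF actC_bilin c(2)]]
    lin_comp[OF W_snd_lin bilinR[OF actC_op_bilin c(1)]]
    lin_comp[OF W_snd_lin bilinL[OF brC_bilin c(2)]])+)
qed

lemma Wbr_lie_lie:
 assumes "g : carrier L" "d : carrier L"
 shows "Wbr (lie g) (lie d) = lie (br g d)"
proof -
 interpret C: module R C by (rule CM)
 show ?thesis
  using lin_zero[OF CM CM bilinR[OF actC_bilin assms(1)]]
   lin_zero[OF CM CM bilinR[OF actC_op_bilin assms(2)]]
   lin_zero[OF CM CM bilinR[OF brC_bilin C.M.zero_closed]]
  by (simp add: Wbr_eq)
qed

lemma Wbr_lie_word:
 assumes "g : carrier L" "x : carrier C"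
 shows "Wbr (lie g) (0[L], x) = (0[L], actC g x)" "Wbr (0[L], x) (lie g) = (0[L], -[C] actC g x)"
proof -
 interpret C: module R C by (rule CM)
 interpret L: module R L by (rule LM)
 note c = bilinC[OF actC_bilin assms]
 note z = lin_zero[OF LM LM bilinR[OF br_bilin assms(1)]]
  lin_zero[OF LM LM bilinL[OF br_bilin assms(1)]]
  lin_zero[OF CM CM bilinL[OF brC_bilin assms(2)]]
  lin_zero[OF CM CM bilinR[OF brC_bilin assms(2)]]
  lin_zero[OF CM CM bilinR[OF actC_op_bilin L.M.zero_closed]]
  lin_zero[OF CM CM bilinR[OF actC_bilin L.M.zero_closed]]
 show "Wbr (lie g) (0[L], x) = (0[L], actC g x)" "Wbr (0[L], x) (lie g) = (0[L], -[C] actC g x)"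
  using c z actC_op_eq[OF assms] by (simp_all add: Wbr_eq)
qed

lemma Wbr_word_word:
 assumes "x : carrier C" "y : carrier C"
 shows "Wbr (0[L], x) (0[L], y) = (0[L], brC x y)"
proof -
 interpret C: module R C by (rule CM)
 interpret L: module R L by (rule LM)
 note z = lin_zero[OF LM LM bilinR[OF br_bilin L.M.zero_closed]]
  lin_zero[OF LM CM bilinL[OF actC_op_bilin assms(1)]]
  lin_zero[OF LM CM bilinL[OF actC_bilin assms(2)]]
 show ?thesis using z bilinC[OF brC_bilin assms] by (simp add: Wbr_eq)
qed

lemma character_word: "character R W \<psi> ==> character R C (%x. \<psi> (0[L], x))"
 by (rule lin_comp[OF cyc_inj_lin])

lemma map_Aop_index: "map fst (map (Aop g i x) l) = map fst (map x l)"
 by (auto simp: Aop_def)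

text \<open>The action keeps the arrows of a word, hence its index, so for an index outside
  \<open>cyc_index I\<close> both sides are zero and the formula still holds.\<close>

lemma character_lie_word:
 assumes \<psi>: "character R W \<psi>" and a: "g : carrier L" and x: "labelling x" and l: "distinct l"
 shows "\<psi> (Wbr (lie g) (word (map x l))) = (SUM i:set l. \<psi> (word (map (Aop g i x) l)))"
  "\<psi> (Wbr (word (map x l)) (lie g)) = - (SUM i:set l. \<psi> (word (map (Aop g i x) l)))"
proof -
 note wc = cw_closed[OF labelling_map[OF x, of l]]
 note \<Phi> = character_word[OF \<psi>]
 have 1: "\<psi> (0[L], actC g (cw (map x l))) = (SUM i:set l. \<psi> (word (map (Aop g i x) l)))"
 proof (cases "map x l : words I P")
  case True
  then show ?thesis
   using cyc_lift_word[OF CM act_word_cyclic[OF a] True] character_act_word[OF \<Phi> a x l] by simp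
 next
  case False
  then have bad: "map fst (map x l) ~: cyc_index I" using labelling_map[OF x] by (auto simp: words_iff)
  have "\<psi> (word (map (Aop g i x) l)) = 0" for i
   using word_zero[of "map (Aop g i x) l"] bad character_zero[OF W_mod \<psi>]
   unfolding map_Aop_index by simp
  moreover have "actC g (cw (map x l)) = 0[C]"
   by (rule cyc_lift_word_zero[OF CM act_word_cyclic[OF a] bad])
  ultimately show ?thesis using character_zero[OF CM \<Phi>] by simp
 qed
 then show "\<psi> (Wbr (lie g) (word (map x l))) = (SUM i:set l. \<psi> (word (map (Aop g i x) l)))"
  "\<psi> (Wbr (word (map x l)) (lie g)) = - (SUM i:set l. \<psi> (word (map (Aop g i x) l)))"
  using Wbr_lie_word[OF a wc] character_minus[OF CM \<Phi> bilinC[OF actC_bilin a wc]] by simp_all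
qed

lemma Bop_eq_zero:
 assumes "!!u v. (u, v) : set (dd (x i) (x j)) ==> F (x(i := u, j := v)) = 0"
 shows "Bop i j F x = 0"
proof -
 have "Bop i j F x = psum (dd (x i) (x j)) (%u v. 0)"
  unfolding Bop_def by (rule psum_cong) (rule assms)
 then show ?thesis by simp
qed

text \<open>For admissible words this is the defining formula. If one of the words has a bad index,
  the left side is zero, and by \<open>admissible_cut\<close> every joined word on the right is zero
  as well. Iterated brackets can thus be expanded without tracking indices.\<close>

lemma character_word_word:
 assumes \<psi>: "character R W \<psi>" and x: "labelling x"
  and s: "cycle s l" "cycle s l'" "set l Int set l' = {}"
 shows "\<psi> (Wbr (word (map x l)) (word (map x l'))) =
  (SUM i:set l. SUM j:set l'. Bop i j (%y. \<psi> (word (map y (cyc_at (cut s i j) i)))) x)"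
proof -
 note wc = cw_closed[OF labelling_map[OF x]]
 note \<Phi> = character_word[OF \<psi>]
 have "\<psi> (0[L], brC (cw (map x l)) (cw (map x l'))) =
  (SUM i:set l. SUM j:set l'. Bop i j (%y. \<psi> (word (map y (cyc_at (cut s i j) i)))) x)"
 proof (cases "map x l : words I P & map x l' : words I P")
  case True
  then show ?thesis using brC_words character_bracket_words[OF \<Phi> x s] by simp
 next
  case False
  then have bad: "~ (admissible x s (set l) & admissible x s (set l'))"
   using labelling_map[OF x] cyc_index_admissible[OF s(1) x] cyc_index_admissible[OF s(2) x]
   by (auto simp: words_iff)
  then have bad': "~ admissible x s (set l Un set l')" by (auto simp: admissible_def)
  have "brC (cw (map x l)) (cw (map x l')) = 0[C]"
  proof (cases "map x l : words I P")
   case True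
   then have "cw (map x l') = 0[C]"
    using False labelling_map[OF x] by (intro cw_zero) (auto simp: words_iff)
   then show ?thesis using lin_zero[OF CM CM bilinR[OF brC_bilin wc]] by simp
  next
   case False
   then have "cw (map x l) = 0[C]"
    using labelling_map[OF x] by (intro cw_zero) (auto simp: words_iff)
   then show ?thesis using lin_zero[OF CM CM bilinL[OF brC_bilin wc]] by simp
  qed
  moreover have "Bop i j (%y. \<psi> (word (map y (cyc_at (cut s i j) i)))) x = 0"
   if ij: "i : set l" "j : set l'" for i j
  proof (rule Bop_eq_zero)
   fix u v assume uv: "(u, v) : set (dd (x i) (x j))"
   note c = cset_cut_two[OF s ij]
   let ?y = "x(i := u, j := v)"
   have y: "labelling ?y" using x dd_mem(1,2)[OF labellingD[OF x] labellingD[OF x] uv] by simp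
   have "~ admissible ?y (cut s i j) (set l Un set l')"
    using admissible_cut[OF x _ _ c(4) uv, of "set l Un set l'" s] bad' ij by auto
   then have "map fst (map ?y (cyc_at (cut s i j) i)) ~: cyc_index I"
    using cyc_index_admissible[OF cycle_cyc_at(1)[OF c(3)] y, of i] c(1) ij by auto
   then show "\<psi> (word (map ?y (cyc_at (cut s i j) i))) = 0"
    using word_zero character_zero[OF W_mod \<psi>] by simp
  qed
  ultimately show ?thesis using character_zero[OF CM \<Phi>] by simp
 qed
 then show ?thesis using Wbr_word_word[OF wc wc] by simp
qed

end

text \<open>The two terms of the cobracket for positions i < j are one expression with the roles of
  the positions exchanged. As a sum over ordered pairs of distinct positions it no longer depends on
  where the cyclic word starts.\<close>

lemma sum_ordered_pairs:
 fixes f :: "nat => nat => 'g::ab_group_add"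
 shows "(\<Sum>p<n. SUM q:{p<..<n}. f p q + f q p) = (\<Sum>p<n. SUM q:{..<n} - {p}. f p q)"
proof -
 have "(\<Sum>p<n. SUM q:{p<..<n}. f q p) = (\<Sum>p<n. \<Sum>q<p. f p q)"
 proof -
  have "(\<Sum>p<n. SUM q:{p<..<n}. f q p) = (\<Sum>(p, q)\<in>Sigma {..<n} (%p. {p<..<n}). f q p)"
   by (rule sum.Sigma) auto
  also have "... = (\<Sum>(p, q)\<in>Sigma {..<n} (%p. {..<p}). f p q)"
   by (rule sum.reindex_bij_witness[of _ "%(p, q). (q, p)" "%(p, q). (q, p)"]) auto
  also have "... = (\<Sum>p<n. \<Sum>q<p. f p q)" by (rule sum.Sigma[symmetric]) auto
  finally show ?thesis .
 qed
 then have "(\<Sum>p<n. SUM q:{p<..<n}. f p q + f q p) = (\<Sum>p<n. (SUM q:{p<..<n}. f p q) + (\<Sum>q<p. f p q))"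
  by (simp add: sum.distrib)
 also have "... = (\<Sum>p<n. SUM q:{..<n} - {p}. f p q)"
 proof (rule sum.cong[OF refl])
  fix p assume "p : {..<n}"
  then have "{..<n} - {p} = {p<..<n} Un {..<p}" by auto
  then show "(SUM q:{p<..<n}. f p q) + (\<Sum>q<p. f p q) = (SUM q:{..<n} - {p}. f p q)"
   by (simp add: sum.union_disjoint[symmetric] Int_def)
 qed
 finally show ?thesis .
qed

lemma sum_positions_distinct_pairs:
 assumes "distinct l"
 shows "(\<Sum>p<length l. SUM q:{..<length l} - {p}. G (l ! p) (l ! q)) = (SUM i:set l. SUM j:set l - {i}. G i j)"
proof -
 have "(SUM q:{..<length l} - {p}. G (l ! p) (l ! q)) = (SUM j:set l - {l ! p}. G (l ! p) j)"
  if p: "p < length l" for p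
 proof (rule sum.reindex_bij_betw)
  have "(%q. l ! q) ` ({..<length l} - {p}) = set l - {l ! p}"
   using assms p by (auto simp: in_set_conv_nth nth_eq_iff_index_eq image_iff)
  moreover have "inj_on (%q. l ! q) ({..<length l} - {p})"
   using assms by (auto simp: inj_on_def nth_eq_iff_index_eq)
  ultimately show "bij_betw (%q. l ! q) ({..<length l} - {p}) (set l - {l ! p})"
   by (simp add: bij_betw_def)
 qed
 then show ?thesis using sum_positions[OF assms, of "%i. SUM j:set l - {i}. G i j"] by simp
qed

lemma split_positions:
 assumes "p < q" "q < length l"
 shows "rotate p l = l ! p # drop (Suc p) (take q l) @ l ! q # drop (Suc q) l @ take p l"
proof -
 have "drop (Suc p) l = drop (Suc p) (take q l) @ l ! q # drop (Suc q) l"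
 proof -
  have "l = take q l @ l ! q # drop (Suc q) l" using assms by (simp add: id_take_nth_drop[symmetric])
  then have "drop (Suc p) l = drop (Suc p) (take q l @ l ! q # drop (Suc q) l)" by simp
  also have "... = drop (Suc p) (take q l) @ l ! q # drop (Suc q) l" using assms by simp
  finally show ?thesis .
 qed
 then show ?thesis using assms by (simp add: rotate_position)
qed

context double_lie_data
begin

section \<open>The cobracket\<close>

lemma word_bilin_slin:
 assumes K: "bilin R W W G K" and d: "distinct l1" "distinct l2" "set l1 Int set l2 = {}"
 shows "slin (set l1 Un set l2) (%y. K (word (map y l1)) (word (map y l2)))"
 unfolding slin_def
proof (intro allI impI)
 fix x i assume x: "labelling x" and i: "i : set l1 Un set l2"
 note wc = W_closed(2)[OF labelling_map[OF x]]
 show "llin (%u. K (word (map (x(i := u)) l1)) (word (map (x(i := u)) l2)))"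
 proof (cases "i : set l1")
  case True
  then have eq: "map (x(i := u)) l2 = map x l2" for u using d(3) by auto
  show ?thesis unfolding eq
   by (rule slot_linD[OF slin_word[OF wlin_comp[OF word_wlin bilinL[OF K wc]] d(1)] x True])
 next
  case False
  then have i2: "i : set l2" and eq: "map (x(i := u)) l1 = map x l1" for u using i by auto
  show ?thesis unfolding eq
   by (rule slot_linD[OF slin_word[OF wlin_comp[OF word_wlin bilinR[OF K wc]] d(2)] x i2])
 qed
qed

text \<open>\<open>K\<close> is a test function on tensors of two elements of \<open>W\<close>. The
  piece through \<open>j\<close> comes first because the cobracket places the second component of
  the double bracket in its first tensor factor.\<close>

definition cpair :: "('l \<times> ('k, 'i, 'p) cyc => 'l \<times> ('k, 'i, 'p) cyc => 'k => ratz) => (nat => nat) =>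
  nat => nat => (nat => ('i, 'p) letter) => 'k => ratz" where
 "cpair K s i j = Bop i j (%y. K (word (map y (cyc_at (cut s i j) j))) (word (map y (cyc_at (cut s i j) i))))"

text \<open>The cobracket of the word carried by \<open>l\<close>, tested with \<open>K\<close>. The
  minus sign is the one in the barred coaction.\<close>

definition csum :: "('l \<times> ('k, 'i, 'p) cyc => 'l \<times> ('k, 'i, 'p) cyc => 'k => ratz) => (nat => nat) =>
  nat list => (nat => ('i, 'p) letter) => 'k => ratz" where
 "csum K s l x =
  (SUM i:set l. Cop i (%g y. K (lie g) (word (map y l)) - K (word (map y l)) (lie g)) x) +
  (SUM i:set l. SUM j:set l - {i}. cpair K s i j x)"

lemma word_lie_slinL:
 assumes K: "bilin R W W G K" and d: "distinct l"
 shows "slinL (set l) (%g y. K (lie g) (word (map y l)))"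
  "slinL (set l) (%g y. K (word (map y l)) (lie g))"
  "slinL (set l) (%g y. K (lie g) (word (map y l)) - K (word (map y l)) (lie g))"
proof -
 have 1: "slin (set l) (%y. K (lie g) (word (map y l)))" "slin (set l) (%y. K (word (map y l)) (lie g))"
  if "g : carrier L" for g
  by (rule slin_word[OF wlin_comp[OF word_wlin bilinR[OF K W_closed(1)[OF that]]] d],
    rule slin_word[OF wlin_comp[OF word_wlin bilinL[OF K W_closed(1)[OF that]]] d])
 have 2: "character R L (%g. K (lie g) (word (map x l)))" "character R L (%g. K (word (map x l)) (lie g))"
  if "labelling x" for x
  by (rule lin_comp[OF lie_lin bilinL[OF K W_closed(2)[OF labelling_map[OF that]]]],
    rule lin_comp[OF lie_lin bilinR[OF K W_closed(2)[OF labelling_map[OF that]]]])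
 show "slinL (set l) (%g y. K (lie g) (word (map y l)))"
  "slinL (set l) (%g y. K (word (map y l)) (lie g))"
  using 1 2 by (simp_all add: slinL_def)
 show "slinL (set l) (%g y. K (lie g) (word (map y l)) - K (word (map y l)) (lie g))"
  unfolding slinL_def
  using slin_add[OF 1(1) slin_minus[OF 1(2)]] character_lin_diff[OF R LM 2] by simp
qed

lemma cyc_at_split_cycle:
 assumes s: "cycle s l" and ij: "i : set l" "j : set l" "i ~= j"
 shows "distinct (cyc_at (cut s i j) j)" "distinct (cyc_at (cut s i j) i)"
  "cset (cut s i j) j Int cset (cut s i j) i = {}"
  "cset (cut s i j) j Un cset (cut s i j) i = set l"
  "permutes_on (cut s i j) (set l)"
proof -
 note p = cycle_permutes_on(1)[OF s]
 have c: "cset s i = set l" "j : cset s i" using cycle_permutes_on(2)[OF s ij(1)] ij by auto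
 show q: "permutes_on (cut s i j) (set l)" by (rule permutes_on_cut[OF p ij])
 show "distinct (cyc_at (cut s i j) j)" "distinct (cyc_at (cut s i j) i)"
  using cycle_cyc_at(4)[OF q] ij by auto
 show "cset (cut s i j) j Un cset (cut s i j) i = set l"
  using cset_split(2)[OF p ij c(2)] c(1) by auto
 show "cset (cut s i j) j Int cset (cut s i j) i = {}"
  using cset_disjoint[OF q ij(1,2) cset_split(1)[OF p ij c(2)]] by auto
qed

lemma cpair_slin:
 assumes K: "bilin R W W G K" and s: "cycle s l" and ij: "i : set l" "j : set l" "i ~= j"
 shows "slin (set l) (%y. K (word (map y (cyc_at (cut s i j) j))) (word (map y (cyc_at (cut s i j) i))))"
  "slin (set l) (cpair K s i j)"
proof -
 note c = cyc_at_split_cycle[OF s ij]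
 show "slin (set l) (%y. K (word (map y (cyc_at (cut s i j) j))) (word (map y (cyc_at (cut s i j) i))))"
  using word_bilin_slin[OF K c(1-3)] unfolding c(4) .
 from slin_Bop[OF this ij] show "slin (set l) (cpair K s i j)" by (simp add: cpair_def)
qed

lemma csum_slin:
 assumes K: "bilin R W W G K" and s: "cycle s l"
 shows "slin (set l) (csum K s l)"
proof -
 have d: "distinct l" using s by (simp add: cycle_def)
 have "slin (set l) (%x. SUM i:set l. Cop i (%g y. K (lie g) (word (map y l)) - K (word (map y l)) (lie g)) x)"
  by (intro slin_sum slin_Cop[OF word_lie_slinL(3)[OF K d]])
 moreover have "slin (set l) (%x. SUM i:set l. SUM j:set l - {i}. cpair K s i j x)"
  by (intro slin_sum cpair_slin(2)[OF K s]) auto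
 ultimately show ?thesis unfolding csum_def by (rule slin_add)
qed

lemma coaction_terms:
 assumes l: "(e, m) : letters" and F: "lin R (P e) W (%m. F (e, m))"
 shows "tlift R WW (%g m'. tens R W W (lie g) (F (e, m'))) (\<sigma> e m) : carrier WW"
  "tlift R WW (%m' g. tens R W W (F (e, m')) (lie g)) (coact_op R L (P e) (\<sigma> e) m) : carrier WW"
  "character R WW \<Psi> ==> \<Psi> (tlift R WW (%g m'. tens R W W (lie g) (F (e, m'))) (\<sigma> e m)) =
   psum (co (e, m)) (%g u. \<Psi> (tens R W W (lie g) (F u)))"
  "character R WW \<Psi> ==> \<Psi> (tlift R WW (%m' g. tens R W W (F (e, m')) (lie g)) (coact_op R L (P e) (\<sigma> e) m)) =
   - psum (co (e, m)) (%g u. \<Psi> (tens R W W (F u) (lie g)))"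
proof -
 have e: "e : I \<times> I" and m: "m : carrier (P e)" using l by (auto simp: letters_iff)
 note Pe = PM[OF e] and sc = linC[OF \<sigma>_lin[OF e] m]
 note T = tens_bilin[OF W_mod W_mod]
 have b1: "bilin R L (P e) WW (%g m'. tens R W W (lie g) (F (e, m')))"
  by (rule bilin_comp2[OF T lie_lin F])
 have b2: "bilin R (P e) L WW (%m' g. tens R W W (F (e, m')) (lie g))"
  by (rule bilin_comp2[OF T F lie_lin])
 interpret PL: module R "tensor_mod R (P e) L" by (rule tens_mod[OF Pe LM])
 note swc = swap_closed[OF LM Pe sc]
 show "tlift R WW (%g m'. tens R W W (lie g) (F (e, m'))) (\<sigma> e m) : carrier WW"
  by (rule linC[OF tlift_lin[OF LM Pe WWM b1] sc])
 show "tlift R WW (%m' g. tens R W W (F (e, m')) (lie g)) (coact_op R L (P e) (\<sigma> e) m) : carrier WW"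
  unfolding coact_op_def
  by (rule linC[OF tlift_lin[OF Pe LM WWM b2] PL.M.a_inv_closed[OF swc]])
 assume \<Psi>: "character R WW \<Psi>"
 show "\<Psi> (tlift R WW (%g m'. tens R W W (lie g) (F (e, m'))) (\<sigma> e m)) =
   psum (co (e, m)) (%g u. \<Psi> (tens R W W (lie g) (F u)))"
  using character_tlift[OF LM Pe WWM \<Psi> b1 sc] by (simp add: co_def psum_map)
 have b2': "bilin R (P e) L G (%m' g. \<Psi> (tens R W W (F (e, m')) (lie g)))"
  by (rule bilin_comp[OF b2 \<Psi>])
 show "\<Psi> (tlift R WW (%m' g. tens R W W (F (e, m')) (lie g)) (coact_op R L (P e) (\<sigma> e) m)) =
   - psum (co (e, m)) (%g u. \<Psi> (tens R W W (F u) (lie g)))"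
  unfolding coact_op_def
  using character_tlift[OF Pe LM WWM \<Psi> b2 PL.M.a_inv_closed[OF swc]]
   psumt_minus[OF Pe LM b2' swc] psumt_swap[OF LM Pe b2' sc]
  by (simp add: co_def psum_map)
qed

lemma word_position_lin:
 assumes f: "set f <= letters" and i: "i < length f" and e: "e : I \<times> I"
 shows "lin R (P e) W (%m. word (f[i := (e, m)]))"
proof -
 have "lin R (P e) W (%m. word (take i f @ (e, m) # drop (Suc i) f))"
  by (rule word_linD[OF word_wlin e]) (use f set_take_subset set_drop_subset in fast)+
 then show ?thesis using i by (simp add: upd_conv_take_nth_drop)
qed

lemma tens_word_bilin_letters:
 assumes e: "e : I \<times> I" "e' : I \<times> I" and AB: "set A <= letters" "set B <= letters"
 shows "bilin R (P e) (P e') WW (%u v. tens R W W (word ((e', v) # A)) (word ((e, u) # B)))"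
 by (rule bilin_swap[OF bilin_comp2[OF tens_bilin[OF W_mod W_mod]
    word_linD[OF word_wlin e(2), of "[]", simplified] word_linD[OF word_wlin e(1), of "[]", simplified]]])
  (use AB in auto)

abbreviation "cobr_word == cobracket_word R L I P \<sigma> D"

context
 fixes f :: "('i, 'p) letter list"
 assumes f: "set f <= letters"
begin

definition "coact_term i = (case f ! i of (e, m) =>
    tlift R WW (%g m'. tens R W W (lie g) (word (f[i := (e, m')]))) (\<sigma> e m)
    +[WW]
    tlift R WW (%m' g. tens R W W (word (f[i := (e, m')])) (lie g))
     (coact_op R L (P e) (\<sigma> e) m))"

definition "pterm i j = dbl_letters R D WW
  (%u v. tens R W W (word (v # between f i j)) (word (u # between f j i))) (f ! i) (f ! j)"

lemma cobr_word_eq: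
 "cobr_word f = (\<Oplus>\<^bsub>WW\<^esub>i\<in>{..<length f}. coact_term i) +[WW]
  (\<Oplus>\<^bsub>WW\<^esub>i\<in>{..<length f}. \<Oplus>\<^bsub>WW\<^esub>j\<in>{i<..<length f}. pterm i j +[WW] pterm j i)"
 unfolding cobracket_word_def Let_def coact_term_def pterm_def ..

lemma coact_term:
 assumes i: "i < length f"
 shows "coact_term i : carrier WW"
  "character R WW \<Psi> ==> \<Psi> (coact_term i) = psum (co (f ! i))
   (%g u. \<Psi> (tens R W W (lie g) (word (f[i := u]))) - \<Psi> (tens R W W (word (f[i := u])) (lie g)))"
proof -
 obtain e m where em: "f ! i = (e, m)" by (metis surj_pair)
 have l: "(e, m) : letters" using f nth_mem[OF i] em by auto
 then have e: "e : I \<times> I" by (simp add: letters_iff)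
 interpret WW: module R WW by (rule WWM)
 note t = coaction_terms[OF l word_position_lin[OF f i e]]
 show "coact_term i : carrier WW" using t(1,2) by (simp add: coact_term_def em)
 show "character R WW \<Psi> ==> \<Psi> (coact_term i) = psum (co (f ! i))
   (%g u. \<Psi> (tens R W W (lie g) (word (f[i := u]))) - \<Psi> (tens R W W (word (f[i := u])) (lie g)))"
  unfolding coact_term_def em psum_diff
  using character_add[OF WWM _ t(1,2)] t(3,4) by (simp add: fun_diff_def)
qed

lemma pterm:
 assumes ij: "i < length f" "j < length f"
 shows "pterm i j : carrier WW"
  "character R WW g ==> g (pterm i j) = psum (dd (f ! i) (f ! j))
   (%u v. g (tens R W W (word (v # between f i j)) (word (u # between f j i))))"
proof -
 have l: "f ! i : letters" "f ! j : letters" using f ij nth_mem by blast+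
 show "pterm i j : carrier WW"
  unfolding pterm_def
  by (rule character_dbl_letters(1)[OF WWM l tens_word_bilin_letters])
   (auto intro!: between_letters[OF f, THEN subsetD])
 assume g: "character R WW g"
 show "g (pterm i j) = psum (dd (f ! i) (f ! j))
   (%u v. g (tens R W W (word (v # between f i j)) (word (u # between f j i))))"
  unfolding pterm_def
  by (rule character_dbl_letters(2)[OF WWM l tens_word_bilin_letters g])
   (auto intro!: between_letters[OF f, THEN subsetD])
qed

lemma cobr_word_closed: "cobr_word f : carrier WW"
proof -
 interpret WW: module R WW by (rule WWM)
 show ?thesis unfolding cobr_word_eq
  by (intro WW.M.a_closed WW.M.finsum_closed Pi_I coact_term(1) pterm(1)) auto
qed

lemma character_cobr_word_positions:
 assumes g: "character R WW g"
 shows "g (cobr_word f) = (\<Sum>i<length f. g (coact_term i)) +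
  (\<Sum>i<length f. SUM j:{i<..<length f}. g (pterm i j) + g (pterm j i))"
proof -
 interpret WW: module R WW by (rule WWM)
 note c = coact_term(1) pterm(1)
 have 1: "g (\<Oplus>\<^bsub>WW\<^esub>i\<in>{..<length f}. coact_term i) = (\<Sum>i<length f. g (coact_term i))"
  by (rule character_finsum[OF WWM g]) (use c in auto)
 have 2: "g (\<Oplus>\<^bsub>WW\<^esub>j\<in>{i<..<length f}. pterm i j +[WW] pterm j i) =
   (SUM j:{i<..<length f}. g (pterm i j) + g (pterm j i))" if "i < length f" for i
 proof -
  have "g (\<Oplus>\<^bsub>WW\<^esub>j\<in>{i<..<length f}. pterm i j +[WW] pterm j i) =
    (SUM j:{i<..<length f}. g (pterm i j +[WW] pterm j i))"
   by (rule character_finsum[OF WWM g]) (use c that in auto)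
  then show ?thesis using c that by (simp add: character_add[OF WWM g])
 qed
 have 3: "g (\<Oplus>\<^bsub>WW\<^esub>i\<in>{..<length f}. \<Oplus>\<^bsub>WW\<^esub>j\<in>{i<..<length f}. pterm i j +[WW] pterm j i) =
   (\<Sum>i<length f. g (\<Oplus>\<^bsub>WW\<^esub>j\<in>{i<..<length f}. pterm i j +[WW] pterm j i))"
  by (rule character_finsum[OF WWM g]) (intro Pi_I WW.M.finsum_closed WW.M.a_closed c, auto)
 show ?thesis
  unfolding cobr_word_eq
  by (subst character_add[OF WWM g])
   (auto intro!: WW.M.finsum_closed Pi_I WW.M.a_closed c simp: 1 2 3)
qed

end

text \<open>For positions p < q the two segments between them are the two cycles into which the cut
  splits \<open>l\<close>; the same cut serves both terms of the pair, as \<open>cut_sym\<close>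
  shows.\<close>

lemma character_cobr_word:
 assumes \<Psi>: "character R WW \<Psi>" and x: "labelling x" and s: "cycle s l"
 shows "\<Psi> (cobr_word (map x l)) = csum (%a b. \<Psi> (tens R W W a b)) s l x"
proof -
 note f = labelling_map[OF x, of l]
 have d: "distinct l" using s by (simp add: cycle_def)
 let ?K = "%a b. \<Psi> (tens R W W a b)"
 let ?f = "map x l"
 have 1: "\<Psi> (coact_term ?f p) = Cop (l ! p) (%g y. ?K (lie g) (word (map y l)) - ?K (word (map y l)) (lie g)) x"
  if p: "p < length l" for p
 proof -
  have "(map x l)[p := u] = map (x(l ! p := u)) l" for u
   by (rule nth_equalityI) (use p d in "auto simp: nth_list_update nth_eq_iff_index_eq")
  then show ?thesis using coact_term(2)[OF f _ \<Psi>, of p] p by (simp add: Cop_def)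
 qed
 have 2: "\<Psi> (pterm ?f p q) = cpair ?K s (l ! p) (l ! q) x"
  "\<Psi> (pterm ?f q p) = cpair ?K s (l ! q) (l ! p) x" if pq: "p < q" "q < length l" for p q
 proof -
  let ?i = "l ! p" and ?j = "l ! q"
  let ?A = "drop (Suc p) (take q l)" and ?B = "drop (Suc q) l @ take p l"
  have r: "cycle s (?i # ?A @ ?j # ?B)"
   using cycle_rotate[OF s, of p] split_positions[OF pq] by simp
  note c = cycle_split[OF r]
  have dd: "distinct (?i # ?A @ ?j # ?B)" using r by (simp add: cycle_def)
  then have ne: "?i ~= ?j" by auto
  have AB: "between ?f p q = map x ?A" "between ?f q p = map x ?B"
   using pq by (simp_all add: between_def drop_map take_map)
  have m: "map (x(?i := u, ?j := v)) (?j # ?A) = v # map x ?A" "map (x(?i := u, ?j := v)) (?i # ?B) = u # map x ?B"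
   "map (x(?j := u, ?i := v)) (?j # ?A) = u # map x ?A" "map (x(?j := u, ?i := v)) (?i # ?B) = v # map x ?B" for u v
   using dd ne by auto
  have l: "p < length ?f" "q < length ?f" using pq by auto
  show "\<Psi> (pterm ?f p q) = cpair ?K s ?i ?j x"
   unfolding pterm(2)[OF f l \<Psi>] AB cpair_def Bop_def cyc_at_eq[OF c(1)] cyc_at_eq[OF c(2)] m
   using pq by simp
  show "\<Psi> (pterm ?f q p) = cpair ?K s ?j ?i x"
   unfolding pterm(2)[OF f l(2,1) \<Psi>] AB cpair_def Bop_def cut_sym[of s ?j ?i]
    cyc_at_eq[OF c(1)] cyc_at_eq[OF c(2)] m
   using pq by simp
 qed
 have "\<Psi> (cobr_word ?f) =
   (\<Sum>p<length l. Cop (l ! p) (%g y. ?K (lie g) (word (map y l)) - ?K (word (map y l)) (lie g)) x) +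
   (\<Sum>p<length l. SUM q:{p<..<length l}. cpair ?K s (l ! p) (l ! q) x + cpair ?K s (l ! q) (l ! p) x)"
  unfolding character_cobr_word_positions[OF f \<Psi>] using 1 2 by simp
 also have "(\<Sum>p<length l. Cop (l ! p) (%g y. ?K (lie g) (word (map y l)) - ?K (word (map y l)) (lie g)) x) =
   (SUM i:set l. Cop i (%g y. ?K (lie g) (word (map y l)) - ?K (word (map y l)) (lie g)) x)"
  by (rule sum_positions[OF d])
 also have "(\<Sum>p<length l. SUM q:{p<..<length l}. cpair ?K s (l ! p) (l ! q) x + cpair ?K s (l ! q) (l ! p) x) =
   (SUM i:set l. SUM j:set l - {i}. cpair ?K s i j x)"
  unfolding sum_ordered_pairs[of "%p q. cpair ?K s (l ! p) (l ! q) x"]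
  by (rule sum_positions_distinct_pairs[OF d, of "%i j. cpair ?K s i j x"])
 finally show ?thesis by (simp add: csum_def plus_fun_def fun_diff_def)
qed

lemma csum_rotate:
 assumes x: "labelling x"
 shows "csum K s (rotate1 l) x = csum K s l x"
proof -
 have "word (map y (rotate1 l)) = word (map y l)" if "labelling y" for y
  using rot_inv_rotate[OF word_rotate labelling_map[OF that], of 1 l] by (simp add: rotate1_map)
 then have "Cop i (%g y. K (lie g) (word (map y (rotate1 l))) - K (word (map y (rotate1 l))) (lie g)) x =
   Cop i (%g y. K (lie g) (word (map y l)) - K (word (map y l)) (lie g)) x" for i
  by (intro Cop_cong[OF x]) simp
 then show ?thesis by (simp add: csum_def)
qed

lemma cobr_word_cyclic: "wlin WW cobr_word" "rot_inv cobr_word"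
proof -
 have ev: "EX x s l E. labelling x & cycle s l & w = map x l & slin (set l) E &
    (ALL y. labelling y --> (ALL k. k ~: set l --> y k = x k) --> g (cobr_word (map y l)) = E y) &
    g (cobr_word (map x (rotate1 l))) = E x"
  if g: "character R WW g" and w: "set w <= letters" "w ~= []" for g w
 proof -
  obtain x s l where s: "labelling x" "cycle s l" "w = map x l" by (rule exists_slots1[OF w])
  let ?E = "csum (%a b. g (tens R W W a b)) s l"
  have "slin (set l) ?E"
   by (rule csum_slin[OF bilin_comp[OF tens_bilin[OF W_mod W_mod] g] s(2)])
  moreover have "g (cobr_word (map y l)) = ?E y" if "labelling y" for y
   by (rule character_cobr_word[OF g that s(2)])
  moreover have "g (cobr_word (map x (rotate1 l))) = ?E x"
   using character_cobr_word[OF g s(1) cycle_rotate1[OF s(2)]] csum_rotate[OF s(1)] by simp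
  ultimately show ?thesis using s by blast
 qed
 show "wlin WW cobr_word" "rot_inv cobr_word"
  by (rule slot_eval[where X = WW and F = cobr_word], rule WWM, rule cobr_word_closed, assumption,
    rule ev, assumption+)+
qed

lemma lie_tens_bilin: "bilin R L L WW (%g d. tens R W W (lie g) (lie d))"
 by (rule bilin_comp2[OF tens_bilin[OF W_mod W_mod] lie_lin lie_lin])

lemma Wcobr_eq:
 "Wcobr p = tlift R WW (%g d. tens R W W (lie g) (lie d)) (\<delta> (fst p)) +[WW]
  cyc_lift R I P WW cobr_word (snd p)"
 unfolding W_cobracket_def Let_def by (simp add: case_prod_unfold)

lemma Wcobr_lin: "lin R W WW Wcobr"
 unfolding Wcobr_eq
 by (rule lin_plus[OF WWM
    lin_comp[OF W_fst_lin lin_comp[OF \<delta>_lin tlift_lin[OF LM LM WWM lie_tens_bilin]]]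
    lin_comp[OF W_snd_lin cyc_lift_lin[OF WWM cobr_word_cyclic]]])

lemma Wcobr_closed: "p : carrier W ==> Wcobr p : carrier WW"
 by (rule linC[OF Wcobr_lin])

abbreviation "wsum t K == psum (tlist R W W t) K"

lemma wsum_lie:
 assumes K: "bilin R W W G K" and a: "g : carrier L"
 shows "wsum (Wcobr (lie g)) K = psum (dl g) (%d t. K (lie d) (lie t))"
proof -
 note dc = linC[OF \<delta>_lin a]
 interpret WW: module R WW by (rule WWM)
 have "Wcobr (lie g) = tlift R WW (%d t. tens R W W (lie d) (lie t)) (\<delta> g)"
  using linC[OF tlift_lin[OF LM LM WWM lie_tens_bilin] dc]
   lin_zero[OF CM WWM cyc_lift_lin[OF WWM cobr_word_cyclic]] by (simp add: Wcobr_eq)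
 then have "wsum (Wcobr (lie g)) K = psum (dl g) (%d t. wsum (tens R W W (lie d) (lie t)) K)"
  using psumt_tlift[OF W_mod W_mod LM LM K lie_tens_bilin dc] by (simp add: dl_def)
 also have "... = psum (dl g) (%d t. K (lie d) (lie t))"
  by (rule psum_cong, rule psumt_tens[OF W_mod W_mod K]) (use dl_mem[OF a] W_closed in auto)
 finally show ?thesis .
qed

lemma csum_cong:
 assumes x: "labelling x" and s: "cycle s l" and K: "!!a b. a : carrier W ==> b : carrier W ==> K a b = K' a b"
 shows "csum K s l x = csum K' s l x"
proof -
 have "Cop i (%g y. K (lie g) (word (map y l)) - K (word (map y l)) (lie g)) x =
   Cop i (%g y. K' (lie g) (word (map y l)) - K' (word (map y l)) (lie g)) x" for i
  by (intro Cop_cong[OF x]) (simp add: K W_closed(1) W_closed(2)[OF labelling_map])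
 moreover have "cpair K s i j x = cpair K' s i j x" for i j
  unfolding cpair_def by (intro Bop_cong[OF x] K W_closed(2) labelling_map)
 ultimately show ?thesis by (simp add: csum_def)
qed

text \<open>As for brackets, a bad index makes both sides zero, so the formula is available for
  every labelling.\<close>

lemma wsum_word:
 assumes K: "bilin R W W G K" and x: "labelling x" and s: "cycle s l"
 shows "wsum (Wcobr (word (map x l))) K = csum K s l x"
proof -
 interpret WW: module R WW by (rule WWM)
 interpret L: module R L by (rule LM)
 note wc = cw_closed[OF labelling_map[OF x, of l]]
 note T = tlift_lin[OF LM LM WWM lie_tens_bilin]
 have z: "tlift R WW (%d t. tens R W W (lie d) (lie t)) (\<delta> 0[L]) = 0[WW]"
  by (rule lin_zero[OF LM WWM lin_comp[OF \<delta>_lin T]])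
 have eq: "Wcobr (word (map x l)) = cyc_lift R I P WW cobr_word (cw (map x l))"
  using z linC[OF cyc_lift_lin[OF WWM cobr_word_cyclic] wc] by (simp add: Wcobr_eq)
 note \<Psi> = psumt_lin[OF W_mod W_mod K]
 show ?thesis
 proof (cases "map x l : words I P")
  case True
  have "wsum (Wcobr (word (map x l))) K = csum (%a b. wsum (tens R W W a b) K) s l x"
   unfolding eq cyc_lift_word[OF WWM cobr_word_cyclic True] by (rule character_cobr_word[OF \<Psi> x s])
  also have "... = csum K s l x"
   by (rule csum_cong[OF x s]) (rule psumt_tens[OF W_mod W_mod K])
  finally show ?thesis .
 next
  case False
  then have bad: "map fst (map x l) ~: cyc_index I" using labelling_map[OF x] by (auto simp: words_iff)
  then have bad': "~ admissible x s (set l)" using cyc_index_admissible[OF s x] by simp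
  have K0: "K (word w) b = 0" "K b (word w) = 0" if "map fst w ~: cyc_index I" "b : carrier W" for w b
   using word_zero[OF that(1)] character_zero[OF W_mod bilinL[OF K that(2)]]
    character_zero[OF W_mod bilinR[OF K that(2)]] by simp_all
  have "Cop i (%g y. K (lie g) (word (map y l)) - K (word (map y l)) (lie g)) x = 0" for i
  proof -
   have "psum (co (x i)) (%g u. K (lie g) (word (map (x(i := u)) l)) - K (word (map (x(i := u)) l)) (lie g)) =
     psum (co (x i)) (%g u. 0)"
   proof (rule psum_cong)
    fix g u assume "(g, u) : set (co (x i))"
    note m = co_mem[OF labellingD[OF x] this]
    have "map fst (map (x(i := u)) l) = map fst (map x l)" using m(3) by auto
    then have "map fst (map (x(i := u)) l) ~: cyc_index I" using bad by metis
    then show "K (lie g) (word (map (x(i := u)) l)) - K (word (map (x(i := u)) l)) (lie g) = 0"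
     using K0 W_closed(1)[OF m(1)] by simp
   qed
   then show ?thesis by (simp add: Cop_def)
  qed
  moreover have "cpair K s i j x = 0" if ij: "i : set l" "j : set l" "i ~= j" for i j
   unfolding cpair_def
  proof (rule Bop_eq_zero)
   fix u v assume uv: "(u, v) : set (dd (x i) (x j))"
   note c = cyc_at_split_cycle[OF s ij]
   let ?y = "x(i := u, j := v)" and ?s = "cut s i j"
   have y: "labelling ?y" using x dd_mem(1,2)[OF labellingD[OF x] labellingD[OF x] uv] by simp
   have "~ admissible ?y ?s (set l)"
    using admissible_cut[OF x ij uv] bad' by simp
   \<comment> \<open>The two pieces exhaust \<open>l\<close>, so a violated condition lies on one of
     them; that factor is the zero word and \<open>K\<close> vanishes.\<close>
   then have "~ admissible ?y ?s (cset ?s j) | ~ admissible ?y ?s (cset ?s i)"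
    unfolding c(4)[symmetric] admissible_def by blast
   then have "map fst (map ?y (cyc_at ?s j)) ~: cyc_index I | map fst (map ?y (cyc_at ?s i)) ~: cyc_index I"
    using cyc_index_admissible[OF cycle_cyc_at(1)[OF c(5)] y] ij by auto
   then show "K (word (map ?y (cyc_at ?s j))) (word (map ?y (cyc_at ?s i))) = 0"
    using K0 W_closed(2)[OF labelling_map[OF y]] by blast
  qed
  ultimately have "csum K s l x = 0" by (simp add: csum_def)
  moreover have "wsum (Wcobr (word (map x l))) K = 0"
   unfolding eq cyc_lift_word_zero[OF WWM cobr_word_cyclic bad]
   by (rule psumt_zero[OF W_mod W_mod K])
  ultimately show ?thesis by simp
 qed
qed

end

section \<open>Cyclically ordered triples and quadruples\<close>

lemma sum_off_diagonal_swap: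
 assumes "finite A"
 shows "(SUM i:A. SUM j:A - {i}. f i j) = (SUM i:A. SUM j:A - {i}. f j i)"
proof -
 have "(SUM i:A. SUM j:A - {i}. f i j) = (\<Sum>(i, j)\<in>Sigma A (%i. A - {i}). f i j)"
  by (rule sum.Sigma) (use assms in auto)
 also have "... = (\<Sum>(i, j)\<in>Sigma A (%i. A - {i}). f j i)"
  by (rule sum.reindex_bij_witness[of _ "%(i, j). (j, i)" "%(i, j). (j, i)"]) auto
 also have "... = (SUM i:A. SUM j:A - {i}. f j i)" by (rule sum.Sigma[symmetric]) (use assms in auto)
 finally show ?thesis .
qed

text \<open>Triples of slots met in this cyclic order along \<open>l\<close>. The starting point is
  free, so a triple occurs together with its rotations.\<close>

definition triples :: "'n list => ('n \<times> 'n \<times> 'n) set" where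
 "triples l = {(i, j, k). EX n A B C. rotate n l = i # A @ j # B @ k # C}"

definition quads :: "'n list => ('n \<times> 'n \<times> 'n \<times> 'n) set" where
 "quads l = {(i, j, k, m). EX n A B C E. rotate n l = i # A @ j # B @ k # C @ m # E}"

lemma triplesE:
 assumes "(i, j, k) : triples l"
 obtains n A B C where "rotate n l = i # A @ j # B @ k # C"
 using assms by (auto simp: triples_def)

lemma quadsE:
 assumes "(i, j, k, m) : quads l"
 obtains n A B C E where "rotate n l = i # A @ j # B @ k # C @ m # E"
 using assms by (auto simp: quads_def)

lemma rotate_append_rotate:
 assumes "rotate n l = xs @ ys"
 shows "EX n'. rotate n' l = ys @ xs"
by (metis assms rotate_rotate rotate_append)

lemma triples_mem:
 assumes "(i, j, k) : triples l"
 shows "i : set l" "j : set l" "k : set l" "distinct l ==> distinct [i, j, k]" "(j, k, i) : triples l"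
proof -
 obtain n A B C where r: "rotate n l = i # A @ j # B @ k # C" by (rule triplesE[OF assms])
 have "set (rotate n l) = set l" by simp
 then show "i : set l" "j : set l" "k : set l" unfolding r by auto
 have "distinct (rotate n l) = distinct l" by simp
 then show "distinct l ==> distinct [i, j, k]" unfolding r by auto
 show "(j, k, i) : triples l"
  using rotate_append_rotate[of n l "i # A" "j # B @ k # C"] r unfolding triples_def by force
qed

lemma quads_mem:
 assumes "(i, j, k, m) : quads l"
 shows "i : set l" "j : set l" "k : set l" "m : set l" "distinct l ==> distinct [i, j, k, m]"
  "(j, k, m, i) : quads l"
proof -
 obtain n A B C E where r: "rotate n l = i # A @ j # B @ k # C @ m # E" by (rule quadsE[OF assms])
 have "set (rotate n l) = set l" by simp
 then show "i : set l" "j : set l" "k : set l" "m : set l" unfolding r by auto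
 have "distinct (rotate n l) = distinct l" by simp
 then show "distinct l ==> distinct [i, j, k, m]" unfolding r by auto
 show "(j, k, m, i) : quads l"
  using rotate_append_rotate[of n l "i # A" "j # B @ k # C @ m # E"] r unfolding quads_def by force
qed

lemma triples_finite: "finite (triples l)" "finite (quads l)"
proof -
 have "triples l <= set l \<times> set l \<times> set l" using triples_mem by fast
 then show "finite (triples l)" by (rule finite_subset) auto
 have "quads l <= set l \<times> set l \<times> set l \<times> set l" using quads_mem by fast
 then show "finite (quads l)" by (rule finite_subset) auto
qed

text \<open>The values may have torsion, so the orbits of the cyclic rotation are summed one by one,
 each represented by the element that starts with the smallest entry.\<close>

lemma sum_triples_eq_0:
 fixes l :: "'n::linorder list" and f :: "'n => 'n => 'n => 'g::ab_group_add"
 assumes l: "distinct l" and f: "!!i j k. (i, j, k) : triples l ==> f i j k + f j k i + f k i j = 0"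
 shows "(\<Sum>(i, j, k)\<in>triples l. f i j k) = 0"
proof -
 let ?T = "triples l"
 define T1 where "T1 = {(i, j, k). (i, j, k) : ?T & i < j & i < k}"
 define T2 where "T2 = {(i, j, k). (i, j, k) : ?T & j < i & j < k}"
 define T3 where "T3 = {(i, j, k). (i, j, k) : ?T & k < i & k < j}"
 have T: "?T = T1 Un (T2 Un T3)" using triples_mem(4)[OF _ l] by (fastforce simp: T1_def T2_def T3_def)
 have fin: "finite T1" "finite T2" "finite T3"
  using triples_finite(1)[of l] by (auto intro: finite_subset simp: T)
 have dj: "T1 Int (T2 Un T3) = {}" "T2 Int T3 = {}" by (auto simp: T1_def T2_def T3_def)
 have r2: "(\<Sum>(i, j, k)\<in>T2. f i j k) = (\<Sum>(i, j, k)\<in>T1. f k i j)"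
  by (rule sum.reindex_bij_witness[of _ "%(i, j, k). (k, i, j)" "%(i, j, k). (j, k, i)"])
   (auto simp: T1_def T2_def intro: triples_mem(5))
 have r3: "(\<Sum>(i, j, k)\<in>T3. f i j k) = (\<Sum>(i, j, k)\<in>T1. f j k i)"
  by (rule sum.reindex_bij_witness[of _ "%(i, j, k). (j, k, i)" "%(i, j, k). (k, i, j)"])
   (auto simp: T1_def T3_def intro: triples_mem(5))
 have "(\<Sum>(i, j, k)\<in>?T. f i j k) = (\<Sum>(i, j, k)\<in>T1. f i j k) + (\<Sum>(i, j, k)\<in>T1. f j k i) + (\<Sum>(i, j, k)\<in>T1. f k i j)"
  using fin dj by (simp add: T sum.union_disjoint r2 r3 add_ac)
 also have "... = (\<Sum>(i, j, k)\<in>T1. f i j k + f j k i + f k i j)"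
  by (simp add: sum.distrib case_prod_unfold)
 also have "... = 0" by (rule sum.neutral) (auto simp: T1_def f)
 finally show ?thesis .
qed

text \<open>Values alternate in sign along a rotation orbit. To avoid a division by two, the
  quadruples are divided according to whether the smallest entry stands in an odd or an even place;
  one rotation step exchanges the two halves.\<close>

lemma sum_quads_eq_0:
 fixes l :: "'n::linorder list" and f :: "'n => 'n => 'n => 'n => 'g::ab_group_add"
 assumes l: "distinct l" and f: "!!i j k m. (i, j, k, m) : quads l ==> f j k m i = - f i j k m"
 shows "(\<Sum>(i, j, k, m)\<in>quads l. f i j k m) = 0"
proof -
 let ?Q = "quads l"
 define Q1 where "Q1 = {(i, j, k, m). (i, j, k, m) : ?Q & min i k < min j m}"
 define Q2 where "Q2 = {(i, j, k, m). (i, j, k, m) : ?Q & min j m < min i k}"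
 have Q: "?Q = Q1 Un Q2"
 proof (intro equalityI subsetI)
  fix q assume q: "q : ?Q"
  obtain i j k m where e: "q = (i, j, k, m)" by (cases q)
  have "min i k ~= min j m" using quads_mem(5)[OF q[unfolded e] l] by (auto simp: min_def)
  then have "min i k < min j m | min j m < min i k" by (rule linorder_neqE) blast+
  then show "q : Q1 Un Q2" using q unfolding e Q1_def Q2_def by blast
 qed (auto simp: Q1_def Q2_def)
 have fin: "finite Q1" "finite Q2" using triples_finite(2)[of l] by (auto intro: finite_subset simp: Q)
 have "(\<Sum>(i, j, k, m)\<in>Q2. f i j k m) = (\<Sum>(i, j, k, m)\<in>Q1. f j k m i)"
  by (rule sum.reindex_bij_witness[of _ "%(i, j, k, m). (j, k, m, i)" "%(i, j, k, m). (m, i, j, k)"])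
   (auto simp: Q1_def Q2_def min.commute intro: quads_mem(6))
 also have "... = (\<Sum>(i, j, k, m)\<in>Q1. - f i j k m)" by (rule sum.cong) (auto simp: Q1_def f)
 finally have "(\<Sum>(i, j, k, m)\<in>Q2. f i j k m) = - (\<Sum>(i, j, k, m)\<in>Q1. f i j k m)"
  by (simp add: sum_negf case_prod_unfold)
 moreover have "Q1 Int Q2 = {}" using less_asym unfolding Q1_def Q2_def by blast
 ultimately show ?thesis using fin by (simp add: Q sum.union_disjoint)
qed

context
 fixes s :: "'n => 'n" and l :: "'n list"
 assumes s: "cycle s l"
begin

lemma cycle_distinct: "distinct l"
 using s by (simp add: cycle_def)

lemma cycle_rotated: "rotate n l = l' ==> cycle s l'"
 using cycle_rotate[OF s] by blast

lemma split_cycle: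
 assumes "i : set l" "j : set l" "i ~= j"
 obtains n A B where "rotate n l = i # A @ j # B" "cyc_at (cut s i j) i = i # B" "cyc_at (cut s i j) j = j # A"
using cyc_at_split[OF cycle_permutes_on(1)[OF s] assms] assms(2) cycle_permutes_on(3)[OF s assms(1)]
 by fastforce

text \<open>If \<open>l\<close> reads i A j B, the cut leaves the cycle i B at \<open>i\<close>, and
  its other members are the slots met after \<open>j\<close>.\<close>

lemma cset_split_first:
 assumes ij: "i : set l" "j : set l" "i ~= j"
 shows "k : cset (cut s i j) i - {i} \<longleftrightarrow> (i, j, k) : triples l"
proof
 obtain n A B where r: "rotate n l = i # A @ j # B" and c: "cyc_at (cut s i j) i = i # B"
  by (rule split_cycle[OF ij])
 assume "k : cset (cut s i j) i - {i}"
 then obtain B1 B2 where "B = B1 @ k # B2" using c by (auto dest: split_list)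
 then show "(i, j, k) : triples l" using r by (auto simp: triples_def)
next
 assume "(i, j, k) : triples l"
 then obtain n A B C where "rotate n l = i # A @ j # B @ k # C" by (rule triplesE)
 note r = cycle_rotated[OF this]
 have "k ~= i" using r by (auto simp: cycle_def)
 then show "k : cset (cut s i j) i - {i}" using cyc_at_eq[OF cycle_split(1)[OF r]] by simp
qed

lemma cset_split_second:
 assumes ij: "i : set l" "j : set l" "i ~= j"
 shows "k : cset (cut s i j) j - {j} \<longleftrightarrow> (i, k, j) : triples l"
 using cset_split_first[of j i k] ij triples_mem(5)[of j i k l] triples_mem(5)[of k j i l] triples_mem(5)[of i k j l]
 by (auto simp: cut_sym[of s j i])

text \<open>If \<open>l\<close> reads i A j B k C m E, the first cut gives i B k C m E and j A, and
  the second splits the former into m C and k E i B. In particular \<open>i\<close> ends up with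
  \<open>k\<close>.\<close>

lemma quads_first:
 assumes "(i, j, k, m) : quads l"
 shows "cycle (cut (cut s i j) k m) (cyc_at (cut (cut s i j) k m) j)"
  "cset (cut (cut s i j) k m) j Int cset (cut (cut s i j) k m) m = {}"
  "cset (cut (cut s i j) k m) j Int cset (cut (cut s i j) k m) k = {}"
  "cset (cut (cut s i j) k m) m Int cset (cut (cut s i j) k m) k = {}"
  "cset (cut (cut s i j) k m) j Un cset (cut (cut s i j) k m) m Un
   cset (cut (cut s i j) k m) k = set l"
  "i : cset (cut (cut s i j) k m) k" "k : cset (cut s i j) i" "m : cset (cut s i j) i"
  "j : cset (cut (cut s i j) k m) j" "m : cset (cut (cut s i j) k m) m"
  "k : cset (cut (cut s i j) k m) k"
  "permutes_on (cut (cut s i j) k m) (set l)"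
proof -
 obtain n A B C E where r: "rotate n l = i # A @ j # B @ k # C @ m # E" by (rule quadsE[OF assms])
 note r1 = cycle_split[OF cycle_rotated[OF r]]
 let ?t = "cut (cut s i j) k m"
 have d: "distinct (i # A @ j # B @ k # C @ m # E)" using cycle_rotated[OF r] by (simp add: cycle_def)
 have "cycle (cut s i j) (k # C @ m # (E @ i # B))"
  using cycle_rotate[OF r1(1), of "length (i # B)"] rotate_append[of "i # B" "k # C @ m # E"] by simp
 note r2 = cycle_split[OF this]
 have r3: "cycle ?t (j # A)" by (rule cycle_cut_other[OF r1(2)]) (use d in auto)
 note e = cyc_at_eq[OF r2(1)] cyc_at_eq[OF r2(2)] cyc_at_eq[OF r3] cyc_at_eq[OF r1(1)]
 have "set (rotate n l) = set l" by simp
 then have sl: "set l = set (i # A @ j # B @ k # C @ m # E)" unfolding r by blast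
 show "cycle ?t (cyc_at ?t j)" "cset ?t j Int cset ?t m = {}" "cset ?t j Int cset ?t k = {}"
  "cset ?t m Int cset ?t k = {}" "i : cset ?t k" "k : cset (cut s i j) i" "m : cset (cut s i j) i"
  "j : cset ?t j" "m : cset ?t m" "k : cset ?t k"
  using d r3 unfolding e by auto
 show "cset ?t j Un cset ?t m Un cset ?t k = set l" unfolding e sl by auto
 have "permutes_on ?t (set (j # A) Un (set (m # C) Un set (k # E @ i # B)))"
  by (intro permutes_on_Un cycle_permutes_on(1)) (use r2 r3 in simp_all)
 moreover have "set (j # A) Un (set (m # C) Un set (k # E @ i # B)) = set l" unfolding sl by auto
 ultimately show "permutes_on ?t (set l)" by simp
qed

lemma sum_triples:
 "(SUM i:set l. SUM j:set l - {i}. SUM m:cset (cut s i j) i - {i}. g i j m) = (\<Sum>(i, j, k)\<in>triples l. g i j k)"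
proof -
 let ?T = "SIGMA i:set l. SIGMA j:set l - {i}. cset (cut s i j) i - {i}"
 have eq: "(i, j, k) : ?T \<longleftrightarrow> (i, j, k) : triples l" for i j k
  using triples_mem[of i j k l] cycle_distinct cset_split_first[of i j k] by auto
 have "?T = triples l"
 using eq by fastforce
 then show ?thesis by (simp add: sum.Sigma)
qed

text \<open>Both slots of the second cut lie on the piece through \<open>i\<close>. Either the first
  of them is \<open>i\<close>, or the second is, or neither; in the last case they occur in either
  cyclic order after \<open>j\<close>, which gives the two sums over quadruples.\<close>

lemma sum_split_first:
 fixes f :: "'n => 'n => 'n => 'n => 'g::ab_group_add"
 shows "(SUM i:set l. SUM j:set l - {i}. SUM k:cset (cut s i j) i. SUM m:cset (cut s i j) i - {k}. f i j k m) =
  (\<Sum>(i, j, k)\<in>triples l. f i j i k) + (\<Sum>(i, j, k)\<in>triples l. f i j k i) +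
  (\<Sum>(i, j, k, m)\<in>quads l. f i j k m) + (\<Sum>(i, j, k, m)\<in>quads l. f i j m k)"
proof -
 let ?c = "%i j. cset (cut s i j) i"
 have one: "(SUM k:?c i j. SUM m:?c i j - {k}. f i j k m) =
   (SUM m:?c i j - {i}. f i j i m) + (SUM m:?c i j - {i}. f i j m i) +
   (SUM k:?c i j - {i}. SUM m:?c i j - {i} - {k}. f i j k m)"
  if ij: "i : set l" "j : set l" "i ~= j" for i j
 proof -
  have i: "i : ?c i j" by (rule split_cycle[OF ij]) auto
  have "(SUM k:?c i j. SUM m:?c i j - {k}. f i j k m) =
    (SUM m:?c i j - {i}. f i j i m) + (SUM k:?c i j - {i}. SUM m:?c i j - {k}. f i j k m)"
   by (rule sum.remove) (use i in auto)
  also have "(SUM k:?c i j - {i}. SUM m:?c i j - {k}. f i j k m) =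
    (SUM k:?c i j - {i}. f i j k i + (SUM m:?c i j - {i} - {k}. f i j k m))"
  proof (rule sum.cong[OF refl])
   fix k assume "k : ?c i j - {i}"
   then have "(SUM m:?c i j - {k}. f i j k m) = f i j k i + (SUM m:?c i j - {k} - {i}. f i j k m)"
    by (intro sum.remove) (use i in auto)
   moreover have "?c i j - {k} - {i} = ?c i j - {i} - {k}" by blast
   ultimately show "(SUM m:?c i j - {k}. f i j k m) = f i j k i + (SUM m:?c i j - {i} - {k}. f i j k m)" by simp
  qed
  finally show ?thesis by (simp add: sum.distrib add_ac)
 qed
 define S where "S = (SIGMA i:set l. SIGMA j:set l - {i}. SIGMA k:?c i j - {i}. ?c i j - {i} - {k})"
 have "quads l <= S"
 proof
  fix q assume q: "q : quads l"
  obtain i j k m where e: "q = (i, j, k, m)" by (cases q)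
  show "q : S" using quads_mem[OF q[unfolded e]] quads_first[OF q[unfolded e]] cycle_distinct
   by (auto simp: S_def e)
 qed
 define Q' where "Q' = {(i, j, k, m). (i, j, m, k) : quads l}"
 have sub': "Q' <= S" using \<open>quads l <= S\<close> by (auto simp: Q'_def S_def)
 have "S <= quads l Un Q'"
 proof
  fix q assume q: "q : S"
  obtain i j k m where e: "q = (i, j, k, m)" by (cases q)
  have ij: "i : set l" "j : set l" "i ~= j" and km: "k : ?c i j - {i}" "m : ?c i j - {i}" "k ~= m"
   using q by (auto simp: S_def e)
  obtain n A B where r: "rotate n l = i # A @ j # B" and c: "cyc_at (cut s i j) i = i # B"
   by (rule split_cycle[OF ij])
  obtain B1 B2 where B: "B = B1 @ k # B2" "m : set B1 Un set B2"
   using km c split_list[of k B] by fastforce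
  show "q : quads l Un Q'"
  using split_list r B Q'_def e quads_def by fastforce
 qed
 then have S: "S = quads l Un Q'" using \<open>quads l <= S\<close> sub' by blast
 \<comment> \<open>A common element would place \<open>i\<close> on the piece through
   \<open>k\<close> and on the piece through \<open>m\<close>, which are disjoint.\<close>
 have dj: "quads l Int Q' = {}"
 proof (rule ccontr)
  assume "quads l Int Q' ~= {}"
  then obtain i j k m where q: "(i, j, k, m) : quads l" "(i, j, m, k) : quads l" by (auto simp: Q'_def)
  show False using quads_first(4,6)[OF q(1)] quads_first(6)[OF q(2)] by (auto simp: cut_sym[of _ m k])
 qed
 have fin: "finite S" by (simp add: S_def)
 have "(SUM i:set l. SUM j:set l - {i}. SUM k:?c i j - {i}. SUM m:?c i j - {i} - {k}. f i j k m) =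
   (\<Sum>(i, j, k, m)\<in>S. f i j k m)"
  unfolding S_def by (simp add: sum.Sigma)
 also have "... = (\<Sum>(i, j, k, m)\<in>quads l. f i j k m) + (\<Sum>(i, j, k, m)\<in>Q'. f i j k m)"
  unfolding S by (rule sum.union_disjoint) (use fin dj in "auto simp: S")
 also have "(\<Sum>(i, j, k, m)\<in>Q'. f i j k m) = (\<Sum>(i, j, k, m)\<in>quads l. f i j m k)"
  by (rule sum.reindex_bij_witness[of _ "%(i, j, k, m). (i, j, m, k)" "%(i, j, k, m). (i, j, m, k)"])
   (auto simp: Q'_def)
 finally have q: "(SUM i:set l. SUM j:set l - {i}. SUM k:?c i j - {i}. SUM m:?c i j - {i} - {k}. f i j k m) =
   (\<Sum>(i, j, k, m)\<in>quads l. f i j k m) + (\<Sum>(i, j, k, m)\<in>quads l. f i j m k)" .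
 have "(SUM i:set l. SUM j:set l - {i}. SUM k:?c i j. SUM m:?c i j - {k}. f i j k m) =
   (SUM i:set l. SUM j:set l - {i}. (SUM m:?c i j - {i}. f i j i m) + (SUM m:?c i j - {i}. f i j m i) +
   (SUM k:?c i j - {i}. SUM m:?c i j - {i} - {k}. f i j k m))"
  by (intro sum.cong refl) (auto simp: one)
 then show ?thesis by (simp add: sum.distrib q sum_triples add_ac)
qed

text \<open>Here the second operation joins the two pieces again. Its slots either are the original
  \<open>j\<close> and \<open>i\<close>, or share one slot with them, or are both new; in the last
  case the four slots alternate along the cycle.\<close>

lemma sum_split_across:
 fixes f :: "'n => 'n => 'n => 'n => 'g::ab_group_add"
 shows "(SUM i:set l. SUM j:set l - {i}. SUM k:cset (cut s i j) j. SUM m:cset (cut s i j) i. f i j k m) =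
  (SUM i:set l. SUM j:set l - {i}. f i j j i) + (\<Sum>(i, j, k)\<in>triples l. f i j j k) +
  (\<Sum>(i, j, k)\<in>triples l. f j i k j) + (\<Sum>(i, j, k, m)\<in>quads l. f i k j m)"
proof -
 let ?c = "%i j. cset (cut s i j) i" and ?d = "%i j. cset (cut s i j) j"
 have one: "(SUM k:?d i j. SUM m:?c i j. f i j k m) =
   f i j j i + (SUM m:?c i j - {i}. f i j j m) + (SUM k:?d i j - {j}. f i j k i) +
   (SUM k:?d i j - {j}. SUM m:?c i j - {i}. f i j k m)"
  if ij: "i : set l" "j : set l" "i ~= j" for i j
 proof -
  have i: "i : ?c i j" "j : ?d i j" by (rule split_cycle[OF ij], auto)+
  have "(SUM k:?d i j. SUM m:?c i j. f i j k m) = (SUM k:?d i j. f i j k i + (SUM m:?c i j - {i}. f i j k m))"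
   by (intro sum.cong refl sum.remove) (use i in auto)
  also have "... = f i j j i + (SUM m:?c i j - {i}. f i j j m) +
    (SUM k:?d i j - {j}. f i j k i + (SUM m:?c i j - {i}. f i j k m))"
   by (rule sum.remove) (use i in auto)
  finally show ?thesis by (simp add: sum.distrib add_ac)
 qed
 have tr': "(SUM i:set l. SUM j:set l - {i}. SUM m:?d i j - {j}. g i j m) = (\<Sum>(i, j, k)\<in>triples l. g j i k)"
  for g :: "'n => 'n => 'n => 'g"
  using sum_off_diagonal_swap[of "set l" "%i j. SUM m:?d i j - {j}. g i j m"] sum_triples[of "%i j m. g j i m"]
  by (simp add: cut_sym)
 define S where "S = (SIGMA i:set l. SIGMA j:set l - {i}. SIGMA k:?d i j - {j}. ?c i j - {i})"
 have S: "S = {(i, j, k, m). (i, k, j, m) : quads l}"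
 proof (intro equalityI subsetI)
  fix q assume q: "q : S"
  obtain i j k m where e: "q = (i, j, k, m)" by (cases q)
  have ij: "i : set l" "j : set l" "i ~= j" and km: "k : ?d i j - {j}" "m : ?c i j - {i}"
   using q by (auto simp: S_def e)
  obtain n A B where r: "rotate n l = i # A @ j # B" and c: "cyc_at (cut s i j) i = i # B"
   "cyc_at (cut s i j) j = j # A"
   by (rule split_cycle[OF ij])
  obtain A1 A2 B1 B2 where "A = A1 @ k # A2" "B = B1 @ m # B2"
   using km c by (auto dest!: split_list)
  then have "rotate n l = i # A1 @ k # A2 @ j # B1 @ m # B2" using r by simp
  then show "q : {(i, j, k, m). (i, k, j, m) : quads l}" unfolding e quads_def by blast
 next
  fix q assume q: "q : {(i, j, k, m). (i, k, j, m) : quads l}"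
  obtain i j k m where e: "q = (i, j, k, m)" by (cases q)
  have q: "(i, k, j, m) : quads l" using q e by simp
  note d = quads_mem[OF q]
  obtain n A B C E where r: "rotate n l = i # A @ k # B @ j # C @ m # E" by (rule quadsE[OF q])
  have "cycle s (i # (A @ k # B) @ j # C @ m # E)" using cycle_rotated[OF r] by simp
  note c = cycle_split[OF this]
  show "q : S" using d cycle_distinct cyc_at_eq[OF c(1)] cyc_at_eq[OF c(2)] by (auto simp: S_def e)
 qed
 have "(SUM i:set l. SUM j:set l - {i}. SUM k:?d i j - {j}. SUM m:?c i j - {i}. f i j k m) =
   (\<Sum>(i, j, k, m)\<in>S. f i j k m)"
  unfolding S_def by (simp add: sum.Sigma)
 also have "... = (\<Sum>(i, j, k, m)\<in>quads l. f i k j m)"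
  by (rule sum.reindex_bij_witness[of _ "%(i, j, k, m). (i, k, j, m)" "%(i, j, k, m). (i, k, j, m)"])
   (auto simp: S)
 finally have q: "(SUM i:set l. SUM j:set l - {i}. SUM k:?d i j - {j}. SUM m:?c i j - {i}. f i j k m) =
   (\<Sum>(i, j, k, m)\<in>quads l. f i k j m)" .
 have "(SUM i:set l. SUM j:set l - {i}. SUM k:?d i j. SUM m:?c i j. f i j k m) =
   (SUM i:set l. SUM j:set l - {i}. f i j j i + (SUM m:?c i j - {i}. f i j j m) + (SUM k:?d i j - {j}. f i j k i) +
   (SUM k:?d i j - {j}. SUM m:?c i j - {i}. f i j k m))"
  by (intro sum.cong refl) (auto simp: one)
 then show ?thesis by (simp add: sum.distrib q sum_triples tr' add_ac)
qed

end

text \<open>\<open>E j k i m\<close> stands for a surgery at \<open>j\<close>, \<open>k\<close>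
  followed by one at \<open>i\<close>, \<open>m\<close>. If \<open>m\<close> is \<open>j\<close> or
  \<open>k\<close>, the terms cancel in threes by the double Jacobi identity. Otherwise the
  surgeries use four distinct slots, and each term cancels against the one with the opposite order
  of surgeries in another of the three sums.\<close>

lemma jacobi_sums:
 fixes E :: "'n => 'n => 'n => 'n => 'g::ab_group_add"
 assumes fin: "finite A" "finite B" "finite C"
  and dj: "A Int B = {}" "A Int C = {}" "B Int C = {}"
  and comm: "!!i j k m. (i : A & j : B & k : C & m : B) | (i : C & j : A & k : B & m : A) |
   (i : B & j : C & k : A & m : C) ==> m ~= j ==> E j k i m = - E i m k j"
  and jac: "!!i j k. i : A ==> j : B ==> k : C ==> E j k i j + E k i j k + E i j k i = 0"
   "!!i j k. i : A ==> j : B ==> k : C ==> E j k i k + E i j k j + E k i j i = 0"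
 shows "(SUM j:B. SUM k:C. SUM i:A. SUM m:B Un C. E j k i m) + (SUM i:A. SUM j:B. SUM k:C. SUM m:A Un B. E i j k m) +
  (SUM k:C. SUM i:A. SUM j:B. SUM m:C Un A. E k i j m) = 0"
proof -
 define S where "S A B C = (SUM j:B. SUM k:C. SUM i:A. E j k i j + E j k i k)" for A B C
 define D where "D A B C = (SUM j:B. SUM k:C. SUM i:A. SUM m:B - {j}. E j k i m)" for A B C
 define D' where "D' A B C = (SUM j:B. SUM k:C. SUM i:A. SUM m:C - {k}. E j k i m)" for A B C
 have split: "(SUM j:B. SUM k:C. SUM i:A. SUM m:B Un C. E j k i m) = S A B C + D A B C + D' A B C"
  if "finite B" "finite C" "B Int C = {}" for A B C
 proof -
  have "(SUM m:B Un C. E j k i m) = E j k i j + E j k i k + (SUM m:B - {j}. E j k i m) + (SUM m:C - {k}. E j k i m)"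
   if "j : B" "k : C" for i j k
   using that \<open>finite B\<close> \<open>finite C\<close> \<open>B Int C = {}\<close>
   by (simp add: sum.union_disjoint sum.remove[of B j] sum.remove[of C k] add_ac)
  then show ?thesis by (simp add: S_def D_def D'_def sum.distrib add_ac)
 qed
 have DD: "D A B C + D' C A B = 0"
  if f: "finite A" "finite B" "finite C"
   and c: "!!i j k m. i : A ==> j : B ==> k : C ==> m : B ==> m ~= j ==> E j k i m = - E i m k j"
  for A B C
 proof -
  have "D A B C = (\<Sum>(j, k, i, m)\<in>(SIGMA j:B. SIGMA k:C. SIGMA i:A. B - {j}). E j k i m)"
   using f by (simp add: D_def sum.Sigma)
  also have "... = (\<Sum>(i, j, k, m)\<in>(SIGMA i:A. SIGMA j:B. SIGMA k:C. B - {j}). - E i j k m)"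
  proof (rule sum.reindex_bij_witness[of _ "%(i, j, k, m). (m, k, i, j)" "%(j, k, i, m). (i, m, k, j)"])
   fix q assume "q : (SIGMA j:B. SIGMA k:C. SIGMA i:A. B - {j})"
   then obtain i j k m where q: "q = (j, k, i, m)" "j : B" "k : C" "i : A" "m : B" "m ~= j" by auto
   have "E j k i m = - E i m k j" by (rule c) (use q in auto)
   then show "(case case q of (j, k, i, m) => (i, m, k, j) of (i, j, k, m) => - E i j k m) =
     (case q of (j, k, i, m) => E j k i m)"
    by (simp add: q)
  qed auto
  also have "... = - D' C A B" using f by (simp add: D'_def sum.Sigma sum_negf case_prod_unfold)
  finally show ?thesis by simp
 qed
 have 1: "D A B C + D' C A B = 0" "D C A B + D' B C A = 0" "D B C A + D' A B C = 0"
  by (rule DD; use fin comm in blast)+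
 have "S A B C + S C A B + S B C A =
   (SUM j:B. SUM k:C. SUM i:A. (E j k i j + E j k i k) + (E i j k i + E i j k j) + (E k i j k + E k i j i))"
 proof -
  have "S C A B = (SUM j:B. SUM k:C. SUM i:A. E i j k i + E i j k j)"
   unfolding S_def by (subst sum.swap, rule sum.cong[OF refl], rule sum.swap)
  moreover have "S B C A = (SUM j:B. SUM k:C. SUM i:A. E k i j k + E k i j i)"
   unfolding S_def by (subst (2) sum.swap, subst sum.swap, rule sum.cong[OF refl], rule refl)
  ultimately show ?thesis by (simp add: S_def sum.distrib add_ac)
 qed
 also have "... = 0"
 proof (intro sum.neutral ballI)
  fix i j k assume "j : B" "k : C" "i : A"
  then have "(E j k i j + E k i j k + E i j k i) + (E j k i k + E i j k j + E k i j i) = 0"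
   using jac by simp
  then show "(E j k i j + E j k i k) + (E i j k i + E i j k j) + (E k i j k + E k i j i) = 0"
   by (simp add: add_ac)
 qed
 finally have "S A B C + S C A B + S B C A = 0" .
 moreover have "(S A B C + D A B C + D' A B C) + (S C A B + D C A B + D' C A B) + (S B C A + D B C A + D' B C A) =
   (S A B C + S C A B + S B C A) + (D A B C + D' C A B) + (D C A B + D' B C A) + (D B C A + D' A B C)"
  by (simp only: add_ac)
 ultimately show ?thesis using fin dj by (simp add: split 1 Int_commute)
qed

context double_lie_data
begin

section \<open>Iterated surgery\<close>

abbreviation "orb s y i == word (map y (cyc_at s i))"

lemma Bop_cong_off:
 assumes "labelling x" "!!y. labelling y ==> (!!k. k ~= i ==> k ~= j ==> y k = x k) ==> F y = F' y"
 shows "Bop i j F x = Bop i j F' x"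
 unfolding Bop_def
proof (rule psum_cong)
 fix u v assume "(u, v) : set (dd (x i) (x j))"
 then have "labelling (x(i := u, j := v))" using assms(1) dd_mem(1,2)[OF labellingD labellingD] by simp
 then show "F (x(i := u, j := v)) = F' (x(i := u, j := v))" by (rule assms(2)) simp
qed

lemma Cop_cong_off:
 assumes "labelling x" "!!g y. g : carrier L ==> labelling y ==> (!!k. k ~= i ==> y k = x k) ==> F g y = F' g y"
 shows "Cop i F x = Cop i F' x"
 unfolding Cop_def
proof (rule psum_cong)
 fix g u assume "(g, u) : set (co (x i))"
 note m = co_mem[OF labellingD[OF assms(1)] this]
 show "F g (x(i := u)) = F' g (x(i := u))" by (rule assms(2)) (use m assms(1) in auto)
qed

text \<open>The derivation property mixes the actions at \<open>i\<close> and \<open>j\<close>,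
  whereas actions at other slots commute with the bracket. So the sum over all slots commutes with
  it.\<close>

lemma Bop_Aop_all:
 assumes F: "slin N F" and N: "finite N" "i : N" "j : N" "i ~= j" and x: "labelling x" and a: "g : carrier L"
 shows "(SUM k:N. Bop i j F (Aop g k x)) = Bop i j (%y. SUM k:N. F (Aop g k y)) x"
proof -
 have F': "slin {i, j} F" by (rule slin_mono[OF F]) (use N in auto)
 have s: "(SUM k:N. f k) = f i + f j + (SUM k:N - {i} - {j}. f k)" for f :: "nat => 'k => ratz"
  using N by (simp add: sum.remove[of N i] sum.remove[of "N - {i}" j] add_ac)
 show ?thesis
  unfolding s using Bop_Aop[OF F' x N(4) a] by (simp add: Bop_add Bop_sum Bop_Aop_other)
qed

lemma Bop_Cop_all:
 assumes F: "slinL N F" and N: "finite N" "i : N" "j : N" "i ~= j" and x: "labelling x"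
 shows "Bop i j (%y. SUM k:N. Cop k F y) x = (SUM k:N. Cop k (%g. Bop i j (F g)) x)"
proof -
 have F': "slinL {i, j} F" using F N by (auto simp: slinL_def intro: slin_mono)
 have s: "(SUM k:N. f k) = f i + f j + (SUM k:N - {i} - {j}. f k)" for f :: "nat => 'k => ratz"
  using N by (simp add: sum.remove[of N i] sum.remove[of "N - {i}" j] add_ac)
 show ?thesis
  unfolding s using Bop_Cop[OF F' x N(4)] by (simp add: Bop_add Bop_sum Bop_Cop_other)
qed

text \<open>Two successive surgeries, on labels and on the permutation together: first at
  \<open>i\<close>, \<open>j\<close>, then at \<open>k\<close>, \<open>m\<close>.\<close>

definition BB :: "((nat => nat) => (nat => ('i, 'p) letter) => 'k => ratz) => (nat => nat) =>
  nat => nat => nat => nat => (nat => ('i, 'p) letter) => 'k => ratz" where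
 "BB F s i j k m = Bop i j (Bop k m (F (cut (cut s i j) k m)))"

lemma BB_cong:
 assumes "labelling x" "!!y. labelling y ==> F (cut (cut s i j) k m) y = F' (cut (cut s i j) k m) y"
 shows "BB F s i j k m x = BB F' s i j k m x"
 unfolding BB_def by (intro Bop_cong assms)

lemma BB_swap:
 assumes x: "labelling x" and F: "slin N (F (cut (cut s i j) k m))"
  and N: "{i, j, k, m} <= N" "i ~= j" "k ~= m"
 shows "BB F s j i k m x = - BB F s i j k m x" "BB F s i j m k x = - BB F s i j k m x"
proof -
 have "slin N (Bop k m (F (cut (cut s i j) k m)))" by (rule slin_Bop[OF F]) (use N in auto)
 then have "slin {i, j} (Bop k m (F (cut (cut s i j) k m)))" by (rule slin_mono) (use N in auto)
 from Bop_antisym[OF this x N(2)] show "BB F s j i k m x = - BB F s i j k m x"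
  by (simp add: BB_def cut_sym[of s j i])
 have "slin {k, m} (F (cut (cut s i j) k m))" by (rule slin_mono[OF F]) (use N in auto)
 note a = Bop_antisym[OF this _ N(3)]
 have "BB F s i j m k x = Bop i j (%y. - Bop k m (F (cut (cut s i j) k m)) y) x"
  unfolding BB_def cut_sym[of _ m k] by (intro Bop_cong[OF x] a)
 then show "BB F s i j m k x = - BB F s i j k m x" by (simp add: BB_def Bop_minus)
qed

lemma BB_commute:
 assumes "distinct [i, j, k, m]"
 shows "BB F s i j k m = BB F s k m i j"
 unfolding BB_def cut_commute[OF assms] by (intro ext Bop_commute[OF assms])

text \<open>By \<open>cut_three\<close> the three final permutations coincide, so one and the same
  function of the labelling occurs in all terms.\<close>

lemma BB_jacobi:
 assumes x: "labelling x" and F: "slin N (F (cut (cut s j k) i j))"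
  and N: "{i, j, k} <= N" "distinct [i, j, k]"
 shows "BB F s j k i j x + BB F s k i j k x + BB F s i j k i x = 0"
 unfolding BB_def cut_three[OF N(2)]
 by (rule Bop_jacobi[OF slin_mono[OF F N(1)] x N(2)])

text \<open>The mirror image, where the second surgery uses the other slot of the first one. It is
  \<open>BB_jacobi\<close> with \<open>j\<close> and \<open>k\<close> exchanged, after restoring the
  order of the first two slots in each term at the cost of one sign.\<close>

lemma BB_jacobi':
 assumes x: "labelling x" and F: "slin N (F (cut (cut s j k) i k))"
  and N: "{i, j, k} <= N" "distinct [i, j, k]"
 shows "BB F s j k i k x + BB F s k i j i x + BB F s i j k j x = 0"
proof -
 have d: "distinct [i, k, j]" using N by auto
 have eq: "cut (cut s k i) j i = cut (cut s j k) i k" "cut (cut s i j) k j = cut (cut s j k) i k"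
  using cut_three[OF d, of s]
  unfolding cut_sym[of s i k] cut_sym[of s k j] cut_sym[of s j i] by blast+
 have F2: "slin N (F (cut (cut s k i) j i))" "slin N (F (cut (cut s i j) k j))"
  unfolding eq using F by simp_all
 have F': "slin N (F (cut (cut s k j) i k))" using F by (simp add: cut_sym[of s k j])
 have "BB F s k j i k x = - BB F s j k i k x" by (rule BB_swap(1)[where F = F, OF x F]) (use N in auto)
 moreover have "BB F s i k j i x = - BB F s k i j i x" by (rule BB_swap(1)[where F = F, OF x F2(1)]) (use N in auto)
 moreover have "BB F s j i k j x = - BB F s i j k j x" by (rule BB_swap(1)[where F = F, OF x F2(2)]) (use N in auto)
 moreover have "BB F s k j i k x + BB F s j i k j x + BB F s i k j i x = 0"
  by (rule BB_jacobi[where F = F, OF x F']) (use N in auto)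
 ultimately have "- (BB F s j k i k x + BB F s k i j i x + BB F s i j k j x) = 0" by (simp add: algebra_simps)
 then show ?thesis using neg_equal_0_iff_equal by blast
qed

lemma W_zeroI:
 assumes f: "character R W f" and l: "!!g. g : carrier L ==> f (lie g) = 0"
  and w: "!!w. w : words I P ==> f (word w) = 0" and p: "p : carrier W"
 shows "f p = 0"
 by (rule spans_eqI[OF W_mod dual_module[OF R] W_spans f character_lin_zero[OF R] _ p]) (use l w in auto)

lemma W_bilin_zeroI:
 assumes K: "bilin R W W G K"
  and ll: "!!g d. g : carrier L ==> d : carrier L ==> K (lie g) (lie d) = 0"
  and lw: "!!g x s l. g : carrier L ==> labelling x ==> cycle s l ==> K (lie g) (word (map x l)) = 0"
  and wl: "!!g x s l. g : carrier L ==> labelling x ==> cycle s l ==> K (word (map x l)) (lie g) = 0"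
  and ww: "!!x s l l'. labelling x ==> cycle s l ==> cycle s l' ==> set l Int set l' = {} ==>
   K (word (map x l)) (word (map x l')) = 0"
  and pq: "p : carrier W" "q : carrier W"
 shows "K p q = 0"
proof (rule W_zeroI[OF bilinL[OF K pq(2)] _ _ pq(1)])
 fix g assume a: "g : carrier L"
 show "K (lie g) q = 0"
  by (rule W_zeroI[OF bilinR[OF K W_closed(1)[OF a]] ll[OF a] _ pq(2)], assumption, erule word_exists_slots)
   (simp add: lw[OF a] zero_fun_def)
next
 fix w assume w: "w : words I P"
 note wc = words_letters[OF w]
 show "K (word w) q = 0"
 proof (rule W_zeroI[OF bilinR[OF K W_closed(2)[OF wc(1)]] _ _ pq(2)])
  show "K (word w) (lie g) = 0" if "g : carrier L" for g
   by (rule word_exists_slots[OF w]) (simp add: wl[OF that])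
  show "K (word w) (word w') = 0" if "w' : words I P" for w'
   by (rule exists_slots2[OF wc words_letters[OF that]]) (simp add: ww)
 qed
qed

text \<open>Each argument may be an element of \<open>L\<close> or a word, which makes eight
  combinations; cyclic symmetry of \<open>H\<close> leaves four of them.\<close>

lemma W_trilin_zeroI:
 assumes H: "trilin R W W W G H" and cyc: "!!a b c. H a b c = H b c a"
  and lll: "!!d t z. d : carrier L ==> t : carrier L ==> z : carrier L ==> H (lie d) (lie t) (lie z) = 0"
  and llw: "!!d t x s l. d : carrier L ==> t : carrier L ==> labelling x ==> cycle s l ==>
   H (lie d) (lie t) (word (map x l)) = 0"
  and lww: "!!d x s l l'. d : carrier L ==> labelling x ==> cycle s l ==> cycle s l' ==>
   set l Int set l' = {} ==> H (lie d) (word (map x l)) (word (map x l')) = 0"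
  and www: "!!x s l l' l''. labelling x ==> cycle s l ==> cycle s l' ==> cycle s l'' ==>
   set l Int set l' = {} ==> set l Int set l'' = {} ==> set l' Int set l'' = {} ==>
   H (word (map x l)) (word (map x l')) (word (map x l'')) = 0"
  and pqr: "p : carrier W" "q : carrier W" "r : carrier W"
 shows "H p q r = 0"
proof -
 have H1: "bilin R W W G (H a)" if "a : carrier W" for a using H that by (simp add: trilin_def)
 have H2: "character R W (%a. H a b c)" if "b : carrier W" "c : carrier W" for b c
  using H that by (simp add: trilin_def)
 let ?L = "(%d. lie d) ` carrier L" and ?C = "(%w. word w) ` words I P"
 have LLL: "H a b c = 0" if "a : ?L" "b : ?L" "c : ?L" for a b c
  using that lll by auto
 have LLC: "H a b c = 0" if "a : ?L" "b : ?L" "c : ?C" for a b c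
  using that llw by (auto elim!: word_exists_slots)
 have LCC: "H a b c = 0" if abc: "a : ?L" "b : ?C" "c : ?C" for a b c
 proof -
  obtain d w w' where a: "a = lie d" "d : carrier L" and w: "b = word w" "w : words I P"
   and w': "c = word w'" "w' : words I P" using abc by blast
  obtain x s l l' where "labelling x" "cycle s l" "cycle s l'" "set l Int set l' = {}" "w = map x l" "w' = map x l'"
   by (rule exists_slots2[OF words_letters[OF w(2)] words_letters[OF w'(2)]])
  then show ?thesis using lww[OF a(2)] a w w' by simp
 qed
 have CCC: "H a b c = 0" if abc: "a : ?C" "b : ?C" "c : ?C" for a b c
 proof -
  obtain w w' w'' where w: "a = word w" "w : words I P" and w': "b = word w'" "w' : words I P"
   and w'': "c = word w''" "w'' : words I P" using abc by blast
  obtain x s l l' l'' where "labelling x" "cycle s l" "cycle s l'" "cycle s l''" "set l Int set l' = {}"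
   "set l Int set l'' = {}" "set l' Int set l'' = {}" "w = map x l" "w' = map x l'" "w'' = map x l''"
   by (rule exists_slots3[OF words_letters[OF w(2)] words_letters[OF w'(2)] words_letters[OF w''(2)]])
  then show ?thesis using www w w' w'' by simp
 qed
 let ?g = "?L Un ?C"
 have g: "H a b c = 0" if "a : ?g" "b : ?g" "c : ?g" for a b c
 proof -
  have "(a : ?L | a : ?C) & (b : ?L | b : ?C) & (c : ?L | c : ?C)" using that by (simp only: Un_iff)
  then show ?thesis
   by (elim conjE disjE) (use LLL LLC LCC CCC cyc[of a b c] cyc[of b c a] cyc[of c a b] in metis)+
 qed
 have gc: "?g <= carrier W" using W_closed words_letters by (intro Un_least image_subsetI) auto
 have z: "f p = 0" if "character R W f" "!!a. a : ?g ==> f a = 0" "p : carrier W" for f p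
  by (rule W_zeroI[OF that(1)]) (use that in auto)
 have "H a b r = 0" if "a : ?g" "b : ?g" for a b
  by (rule z[OF bilinR[OF H1] g pqr(3)]) (use that gc in auto)
 then have "H a q r = 0" if "a : ?g" for a
  by (intro z[OF bilinL[OF H1 pqr(3)] _ pqr(2)]) (use that gc in auto)
 then show ?thesis by (intro z[OF H2[OF pqr(2,3)] _ pqr(1)])
qed

lemma orb_eq:
 assumes y: "labelling y" and s: "permutes_on s N" "i : N" "k : cset s i"
 shows "orb s y k = orb s y i"
 by (rule cyc_at_rotation[OF word_rotate y s])

section \<open>The Lie algebra structure\<close>

context
 fixes \<psi> assumes \<psi>: "character R W \<psi>"
begin

lemma Wbr_character: "q : carrier W ==> character R W (%p. \<psi> (Wbr q p))" "q : carrier W ==> character R W (%p. \<psi> (Wbr p q))"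
 by (rule lin_comp[OF bilinR[OF Wbr_bilin] \<psi>], assumption, rule lin_comp[OF bilinL[OF Wbr_bilin] \<psi>])

lemma orb_slin:
 assumes "permutes_on s N" "i : N" "cset s i = N"
 shows "slin N (%y. \<psi> (orb s y i))"
 using slin_cyc_at[OF wlin_comp[OF word_wlin \<psi>] assms(1,2)] assms(3) by simp

lemma character_antisym:
 assumes pq: "p : carrier W" "q : carrier W"
 shows "\<psi> (Wbr q p) + \<psi> (Wbr p q) = 0"
proof (rule W_bilin_zeroI[where K = "%p q. \<psi> (Wbr q p) + \<psi> (Wbr p q)", OF _ _ _ _ _ pq])
 show "bilin R W W G (%p q. \<psi> (Wbr q p) + \<psi> (Wbr p q))"
  by (rule bilinI; rule character_lin_plus[OF R]; rule Wbr_character)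
 fix g d assume "g : carrier L" "d : carrier L"
 then show "\<psi> (Wbr (lie d) (lie g)) + \<psi> (Wbr (lie g) (lie d)) = 0"
  using br_antisym[of g d] character_minus[OF LM lin_comp[OF lie_lin \<psi>]] bilinC[OF br_bilin]
  by (simp add: Wbr_lie_lie)
next
 fix g x and s :: "nat => nat" and l assume a: "g : carrier L" "labelling x" and s: "cycle s l"
 note c = character_lie_word[OF \<psi> a cycle_distinct[OF s]]
 show "\<psi> (Wbr (word (map x l)) (lie g)) + \<psi> (Wbr (lie g) (word (map x l))) = 0"
  "\<psi> (Wbr (lie g) (word (map x l))) + \<psi> (Wbr (word (map x l)) (lie g)) = 0" by (simp_all add: c)
next
 fix x and s :: "nat => nat" and l l'
 assume x: "labelling x" and s: "cycle s l" "cycle s l'" "set l Int set l' = {}"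
 have s': "set l' Int set l = {}" using s by blast
 have "\<psi> (Wbr (word (map x l')) (word (map x l))) =
   (SUM i:set l. SUM j:set l'. Bop j i (%y. \<psi> (orb (cut s j i) y j)) x)"
  unfolding character_word_word[OF \<psi> x s(2,1) s'] by (rule sum.swap)
 also have "... = (SUM i:set l. SUM j:set l'. - Bop i j (%y. \<psi> (orb (cut s i j) y i)) x)"
 proof (intro sum.cong refl)
  fix i j assume ij: "i : set l" "j : set l'"
  note c = cset_cut_two[OF s ij]
  have N: "i : set l Un set l'" "{i, j} <= set l Un set l'" "j : cset (cut s i j) i" using ij c(1) by auto
  have "Bop j i (%y. \<psi> (orb (cut s j i) y j)) x = Bop j i (%y. \<psi> (orb (cut s i j) y i)) x"
   unfolding cut_sym[of s j i] by (intro Bop_cong[OF x]) (simp only: orb_eq[OF _ c(3) N(1,3)])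
  also have "... = - Bop i j (%y. \<psi> (orb (cut s i j) y i)) x"
   by (rule Bop_antisym[OF slin_mono[OF orb_slin[OF c(3) N(1) c(1)] N(2)] x c(4)])
  finally show "Bop j i (%y. \<psi> (orb (cut s j i) y j)) x = - Bop i j (%y. \<psi> (orb (cut s i j) y i)) x" .
 qed
 finally show "\<psi> (Wbr (word (map x l')) (word (map x l))) + \<psi> (Wbr (word (map x l)) (word (map x l'))) = 0"
  unfolding character_word_word[OF \<psi> x s] by (simp add: sum_negf)
qed

text \<open>The final cycle runs through all slots of the three words, so it may be read from any
  base slot \<open>b\<close>. With one base slot for all terms, the rules for \<open>BB\<close>
  apply to a single function.\<close>

lemma character_two:
 assumes x: "labelling x" and s: "cycle s l" "cycle s l'" "cycle s l''"
  and d: "set l Int set l' = {}" "set l Int set l'' = {}" "set l' Int set l'' = {}"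
  and b: "b : set l Un set l' Un set l''"
 shows "\<psi> (Wbr (word (map x l)) (Wbr (word (map x l')) (word (map x l'')))) =
  (SUM j:set l'. SUM k:set l''. SUM i:set l. SUM m:set l' Un set l''. BB (%s y. \<psi> (orb s y b)) s j k i m x)"
  "j : set l' ==> k : set l'' ==> i : set l ==> m : set l' Un set l'' ==>
   slin (set l Un set l' Un set l'') (%y. \<psi> (orb (cut (cut s j k) i m) y b))"
proof -
 let ?N = "set l Un set l' Un set l''"
 have fin: "permutes_on (cut (cut s j k) i m) ?N & cset (cut (cut s j k) i m) i = ?N"
  "cycle (cut s j k) l" "cycle (cut s j k) (cyc_at (cut s j k) j)" "set l Int cset (cut s j k) j = {}"
  "cset (cut s j k) j = set l' Un set l''"
  if jk: "j : set l'" "k : set l''" and i: "i : set l" and m: "m : set l' Un set l''" for i j k m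
 proof -
  note c = cset_cut_two[OF s(2,3) d(3) jk]
  show 1: "cycle (cut s j k) l" by (rule cycle_cut_other[OF s(1)]) (use jk d in auto)
  show 2: "cycle (cut s j k) (cyc_at (cut s j k) j)" by (rule cycle_cyc_at(1)[OF c(3)]) (use jk in auto)
  show 3: "set l Int cset (cut s j k) j = {}" using c(1) d by auto
  show "cset (cut s j k) j = set l' Un set l''" by (rule c(1))
  have "m : cset (cut s j k) j" using c(1) m by simp
  from cset_cut_two[OF 1 2 3 i this] c(1)
  show "permutes_on (cut (cut s j k) i m) ?N & cset (cut (cut s j k) i m) i = ?N"
   by (simp add: Un_assoc)
 qed
 have N: "i : ?N" if "i : set l" for i using that by simp
 have eq: "orb (cut (cut s j k) i m) y i = orb (cut (cut s j k) i m) y b"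
  if "labelling y" "j : set l'" "k : set l''" "i : set l" "m : set l' Un set l''" for i j k m y
  using orb_eq[OF that(1) _ N[OF that(4)], of "cut (cut s j k) i m" b] fin(1)[OF that(2-5)] b by simp
 show "slin ?N (%y. \<psi> (orb (cut (cut s j k) i m) y b))"
  if jk: "j : set l'" "k : set l''" "i : set l" "m : set l' Un set l''"
 proof -
  have p: "permutes_on (cut (cut s j k) i m) ?N" "cset (cut (cut s j k) i m) i = ?N"
   using fin(1)[OF jk] by auto
  have "cset (cut (cut s j k) i m) b = ?N"
   using cyc_at_member(2)[OF p(1) N[OF jk(3)], of b] p(2) b by simp
  then show ?thesis by (rule orb_slin[OF p(1) b])
 qed
 have wc: "word (map x l) : carrier W" by (rule W_closed(2)[OF labelling_map[OF x]])
 have "\<psi> (Wbr (word (map x l)) (Wbr (word (map x l')) (word (map x l'')))) =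
   (SUM j:set l'. SUM k:set l''. Bop j k (%y. \<psi> (Wbr (word (map x l)) (orb (cut s j k) y j))) x)"
  by (rule character_word_word[OF Wbr_character(1)[OF wc] x s(2,3) d(3)])
 also have "... = (SUM j:set l'. SUM k:set l''. Bop j k (%y. SUM i:set l. SUM m:set l' Un set l''.
   Bop i m (%y. \<psi> (orb (cut (cut s j k) i m) y b)) y) x)"
 proof (intro sum.cong refl Bop_cong_off[OF x])
  fix j k y assume jk: "j : set l'" "k : set l''" and y: "labelling y" "!!i. i ~= j ==> i ~= k ==> y i = x i"
  have l: "map x l = map y l" using jk d by (intro map_cong refl y(2)[symmetric]) auto
  \<comment> \<open>Any slots serve; the facts extracted from \<open>fin\<close> do not mention
    them.\<close>
  obtain i m where im: "i : set l" "m : set l' Un set l''" using s hd_in_set unfolding cycle_def by (meson UnI1)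
  note f = fin(2-)[OF jk im]
  have "\<psi> (Wbr (word (map x l)) (orb (cut s j k) y j)) = (SUM i:set l. SUM m:set l' Un set l''.
    Bop i m (%y. \<psi> (orb (cut (cut s j k) i m) y i)) y)"
   unfolding l character_word_word[OF \<psi> y(1) f(1-3)] f(4) ..
  also have "... = (SUM i:set l. SUM m:set l' Un set l''. Bop i m (%y. \<psi> (orb (cut (cut s j k) i m) y b)) y)"
   by (intro sum.cong refl Bop_cong[OF y(1)]) (simp only: eq jk)
  finally show "\<psi> (Wbr (word (map x l)) (orb (cut s j k) y j)) = (SUM i:set l. SUM m:set l' Un set l''.
    Bop i m (%y. \<psi> (orb (cut (cut s j k) i m) y b)) y)" .
 qed
 finally show "\<psi> (Wbr (word (map x l)) (Wbr (word (map x l')) (word (map x l'')))) =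
  (SUM j:set l'. SUM k:set l''. SUM i:set l. SUM m:set l' Un set l''. BB (%s y. \<psi> (orb s y b)) s j k i m x)"
  by (simp add: BB_def Bop_sum)
qed

lemma character_jacobi_words:
 assumes x: "labelling x" and s: "cycle s l" "cycle s l'" "cycle s l''"
  and d: "set l Int set l' = {}" "set l Int set l'' = {}" "set l' Int set l'' = {}"
 shows "\<psi> (Wbr (word (map x l)) (Wbr (word (map x l')) (word (map x l'')))) +
  \<psi> (Wbr (word (map x l'')) (Wbr (word (map x l)) (word (map x l')))) +
  \<psi> (Wbr (word (map x l')) (Wbr (word (map x l'')) (word (map x l)))) = 0"
proof -
 let ?N = "set l Un set l' Un set l''"
 obtain b where b: "b : set l" using s(1) hd_in_set unfolding cycle_def by blast
 let ?F = "%s y. \<psi> (orb s y b)"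
 note e1 = character_two[OF x s d, of b] and e2 = character_two[OF x s(3,1,2) _ _ d(1), of b]
  and e3 = character_two[OF x s(2,3,1) d(3) _ _, of b]
 have d': "set l'' Int set l = {}" "set l'' Int set l' = {}" "set l' Int set l = {}" using d by auto
 let ?E = "%i j k m. BB ?F s i j k m x"
 have N: "set l'' Un set l Un set l' = ?N" "set l' Un set l'' Un set l = ?N" by auto
 note sl = e1(2) e2(2)[OF d'(1,2), unfolded N] e3(2)[OF d'(3,1), unfolded N]
 have comm: "?E j k i m = - ?E i m k j"
  if d: "distinct [j, k, i, m]" "{i, j, k, m} <= ?N" and sl: "slin ?N (?F (cut (cut s j k) i m))" for i j k m
 proof -
  have "slin ?N (?F (cut (cut s i m) j k))" using sl cut_commute[OF d(1)] by simp
  from BB_swap(2)[where F = ?F, OF x this] d have "?E i m k j = - ?E i m j k" by auto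
  moreover have "?E j k i m = ?E i m j k" using BB_commute[OF d(1), of ?F s] by simp
  ultimately show ?thesis by simp
 qed
 have b': "b : set l Un set l' Un set l''" "b : set l'' Un set l Un set l'" "b : set l' Un set l'' Un set l" using b by auto
 show ?thesis
  unfolding e1(1)[OF b'(1)] e2(1)[OF d'(1,2) b'(2)] e3(1)[OF d'(3,1) b'(3)]
 proof (rule jacobi_sums[where E = ?E, OF _ _ _ d])
  fix i j k m
  assume "(i : set l & j : set l' & k : set l'' & m : set l') | (i : set l'' & j : set l & k : set l' & m : set l) |
   (i : set l' & j : set l'' & k : set l & m : set l'')" and mj: "m ~= j"
  then have "slin ?N (?F (cut (cut s j k) i m)) & distinct [j, k, i, m] & {i, j, k, m} <= ?N"
   using sl[OF b'(1), of j k i m] sl(2)[OF b'(1), of j k i m] sl(3)[OF b'(1), of j k i m] d by auto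
  then show "?E j k i m = - ?E i m k j" using comm by blast
 next
  fix i j k assume ijk: "i : set l" "j : set l'" "k : set l''"
  then have *: "{i, j, k} <= ?N" "distinct [i, j, k]" using d by auto
  show "?E j k i j + ?E k i j k + ?E i j k i = 0"
   by (rule BB_jacobi[where F = ?F, OF x sl(1)[OF b'(1) ijk(2,3,1)] *]) (use ijk in simp)
  have "?E j k i k + ?E k i j i + ?E i j k j = 0"
   by (rule BB_jacobi'[where F = ?F, OF x sl(1)[OF b'(1) ijk(2,3,1)] *]) (use ijk in simp)
  then show "?E j k i k + ?E i j k j + ?E k i j i = 0" by (simp add: add_ac)
 qed simp_all
qed

lemma lie_wlin:
 assumes "labelling x" "distinct l"
 shows "slin (set l) (%y. \<psi> (word (map y l)))"
 by (rule slin_word[OF wlin_comp[OF word_wlin \<psi>] assms(2)])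

text \<open>The Jacobi expression is invariant under rotation of its arguments, so only the number
  of arguments from \<open>L\<close> matters. With none of them, the identity is
  \<open>character_jacobi_words\<close>.\<close>

lemma character_jacobi:
 assumes pqr: "p : carrier W" "q : carrier W" "r : carrier W"
 shows "\<psi> (Wbr p (Wbr q r)) + \<psi> (Wbr r (Wbr p q)) + \<psi> (Wbr q (Wbr r p)) = 0"
proof (rule W_trilin_zeroI[where H = "%p q r. \<psi> (Wbr p (Wbr q r)) + \<psi> (Wbr r (Wbr p q)) + \<psi> (Wbr q (Wbr r p))",
  OF _ _ _ _ _ _ pqr])
 note B = bilinC[OF Wbr_bilin]
 have 1: "character R W (%r. \<psi> (Wbr p (Wbr q r)) + \<psi> (Wbr r (Wbr p q)) + \<psi> (Wbr q (Wbr r p)))"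
  if "p : carrier W" "q : carrier W" for p q
  by (intro character_lin_plus[OF R]; (rule Wbr_character(2), use that B in blast)?)
   ((rule lin_comp[OF bilinR[OF Wbr_bilin] Wbr_character(1)] lin_comp[OF bilinL[OF Wbr_bilin] Wbr_character(1)],
    use that in blast, use that in blast))+
 show "trilin R W W W G (%p q r. \<psi> (Wbr p (Wbr q r)) + \<psi> (Wbr r (Wbr p q)) + \<psi> (Wbr q (Wbr r p)))"
  unfolding trilin_def bilin_def
 proof (intro conjI ballI)
  show "character R W (%q. \<psi> (Wbr p (Wbr q r)) + \<psi> (Wbr r (Wbr p q)) + \<psi> (Wbr q (Wbr r p)))"
   if "p : carrier W" "r : carrier W" for p r using 1[OF that(2,1)] by (simp add: add_ac)
  show "character R W (%p. \<psi> (Wbr p (Wbr q r)) + \<psi> (Wbr r (Wbr p q)) + \<psi> (Wbr q (Wbr r p)))"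
   if "q : carrier W" "r : carrier W" for q r using 1[OF that] by (simp add: add_ac)
 qed (rule 1)
 show "\<psi> (Wbr a (Wbr b c)) + \<psi> (Wbr c (Wbr a b)) + \<psi> (Wbr b (Wbr c a)) =
   \<psi> (Wbr b (Wbr c a)) + \<psi> (Wbr a (Wbr b c)) + \<psi> (Wbr c (Wbr a b))" for a b c by (simp add: add_ac)
next
 interpret L: module R L by (rule LM)
 fix g d t assume a: "g : carrier L" "d : carrier L" "t : carrier L"
 have "\<psi> (lie (br g (br d t) +[L] br t (br g d) +[L] br d (br t g))) = 0"
  unfolding br_jacobi[OF a] by (rule character_zero[OF LM lin_comp[OF lie_lin \<psi>]])
 then show "\<psi> (Wbr (lie g) (Wbr (lie d) (lie t))) + \<psi> (Wbr (lie t) (Wbr (lie g) (lie d))) +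
   \<psi> (Wbr (lie d) (Wbr (lie t) (lie g))) = 0"
  using a character_add[OF LM lin_comp[OF lie_lin \<psi>]] bilinC[OF br_bilin] by (simp add: Wbr_lie_lie)
next
 fix g d x and s :: "nat => nat" and l
 assume a: "g : carrier L" "d : carrier L" and x: "labelling x" and s: "cycle s l"
 note d = cycle_distinct[OF s] and c = W_closed(1)[OF a(1)] W_closed(1)[OF a(2)]
 let ?w = "word (map x l)" and ?F = "%y. \<psi> (word (map y l))"
 note F = lie_wlin[OF x d]
 have 1: "\<psi> (Wbr (lie g) (Wbr (lie d) ?w)) = (SUM i:set l. SUM k:set l. ?F (Aop g k (Aop d i x)))"
  if a: "g : carrier L" "d : carrier L" for g d
  using character_lie_word(1)[OF Wbr_character(1)[OF W_closed(1)[OF a(1)]] a(2) x d]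
   character_lie_word(1)[OF \<psi> a(1) _ d] x a by simp
 have 2: "\<psi> (Wbr (lie d) (Wbr ?w (lie g))) = - \<psi> (Wbr (lie d) (Wbr (lie g) ?w))"
  using character_lie_word[OF Wbr_character(1)[OF c(2)] a(1) x d] by simp
 have 3: "\<psi> (Wbr ?w (Wbr (lie g) (lie d))) = - (SUM i:set l. ?F (Aop (br g d) i x))"
  using character_lie_word(2)[OF \<psi> bilinC[OF br_bilin a] x d] by (simp add: Wbr_lie_lie[OF a])
 have br: "?F (Aop (br g d) i x) = ?F (Aop g i (Aop d i x)) - ?F (Aop d i (Aop g i x))" if "i : set l" for i
  using ac_br[OF slot_linD[OF F x that] a labellingD[OF x, of i]] by (simp add: Aop_def)
 have "(SUM i:set l. SUM k:set l. ?F (Aop g k (Aop d i x))) - (SUM i:set l. SUM k:set l. ?F (Aop d k (Aop g i x))) =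
   (SUM i:set l. ?F (Aop (br g d) i x))"
 proof -
  have "(SUM i:set l. SUM k:set l. ?F (Aop d k (Aop g i x))) = (SUM i:set l. SUM k:set l. ?F (Aop d i (Aop g k x)))"
   by (rule sum.swap)
  \<comment> \<open>Actions at different slots commute; only the diagonal contributes, and there the
    module axiom gives the action of \<open>br g d\<close>.\<close>
  moreover have "(SUM k:set l. ?F (Aop g k (Aop d i x))) - (SUM k:set l. ?F (Aop d i (Aop g k x))) = ?F (Aop (br g d) i x)"
   if i: "i : set l" for i
  proof -
   have "Aop g k (Aop d i x) = Aop d i (Aop g k x)" if "k ~= i" for k
    using that by (auto simp: Aop_def)
   then have "(SUM k:set l. ?F (Aop g k (Aop d i x)) - ?F (Aop d i (Aop g k x))) =
     (SUM k:set l. if k = i then ?F (Aop (br g d) i x) else 0)"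
    by (intro sum.cong refl) (simp add: br[OF i])
   then show ?thesis using i by (simp add: sum_subtractf[symmetric])
  qed
  ultimately show ?thesis by (simp add: sum_subtractf[symmetric])
 qed
 then show "\<psi> (Wbr (lie g) (Wbr (lie d) ?w)) + \<psi> (Wbr ?w (Wbr (lie g) (lie d))) +
   \<psi> (Wbr (lie d) (Wbr ?w (lie g))) = 0"
  unfolding 2 3 1[OF a] 1[OF a(2,1)] by (simp add: algebra_simps)
next
 fix g x and s :: "nat => nat" and l l'
 assume a: "g : carrier L" and x: "labelling x" and s: "cycle s l" "cycle s l'" "set l Int set l' = {}"
 note d = cycle_distinct[OF s(1)] cycle_distinct[OF s(2)] and c = W_closed(1)[OF a] W_closed(2)[OF labelling_map[OF x]]
 let ?w = "word (map x l)" and ?w' = "word (map x l')" and ?N = "set l Un set l'"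
 let ?F = "%i j y. \<psi> (orb (cut s i j) y i)"
 have 1: "\<psi> (Wbr (lie g) (Wbr ?w ?w')) = (SUM i:set l. SUM j:set l'. SUM k:?N. Bop i j (?F i j) (Aop g k x))"
  unfolding character_word_word[OF Wbr_character(1)[OF c(1)] x s]
 proof (intro sum.cong refl)
  fix i j assume ij: "i : set l" "j : set l'"
  note r = cset_cut_two[OF s ij]
  have N: "i : ?N" "j : ?N" using ij by auto
  have "Bop i j (%y. \<psi> (Wbr (lie g) (orb (cut s i j) y i))) x = Bop i j (%y. SUM k:?N. ?F i j (Aop g k y)) x"
   using character_lie_word(1)[OF \<psi> a _ cycle_cyc_at(4)[OF r(3) N(1)]] r(1) by (intro Bop_cong[OF x]) simp
  also have "... = (SUM k:?N. Bop i j (?F i j) (Aop g k x))"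
   by (rule Bop_Aop_all[symmetric, OF orb_slin[OF r(3) N(1) r(1)] _ N r(4) x a]) simp
  finally show "Bop i j (%y. \<psi> (Wbr (lie g) (orb (cut s i j) y i))) x = (SUM k:?N. Bop i j (?F i j) (Aop g k x))" .
 qed
 have off: "map (Aop g k x) l = map x l" if "k ~: set l" for k l using that by (auto simp: Aop_def)
 \<comment> \<open>Antisymmetry brings the two words into a fixed order. All three terms then become
   brackets of the words of one labelling, acted on in a slot of \<open>l\<close>, of
   \<open>l'\<close>, or of either.\<close>
 have anti: "\<psi> (Wbr ?w' (Wbr (lie g) ?w)) = - (SUM k:set l. \<psi> (Wbr (word (map (Aop g k x) l)) (word (map (Aop g k x) l'))))"
 proof -
  have "\<psi> (Wbr ?w' (word (map (Aop g k x) l))) = - \<psi> (Wbr (word (map (Aop g k x) l)) (word (map (Aop g k x) l')))"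
   if k: "k : set l" for k
  proof -
   have "k ~: set l'" using k s(3) by auto
   note o = off[OF this]
   have "\<psi> (Wbr ?w' (word (map (Aop g k x) l))) + \<psi> (Wbr (word (map (Aop g k x) l)) ?w') = 0"
    by (rule character_antisym) (use c W_closed(2)[OF labelling_map] x a in auto)
   then show ?thesis unfolding o by (simp only: eq_neg_iff_add_eq_0)
  qed
  then show ?thesis using character_lie_word(1)[OF Wbr_character(1)[OF c(2)] a x d(1)] by (simp add: sum_negf)
 qed
 have r: "\<psi> (Wbr ?w (Wbr ?w' (lie g))) = - (SUM k:set l'. \<psi> (Wbr (word (map (Aop g k x) l)) (word (map (Aop g k x) l'))))"
  unfolding character_lie_word(2)[OF Wbr_character(1)[OF c(2)] a x d(2)]
  by (intro arg_cong[of _ _ uminus] sum.cong refl) (subst off, use s(3) in auto)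
 have "(SUM k:?N. \<psi> (Wbr (word (map (Aop g k x) l)) (word (map (Aop g k x) l')))) =
   (SUM k:?N. SUM i:set l. SUM j:set l'. Bop i j (?F i j) (Aop g k x))"
  using character_word_word[OF \<psi> _ s] x a by simp
 also have "... = (SUM i:set l. SUM j:set l'. SUM k:?N. Bop i j (?F i j) (Aop g k x))"
  by (subst sum.swap, rule sum.cong[OF refl], rule sum.swap)
 finally have e: "\<psi> (Wbr (lie g) (Wbr ?w ?w')) =
   (SUM k:?N. \<psi> (Wbr (word (map (Aop g k x) l)) (word (map (Aop g k x) l'))))"
  unfolding 1 ..
 show "\<psi> (Wbr (lie g) (Wbr ?w ?w')) + \<psi> (Wbr ?w' (Wbr (lie g) ?w)) + \<psi> (Wbr ?w (Wbr ?w' (lie g))) = 0"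
  unfolding e anti r by (simp add: sum.union_disjoint s(3))
qed (rule character_jacobi_words)

end

theorem W_lie_algebra: "lie_algebra R W Wbr"
 unfolding lie_algebra_def
proof (intro conjI ballI)
 interpret W: module R W by (rule W_mod)
 note B = bilinC[OF Wbr_bilin]
 show "module R W" "bilin R W W W Wbr" by (rule W_mod, rule Wbr_bilin)
 fix p q assume pq: "p : carrier W" "q : carrier W"
 show "Wbr q p = -[W] Wbr p q"
 proof (rule character_sep[OF W_mod])
  show "\<psi> (Wbr q p) = \<psi> (-[W] Wbr p q)" if "character R W \<psi>" for \<psi>
   using character_antisym[OF that pq] character_minus[OF W_mod that B[OF pq]] by (metis eq_neg_iff_add_eq_0)
 qed (use B pq in auto)
 fix r assume r: "r : carrier W"
 show "Wbr p (Wbr q r) +[W] Wbr r (Wbr p q) +[W] Wbr q (Wbr r p) = 0[W]"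
 proof (rule character_sep[OF W_mod])
  show "\<psi> (Wbr p (Wbr q r) +[W] Wbr r (Wbr p q) +[W] Wbr q (Wbr r p)) = \<psi> 0[W]" if "character R W \<psi>" for \<psi>
   using character_jacobi[OF that pq r] character_add[OF W_mod that] character_zero[OF W_mod that] B pq r by simp
 qed (use B pq r in auto)
qed

end

lemma tensor_eqI:
 assumes A: "module R A" and B: "module R B"
  and t: "t : carrier (tensor_mod R A B)" "t' : carrier (tensor_mod R A B)"
  and eq: "!!K. bilin R A B (dual_mod R) K ==> psum (tlist R A B t) K = psum (tlist R A B t') K"
 shows "t = t'"
proof (rule character_sep[OF tens_mod[OF A B] t])
 fix \<Phi> assume \<Phi>: "character R (tensor_mod R A B) \<Phi>"
 show "\<Phi> t = \<Phi> t'"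
  using eq[OF bilin_comp[OF tens_bilin[OF A B] \<Phi>]] by (simp add: psumt[OF A B _ \<Phi>] t)
qed

lemma tensor3_eqI:
 assumes A: "module R A" and B: "module R B" and C: "module R C"
  and t: "t : carrier (tensor3 R A B C)" "t' : carrier (tensor3 R A B C)"
  and eq: "!!H. trilin R A B C (dual_mod R) H ==> tsum3 R A B C t H = tsum3 R A B C t' H"
 shows "t = t'"
proof (rule character_sep[OF tensor3_module[OF A B C] t])
 fix \<Phi> assume \<Phi>: "character R (tensor3 R A B C) \<Phi>"
 note BC = tens_mod[OF B C]
 have e: "tsum3 R A B C t (%x y z. \<Phi> (tens3 R A B C x y z)) = \<Phi> t" if t: "t : carrier (tensor3 R A B C)" for t
 proof -
  have t': "t : carrier (tensor_mod R A (tensor_mod R B C))" using t by (simp add: tensor3_def)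
  have \<Phi>': "character R (tensor_mod R A (tensor_mod R B C)) \<Phi>" using \<Phi> by (simp add: tensor3_def)
  have "psum (tlist R A (tensor_mod R B C) t) (%x u. psum (tlist R B C u) (%y z. \<Phi> (tens3 R A B C x y z))) =
    psum (tlist R A (tensor_mod R B C) t) (%x u. \<Phi> (tens R A (tensor_mod R B C) x u))"
  proof (rule psum_cong)
   fix x u assume "(x, u) : set (tlist R A (tensor_mod R B C) t)"
   note m = tlist_mem[OF A BC t' this]
   show "psum (tlist R B C u) (%y z. \<Phi> (tens3 R A B C x y z)) = \<Phi> (tens R A (tensor_mod R B C) x u)"
    unfolding tens3_def by (rule psumt[OF B C m(2) lin_comp[OF bilinR[OF tens_bilin[OF A BC] m(1)] \<Phi>']])
  qed
  then show ?thesis using psumt[OF A BC t' \<Phi>'] by (simp add: tsum3_def)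
 qed
 have "trilin R A B C (dual_mod R) (%x y z. \<Phi> (tens3 R A B C x y z))"
  using tens3_trilin[OF A B C] unfolding trilin_def
  by (intro conjI ballI bilin_comp[OF _ \<Phi>] lin_comp[OF _ \<Phi>]) blast+
 from eq[OF this] show "\<Phi> t = \<Phi> t'" by (simp add: e t)
qed

text \<open>If \<open>l\<close> reads i A j B k C, the three pieces are j A, k B and i C.\<close>

lemma triples_first:
 assumes s: "cycle s l" and t: "(i, j, k) : triples l"
 shows "distinct (cyc_at (cut (cut s i j) k i) j)" "distinct (cyc_at (cut (cut s i j) k i) k)"
  "distinct (cyc_at (cut (cut s i j) k i) i)"
  "cset (cut (cut s i j) k i) j Int cset (cut (cut s i j) k i) k = {}"
  "cset (cut (cut s i j) k i) j Int cset (cut (cut s i j) k i) i = {}"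
  "cset (cut (cut s i j) k i) k Int cset (cut (cut s i j) k i) i = {}"
  "cset (cut (cut s i j) k i) j Un cset (cut (cut s i j) k i) k Un
   cset (cut (cut s i j) k i) i = set l"
proof -
 obtain n A B C where r: "rotate n l = i # A @ j # B @ k # C" by (rule triplesE[OF t])
 note c = cycle_rotated[OF s r] and d = cycle_distinct[OF cycle_rotated[OF s r]]
 note c1 = cycle_split[OF c]
 note c2 = cycle_split[OF c1(1)]
 have "cycle (cut (cut s i j) i k) (j # A)" by (rule cycle_cut_other[OF c1(2)]) (use d in auto)
 note e = cyc_at_eq[OF c2(1)] cyc_at_eq[OF c2(2)] cyc_at_eq[OF this]
 have "set (rotate n l) = set l" by simp
 then have sl: "set l = set (i # A @ j # B @ k # C)" unfolding r by blast
 show "distinct (cyc_at (cut (cut s i j) k i) j)" "distinct (cyc_at (cut (cut s i j) k i) k)"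
  "distinct (cyc_at (cut (cut s i j) k i) i)"
  "cset (cut (cut s i j) k i) j Int cset (cut (cut s i j) k i) k = {}"
  "cset (cut (cut s i j) k i) j Int cset (cut (cut s i j) k i) i = {}"
  "cset (cut (cut s i j) k i) k Int cset (cut (cut s i j) k i) i = {}"
  using d unfolding cut_sym[of _ k i] e by auto
 show "cset (cut (cut s i j) k i) j Un cset (cut (cut s i j) k i) k Un
   cset (cut (cut s i j) k i) i = set l"
  unfolding cut_sym[of _ k i] e sl by auto
qed

context double_lie_data
begin

section \<open>The Lie coalgebra structure\<close>

lemma wsum_character:
 assumes K: "bilin R W W G K"
 shows "character R W (%p. wsum (Wcobr p) K)"
 by (rule lin_comp[OF Wcobr_lin psumt_lin[OF W_mod W_mod K]])

lemma Wcobr_antisym: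
 assumes K: "bilin R W W G K" and p: "p : carrier W"
 shows "wsum (Wcobr p) (%a b. K b a) + wsum (Wcobr p) K = 0"
proof (rule W_zeroI[where f = "%p. wsum (Wcobr p) (%a b. K b a) + wsum (Wcobr p) K", OF _ _ _ p])
 note K' = bilin_swap[OF K]
 show "character R W (%p. wsum (Wcobr p) (%a b. K b a) + wsum (Wcobr p) K)"
  by (intro character_lin_plus[OF R] wsum_character K K')
 show "wsum (Wcobr (lie g)) (%a b. K b a) + wsum (Wcobr (lie g)) K = 0" if a: "g : carrier L" for g
  using dl_antisym[OF bilin_comp2[OF K lie_lin lie_lin] a] by (simp add: wsum_lie[OF K a] wsum_lie[OF K' a])
 fix w assume "w : words I P"
 then obtain x s l where x: "labelling x" and s: "cycle s l" and w: "w = map x l" by (rule word_exists_slots)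
 have c: "Cop i (%g y. K (word (map y l)) (lie g) - K (lie g) (word (map y l))) x =
   - Cop i (%g y. K (lie g) (word (map y l)) - K (word (map y l)) (lie g)) x" for i
  unfolding Cop_minus[symmetric] by simp
 have "cpair (%a b. K b a) s i j x = - cpair K s j i x" if ij: "i : set l" "j : set l - {i}" for i j
 proof -
  have d: "i : set l" "j : set l" "i ~= j" using ij by auto
  have "slin {i, j} (%y. K (orb (cut s j i) y i) (orb (cut s j i) y j))"
   by (rule slin_mono[OF cpair_slin(1)[OF K s d(2,1)]]) (use d in auto)
  from Bop_antisym[OF this x d(3)] show ?thesis by (simp add: cpair_def cut_sym[of s j i])
 qed
 then have "(SUM i:set l. SUM j:set l - {i}. cpair (%a b. K b a) s i j x) =
   - (SUM i:set l. SUM j:set l - {i}. cpair K s j i x)"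
  by (simp add: sum_negf)
 also have "(SUM i:set l. SUM j:set l - {i}. cpair K s j i x) = (SUM i:set l. SUM j:set l - {i}. cpair K s i j x)"
  by (rule sum_off_diagonal_swap) simp
 finally show "wsum (Wcobr (word w)) (%a b. K b a) + wsum (Wcobr (word w)) K = 0"
  unfolding w wsum_word[OF K x s] wsum_word[OF K' x s] csum_def c by (simp add: sum_negf fun_eq_iff)
qed

lemma word_trilin_slin:
 assumes H: "trilin R W W W G H" and d: "distinct l1" "distinct l2" "distinct l3"
  "set l1 Int set l2 = {}" "set l1 Int set l3 = {}" "set l2 Int set l3 = {}"
 shows "slin (set l1 Un set l2 Un set l3) (%y. H (word (map y l1)) (word (map y l2)) (word (map y l3)))"
 unfolding slin_def
proof (intro allI impI)
 fix x i assume x: "labelling x" and i: "i : set l1 Un set l2 Un set l3"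
 note wc = W_closed(2)[OF labelling_map[OF x]]
 have H': "bilin R W W G (H (word (map x l1)))" "character R W (%a. H a (word (map x l2)) (word (map x l3)))"
  using H wc by (auto simp: trilin_def)
 have eq: "map (x(i := u)) l = map x l" if "i ~: set l" for l u using that by simp
 show "llin (%u. H (word (map (x(i := u)) l1)) (word (map (x(i := u)) l2)) (word (map (x(i := u)) l3)))"
 proof (cases "i : set l1")
  case True
  then have n: "i ~: set l2" "i ~: set l3" using d by auto
  show ?thesis unfolding eq[OF n(1)] eq[OF n(2)]
   by (rule slot_linD[OF slin_word[OF wlin_comp[OF word_wlin H'(2)] d(1)] x True])
 next
  case False
  then have i: "i : set l2 Un set l3" using i by auto
  show ?thesis unfolding eq[OF False] by (rule slot_linD[OF word_bilin_slin[OF H'(1) d(2,3,6)] x i])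
 qed
qed

lemma cobr2_bilin:
 assumes H: "trilin R W W W G H"
 shows "bilin R W W G (%u v. wsum (Wcobr v) (H u))"
proof (rule bilinI)
 show "character R W (%v. wsum (Wcobr v) (H u))" if "u : carrier W" for u
  by (rule wsum_character) (use H that in "simp add: trilin_def")
 show "character R W (%u. wsum (Wcobr v) (H u))" if "v : carrier W" for v
  by (rule character_psum[OF R]) (use H tlist_mem[OF W_mod W_mod Wcobr_closed[OF that]] in "simp add: trilin_def")
qed

context
 fixes H :: "'l \<times> ('k, 'i, 'p) cyc => 'l \<times> ('k, 'i, 'p) cyc => 'l \<times> ('k, 'i, 'p) cyc => 'k => ratz"
  and x and s :: "nat => nat" and l
 assumes H: "trilin R W W W G H" and cyc: "!!a b c. H a b c = H b c a"
  and x: "labelling x" and s: "cycle s l"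
begin

text \<open>The iterated cobracket of a word has components with two, one or no factors in
  \<open>L\<close>, recorded by \<open>MM\<close>, \<open>NN\<close> and \<open>PP\<close>. As
  \<open>H\<close> is cyclically symmetric, one normal form for each suffices.\<close>

definition "NN i j g y = H (lie g) (orb (cut s i j) y j) (orb (cut s i j) y i)"
definition "MM g d y = H (lie g) (lie d) (word (map y l))"
definition "PP a b c t y = H (orb t y a) (orb t y b) (orb t y c)"

lemma H_bilin: "a : carrier W ==> bilin R W W G (H a)" "b : carrier W ==> c : carrier W ==> character R W (%a. H a b c)"
 using H by (simp_all add: trilin_def)

lemma PP_rotate: "PP a b c = PP b c a"
 unfolding PP_def by (rule ext, rule ext, rule cyc)

lemma NN_slinL:
 assumes ij: "i : set l" "j : set l" "i ~= j"
 shows "slinL (set l) (NN i j)"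
 unfolding slinL_def NN_def
proof (intro conjI ballI allI impI)
 note c = cyc_at_split_cycle[OF s ij]
 show "slin (set l) (%y. H (lie g) (orb (cut s i j) y j) (orb (cut s i j) y i))" if "g : carrier L" for g
  using word_bilin_slin[OF H_bilin(1)[OF W_closed(1)[OF that]] c(1-3)] unfolding c(4) .
 show "character R L (%g. H (lie g) (orb (cut s i j) y j) (orb (cut s i j) y i))" if y: "labelling y" for y
  by (rule lin_comp[OF lie_lin H_bilin(2)]) (rule W_closed(2)[OF labelling_map[OF y]])+
qed

lemma MM_slinL:
 assumes a: "g : carrier L"
 shows "slinL (set l) (MM g)" "slinL (set l) (%d. MM d g)"
proof -
 have 1: "slin (set l) (MM g d)" if "g : carrier L" "d : carrier L" for g d
  unfolding MM_def
  by (rule slin_word[OF wlin_comp[OF word_wlin bilinR[OF H_bilin(1)[OF W_closed(1)[OF that(1)]] W_closed(1)[OF that(2)]]] cycle_distinct[OF s]])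
 have 2: "character R L (%d. MM g d y)" "character R L (%d. MM d g y)" if y: "labelling y" for y
  unfolding MM_def
  by (rule lin_comp[OF lie_lin bilinL[OF H_bilin(1)[OF W_closed(1)[OF a]] W_closed(2)[OF labelling_map[OF y]]]],
    rule lin_comp[OF lie_lin H_bilin(2)[OF W_closed(1)[OF a] W_closed(2)[OF labelling_map[OF y]]]])
 show "slinL (set l) (MM g)" "slinL (set l) (%d. MM d g)" using 1 2 a by (simp_all add: slinL_def)
qed

text \<open>Coactions at different slots commute, so the antisymmetrised terms for (i, k) and (k, i)
  cancel. Two coactions at one slot are turned into the cobracket of \<open>L\<close> by the
  comodule axiom.\<close>

lemma coaction_terms_cancel:
 "(SUM i:set l. SUM k:set l. Cop i (%d. Cop k (%t z. MM d t z - MM t d z)) x) =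
  (SUM i:set l. Cop i (%d y. psum (dl d) (%t q. MM t q y)) x)"
proof -
 let ?g = "%i k. Cop i (%d. Cop k (%t z. MM d t z)) x"
 have d: "Cop i (%d. Cop i (%t z. MM d t z - MM t d z)) x = Cop i (%d y. psum (dl d) (%t q. MM t q y)) x"
  if "i : set l" for i
  by (rule Cop_Cop[OF _ _ x])
   (use MM_slinL that in "auto simp: slinL_def intro: slin_mono")
 have e: "Cop k (%t z. MM d t z - MM t d z) = (%y. Cop k (MM d) y - Cop k (%t. MM t d) y)" for k d
  by (intro ext) (simp add: Cop_diff)
 have o: "Cop i (%d. Cop k (%t z. MM d t z - MM t d z)) x = ?g i k - ?g k i" if "i ~= k" for i k
  using Cop_Cop_commute[OF that, of "%d t. MM t d" x] by (simp add: e Cop_diff)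
 have "(SUM k:set l. Cop i (%d. Cop k (%t z. MM d t z - MM t d z)) x) =
   Cop i (%d y. psum (dl d) (%t q. MM t q y)) x + (SUM k:set l - {i}. ?g i k - ?g k i)" if i: "i : set l" for i
  using sum.remove[OF finite_set i, of "%k. Cop i (%d. Cop k (%t z. MM d t z - MM t d z)) x"]
  by (simp add: d[OF i] o)
 then have "(SUM i:set l. SUM k:set l. Cop i (%d. Cop k (%t z. MM d t z - MM t d z)) x) =
   (SUM i:set l. Cop i (%d y. psum (dl d) (%t q. MM t q y)) x) +
   ((SUM i:set l. SUM k:set l - {i}. ?g i k) - (SUM i:set l. SUM k:set l - {i}. ?g k i))"
  by (simp add: sum.distrib sum_subtractf)
 then show ?thesis using sum_off_diagonal_swap[of "set l" ?g] by simp
qed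

text \<open>On the left, the coaction follows a cut and is restricted to the piece through
  \<open>i\<close>. Exchanging the roles of \<open>i\<close> and \<open>j\<close> in one half of the
  sum supplies the other piece; together they give all slots, and the total coaction commutes with
  the bracket.\<close>

lemma mixed_terms_cancel:
 "(SUM i:set l. SUM j:set l - {i}. Bop i j (%y. SUM k:cset (cut s i j) i. Cop k (NN j i) y - Cop k (NN i j) y) x) =
  - (SUM i:set l. SUM j:set l - {i}. SUM k:set l. Cop k (%g. Bop i j (NN i j g)) x)"
proof -
 let ?f = "%i j M y. SUM k:M. Cop k (NN i j) y"
 have 1: "Bop i j (%y. SUM k:cset (cut s i j) i. Cop k (NN j i) y - Cop k (NN i j) y) x =
   - Bop j i (?f j i (cset (cut s i j) i)) x - Bop i j (?f i j (cset (cut s i j) i)) x"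
  if ij: "i : set l" "j : set l - {i}" for i j
 proof -
  have d: "i : set l" "j : set l" "j ~= i" "i ~= j" using ij by auto
  have "slin {j, i} (?f j i (cset (cut s i j) i))"
   by (rule slin_mono[where N = "set l"], intro slin_sum slin_Cop NN_slinL)
    (use d cyc_at_split_cycle(4)[OF s d(1,2,4)] in auto)
  from Bop_antisym[OF this x d(3)] show ?thesis by (simp add: Bop_diff sum_subtractf)
 qed
 have "(SUM i:set l. SUM j:set l - {i}. Bop i j (%y. SUM k:cset (cut s i j) i. Cop k (NN j i) y - Cop k (NN i j) y) x) =
   (SUM i:set l. SUM j:set l - {i}. - Bop j i (?f j i (cset (cut s i j) i)) x - Bop i j (?f i j (cset (cut s i j) i)) x)"
  by (intro sum.cong refl 1)
 also have "... = - (SUM i:set l. SUM j:set l - {i}. Bop j i (?f j i (cset (cut s i j) i)) x) -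
   (SUM i:set l. SUM j:set l - {i}. Bop i j (?f i j (cset (cut s i j) i)) x)"
  by (simp only: sum_subtractf sum_negf)
 also have "(SUM i:set l. SUM j:set l - {i}. Bop j i (?f j i (cset (cut s i j) i)) x) =
   (SUM i:set l. SUM j:set l - {i}. Bop i j (?f i j (cset (cut s j i) j)) x)"
  by (rule sum_off_diagonal_swap) simp
 also have "- ... - (SUM i:set l. SUM j:set l - {i}. Bop i j (?f i j (cset (cut s i j) i)) x) =
   - (SUM i:set l. SUM j:set l - {i}. Bop i j (?f i j (cset (cut s j i) j)) x + Bop i j (?f i j (cset (cut s i j) i)) x)"
  by (simp add: sum.distrib)
 also have "(SUM i:set l. SUM j:set l - {i}. Bop i j (?f i j (cset (cut s j i) j)) x + Bop i j (?f i j (cset (cut s i j) i)) x) =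
   (SUM i:set l. SUM j:set l - {i}. SUM k:set l. Cop k (%g. Bop i j (NN i j g)) x)"
 proof (intro sum.cong refl)
  fix i j assume "i : set l" "j : set l - {i}"
  then have ij: "i : set l" "j : set l" "i ~= j" by auto
  note c = cyc_at_split_cycle[OF s ij]
  have "(SUM k:set l. Cop k (NN i j) y) = ?f i j (cset (cut s i j) j) y + ?f i j (cset (cut s i j) i) y" for y
   unfolding c(4)[symmetric] by (rule sum.union_disjoint) (use c(3) in auto)
  then show "Bop i j (?f i j (cset (cut s j i) j)) x + Bop i j (?f i j (cset (cut s i j) i)) x =
    (SUM k:set l. Cop k (%g. Bop i j (NN i j g)) x)"
   using Bop_Cop_all[OF NN_slinL[OF ij] finite_set ij x] by (simp add: cut_sym[of s j i] Bop_add)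
 qed
 finally show ?thesis .
qed

lemma PP_slin_quads:
 assumes "(i, j, k, m) : quads l"
 shows "slin (set l) (PP j m k (cut (cut s i j) k m))" "slin (set l) (PP j k m (cut (cut s i j) k m))"
proof -
 note q = quads_first[OF s assms]
 note d = cycle_cyc_at(4)[OF q(12)]
 have mem: "j : set l" "k : set l" "m : set l" using quads_mem[OF assms] by auto
 show "slin (set l) (PP j m k (cut (cut s i j) k m))"
  using word_trilin_slin[OF H d[OF mem(1)] d[OF mem(3)] d[OF mem(2)] q(2-4)] unfolding q(5) PP_def[abs_def] .
 have "cset (cut (cut s i j) k m) k Int cset (cut (cut s i j) k m) m = {}" using q(4) by blast
 from word_trilin_slin[OF H d[OF mem(1)] d[OF mem(2)] d[OF mem(3)] q(3,2) this]
 have "slin (cset (cut (cut s i j) k m) j Un cset (cut (cut s i j) k m) k Un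
   cset (cut (cut s i j) k m) m) (PP j k m (cut (cut s i j) k m))" unfolding PP_def[abs_def] .
 then show "slin (set l) (PP j k m (cut (cut s i j) k m))"
  using q(5) by (simp add: Un_ac)
qed

lemma PP_slin_triples:
 assumes t: "(i, j, k) : triples l"
 shows "slin (set l) (PP j k i (cut (cut s i j) k i))" "slin (set l) (PP j i k (cut (cut s i j) k i))"
proof -
 note q = triples_first[OF s t]
 show "slin (set l) (PP j k i (cut (cut s i j) k i))"
  using word_trilin_slin[OF H q(1-6)] unfolding q(7) PP_def[abs_def] .
 have "cset (cut (cut s i j) k i) i Int cset (cut (cut s i j) k i) k = {}" using q(6) by blast
 from word_trilin_slin[OF H q(1,3,2,5,4) this]
 have "slin (cset (cut (cut s i j) k i) j Un cset (cut (cut s i j) k i) i Un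
   cset (cut (cut s i j) k i) k) (PP j i k (cut (cut s i j) k i))" unfolding PP_def[abs_def] .
 then show "slin (set l) (PP j i k (cut (cut s i j) k i))"
  using q(7) by (simp add: Un_ac)
qed

text \<open>The three rotations of a triple yield exactly the three terms of the double Jacobi
  identity, all with the same function because \<open>F\<close> is rotation invariant.\<close>

lemma triples_rot_zero:
 assumes F: "!!i j k. (i, j, k) : triples l ==> slin (set l) (F i j k (cut (cut s i j) k i))"
  and rot: "!!i j k. F i j k = F j k i"
 shows "(\<Sum>(i, j, k)\<in>triples l. BB (F i j k) s i j k i x) = 0"
proof (rule sum_triples_eq_0[OF cycle_distinct[OF s]])
 fix i j k assume t: "(i, j, k) : triples l"
 note m = triples_mem[OF t]
 note d = m(4)[OF cycle_distinct[OF s]]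
 have N: "{i, j, k} <= set l" using m(1-3) by auto
 have "slin (set l) (F i j k (cut (cut s j k) i j))"
  using F[OF t] cut_three(2)[OF d, of s] by simp
 from BB_jacobi[where F = "F i j k", OF x this N d]
 show "BB (F i j k) s i j k i x + BB (F j k i) s j k i j x + BB (F k i j) s k i j k x = 0"
  using rot[of i j k] rot[of j k i] by (simp add: add_ac)
qed

text \<open>Classified by \<open>sum_split_first\<close>: each sum over triples vanishes by the
  double Jacobi identity, and the two sums over quadruples cancel because disjoint surgeries
  commute, after a half turn of the quadruple.\<close>

lemma surg_terms_cancel:
 "(SUM i:set l. SUM j:set l - {i}. SUM k:cset (cut s i j) i. SUM m:cset (cut s i j) i - {k}.
  BB (PP j m k) s i j k m x) = 0"
proof -
 note cd = cycle_distinct[OF s]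
 have "(\<Sum>(i, j, k)\<in>triples l. BB (PP j k i) s i j i k x) = (\<Sum>(i, j, k)\<in>triples l. - BB (PP j k i) s i j k i x)"
 proof (intro sum.cong refl, clarify)
  fix i j k assume t: "(i, j, k) : triples l"
  note m = triples_mem[OF t]
  show "BB (PP j k i) s i j i k x = - BB (PP j k i) s i j k i x"
   by (rule BB_swap(2)[where F = "PP j k i", OF x PP_slin_triples(1)[OF t]]) (use m(1-3) m(4)[OF cd] in auto)
 qed
 also have "... = - (\<Sum>(i, j, k)\<in>triples l. BB (PP j k i) s i j k i x)"
  by (simp add: sum_negf case_prod_unfold)
 also have "(\<Sum>(i, j, k)\<in>triples l. BB (PP j k i) s i j k i x) = 0"
  by (rule triples_rot_zero[of "%i j k. PP j k i"]) (rule PP_slin_triples(1), assumption, metis PP_rotate)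
 finally have 1: "(\<Sum>(i, j, k)\<in>triples l. BB (PP j k i) s i j i k x) = 0" by (simp add: zero_fun_def)
 have 2: "(\<Sum>(i, j, k)\<in>triples l. BB (PP j i k) s i j k i x) = 0"
  by (rule triples_rot_zero[of "%i j k. PP j i k"]) (rule PP_slin_triples(2), assumption, metis PP_rotate)
 have "(\<Sum>(i, j, k, m)\<in>quads l. BB (PP j k m) s i j m k x) = (\<Sum>(i, j, k, m)\<in>quads l. - BB (PP m j i) s k m i j x)"
 proof (intro sum.cong refl, clarify)
  fix i j k m assume t: "(i, j, k, m) : quads l"
  note q = quads_first[OF s t] and mm = quads_mem[OF t]
  note d = mm(5)[OF cd]
  have "BB (PP j k m) s i j m k x = - BB (PP j k m) s i j k m x"
   by (rule BB_swap(2)[where F = "PP j k m", OF x PP_slin_quads(2)[OF t]]) (use mm(1-4) d in auto)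
  \<comment> \<open>After both cuts \<open>i\<close> lies on the piece through \<open>k\<close>, so
    that piece may be read from \<open>i\<close>.\<close>
  also have "BB (PP j k m) s i j k m x = BB (PP j i m) s i j k m x"
   by (rule BB_cong[OF x]) (simp only: PP_def orb_eq[OF _ q(12) mm(3) q(6)])
  also have "... = BB (PP m j i) s k m i j x"
   using BB_commute[OF d, of "PP m j i" s] PP_rotate[of m j i] by simp
  finally show "BB (PP j k m) s i j m k x = - BB (PP m j i) s k m i j x" .
 qed
 also have "... = (\<Sum>(i, j, k, m)\<in>quads l. - BB (PP j m k) s i j k m x)"
  by (rule sum.reindex_bij_witness[of _ "%(i, j, k, m). (k, m, i, j)" "%(i, j, k, m). (k, m, i, j)"])
   (auto intro: quads_mem(6))
 also have "... = - (\<Sum>(i, j, k, m)\<in>quads l. BB (PP j m k) s i j k m x)"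
  by (simp add: sum_negf case_prod_unfold)
 finally have 3: "(\<Sum>(i, j, k, m)\<in>quads l. BB (PP j k m) s i j m k x) = - (\<Sum>(i, j, k, m)\<in>quads l. BB (PP j m k) s i j k m x)" .
 show ?thesis
  unfolding sum_split_first[OF s, of "%i j k m. BB (PP j m k) s i j k m x"] by (simp add: 1 2 3)
qed

lemma cojacobi_word: "wsum (Wcobr (word (map x l))) (%u v. wsum (Wcobr v) (H u)) = 0"
proof -
 let ?K = "%u v. wsum (Wcobr v) (H u)"
 note lc = W_closed(1)
 have 1: "Cop i (%g y. ?K (lie g) (word (map y l)) - ?K (word (map y l)) (lie g)) x =
   (SUM k:set l. Cop i (%g. Cop k (%d z. MM g d z - MM d g z)) x) +
   (SUM k:set l. SUM m:set l - {k}. Cop i (%g. Bop k m (NN k m g)) x) -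
   Cop i (%g y. psum (dl g) (%d t. MM d t y)) x" for i
 proof -
  have "Cop i (%g y. ?K (lie g) (word (map y l)) - ?K (word (map y l)) (lie g)) x =
   Cop i (%g y. (SUM k:set l. Cop k (%d z. MM g d z - MM d g z) y) +
   (SUM k:set l. SUM m:set l - {k}. Bop k m (NN k m g) y) - psum (dl g) (%d t. MM d t y)) x"
  proof (rule Cop_cong[OF x])
   fix g y assume a: "g : carrier L" and y: "labelling y"
   have w: "?K (word (map y l)) (lie g) = psum (dl g) (%d t. MM d t y)"
    unfolding wsum_lie[OF H_bilin(1)[OF W_closed(2)[OF labelling_map[OF y]]] a] MM_def
    by (intro psum_cong cyc)
   have "Cop k (%d z. H (lie g) (lie d) (word (map z l)) - H (lie g) (word (map z l)) (lie d)) y =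
     Cop k (%d z. MM g d z - MM d g z) y" for k
    unfolding MM_def cyc[of "lie _" "lie g" "word _"] by (rule refl)
   then show "?K (lie g) (word (map y l)) - ?K (word (map y l)) (lie g) =
     (SUM k:set l. Cop k (%d z. MM g d z - MM d g z) y) +
     (SUM k:set l. SUM m:set l - {k}. Bop k m (NN k m g) y) - psum (dl g) (%d t. MM d t y)"
    unfolding w wsum_word[OF H_bilin(1)[OF lc[OF a]] y s] csum_def cpair_def NN_def[abs_def] by simp
  qed
  also have "... = (SUM k:set l. Cop i (%g. Cop k (%d z. MM g d z - MM d g z)) x) +
   (SUM k:set l. SUM m:set l - {k}. Cop i (%g. Bop k m (NN k m g)) x) -
   Cop i (%g y. psum (dl g) (%d t. MM d t y)) x"
   by (subst Cop_diff, subst Cop_add, simp only: Cop_sum)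
  finally show ?thesis .
 qed
 have 2: "cpair ?K s i j x =
   Bop i j (%y. SUM k:cset (cut s i j) i. Cop k (NN j i) y - Cop k (NN i j) y) x +
   (SUM k:cset (cut s i j) i. SUM m:cset (cut s i j) i - {k}. BB (PP j m k) s i j k m x)"
  if ij: "i : set l" "j : set l - {i}" for i j
 proof -
  have d: "i : set l" "j : set l" "i ~= j" using ij by auto
  note c = cyc_at_split_cycle[OF s d]
  let ?s = "cut s i j"
  have cj: "cycle ?s (cyc_at ?s j)" "cycle ?s (cyc_at ?s i)"
   using cycle_cyc_at(1)[OF c(5)] d by auto
  \<comment> \<open>The second cobracket acts on the piece through \<open>i\<close> only;
    \<open>off\<close> and \<open>same\<close> say that the piece through \<open>j\<close> keeps its
    letters and its cycle.\<close>
  have off: "orb ?s y j = orb ?s z j" if "!!n. n ~: cset ?s i ==> y n = z n" for y z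
  proof -
   have "map y (cyc_at ?s j) = map z (cyc_at ?s j)" using that c(3) by (intro map_cong refl) blast
   then show ?thesis by (simp only:)
  qed
  have same: "orb ?s z j = orb (cut ?s k m) z j" if "k : cset ?s i" "m : cset ?s i" for k m z
  proof -
   obtain A where A: "cyc_at ?s j = j # A" by (rule permutes_onD[OF c(5) d(2)])
   have "cycle (cut ?s k m) (cyc_at ?s j)" by (rule cycle_cut_other[OF cj(1)]) (use that c(3) in auto)
   then show ?thesis unfolding A by (simp only: cyc_at_eq)
  qed
  have "?K (orb ?s y j) (orb ?s y i) = (SUM k:cset ?s i. Cop k (NN j i) y - Cop k (NN i j) y) +
    (SUM k:cset ?s i. SUM m:cset ?s i - {k}. Bop k m (PP j m k (cut ?s k m)) y)" if y: "labelling y" for y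
  proof -
   have "Cop k (%g z. H (orb ?s y j) (lie g) (orb ?s z i) - H (orb ?s y j) (orb ?s z i) (lie g)) y =
     Cop k (NN j i) y - Cop k (NN i j) y" if k: "k : cset ?s i" for k
    unfolding Cop_diff[symmetric]
   proof (rule Cop_cong_off[OF y])
    fix g z assume z: "!!n. n ~= k ==> z n = y n"
    have e: "orb ?s y j = orb ?s z j" by (rule off) (use z k in metis)
    show "H (orb ?s y j) (lie g) (orb ?s z i) - H (orb ?s y j) (orb ?s z i) (lie g) = NN j i g z - NN i j g z"
     unfolding e NN_def cut_sym[of s j i] cyc[of "orb ?s z j" "lie g"]
      cyc[of "lie g" "orb ?s z j" "orb ?s z i"] ..
   qed
   moreover have "cpair (H (orb ?s y j)) ?s k m y = Bop k m (PP j m k (cut ?s k m)) y"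
    if k: "k : cset ?s i" "m : cset ?s i" for k m
    unfolding cpair_def
   proof (rule Bop_cong_off[OF y])
    fix z assume z: "!!n. n ~= k ==> n ~= m ==> z n = y n"
    have e: "orb ?s y j = orb ?s z j" by (rule off) (use z k in metis)
    show "H (orb ?s y j) (orb (cut ?s k m) z m) (orb (cut ?s k m) z k) = PP j m k (cut ?s k m) z"
     unfolding e unfolding same[OF k] PP_def ..
   qed
   ultimately show ?thesis
    unfolding wsum_word[OF H_bilin(1)[OF W_closed(2)[OF labelling_map[OF y]]] y cj(2)] csum_def by simp
  qed
  then have "cpair ?K s i j x = Bop i j (%y. (SUM k:cset ?s i. Cop k (NN j i) y - Cop k (NN i j) y) +
    (SUM k:cset ?s i. SUM m:cset ?s i - {k}. Bop k m (PP j m k (cut ?s k m)) y)) x"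
   unfolding cpair_def by (rule Bop_cong[OF x])
  then show ?thesis by (simp add: Bop_add Bop_sum BB_def)
 qed
 have "(SUM i:set l. SUM k:set l. SUM m:set l - {k}. Cop i (%g. Bop k m (NN k m g)) x) =
   (SUM k:set l. SUM m:set l - {k}. SUM i:set l. Cop i (%g. Bop k m (NN k m g)) x)"
  by (subst sum.swap, rule sum.cong[OF refl], rule sum.swap)
 then show ?thesis
  unfolding wsum_word[OF cobr2_bilin[OF H] x s] csum_def 1
  using mixed_terms_cancel surg_terms_cancel coaction_terms_cancel
  by (simp add: 2 sum.distrib sum_subtractf)
qed

end

text \<open>The three rotations in the co-Jacobi identity are moved onto the test function. Their
  sum is cyclically symmetric, which is the form that the slot calculation requires.\<close>

lemma W_cojacobi:
 assumes H: "trilin R W W W G H" and p: "p : carrier W"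
 shows "wsum (Wcobr p) (%u v. wsum (Wcobr v) (%a b. H u a b + H b u a + H a b u)) = 0"
proof -
 let ?H = "%u a b. H u a b + H b u a + H a b u"
 have H2: "character R W (%a. H a b c)" "character R W (%a. H c a b)" "character R W (%a. H b c a)"
  if "b : carrier W" "c : carrier W" for b c
  using H that by (auto simp: trilin_def bilin_def)
 have tri: "trilin R W W W G ?H"
  unfolding trilin_def bilin_def
  by (intro conjI ballI character_lin_plus[OF R] H2)
 have cyc: "?H a b c = ?H b c a" for a b c by (simp add: add_ac)
 show ?thesis
 proof (rule W_zeroI[OF wsum_character[OF cobr2_bilin[OF tri]] _ _ p])
  fix g assume a: "g : carrier L"
  have b: "bilin R W W G (?H u)" if "u : carrier W" for u using tri that by (simp add: trilin_def)
  have "trilin R L L L G (%u a b. H (lie u) (lie a) (lie b))"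
   using H lie_lin W_closed(1) unfolding trilin_def bilin_def by (auto intro: lin_comp[OF lie_lin])
  from dl_cojacobi[OF this a]
  show "wsum (Wcobr (lie g)) (%u v. wsum (Wcobr v) (?H u)) = 0"
   unfolding wsum_lie[OF cobr2_bilin[OF tri] a]
   by (subst psum_cong) (use wsum_lie[OF b[OF W_closed(1)]] dl_mem[OF a] in auto)
 next
  fix w assume "w : words I P"
  then obtain x s l where "labelling x" "cycle s l" "w = map x l" by (rule word_exists_slots)
  then show "wsum (Wcobr (word w)) (%u v. wsum (Wcobr v) (?H u)) = 0"
   using cojacobi_word[OF tri cyc] by simp
 qed
qed

theorem W_lie_coalgebra: "lie_coalgebra R W Wcobr"
 unfolding lie_coalgebra_def
proof (intro conjI ballI)
 interpret WW: module R WW by (rule WWM)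
 note W3 = W_mod W_mod W_mod
 show "module R W" "lin R W WW Wcobr" by (rule W_mod, rule Wcobr_lin)
 fix p assume p: "p : carrier W"
 note c = Wcobr_closed[OF p]
 show "swap R W W (Wcobr p) = -[WW] Wcobr p"
 proof (rule tensor_eqI[OF W_mod W_mod swap_closed[OF W_mod W_mod c] WW.M.a_inv_closed[OF c]])
  fix K assume K: "bilin R W W G K"
  show "wsum (swap R W W (Wcobr p)) K = wsum (-[WW] Wcobr p) K"
   using Wcobr_antisym[OF K p]
   unfolding psumt_swap[OF W_mod W_mod K c] psumt_minus[OF W_mod W_mod K c]
   by (simp only: eq_neg_iff_add_eq_0)
 qed
 let ?T = "tensor3 R W W W" and ?c = "cobr2 R W Wcobr p"
 interpret T: module R ?T by (rule tensor3_module[OF W3])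
 note cc = cobr2_closed[OF W_mod Wcobr_lin p]
 have 0: "trilin R W W W G (%_ _ _. 0)" unfolding trilin_def bilin_def using character_lin_zero[OF R, of W] by simp
 note tc = tau123_closed[OF W_mod 0]
 show "?c +[?T] tau123 R W ?c +[?T] tau123 R W (tau123 R W ?c) = 0[?T]"
 proof (rule tensor3_eqI[OF W3])
  show "?c +[?T] tau123 R W ?c +[?T] tau123 R W (tau123 R W ?c) : carrier ?T" using cc tc by simp
  show "0[?T] : carrier ?T" by simp
  fix H assume H: "trilin R W W W G H"
  note H1 = trilin_rotate1[OF H] and H2 = trilin_rotate2[OF H]
  have "tsum3 R W W W (?c +[?T] tau123 R W ?c +[?T] tau123 R W (tau123 R W ?c)) H =
    tsum3 R W W W ?c H + tsum3 R W W W ?c (%x y z. H z x y) + tsum3 R W W W ?c (%x y z. H y z x)"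
   by (simp add: tsum3_add[OF W3 H] cc tc tsum3_tau123[OF W_mod H] tsum3_tau123[OF W_mod H1])
  also have "... = 0"
   using W_cojacobi[OF H p]
   by (simp add: tsum3_cobr2[OF W_mod Wcobr_lin p H] tsum3_cobr2[OF W_mod Wcobr_lin p H1]
     tsum3_cobr2[OF W_mod Wcobr_lin p H2] psum_add)
  finally show "tsum3 R W W W (?c +[?T] tau123 R W ?c +[?T] tau123 R W (tau123 R W ?c)) H = tsum3 R W W W 0[?T] H"
   by (simp add: tsum3_zero[OF W3 H])
 qed
qed

end

section \<open>Rearranging sums over two successive surgeries on two disjoint words\<close>

lemma sum_off_diagonal_Un:
 fixes f :: "'n => 'n => 'g::ab_group_add"
 assumes "finite S" "finite T" "S Int T = {}"
 shows "(SUM k:S Un T. SUM m:S Un T - {k}. f k m) = (SUM k:S. SUM m:S - {k}. f k m) + (SUM k:T. SUM m:T - {k}. f k m) +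
  (SUM k:S. SUM m:T. f k m + f m k)"
proof -
 have "(SUM m:S Un T - {k}. f k m) = (SUM m:S - {k}. f k m) + (SUM m:T. f k m)" if "k : S" for k
 proof -
  have e: "S Un T - {k} = (S - {k}) Un T" using that assms by auto
  show ?thesis unfolding e by (rule sum.union_disjoint) (use assms in auto)
 qed
 moreover have "(SUM m:S Un T - {k}. f k m) = (SUM m:S. f k m) + (SUM m:T - {k}. f k m)" if "k : T" for k
 proof -
  have e: "S Un T - {k} = S Un (T - {k})" using that assms by auto
  show ?thesis unfolding e by (rule sum.union_disjoint) (use assms in auto)
 qed
 moreover have "(SUM k:T. SUM m:S. f k m) = (SUM k:S. SUM m:T. f m k)" by (rule sum.swap)
 ultimately show ?thesis using assms by (simp add: sum.union_disjoint sum.distrib add_ac)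
qed

lemma sum_off_diagonal_remove:
 fixes f :: "'n => 'n => 'g::ab_group_add"
 assumes "finite S" "i : S"
 shows "(SUM k:S. SUM m:S - {k}. f k m) = (SUM m:S - {i}. f i m + f m i) + (SUM k:S - {i}. SUM m:S - {i} - {k}. f k m)"
 using sum_off_diagonal_Un[of "{i}" "S - {i}" f] assms by (simp add: insert_absorb add_ac)

text \<open>\<open>e\<close> joins at \<open>i\<close>, \<open>j\<close> before operating at
  \<open>k\<close>, \<open>m\<close>; \<open>r\<close> operates at \<open>k\<close>,
  \<open>m\<close> first. With four distinct slots the order is immaterial. When a slot is shared,
  two \<open>e\<close>-terms combine to one \<open>r\<close>-term by the double Jacobi identity, and
  for this the terms sharing \<open>j\<close> are reindexed to meet those sharing
  \<open>i\<close>.\<close>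

lemma half_surg_sum:
 fixes e r :: "'n => 'n => 'n => 'n => 'g::ab_group_add"
 assumes fin: "finite A" "finite B"
  and disj: "!!i j k m. i : A ==> j : B ==> k : B ==> m : B ==> distinct [j, k, m] ==> e i j k m = r k m i j"
  and shared: "!!i j m. i : A ==> j : B ==> m : B ==> j ~= m ==> e i j i m + e i m j m = r j m i j"
   "!!i j m. i : A ==> j : B ==> m : B ==> j ~= m ==> e i j m i + e i m m j = r m j i j"
 shows "(SUM i:A. SUM j:B. (SUM m:B - {j}. e i j i m + e i j m i) + (SUM k:B. SUM m:B - {k}. e i j k m)) =
  (SUM k:B. SUM m:B - {k}. SUM i:A. SUM j:B. r k m i j)"
proof -
 have one: "(SUM j:B. (SUM m:B - {j}. e i j i m + e i j m i) + (SUM k:B. SUM m:B - {k}. e i j k m)) =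
   (SUM k:B. SUM m:B - {k}. SUM j:B. r k m i j)" if i: "i : A" for i
 proof -
  have "(SUM j:B. (SUM m:B - {j}. e i j i m + e i j m i) + (SUM k:B. SUM m:B - {k}. e i j k m)) =
    (SUM j:B. (SUM m:B - {j}. e i j i m + e i j m i) + (SUM m:B - {j}. e i j j m + e i j m j) +
    (SUM k:B - {j}. SUM m:B - {j} - {k}. e i j k m))"
  proof (intro sum.cong refl)
   fix j assume j: "j : B"
   show "(SUM m:B - {j}. e i j i m + e i j m i) + (SUM k:B. SUM m:B - {k}. e i j k m) =
     (SUM m:B - {j}. e i j i m + e i j m i) + (SUM m:B - {j}. e i j j m + e i j m j) +
     (SUM k:B - {j}. SUM m:B - {j} - {k}. e i j k m)"
    unfolding sum_off_diagonal_remove[OF fin(2) j, of "e i j"] by (rule add.assoc[symmetric])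
  qed
  also have "... = (SUM j:B. SUM m:B - {j}. e i j i m + e i j m i) + (SUM j:B. SUM m:B - {j}. e i j j m + e i j m j) +
    (SUM j:B. SUM k:B - {j}. SUM m:B - {j} - {k}. e i j k m)"
   by (simp only: sum.distrib)
  also have "(SUM j:B. SUM m:B - {j}. e i j j m + e i j m j) = (SUM j:B. SUM m:B - {j}. e i m m j + e i m j m)"
   by (rule sum_off_diagonal_swap[OF fin(2)])
  also have "(SUM j:B. SUM m:B - {j}. e i j i m + e i j m i) + (SUM j:B. SUM m:B - {j}. e i m m j + e i m j m) =
    (SUM j:B. SUM m:B - {j}. r j m i j + r m j i j)"
   unfolding sum.distrib[symmetric]
  proof (intro sum.cong refl)
   fix j m assume jm: "j : B" "m : B - {j}"
   then have "r j m i j = e i j i m + e i m j m" "r m j i j = e i j m i + e i m m j"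
    using shared[OF i, of j m] by auto
   then show "e i j i m + e i j m i + (e i m m j + e i m j m) = r j m i j + r m j i j" by (simp add: add_ac)
  qed
  also have "... = (SUM j:B. SUM m:B - {j}. r j m i j) + (SUM j:B. SUM m:B - {j}. r m j i j)"
   by (simp only: sum.distrib)
  also have "(SUM j:B. SUM m:B - {j}. r m j i j) = (SUM j:B. SUM m:B - {j}. r j m i m)"
   by (rule sum_off_diagonal_swap[OF fin(2)])
  also have "(SUM j:B. SUM k:B - {j}. SUM m:B - {j} - {k}. e i j k m) = (SUM k:B. SUM m:B - {k}. SUM j:B - {k} - {m}. r k m i j)"
  proof -
   have "(SUM j:B. SUM k:B - {j}. SUM m:B - {j} - {k}. e i j k m) =
     (\<Sum>(j, k, m)\<in>(SIGMA j:B. SIGMA k:B - {j}. B - {j} - {k}). e i j k m)"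
    using fin by (simp add: sum.Sigma)
   also have "... = (\<Sum>(k, m, j)\<in>(SIGMA k:B. SIGMA m:B - {k}. B - {k} - {m}). r k m i j)"
   proof (rule sum.reindex_bij_witness[of _ "%(k, m, j). (j, k, m)" "%(j, k, m). (k, m, j)"])
    fix q assume "q : (SIGMA j:B. SIGMA k:B - {j}. B - {j} - {k})"
    then obtain j k m where q: "q = (j, k, m)" "j : B" "k : B" "m : B" "distinct [j, k, m]" by auto
    show "(case case q of (j, k, m) => (k, m, j) of (k, m, j) => r k m i j) = (case q of (j, k, m) => e i j k m)"
     using disj[OF i q(2-5)] by (simp add: q(1))
   qed auto
   also have "... = (SUM k:B. SUM m:B - {k}. SUM j:B - {k} - {m}. r k m i j)" using fin by (simp add: sum.Sigma)
   finally show ?thesis .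
  qed
  also have "(SUM j:B. SUM m:B - {j}. r j m i j) + (SUM j:B. SUM m:B - {j}. r j m i m) +
    (SUM k:B. SUM m:B - {k}. SUM j:B - {k} - {m}. r k m i j) = (SUM k:B. SUM m:B - {k}. SUM j:B. r k m i j)"
   unfolding sum.distrib[symmetric]
  proof (intro sum.cong refl)
   fix k m assume "k : B" "m : B - {k}"
   then show "r k m i k + r k m i m + (SUM j:B - {k} - {m}. r k m i j) = (SUM j:B. r k m i j)"
    using fin by (simp add: sum.remove[of B k] sum.remove[of "B - {k}" m] add_ac)
  qed
  finally show ?thesis .
 qed
 have "(SUM k:B. SUM m:B - {k}. SUM i:A. SUM j:B. r k m i j) = (SUM i:A. SUM k:B. SUM m:B - {k}. SUM j:B. r k m i j)"
  by (subst (2) sum.swap) (intro sum.cong refl sum.swap)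
 then show ?thesis using one by simp
qed

text \<open>The second pair of slots is the first pair again, or lies in \<open>B\<close> apart from
  a possible \<open>i\<close>, or in \<open>A\<close> apart from a possible \<open>j\<close>, or has
  a new slot on either side. The terms of the last kind cancel under exchange of the two pairs. The
  part for \<open>A\<close> gets a minus sign since its hypothesis has the slots of the first
  surgery in the opposite order.\<close>

lemma surg_sum:
 fixes e r :: "'n => 'n => 'n => 'n => 'g::ab_group_add"
 assumes fin: "finite A" "finite B" "A Int B = {}"
  and anti: "!!i j k m. i : A ==> j : B ==> k : A Un B ==> m : A Un B ==> k ~= m ==> e j i k m = - e i j k m"
  and cross: "!!i j k m. i : A ==> k : A ==> i ~= k ==> j : B ==> m : B ==> j ~= m ==> e k m j i = - e i j k m"
  and half: "(SUM i:A. SUM j:B. (SUM m:B - {j}. e i j i m + e i j m i) + (SUM k:B. SUM m:B - {k}. e i j k m)) = SB"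
   "(SUM j:B. SUM i:A. (SUM m:A - {i}. e j i j m + e j i m j) + (SUM k:A. SUM m:A - {k}. e j i k m)) = SA"
 shows "(SUM i:A. SUM j:B. SUM k:A Un B. SUM m:A Un B - {k}. e i j k m) =
  (SUM i:A. SUM j:B. e i j i j + e i j j i) + SB - SA"
proof -
 let ?a = "%i j. (SUM m:A - {i}. e i j j m + e i j m j) + (SUM k:A. SUM m:A - {k}. e i j k m)"
 let ?b = "%i j. (SUM m:B - {j}. e i j i m + e i j m i) + (SUM k:B. SUM m:B - {k}. e i j k m)"
 let ?c = "%i j. SUM k:A - {i}. SUM m:B - {j}. e i j k m + e i j m k"
 have split: "(SUM k:A Un B. SUM m:A Un B - {k}. e i j k m) = (e i j i j + e i j j i) + ?b i j + ?a i j + ?c i j"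
  if ij: "i : A" "j : B" for i j
 proof -
  have "(SUM k:A. SUM m:B. g k m) = g i j + (SUM m:B - {j}. g i m) + (SUM k:A - {i}. g k j) + (SUM k:A - {i}. SUM m:B - {j}. g k m)"
   for g :: "'n => 'n => 'g"
  proof -
   have "(SUM m:B. g k m) = g k j + (SUM m:B - {j}. g k m)" for k by (rule sum.remove[OF fin(2) ij(2)])
   then show ?thesis by (simp add: sum.remove[OF fin(1) ij(1)] sum.distrib add_ac)
  qed
  from this[of "%k m. e i j k m + e i j m k"] show ?thesis
   unfolding sum_off_diagonal_Un[OF fin] by (simp add: add_ac)
 qed
 have "(SUM i:A. SUM j:B. ?a i j) = - SA"
 proof -
  have "SA = (SUM i:A. SUM j:B. (SUM m:A - {i}. e j i j m + e j i m j) + (SUM k:A. SUM m:A - {k}. e j i k m))"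
   unfolding half(2)[symmetric] by (rule sum.swap)
  also have "... = (SUM i:A. SUM j:B. - ?a i j)"
  proof (intro sum.cong refl)
   fix i j assume ij: "i : A" "j : B"
   have h1: "(SUM m:A - {i}. e j i j m + e j i m j) = (SUM m:A - {i}. - (e i j j m + e i j m j))"
    using ij fin(3) by (intro sum.cong refl) (subst (1 2) anti, auto)
   have h2: "(SUM k:A. SUM m:A - {k}. e j i k m) = (SUM k:A. SUM m:A - {k}. - e i j k m)"
    using ij by (intro sum.cong refl anti) auto
   show "(SUM m:A - {i}. e j i j m + e j i m j) + (SUM k:A. SUM m:A - {k}. e j i k m) = - ?a i j"
    unfolding h1 h2 sum_negf by simp
  qed
  finally show ?thesis by (simp only: sum_negf minus_minus)
 qed
 moreover have "(SUM i:A. SUM j:B. ?c i j) = 0"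
 proof -
  let ?S = "SIGMA i:A. SIGMA j:B. SIGMA k:A - {i}. B - {j}"
  have "(SUM i:A. SUM j:B. ?c i j) = (\<Sum>(i, j, k, m)\<in>?S. e i j k m) + (\<Sum>(i, j, k, m)\<in>?S. e i j m k)"
   using fin by (simp add: sum.Sigma sum.distrib case_prod_unfold)
  also have "(\<Sum>(i, j, k, m)\<in>?S. e i j m k) = (\<Sum>(i, j, k, m)\<in>?S. e k m j i)"
   by (rule sum.reindex_bij_witness[of _ "%(i, j, k, m). (k, m, i, j)" "%(i, j, k, m). (k, m, i, j)"]) auto
  also have "... = (\<Sum>(i, j, k, m)\<in>?S. - e i j k m)"
   by (rule sum.cong[OF refl]) (auto intro: cross)
  finally show ?thesis by (simp add: sum_negf case_prod_unfold)
 qed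
 moreover have "(SUM i:A. SUM j:B. SUM k:A Un B. SUM m:A Un B - {k}. e i j k m) =
   (SUM i:A. SUM j:B. e i j i j + e i j j i) + (SUM i:A. SUM j:B. ?b i j) + (SUM i:A. SUM j:B. ?a i j) + (SUM i:A. SUM j:B. ?c i j)"
  unfolding sum.distrib[symmetric] by (intro sum.cong refl) (simp only: split)
 ultimately show ?thesis unfolding half(1) by simp
qed

context double_lie_data
begin

section \<open>Compatibility of bracket and cobracket\<close>

context
 fixes K :: "'l \<times> ('k, 'i, 'p) cyc => 'l \<times> ('k, 'i, 'p) cyc => 'k => ratz"
 assumes K: "bilin R W W G K"
begin

text \<open>The test function \<open>K\<close> composed with the adjoint action of \<open>p\<close>
  on tensors.\<close>

definition "adK p a b = K (Wbr p a) b + K a (Wbr p b)"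

lemma K_character: "a : carrier W ==> character R W (K a)" "b : carrier W ==> character R W (%a. K a b)"
 by (rule bilinR[OF K], assumption, rule bilinL[OF K])

lemma adK_bilin:
 assumes p: "p : carrier W"
 shows "bilin R W W G (adK p)"
 unfolding adK_def[abs_def]
 by (intro bilinI character_lin_plus[OF R])
  (use bilinC[OF Wbr_bilin p] K_character lin_comp[OF bilinR[OF Wbr_bilin p] K_character(1)]
   lin_comp[OF bilinR[OF Wbr_bilin p] K_character(2)] in auto)

lemma adK_character:
 assumes ab: "a : carrier W" "b : carrier W"
 shows "character R W (%p. adK p a b)"
 unfolding adK_def
 by (intro character_lin_plus[OF R] lin_comp[OF bilinL[OF Wbr_bilin ab(1)] K_character(2)[OF ab(2)]]
  lin_comp[OF bilinL[OF Wbr_bilin ab(2)] K_character(1)[OF ab(1)]])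

lemma wsumK_bilin: "bilin R W W G (%p q. wsum (Wcobr q) (adK p))"
proof (rule bilinI)
 show "character R W (%q. wsum (Wcobr q) (adK p))" if "p : carrier W" for p
  by (rule wsum_character[OF adK_bilin[OF that]])
 show "character R W (%p. wsum (Wcobr q) (adK p))" if "q : carrier W" for q
  by (rule character_psum[OF R]) (use adK_character tlist_mem[OF W_mod W_mod Wcobr_closed[OF that]] in auto)
qed

text \<open>The failure of compatibility, seen by \<open>K\<close>. It is bilinear and
  antisymmetric, so it need only be computed for two elements of \<open>L\<close>, an element and a
  word, and two words.\<close>

definition "defect p q = wsum (Wcobr (Wbr p q)) K - wsum (Wcobr q) (adK p) + wsum (Wcobr p) (adK q)"

lemma defect_bilin: "bilin R W W G defect"
 unfolding defect_def[abs_def]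
 by (intro bilinI character_lin_plus[OF R] character_lin_diff[OF R W_mod])
  (use bilinD[OF wsumK_bilin] bilinD[OF bilin_comp[OF Wbr_bilin wsum_character[OF K]]] in auto)

lemma defect_antisym:
 assumes pq: "p : carrier W" "q : carrier W"
 shows "defect q p = - defect p q"
 using character_antisym[OF wsum_character[OF K] pq]
 by (simp add: defect_def eq_neg_iff_add_eq_0 algebra_simps)

lemma defect_lie_lie:
 assumes a: "g : carrier L" "d : carrier L"
 shows "defect (lie g) (lie d) = 0"
proof -
 have e: "psum (dl d) (%w u. adK (lie g) (lie w) (lie u)) =
   psum (dl d) (%w u. K (lie (br g w)) (lie u) + K (lie w) (lie (br g u)))"
  if "g : carrier L" "d : carrier L" for g d
  by (rule psum_cong) (use dl_mem[OF that(2)] that(1) in "auto simp: adK_def Wbr_lie_lie")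
 show ?thesis
  unfolding defect_def Wbr_lie_lie[OF a] wsum_lie[OF K bilinC[OF br_bilin a]]
   wsum_lie[OF adK_bilin[OF W_closed(1)[OF a(1)]] a(2)] wsum_lie[OF adK_bilin[OF W_closed(1)[OF a(2)]] a(1)]
   e[OF a] e[OF a(2,1)] dl_br[OF bilin_comp2[OF K lie_lin lie_lin] a]
  by simp
qed

text \<open>The action of \<open>g\<close> on all slots passes through cuts by the derivation
  property. At a coaction it produces additional terms from the cobracket of \<open>g\<close>, and
  these are what the cobracket of \<open>lie g\<close>, acted on by the word, compensates.\<close>

lemma defect_lie_word:
 assumes a: "g : carrier L" and x: "labelling x" and s: "cycle s l"
 shows "defect (lie g) (word (map x l)) = 0"
proof -
 note d = cycle_distinct[OF s] and ac = W_closed(1)[OF a]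
 let ?w = "%y. word (map y l)"
 note wc = W_closed(2)[OF labelling_map]
 define M where "M d y = K (lie d) (?w y) - K (?w y) (lie d)" for d y
 have M: "slinL (set l) M" unfolding M_def[abs_def] by (rule word_lie_slinL(3)[OF K d])
 have lw: "K (lie d) (Wbr (lie g) (?w y)) = (SUM k:set l. K (lie d) (?w (Aop g k y)))"
  "K (Wbr (lie g) (?w y)) (lie d) = (SUM k:set l. K (?w (Aop g k y)) (lie d))"
  if "labelling y" "d : carrier L" for y d
  using character_lie_word(1)[OF K_character(1)[OF W_closed(1)[OF that(2)]] a that(1) d]
   character_lie_word(1)[OF K_character(2)[OF W_closed(1)[OF that(2)]] a that(1) d] by auto
 have C1: "(SUM k:set l. Cop i M (Aop g k x)) =
   Cop i (%d y. adK (lie g) (lie d) (?w y) - adK (lie g) (?w y) (lie d)) x + psum (dl g) (%d t. M d (Aop t i x))"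
  if i: "i : set l" for i
 proof -
  have Mi: "slinL {i} M" using M i by (auto simp: slinL_def intro: slin_mono)
  have "Cop i (%d y. adK (lie g) (lie d) (?w y) - adK (lie g) (?w y) (lie d)) x =
    Cop i (%d y. M (br g d) y + (SUM k:set l. M d (Aop g k y))) x"
   by (rule Cop_cong[OF x])
    (simp add: adK_def M_def Wbr_lie_lie[OF a] lw sum_subtractf algebra_simps)
  also have "... = Cop i (%d y. (M (br g d) y + M d (Aop g i y)) + (SUM k:set l - {i}. M d (Aop g k y))) x"
   using i by (simp add: sum.remove[of "set l" i] add.assoc)
  also have "... = Cop i (%d y. M (br g d) y + M d (Aop g i y)) x + (SUM k:set l - {i}. Cop i M (Aop g k x))"
   by (subst Cop_add) (simp add: Cop_sum Cop_Aop_other)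
  finally show ?thesis
   using i Cop_Aop[OF Mi x a] by (simp add: sum.remove[of "set l" i] add_ac)
 qed
 have C2: "(SUM k:set l. cpair K s i j (Aop g k x)) = cpair (adK (lie g)) s i j x"
  if ij: "i : set l" "j : set l - {i}" for i j
 proof -
  have d: "i : set l" "j : set l" "i ~= j" using ij by auto
  note c = cyc_at_split_cycle[OF s d]
  let ?s = "cut s i j" and ?F = "%y. K (orb (cut s i j) y j) (orb (cut s i j) y i)"
  have off: "map (Aop g k y) l' = map y l'" if "k ~: set l'" for k l' y using that by (auto simp: Aop_def)
  have "(SUM k:set l. ?F (Aop g k y)) = adK (lie g) (orb ?s y j) (orb ?s y i)" if y: "labelling y" for y
  proof -
   have k: "?F (Aop g k y) = K (orb ?s (Aop g k y) j) (orb ?s y i)" if "k : cset ?s j" for k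
   proof -
    have "k ~: cset ?s i" using that c(3) by auto
    from off[OF this] show ?thesis by (simp only:)
   qed
   have k': "?F (Aop g k y) = K (orb ?s y j) (orb ?s (Aop g k y) i)" if "k : cset ?s i" for k
   proof -
    have "k ~: cset ?s j" using that c(3) by auto
    from off[OF this] show ?thesis by (simp only:)
   qed
   have "(SUM k:set l. ?F (Aop g k y)) = (SUM k:cset ?s j. ?F (Aop g k y)) + (SUM k:cset ?s i. ?F (Aop g k y))"
    unfolding c(4)[symmetric] by (rule sum.union_disjoint) (use c(3) in auto)
   then show ?thesis
    unfolding adK_def character_lie_word(1)[OF K_character(1)[OF wc[OF y]] a y c(2)]
     character_lie_word(1)[OF K_character(2)[OF wc[OF y]] a y c(1)]
    by (simp only: k k' cong: sum.cong)
  qed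
  then show ?thesis
   unfolding cpair_def Bop_Aop_all[OF cpair_slin(1)[OF K s d] finite_set d x a]
   by (intro Bop_cong[OF x])
 qed
 have w: "wsum (Wcobr (lie g)) (adK (?w x)) = - (SUM i:set l. psum (dl g) (%d t. M d (Aop t i x)))"
 proof -
  let ?h = "%d t. K (Wbr (?w x) (lie t)) (lie d)"
  have h: "bilin R L L G ?h"
   by (rule bilin_swap[OF bilin_comp2[OF K lin_comp[OF lie_lin bilinR[OF Wbr_bilin wc[OF x]]] lie_lin]])
  have "psum (dl g) (%d t. adK (?w x) (lie d) (lie t)) =
    psum (dl g) (%d t. ?h t d) + psum (dl g) (%d t. K (lie d) (Wbr (?w x) (lie t)))"
   by (simp only: adK_def psum_add)
  also have "... = psum (dl g) (%d t. K (lie d) (Wbr (?w x) (lie t)) - ?h d t)"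
   unfolding dl_antisym[OF h a] by (simp add: psum_diff)
  also have "... = psum (dl g) (%d t. - (SUM i:set l. M d (Aop t i x)))"
  proof (rule psum_cong)
   fix d t assume "(d, t) : set (dl g)"
   note m = dl_mem[OF a this]
   show "K (lie d) (Wbr (?w x) (lie t)) - ?h d t = - (SUM i:set l. M d (Aop t i x))"
    unfolding character_lie_word(2)[OF K_character(1)[OF W_closed(1)[OF m(1)]] m(2) x d]
     character_lie_word(2)[OF K_character(2)[OF W_closed(1)[OF m(1)]] m(2) x d]
    by (simp add: M_def sum_subtractf)
  qed
  finally show ?thesis
   unfolding wsum_lie[OF adK_bilin[OF wc[OF x]] a] by (simp only: psum_minus psum_sum)
 qed
 have "wsum (Wcobr (Wbr (lie g) (?w x))) K = (SUM k:set l. csum K s l (Aop g k x))"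
  unfolding character_lie_word(1)[OF wsum_character[OF K] a x d]
  using wsum_word[OF K _ s] x a by simp
 also have "... = (SUM i:set l. SUM k:set l. Cop i M (Aop g k x)) +
   (SUM i:set l. SUM j:set l - {i}. SUM k:set l. cpair K s i j (Aop g k x))"
 proof -
  have "(SUM k:set l. SUM i:set l. SUM j:set l - {i}. cpair K s i j (Aop g k x)) =
    (SUM i:set l. SUM j:set l - {i}. SUM k:set l. cpair K s i j (Aop g k x))"
   by (subst sum.swap, rule sum.cong[OF refl], rule sum.swap)
  moreover have "(SUM k:set l. SUM i:set l. Cop i M (Aop g k x)) = (SUM i:set l. SUM k:set l. Cop i M (Aop g k x))"
   by (rule sum.swap)
  ultimately show ?thesis by (simp only: csum_def sum.distrib M_def[abs_def])
 qed
 also have "... = wsum (Wcobr (?w x)) (adK (lie g)) + (SUM i:set l. psum (dl g) (%d t. M d (Aop t i x)))"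
  unfolding wsum_word[OF adK_bilin[OF ac] x s] csum_def
 proof -
  have "(SUM i:set l. SUM k:set l. Cop i M (Aop g k x)) =
    (SUM i:set l. Cop i (%d y. adK (lie g) (lie d) (?w y) - adK (lie g) (?w y) (lie d)) x +
    psum (dl g) (%d t. M d (Aop t i x)))"
   by (intro sum.cong refl C1)
  moreover have "(SUM i:set l. SUM j:set l - {i}. SUM k:set l. cpair K s i j (Aop g k x)) =
    (SUM i:set l. SUM j:set l - {i}. cpair (adK (lie g)) s i j x)"
   by (intro sum.cong refl C2)
  ultimately show "(SUM i:set l. SUM k:set l. Cop i M (Aop g k x)) +
    (SUM i:set l. SUM j:set l - {i}. SUM k:set l. cpair K s i j (Aop g k x)) =
    (SUM i:set l. Cop i (%d y. adK (lie g) (lie d) (?w y) - adK (lie g) (?w y) (lie d)) x) +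
    (SUM i:set l. SUM j:set l - {i}. cpair (adK (lie g)) s i j x) +
    (SUM i:set l. psum (dl g) (%d t. M d (Aop t i x)))"
   by (simp only: sum.distrib add_ac)
 qed
 finally show ?thesis by (simp add: defect_def w)
qed

text \<open>\<open>KK\<close> tests a pair of words obtained by splitting; \<open>MO\<close> tests
  an element of \<open>L\<close> against the joined word, antisymmetrised as in the coaction part of
  the cobracket.\<close>

definition "KK a b t y = K (orb t y a) (orb t y b)"
definition "MO i j t g y = K (lie g) (orb (cut t i j) y i) - K (orb (cut t i j) y i) (lie g)"

context
 fixes x and s :: "nat => nat" and l l'
 assumes x: "labelling x" and s: "cycle s l" "cycle s l'" "set l Int set l' = {}"
begin

lemma KK_slin:
 assumes ij: "i : set l" "j : set l'" and km: "k : set l Un set l'" "m : set l Un set l'" "k ~= m"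
 shows "slin (set l Un set l') (KK m k (cut (cut s i j) k m))"
  "slin (set l Un set l') (KK k m (cut (cut s i j) k m))"
proof -
 note c = cset_cut_two[OF s ij]
 have i: "i : set l Un set l'" using ij by simp
 note r = cycle_cyc_at(1)[OF c(3) i]
 show "slin (set l Un set l') (KK m k (cut (cut s i j) k m))"
  using cpair_slin(1)[OF K r] km unfolding c(1) KK_def[abs_def] by blast
 have "slin (set l Un set l') (KK k m (cut (cut s i j) m k))"
  using cpair_slin(1)[OF K r, of m k] km unfolding c(1) KK_def[abs_def] by blast
 then show "slin (set l Un set l') (KK k m (cut (cut s i j) k m))" by (simp only: cut_sym[of _ m k])
qed

lemma MO_slinL:
 assumes ij: "i : set l" "j : set l'"
 shows "slinL (set l Un set l') (MO i j s)"
proof -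
 note c = cset_cut_two[OF s ij]
 have i: "i : set l Un set l'" using ij by simp
 show ?thesis
  using word_lie_slinL(3)[OF K cycle_cyc_at(4)[OF c(3) i]] unfolding c(1) MO_def[abs_def] .
qed

lemma wsum_bracket_words:
 "wsum (Wcobr (Wbr (word (map x l)) (word (map x l')))) K =
  (SUM i:set l. SUM j:set l'. SUM k:set l Un set l'. Cop k (%g. Bop i j (MO i j s g)) x) +
  (SUM i:set l. SUM j:set l'. SUM k:set l Un set l'. SUM m:set l Un set l' - {k}. BB (KK m k) s i j k m x)"
proof -
 let ?N = "set l Un set l'"
 have "Bop i j (%y. wsum (Wcobr (orb (cut s i j) y i)) K) x =
   (SUM k:?N. Cop k (%g. Bop i j (MO i j s g)) x) + (SUM k:?N. SUM m:?N - {k}. BB (KK m k) s i j k m x)"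
  if ij: "i : set l" "j : set l'" for i j
 proof -
  note c = cset_cut_two[OF s ij]
  have N: "i : ?N" "j : ?N" using ij by auto
  note r = cycle_cyc_at(1)[OF c(3) N(1)]
  have "Bop i j (%y. wsum (Wcobr (orb (cut s i j) y i)) K) x =
    Bop i j (%y. (SUM k:?N. Cop k (MO i j s) y) + (SUM k:?N. SUM m:?N - {k}. Bop k m (KK m k (cut (cut s i j) k m)) y)) x"
   by (rule Bop_cong[OF x])
    (simp only: wsum_word[OF K _ r] csum_def cpair_def KK_def[abs_def] MO_def[abs_def] c(1))
  then show ?thesis
   using Bop_Cop_all[OF MO_slinL[OF ij] _ N c(4) x] by (simp add: Bop_add Bop_sum BB_def)
 qed
 then show ?thesis
  unfolding character_word_word[OF wsum_character[OF K] x s] by (simp only: sum.distrib[symmetric] cong: sum.cong)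
qed

text \<open>An element of \<open>L\<close> that splits off \<open>l'\<close> by the coaction acts on
  \<open>l\<close>. This gives the first sum, which has no surgery in it; it is matched later by the
  terms where condition (6) is applied.\<close>

lemma wsumK_word:
 "wsum (Wcobr (word (map x l'))) (adK (word (map x l))) =
  (SUM j:set l'. SUM i:set l. Cop j (%g y. K (word (map (Aop g i y) l')) (word (map (Aop g i y) l)) -
   K (word (map (Aop g i y) l)) (word (map (Aop g i y) l'))) x) +
  (SUM k:set l'. SUM i:set l. SUM j:set l'. Cop k (%g. Bop i j (MO i j s g)) x) +
  (SUM k:set l'. SUM m:set l' - {k}. SUM i:set l. SUM j:set l'. BB (KK m k) s k m i j x)"
proof -
 let ?w = "%y. word (map y l)" and ?w' = "%y. word (map y l')"
 let ?F = "%y. K (?w' y) (?w y) - K (?w y) (?w' y)"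
 note d = cycle_distinct[OF s(1)] cycle_distinct[OF s(2)]
 note wc = W_closed(2)[OF labelling_map]
 have C: "Cop j (%g y. adK (?w x) (lie g) (?w' y) - adK (?w x) (?w' y) (lie g)) x =
   (SUM i:set l. Cop j (%g y. ?F (Aop g i y)) x) + (SUM i:set l. SUM k:set l'. Cop j (%g. Bop i k (MO i k s g)) x)"
  if j: "j : set l'" for j
 proof -
  have "Cop j (%g y. adK (?w x) (lie g) (?w' y) - adK (?w x) (?w' y) (lie g)) x =
    Cop j (%g y. (SUM i:set l. ?F (Aop g i y)) + (SUM i:set l. SUM k:set l'. Bop i k (MO i k s g) y)) x"
  proof (rule Cop_cong_off[OF x])
   fix g y assume a: "g : carrier L" and y: "labelling y" and z: "!!k. k ~= j ==> y k = x k"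
   note lc = W_closed(1)[OF a]
   have "map x l = map y l" using z j s(3) by (intro map_cong refl) (metis disjoint_iff)
   then have e: "?w x = ?w y" by (simp only:)
   have off: "map (Aop g i y) l' = map y l'" if "i : set l" for i
    using that s(3) by (auto simp: Aop_def)
   have "adK (?w y) (lie g) (?w' y) - adK (?w y) (?w' y) (lie g) =
     (SUM i:set l. K (?w' y) (?w (Aop g i y)) - K (?w (Aop g i y)) (?w' y)) +
     (SUM i:set l. SUM k:set l'. Bop i k (MO i k s g) y)"
    unfolding adK_def MO_def[abs_def] Bop_diff
     character_lie_word(2)[OF K_character(1)[OF wc[OF y]] a y d(1)]
     character_lie_word(2)[OF K_character(2)[OF wc[OF y]] a y d(1)]
     character_word_word[OF K_character(1)[OF lc] y s] character_word_word[OF K_character(2)[OF lc] y s]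
    by (simp only: sum_subtractf) (simp add: algebra_simps)
   then show "adK (?w x) (lie g) (?w' y) - adK (?w x) (?w' y) (lie g) =
     (SUM i:set l. ?F (Aop g i y)) + (SUM i:set l. SUM k:set l'. Bop i k (MO i k s g) y)"
    unfolding e by (simp only: off cong: sum.cong)
  qed
  also have "... = (SUM i:set l. Cop j (%g y. ?F (Aop g i y)) x) + (SUM i:set l. SUM k:set l'. Cop j (%g. Bop i k (MO i k s g)) x)"
   by (subst Cop_add) (simp only: Cop_sum)
  finally show ?thesis .
 qed
 have B: "cpair (adK (?w x)) s k m x = (SUM i:set l. SUM j:set l'. BB (KK m k) s k m i j x)"
  if km: "k : set l'" "m : set l' - {k}" for k m
 proof -
  have dk: "k : set l'" "m : set l'" "k ~= m" using km by auto
  note c = cyc_at_split_cycle[OF s(2) dk]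
  let ?s = "cut s k m"
  have cl: "cycle ?s l" by (rule cycle_cut_other[OF s(1)]) (use dk s(3) in auto)
  have cc: "cycle ?s (cyc_at ?s m)" "cycle ?s (cyc_at ?s k)" using cycle_cyc_at(1)[OF c(5)] dk by auto
  have dj: "set l Int cset ?s m = {}" "set l Int cset ?s k = {}" using c(4) s(3) by auto
  \<comment> \<open>The bracket with one of the two pieces is read from that piece's own slot
    \<open>a\<close>, so both halves of the adjoint action take the form
    \<open>KK m k\<close>.\<close>
  have half: "f (Wbr (?w y) (orb ?s y a)) = (SUM i:set l. SUM j:cset ?s a. Bop i j (%z. f (orb (cut ?s i j) z a)) y)"
   if f: "character R W f" and y: "labelling y" and a: "a : {k, m}" for f y a
  proof -
   have ca: "cycle ?s (cyc_at ?s a)" "set l Int cset ?s a = {}" using a cc dj by auto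
   have "a : cset ?s a" using cycle_cyc_at(2)[OF c(5)] a dk by auto
   then have "orb (cut ?s i j) z i = orb (cut ?s i j) z a" if "labelling z" "i : set l" "j : cset ?s a" for i j z
    using cset_cut_two[OF cl ca that(2,3)] orb_eq[OF that(1), of "cut ?s i j" "set l Un cset ?s a" i a] that
    by simp
   then show ?thesis
    unfolding character_word_word[OF f y cl ca] by (intro sum.cong refl Bop_cong[OF y]) simp
  qed
  have same: "orb ?s y a = orb (cut ?s i j) z a"
   if ab: "(a = k & b = m) | (a = m & b = k)" and ij: "i : set l" "j : cset ?s b"
    and z: "!!n. n ~= i ==> n ~= j ==> z n = y n" for a b i j y z
  proof -
   have a: "a : set l'" using ab dk by auto
   have n: "i ~: cset ?s a" "j ~: cset ?s a" using ab ij dj c(3) by auto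
   obtain A where A: "cyc_at ?s a = a # A" by (rule permutes_onD[OF c(5) a])
   have "cycle (cut ?s i j) (cyc_at ?s a)"
    by (rule cycle_cut_other[OF cycle_cyc_at(1)[OF c(5) a] n])
   then have "cyc_at (cut ?s i j) a = cyc_at ?s a" unfolding A by (rule cyc_at_eq)
   moreover have "map y (cyc_at ?s a) = map z (cyc_at ?s a)" using n by (intro map_cong refl z[symmetric]) auto
   ultimately show ?thesis by (simp only:)
  qed
  have "Bop k m (%y. adK (?w x) (orb ?s y m) (orb ?s y k)) x =
    Bop k m (%y. SUM i:set l. SUM j:set l'. Bop i j (KK m k (cut ?s i j)) y) x"
  proof (rule Bop_cong_off[OF x])
   fix y assume y: "labelling y" and z: "!!n. n ~= k ==> n ~= m ==> y n = x n"
   have "map x l = map y l" using z dk s(3) by (intro map_cong refl) (metis disjoint_iff)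
   then have e: "?w x = ?w y" by (simp only:)
   have "Bop i j (%z. K (orb (cut ?s i j) z m) (orb ?s y k)) y = Bop i j (KK m k (cut ?s i j)) y"
    if "i : set l" "j : cset ?s m" for i j
   proof (rule Bop_cong_off[OF y])
    fix z assume z: "!!n. n ~= i ==> n ~= j ==> z n = y n"
    have "orb ?s y k = orb (cut ?s i j) z k" by (rule same[of k m]) (use that z in auto)
    then show "K (orb (cut ?s i j) z m) (orb ?s y k) = KK m k (cut ?s i j) z"
     by (simp only: KK_def)
   qed
   then have "K (Wbr (?w y) (orb ?s y m)) (orb ?s y k) = (SUM i:set l. SUM j:cset ?s m. Bop i j (KK m k (cut ?s i j)) y)"
    unfolding half[OF K_character(2)[OF wc[OF y]] y insertI2[OF singletonI]]
    by (intro sum.cong refl)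
   moreover have "Bop i j (%z. K (orb ?s y m) (orb (cut ?s i j) z k)) y = Bop i j (KK m k (cut ?s i j)) y"
    if "i : set l" "j : cset ?s k" for i j
   proof (rule Bop_cong_off[OF y])
    fix z assume z: "!!n. n ~= i ==> n ~= j ==> z n = y n"
    have "orb ?s y m = orb (cut ?s i j) z m" by (rule same[of m k]) (use that z in auto)
    then show "K (orb ?s y m) (orb (cut ?s i j) z k) = KK m k (cut ?s i j) z"
     by (simp only: KK_def)
   qed
   then have "K (orb ?s y m) (Wbr (?w y) (orb ?s y k)) = (SUM i:set l. SUM j:cset ?s k. Bop i j (KK m k (cut ?s i j)) y)"
    unfolding half[OF K_character(1)[OF wc[OF y]] y insertI1]
    by (intro sum.cong refl)
   moreover have "(SUM j:set l'. f j) = (SUM j:cset ?s m. f j) + (SUM j:cset ?s k. f j)" for f :: "nat => 'k => ratz"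
    unfolding c(4)[symmetric] by (rule sum.union_disjoint) (use c(3) in auto)
   ultimately show "adK (?w x) (orb ?s y m) (orb ?s y k) = (SUM i:set l. SUM j:set l'. Bop i j (KK m k (cut ?s i j)) y)"
    unfolding e adK_def by (simp only: sum.distrib)
  qed
  then show ?thesis unfolding cpair_def BB_def by (simp only: Bop_sum)
 qed
 show ?thesis
  unfolding wsum_word[OF adK_bilin[OF wc[OF x]] x s(2)] csum_def
  by (simp only: C B sum.distrib cong: sum.cong)
qed

text \<open>The terms of the cobracket of a joined word whose second cut stays on the side of
  \<open>l'\<close> are those of bracketing with the cobracket of \<open>l'\<close>.\<close>

lemma surg_half:
 "(SUM i:set l. SUM j:set l'. (SUM m:set l' - {j}. BB (KK m i) s i j i m x + BB (KK i m) s i j m i x) +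
   (SUM k:set l'. SUM m:set l' - {k}. BB (KK m k) s i j k m x)) =
  (SUM k:set l'. SUM m:set l' - {k}. SUM i:set l. SUM j:set l'. BB (KK m k) s k m i j x)"
proof (rule half_surg_sum[of "set l" "set l'" "%i j k m. BB (KK m k) s i j k m x" "%k m i j. BB (KK m k) s k m i j x"])
 fix i j k m assume "i : set l" "j : set l'" "k : set l'" "m : set l'" "distinct [j, k, m]"
 then have "distinct [i, j, k, m]" using s(3) by auto
 from BB_commute[OF this] show "BB (KK m k) s i j k m x = BB (KK m k) s k m i j x" by (simp only:)
next
 fix i j m assume i: "i : set l" and jm: "j : set l'" "m : set l'" "j ~= m"
 let ?N = "set l Un set l'"
 have d: "distinct [i, j, m]" using i jm s(3) by auto
 have N: "{i, j, m} <= ?N" "i : ?N" "m : ?N" "i ~= m" using i jm d by auto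
 let ?t = "cut (cut s j m) i j"
 have t: "cut (cut s i j) m i = ?t" "cut (cut s i j) i m = ?t" "cut (cut s m i) j m = ?t"
  "cut (cut s i m) j m = ?t" "cut (cut s i m) m j = ?t" "cut (cut s m j) i j = ?t"
  using cut_three[OF d, of s] by (simp_all add: cut_sym[of s m i, symmetric] cut_sym[of s m j]
   cut_sym[of _ i m] cut_sym[of _ m j])
 have sl: "slin ?N (KK m i ?t)" "slin ?N (KK i m ?t)"
  using KK_slin[OF i jm(1) N(2-4)] unfolding t .
 \<comment> \<open>After both cuts \<open>i\<close> and \<open>j\<close> lie on the same piece. This
   lets the three terms of the double Jacobi identity use one test function.\<close>
 have orb: "orb ?t y j = orb ?t y i" if y: "labelling y" for y
 proof -
  obtain A where A: "cycle s (i # A)" "set (i # A) = set l" using cycle_at[OF s(1) i] by metis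
  obtain B where B: "cycle s (j # B)" "set (j # B) = set l'" using cycle_at[OF s(2) jm(1)] by metis
  obtain C E where CE: "B = C @ m # E" using B(2) jm split_list[of m B] by (metis set_ConsD)
  have "cycle (cut s i j) (i # B @ j # A)" by (rule cycle_join[OF A(1) B(1)]) (use A(2) B(2) s(3) in auto)
  then have "cycle (cut s i j) (i # C @ m # (E @ j # A))" by (simp add: CE)
  from cyc_at_eq[OF cycle_split(1)[OF this]] have j: "j : cset ?t i" unfolding t by simp
  have "permutes_on ?t ?N" unfolding t(2)[symmetric]
   by (rule permutes_on_cut[OF cset_cut_two(3)[OF s i jm(1)] N(2-4)])
  from orb_eq[OF y this N(2) j] show ?thesis .
 qed
 have e: "BB (KK m j) s i m j m x = BB (KK m i) s i m j m x" "BB (KK m j) s j m i j x = BB (KK m i) s j m i j x"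
  "BB (KK j m) s i m m j x = BB (KK i m) s i m m j x" "BB (KK j m) s m j i j x = BB (KK i m) s m j i j x"
  by (rule BB_cong[OF x], (unfold t)?, simp only: KK_def orb)+
 have jac: "BB F s j m i j x + BB F s m i j m x + BB F s i j m i x = 0"
  "BB F s i j i m x = - BB F s i j m i x" "BB F s i m j m x = - BB F s m i j m x"
  "BB F s i m m j x = - BB F s i m j m x" "BB F s m j i j x = - BB F s j m i j x" if F: "slin ?N (F ?t)" for F
 proof -
  show "BB F s j m i j x + BB F s m i j m x + BB F s i j m i x = 0" by (rule BB_jacobi[where F = F, OF x F N(1) d])
  show "BB F s i j i m x = - BB F s i j m i x"
   by (rule BB_swap(2)[where F = F and N = ?N, OF x]) (use F N d t in auto)
  show "BB F s i m j m x = - BB F s m i j m x"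
   by (rule BB_swap(1)[where F = F and N = ?N, OF x]) (use F N d t in auto)
  show "BB F s i m m j x = - BB F s i m j m x"
   by (rule BB_swap(2)[where F = F and N = ?N, OF x]) (use F N d t in auto)
  show "BB F s m j i j x = - BB F s j m i j x"
   by (rule BB_swap(1)[where F = F and N = ?N, OF x]) (use F N d t in auto)
 qed
 have sum3: "a = - c - b" if "a + b + c = 0" for a b c :: "'k => ratz"
 proof -
  have "a = (a + b + c) - c - b" by simp
  then show ?thesis using that by simp
 qed
 show "BB (KK m i) s i j i m x + BB (KK m j) s i m j m x = BB (KK m j) s j m i j x"
  using sum3[OF jac(1)[of "KK m i", OF sl(1)]] unfolding e jac(2,3)[of "KK m i", OF sl(1)] by simp
 show "BB (KK i m) s i j m i x + BB (KK j m) s i m m j x = BB (KK j m) s m j i j x"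
  using sum3[OF jac(1)[of "KK i m", OF sl(2)]]
  unfolding e jac(3-5)[of "KK i m", OF sl(2)] by (simp add: jac(3)[of "KK i m", OF sl(2)])
qed simp_all

text \<open>Joining at \<open>i\<close>, \<open>j\<close> and splitting at \<open>k\<close>,
  \<open>m\<close> yields the same two pieces as joining at \<open>k\<close>, \<open>m\<close> and
  splitting at \<open>i\<close>, \<open>j\<close>: \<open>i\<close> is on the piece of
  \<open>m\<close>, and \<open>j\<close> on that of \<open>k\<close>. The sign comes from the order
  of \<open>j\<close> and \<open>i\<close>.\<close>

lemma surg_cross:
 assumes i: "i : set l" "k : set l" "i ~= k" and j: "j : set l'" "m : set l'" "j ~= m"
 shows "BB (KK i j) s k m j i x = - BB (KK m k) s i j k m x"
proof -
 let ?N = "set l Un set l'" and ?t = "cut (cut s i j) k m"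
 have N: "i : ?N" "j : ?N" "k : ?N" "m : ?N" "k ~= m" "j ~= i" "k ~= m" using i j s(3) by auto
 have d: "distinct [i, j, k, m]" using i j s(3) by auto
 obtain A where A: "cycle s (i # A)" "set (i # A) = set l" using cycle_at[OF s(1) i(1)] by metis
 obtain B where B: "cycle s (j # B)" "set (j # B) = set l'" using cycle_at[OF s(2) j(1)] by metis
 obtain A1 A2 where A12: "A = A1 @ k # A2" using A(2) i split_list[of k A] by (metis set_ConsD)
 obtain B1 B2 where B12: "B = B1 @ m # B2" using B(2) j split_list[of m B] by (metis set_ConsD)
 have "cycle (cut s i j) (i # B @ j # A)" by (rule cycle_join[OF A(1) B(1)]) (use A(2) B(2) s(3) in auto)
 from cycle_rotate[OF this, of "length (i # B1)"]
 have "cycle (cut s i j) (m # (B2 @ j # A1) @ k # (A2 @ i # B1))"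
  using rotate_append[of "i # B1" "m # B2 @ j # A"] by (simp add: A12 B12)
 note c = cycle_split[OF this, unfolded cut_sym[of _ m k]]
 have mem: "i : cset ?t m" "j : cset ?t k" using cyc_at_eq[OF c(1)] cyc_at_eq[OF c(2)] by auto
 have p: "permutes_on ?t ?N"
  by (rule permutes_on_cut[OF cset_cut_two(3)[OF s i(1) j(1)] N(3-5)])
 have "BB (KK i j) s k m j i x = - BB (KK i j) s k m i j x"
  by (rule BB_swap(2)[where F = "KK i j" and N = ?N, OF x])
   (use KK_slin[OF i(2) j(2) N(1,2)] N d in auto)
 also have "BB (KK i j) s k m i j x = BB (KK i j) s i j k m x" using BB_commute[OF d] by simp
 also have "... = BB (KK m k) s i j k m x"
  by (rule BB_cong[OF x]) (simp only: KK_def orb_eq[OF _ p N(4) mem(1)] orb_eq[OF _ p N(3) mem(2)])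
 finally show ?thesis .
qed

end

text \<open>Of the terms of the cobracket of the bracket, those with coactions and those with a cut
  on one side reappear in the two adjoint expressions. What remains are cuts at the slots just
  joined; by condition (6) they equal the terms where an element of \<open>L\<close> split off one
  word acts on the other.\<close>

lemma defect_word_word:
 assumes x: "labelling x" and s: "cycle s l" "cycle s l'" "set l Int set l' = {}"
 shows "defect (word (map x l)) (word (map x l')) = 0"
proof -
 let ?N = "set l Un set l'" and ?w = "%y. word (map y l)" and ?w' = "%y. word (map y l')"
 let ?F = "%y. K (?w' y) (?w y) - K (?w y) (?w' y)"
 have s': "set l' Int set l = {}" using s(3) by blast
 note d = cycle_distinct[OF s(1)] cycle_distinct[OF s(2)]
 have ne: "i ~= j" if "i : set l" "j : set l'" for i j using that s(3) by auto
 define SB where "SB = (SUM k:set l'. SUM m:set l' - {k}. SUM i:set l. SUM j:set l'. BB (KK m k) s k m i j x)"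
 define SA where "SA = (SUM k:set l. SUM m:set l - {k}. SUM i:set l'. SUM j:set l. BB (KK m k) s k m i j x)"
 define c where "c k i j = Cop k (%g. Bop i j (MO i j s g)) x" for i j k
 have BB: "(SUM i:set l. SUM j:set l'. SUM k:?N. SUM m:?N - {k}. BB (KK m k) s i j k m x) =
   (SUM i:set l. SUM j:set l'. BB (KK j i) s i j i j x + BB (KK i j) s i j j i x) + SB - SA"
 proof (rule surg_sum[of "set l" "set l'" "%i j k m. BB (KK m k) s i j k m x"])
  show "BB (KK m k) s j i k m x = - BB (KK m k) s i j k m x"
   if "i : set l" "j : set l'" "k : ?N" "m : ?N" "k ~= m" for i j k m
   by (rule BB_swap(1)[where F = "KK m k" and N = ?N, OF x])
    (use KK_slin[OF x s that] that ne in auto)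
 qed (use surg_cross[OF x s] surg_half[OF x s] surg_half[OF x s(2,1) s'] s(3) in "auto simp: SA_def SB_def")
 have "(SUM i:set l. SUM j:set l'. BB (KK j i) s i j i j x + BB (KK i j) s i j j i x) =
   (SUM i:set l. SUM j:set l'. Cop j (%g y. ?F (Aop g i y)) x + Cop i (%g y. ?F (Aop g j y)) x)"
 proof (intro sum.cong refl)
  fix i j assume ij: "i : set l" "j : set l'"
  have N: "i : ?N" "j : ?N" "i ~= j" using ij ne by auto
  obtain n where n: "cyc_at s i = rotate n l" using cycle_permutes_on(3)[OF s(1) ij(1)] by blast
  obtain n' where n': "cyc_at s j = rotate n' l'" using cycle_permutes_on(3)[OF s(2) ij(2)] by blast
  have orb: "orb s y i = ?w y" "orb s y j = ?w' y" if "labelling y" for y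
   using rot_inv_rotate[OF word_rotate labelling_map[OF that]] by (simp_all only: n n' rotate_map[symmetric])
  have F: "slin ?N ?F"
  proof -
   have "slin (set l' Un set l) (%y. K (?w' y) (?w y))" by (rule word_bilin_slin[OF K d(2,1) s'])
   moreover have "slin ?N (%y. K (?w y) (?w' y))" by (rule word_bilin_slin[OF K d s(3)])
   ultimately show ?thesis using slin_add[OF _ slin_minus] by (fastforce simp: Un_commute)
  qed
  have "BB (KK i j) s i j j i x = - BB (KK i j) s i j i j x"
   by (rule BB_swap(2)[where F = "KK i j" and N = ?N, OF x]) (use KK_slin[OF x s ij N] N in auto)
  \<comment> \<open>The second cut undoes the first, so the two orbits are the original
    words.\<close>
  moreover have "BB (KK j i) s i j i j x = Bop i j (Bop i j (%y. K (?w' y) (?w y))) x"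
   "BB (KK i j) s i j i j x = Bop i j (Bop i j (%y. K (?w y) (?w' y))) x"
   unfolding BB_def KK_def[abs_def] cut_cut by (intro Bop_cong[OF x] Bop_cong; simp only: orb)+
  ultimately have "BB (KK j i) s i j i j x + BB (KK i j) s i j j i x = Bop i j (Bop i j ?F) x"
   by (simp add: Bop_diff[abs_def] Bop_diff)
  then show "BB (KK j i) s i j i j x + BB (KK i j) s i j j i x =
    Cop j (%g y. ?F (Aop g i y)) x + Cop i (%g y. ?F (Aop g j y)) x"
   using Bop_Bop[OF slin_mono[OF F] x N(3)] N by simp
 qed
 also have "... = (SUM j:set l'. SUM i:set l. Cop j (%g y. ?F (Aop g i y)) x) -
   (SUM i:set l. SUM j:set l'. Cop i (%g y. K (?w (Aop g j y)) (?w' (Aop g j y)) - K (?w' (Aop g j y)) (?w (Aop g j y))) x)"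
 proof -
  have "Cop i (%g y. ?F (Aop g j y)) x =
    - Cop i (%g y. K (?w (Aop g j y)) (?w' (Aop g j y)) - K (?w' (Aop g j y)) (?w (Aop g j y))) x" for i j
   unfolding Cop_minus[symmetric] by simp
  moreover have "(SUM i:set l. SUM j:set l'. Cop j (%g y. ?F (Aop g i y)) x) =
    (SUM j:set l'. SUM i:set l. Cop j (%g y. ?F (Aop g i y)) x)"
   by (rule sum.swap)
  ultimately show ?thesis by (simp only: sum.distrib sum_negf diff_conv_add_uminus)
 qed
 finally have FF: "(SUM i:set l. SUM j:set l'. BB (KK j i) s i j i j x + BB (KK i j) s i j j i x) = ..." .
 \<comment> \<open>The joined word is the same whether read from \<open>i\<close> or from
   \<open>j\<close>; exchanging the slots changes the sign of the bracket.\<close>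
 have "Cop k (%g. Bop j i (MO j i s g)) x = - c k i j" if ij: "i : set l" "j : set l'" for i j k
  unfolding c_def Cop_minus[symmetric]
 proof (rule Cop_cong[OF x])
  fix g y assume a: "g : carrier L" and y: "labelling y"
  note q = cset_cut_two[OF s ij]
  have N: "i : ?N" "{i, j} <= ?N" using ij by auto
  have "j : cset (cut s i j) i" using q(1) ij by simp
  note e = orb_eq[OF _ q(3) N(1) this]
  have "Bop j i (MO j i s g) y = Bop j i (MO i j s g) y"
   unfolding MO_def[abs_def] cut_sym[of s j i] by (intro Bop_cong[OF y]) (simp only: e)
  also have "slin {i, j} (MO i j s g)"
   using MO_slinL[OF x s ij] a N(2) by (auto simp: slinL_def intro: slin_mono)
  from Bop_antisym[OF this y q(4)] have "Bop j i (MO i j s g) y = - Bop i j (MO i j s g) y" .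
  finally show "Bop j i (MO j i s g) y = - Bop i j (MO i j s g) y" .
 qed
 then have "(SUM j:set l'. SUM i:set l. Cop k (%g. Bop j i (MO j i s g)) x) = (SUM j:set l'. SUM i:set l. - c k i j)" for k
  by (intro sum.cong refl)
 then have anti: "(SUM j:set l'. SUM i:set l. Cop k (%g. Bop j i (MO j i s g)) x) = - (SUM i:set l. SUM j:set l'. c k i j)" for k
  by (simp only: sum_negf) (simp only: sum.swap[of _ "set l" "set l'"])
 have cs: "(SUM i:set l. SUM j:set l'. SUM k:?N. c k i j) =
   (SUM k:set l'. SUM i:set l. SUM j:set l'. c k i j) + (SUM k:set l. SUM i:set l. SUM j:set l'. c k i j)"
 proof -
  have "(SUM i:set l. SUM j:set l'. SUM k:?N. c k i j) = (SUM k:?N. SUM i:set l. SUM j:set l'. c k i j)"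
   by (subst (2) sum.swap, subst sum.swap, rule refl)
  then show ?thesis using s(3) by (simp add: sum.union_disjoint add_ac)
 qed
 show ?thesis
  unfolding defect_def wsum_bracket_words[OF x s] wsumK_word[OF x s] wsumK_word[OF x s(2,1) s']
   BB FF anti SA_def[symmetric] SB_def[symmetric]
  using cs by (simp add: c_def[symmetric] sum_negf algebra_simps)
qed

lemma defect_zero:
 assumes pq: "p : carrier W" "q : carrier W"
 shows "defect p q = 0"
proof (rule W_bilin_zeroI[OF defect_bilin defect_lie_lie defect_lie_word _ defect_word_word pq])
 fix g x and s :: "nat => nat" and l assume a: "g : carrier L" "labelling x" "cycle s l"
 show "defect (word (map x l)) (lie g) = 0"
  using defect_antisym[OF W_closed(1)[OF a(1)] W_closed(2)[OF labelling_map[OF a(2)]], of l] defect_lie_word[OF a]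
  by (simp add: fun_eq_iff)
qed

end

theorem W_lie_bialgebra: "lie_bialgebra R W Wbr Wcobr"
 unfolding lie_bialgebra_def
proof (intro conjI ballI W_lie_algebra W_lie_coalgebra)
 interpret WW: module R WW by (rule WWM)
 fix p q assume pq: "p : carrier W" "q : carrier W"
 note c = Wcobr_closed[OF pq(1)] Wcobr_closed[OF pq(2)] Wcobr_closed[OF bilinC[OF Wbr_bilin pq]]
 note a = adj_closed[OF W_mod Wbr_bilin]
 show "Wcobr (Wbr p q) = -[WW] adj R W Wbr q (Wcobr p) +[WW] adj R W Wbr p (Wcobr q)"
 proof (rule tensor_eqI[OF W_mod W_mod c(3)])
  show "-[WW] adj R W Wbr q (Wcobr p) +[WW] adj R W Wbr p (Wcobr q) : carrier WW"
   using pq c a by simp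
  fix K assume K: "bilin R W W G K"
  have "wsum (-[WW] adj R W Wbr q (Wcobr p) +[WW] adj R W Wbr p (Wcobr q)) K =
    - wsum (Wcobr p) (adK K q) + wsum (Wcobr q) (adK K p)"
   using pq c a by (simp add: psumt_add[OF W_mod W_mod K] psumt_minus[OF W_mod W_mod K]
    psum_adj[OF W_mod Wbr_bilin _ _ K] adK_def[OF K, abs_def])
  moreover have "wsum (Wcobr (Wbr p q)) K = - wsum (Wcobr p) (adK K q) + wsum (Wcobr q) (adK K p)"
   using defect_zero[OF K pq] unfolding defect_def[OF K] by (simp add: algebra_simps eq_neg_iff_add_eq_0)
  ultimately show "wsum (Wcobr (Wbr p q)) K = wsum (-[WW] adj R W Wbr q (Wcobr p) +[WW] adj R W Wbr p (Wcobr q)) K"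
   by simp
 qed
qed

end

lemma quads_triples:
 assumes "(i, j, k, m) : quads l"
 shows "(i, j, k) : triples l" "(i, k, m) : triples l"
proof -
 obtain n A B C E where r: "rotate n l = i # A @ j # B @ k # C @ m # E" by (rule quadsE[OF assms])
 show "(i, j, k) : triples l" unfolding triples_def using r by blast
 have "rotate n l = i # (A @ j # B) @ k # C @ m # E" using r by simp
 then show "(i, k, m) : triples l" unfolding triples_def by blast
qed

context double_lie_data
begin

section \<open>Involutivity\<close>

context
 fixes h and x and s :: "nat => nat" and l b
 assumes inv: "involutive_double_lie_bimodule R L br \<delta> I P \<rho> \<sigma> D"
  and h: "character R W h" and x: "labelling x" and s: "cycle s l" and b: "b : set l"
begin

text \<open>Splitting and then joining the two pieces restores a single cycle on all slots of
  \<open>l\<close>; reading it from a fixed slot makes all terms comparable.\<close>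

definition "HH t y = h (orb t y b)"

text \<open>At a single slot, coaction followed by action is zero by involutivity of the
  bimodule.\<close>

lemma Cop_Aop_diagonal:
 assumes i: "i : set l"
 shows "Cop i (%g y. h (word (map (Aop g i y) l))) x = 0"
proof -
 have "llin (%u. h (word (map (x(i := u)) l)))"
  by (rule slot_linD[OF lie_wlin[OF h x cycle_distinct[OF s]] x i])
 from co_ac_involutive[OF inv this labellingD[OF x, of i]] show ?thesis
  by (simp add: Cop_def Aop_def)
qed

lemma HH_slin:
 assumes ij: "i : set l" "j : set l" "i ~= j"
  and km: "k : cset (cut s i j) j" "m : cset (cut s i j) i"
 shows "slin (set l) (HH (cut (cut s i j) k m))"
  "labelling y ==> orb (cut (cut s i j) k m) y k = orb (cut (cut s i j) k m) y b"
proof -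
 note c = cyc_at_split_cycle[OF s ij]
 have cc: "cycle (cut s i j) (cyc_at (cut s i j) j)" "cycle (cut s i j) (cyc_at (cut s i j) i)"
  using cycle_cyc_at(1)[OF c(5)] ij by auto
 note q = cset_cut_two[OF cc c(3) km, unfolded c(4)]
 have k: "k : set l" using km(1) c(4) by auto
 have "cset (cut (cut s i j) k m) b = set l"
  using cyc_at_member(2)[OF q(3) k, of b] q(1) b by simp
 then show "slin (set l) (HH (cut (cut s i j) k m))"
  using orb_slin[OF h q(3) b] by (simp add: HH_def[abs_def])
 show "orb (cut (cut s i j) k m) y k = orb (cut (cut s i j) k m) y b" if "labelling y"
  using orb_eq[OF that q(3) k, of b] q(1) b by simp
qed

lemma bracket_cpair:
 assumes ij: "i : set l" "j : set l - {i}"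
 shows "cpair (%a b. h (Wbr a b)) s i j x =
  (SUM k:cset (cut s i j) j. SUM m:cset (cut s i j) i. BB HH s i j k m x)"
proof -
 have d: "i : set l" "j : set l" "i ~= j" using ij by auto
 note c = cyc_at_split_cycle[OF s d]
 have cc: "cycle (cut s i j) (cyc_at (cut s i j) j)" "cycle (cut s i j) (cyc_at (cut s i j) i)"
  using cycle_cyc_at(1)[OF c(5)] d by auto
 have "Bop i j (%y. h (Wbr (orb (cut s i j) y j) (orb (cut s i j) y i))) x =
   Bop i j (%y. SUM k:cset (cut s i j) j. SUM m:cset (cut s i j) i.
    Bop k m (HH (cut (cut s i j) k m)) y) x"
 proof (rule Bop_cong[OF x])
  fix y assume y: "labelling y"
  show "h (Wbr (orb (cut s i j) y j) (orb (cut s i j) y i)) =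
    (SUM k:cset (cut s i j) j. SUM m:cset (cut s i j) i. Bop k m (HH (cut (cut s i j) k m)) y)"
   unfolding character_word_word[OF h y cc c(3)]
   by (intro sum.cong refl Bop_cong[OF y]) (simp only: HH_def HH_slin(2)[OF d])
 qed
 then show ?thesis by (simp only: cpair_def BB_def Bop_sum)
qed

lemma BB_HH_swap:
 assumes ij: "i : set l" "j : set l" "i ~= j"
  and km: "k : cset (cut s i j) j" "m : cset (cut s i j) i"
 shows "BB HH s j i k m x = - BB HH s i j k m x" "BB HH s i j m k x = - BB HH s i j k m x"
  "BB HH s j i m k x = BB HH s i j k m x"
proof -
 note c = cyc_at_split_cycle[OF s ij]
 have km': "k ~= m" "k : set l" "m : set l" using c(3,4) km by auto
 note F = HH_slin(1)[OF ij km]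
 note sw = BB_swap[where F = HH and N = "set l", OF x]
 show "BB HH s j i k m x = - BB HH s i j k m x" by (rule sw(1)) (use F km' ij in auto)
 show 1: "BB HH s i j m k x = - BB HH s i j k m x" by (rule sw(2)) (use F km' ij in auto)
 have "BB HH s j i m k x = - BB HH s i j m k x"
  by (rule sw(1)) (use F km' ij in "auto simp: cut_sym[of _ m k]")
 then show "BB HH s j i m k x = BB HH s i j k m x" using 1 by simp
qed

text \<open>\<open>sum_split_across\<close> sorts the terms by the slots where the pieces are joined
  again. At the original slots, condition (6) gives action-coaction terms that cancel those from the
  coaction part; one shared slot gives orbits killed by the double Jacobi identity; four alternating
  slots change sign under rotation.\<close>

lemma bracket_cobr_word: "wsum (Wcobr (word (map x l))) (%a b. h (Wbr a b)) = 0"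
proof -
 note cd = cycle_distinct[OF s]
 let ?F = "%y. h (word (map y l))"
 note F = lie_wlin[OF h x cd]
 define c where "c i k = Cop i (%g y. ?F (Aop g k y)) x" for i k
 have tr: "j : cset (cut s i j) j" "i : cset (cut s i j) i" if "i : set l" "j : set l" "i ~= j" for i j
  by (rule split_cycle[OF s that], simp)+
 have 1: "Cop i (%g y. h (Wbr (lie g) (word (map y l))) - h (Wbr (word (map y l)) (lie g))) x =
   (SUM k:set l - {i}. c i k) + (SUM k:set l - {i}. c i k)" if i: "i : set l" for i
 proof -
  have "Cop i (%g y. h (Wbr (lie g) (word (map y l))) - h (Wbr (word (map y l)) (lie g))) x =
    Cop i (%g y. (SUM k:set l. ?F (Aop g k y)) + (SUM k:set l. ?F (Aop g k y))) x"
   by (rule Cop_cong[OF x]) (simp add: character_lie_word[OF h _ _ cd])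
  also have "... = (SUM k:set l. c i k) + (SUM k:set l. c i k)" unfolding c_def Cop_add Cop_sum ..
  also have "(SUM k:set l. c i k) = (SUM k:set l - {i}. c i k)"
   using i Cop_Aop_diagonal[OF i] by (simp add: sum.remove[of "set l" i] c_def)
  finally show ?thesis .
 qed
 \<comment> \<open>Rejoining at the slots of the split restores \<open>s\<close>, so condition (6)
   applies; the sign is due to the opposite order of the slots.\<close>
 have 2: "BB HH s i j j i x = - (c j i + c i j)" if ij: "i : set l" "j : set l - {i}" for i j
 proof -
  have d: "i : set l" "j : set l" "i ~= j" using ij by auto
  have orb: "orb s y b = word (map y l)" if "labelling y" for y
  proof -
   obtain n where "cyc_at s b = rotate n l" using cycle_permutes_on(3)[OF s b] by blast
   then show ?thesis using rot_inv_rotate[OF word_rotate labelling_map[OF that]]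
    by (simp only: rotate_map[symmetric])
  qed
  have "BB HH s i j i j x = Bop i j (Bop i j ?F) x"
   unfolding BB_def HH_def[abs_def] cut_cut by (intro Bop_cong[OF x] Bop_cong) (simp_all only: orb)
  also have "... = c j i + c i j"
   unfolding c_def by (rule Bop_Bop[OF slin_mono[OF F] x d(3)]) (use d in auto)
  finally show ?thesis using BB_HH_swap(2)[OF d tr[OF d]] by (metis minus_minus)
 qed
 have u: "(\<Sum>(i, j, k)\<in>triples l. BB HH s i j j k x) = 0"
 proof (rule sum_triples_eq_0[OF cd])
  fix i j k assume t: "(i, j, k) : triples l"
  note m = triples_mem[OF t] and m' = triples_mem[OF triples_mem(5)[OF t]]
  note d = m(4)[OF cd]
  have ne: "i ~= j" "j ~= k" "k ~= i" using d by auto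
  have mem: "k : cset (cut s i j) i" "i : cset (cut s j k) j" "j : cset (cut s k i) k"
   using cset_split_first[OF s m(1,2) ne(1)] cset_split_first[OF s m(2,3) ne(2)]
    cset_split_first[OF s m(3,1) ne(3)] t m(5) m'(5) by blast+
  have F1: "slin (set l) (HH (cut (cut s j k) i k))"
   using HH_slin(1)[OF m(2,3) ne(2) tr(1)[OF m(2,3) ne(2)] mem(2)] by (simp only: cut_sym[of _ k i])
  have "BB HH s j k i k x + BB HH s k i j i x + BB HH s i j k j x = 0"
   by (rule BB_jacobi'[where F = HH, OF x F1 _ d]) (use m in auto)
  then have "- (BB HH s i j j k x + BB HH s j k k i x + BB HH s k i i j x) = 0"
   by (simp add: BB_HH_swap(2)[OF m(1,2) ne(1) tr(1)[OF m(1,2) ne(1)] mem(1)]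
    BB_HH_swap(2)[OF m(2,3) ne(2) tr(1)[OF m(2,3) ne(2)] mem(2)]
    BB_HH_swap(2)[OF m(3,1) ne(3) tr(1)[OF m(3,1) ne(3)] mem(3)] algebra_simps)
  then show "BB HH s i j j k x + BB HH s j k k i x + BB HH s k i i j x = 0" using neg_equal_0_iff_equal by blast
 qed
 have "(\<Sum>(i, j, k)\<in>triples l. BB HH s j i k j x) = (\<Sum>(i, j, k)\<in>triples l. BB HH s i j j k x)"
 proof (intro sum.cong refl, clarify)
  fix i j k assume t: "(i, j, k) : triples l"
  note m = triples_mem[OF t]
  have ne: "i ~= j" using m(4)[OF cd] by auto
  have k: "k : cset (cut s i j) i" using cset_split_first[OF s m(1,2) ne] t by blast
  show "BB HH s j i k j x = BB HH s i j j k x" by (rule BB_HH_swap(3)[OF m(1,2) ne tr(1)[OF m(1,2) ne] k])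
 qed
 note u' = this[unfolded u]
 \<comment> \<open>Rotating the quadruple interchanges the two surgeries and reverses the slots of
   one of them, hence the sign.\<close>
 have v: "(\<Sum>(i, j, k, m)\<in>quads l. BB HH s i k j m x) = 0"
 proof (rule sum_quads_eq_0[OF cd, of "%i j k m. BB HH s i k j m x"])
  fix i j k m assume t: "(i, j, k, m) : quads l"
  note mm = quads_mem[OF t] and t3 = quads_triples[OF t] and t3' = quads_triples[OF quads_mem(6)[OF t]]
  have d: "distinct [i, k, j, m]" "i ~= k" "j ~= m" using mm(5)[OF cd] by auto
  have k: "k : cset (cut s j m) m" using cset_split_second[OF s mm(2,4) d(3)] t3'(1) by blast
  have i: "i : cset (cut s j m) j" using cset_split_first[OF s mm(2,4) d(3)] t3'(2) by blast
  have "BB HH s j m i k x = - BB HH s j m k i x" by (rule BB_HH_swap(2)[OF mm(2,4) d(3) k i])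
  then show "BB HH s j m k i x = - BB HH s i k j m x" using BB_commute[OF d(1), of HH s] by simp
 qed
 have "(SUM i:set l. SUM j:set l - {i}. c j i) = (SUM i:set l. SUM j:set l - {i}. c i j)"
  by (rule sum_off_diagonal_swap) simp
 then have diag: "(SUM i:set l. SUM j:set l - {i}. BB HH s i j j i x) =
   - ((SUM i:set l. SUM j:set l - {i}. c i j) + (SUM i:set l. SUM j:set l - {i}. c i j))"
  using 2 by (simp add: sum.distrib sum_negf sum_subtractf)
 have pairs: "(SUM i:set l. SUM j:set l - {i}. cpair (%a b. h (Wbr a b)) s i j x) =
   (SUM i:set l. SUM j:set l - {i}. SUM k:cset (cut s i j) j. SUM m:cset (cut s i j) i. BB HH s i j k m x)"
  by (intro sum.cong refl bracket_cpair)
 show ?thesis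
  unfolding wsum_word[OF bilin_comp[OF Wbr_bilin h] x s] csum_def pairs
   sum_split_across[OF s, of "%i j k m. BB HH s i j k m x"] u u' v diag
  by (simp add: 1 sum.distrib)
qed

end

theorem W_involutive:
 assumes inv: "involutive_double_lie_bimodule R L br \<delta> I P \<rho> \<sigma> D"
 shows "involutive_lie_bialgebra R W Wbr Wcobr"
 unfolding involutive_lie_bialgebra_def
proof (intro conjI ballI W_lie_bialgebra)
 interpret W: module R W by (rule W_mod)
 fix p assume p: "p : carrier W"
 note c = Wcobr_closed[OF p]
 show "tlift R W Wbr (Wcobr p) = 0[W]"
 proof (rule character_sep[OF W_mod])
  show "tlift R W Wbr (Wcobr p) : carrier W" by (rule linC[OF tlift_lin[OF W_mod W_mod W_mod Wbr_bilin] c])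
  show "0[W] : carrier W" by simp
  fix h assume h: "character R W h"
  have "wsum (Wcobr p) (%a b. h (Wbr a b)) = 0"
  proof (rule W_zeroI[OF wsum_character[OF bilin_comp[OF Wbr_bilin h]] _ _ p])
   fix g assume a: "g : carrier L"
   have "psum (dl g) (%d t. h (Wbr (lie d) (lie t))) = psum (dl g) (%d t. h (lie (br d t)))"
    by (rule psum_cong) (use dl_mem[OF a] in "simp add: Wbr_lie_lie")
   then show "wsum (Wcobr (lie g)) (%a b. h (Wbr a b)) = 0"
    using dl_br_involutive[OF inv lin_comp[OF lie_lin h] a] wsum_lie[OF bilin_comp[OF Wbr_bilin h] a] by simp
  next
   fix w assume "w : words I P"
   then obtain x s l where w: "labelling x" "cycle s l" "w = map x l" by (rule word_exists_slots)
   obtain b where "b : set l" using w(2) hd_in_set unfolding cycle_def by blast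
   then show "wsum (Wcobr (word w)) (%a b. h (Wbr a b)) = 0"
    using bracket_cobr_word[OF inv h w(1,2)] w(3) by simp
  qed
  then show "h (tlift R W Wbr (Wcobr p)) = h 0[W]"
   unfolding character_tlift[OF W_mod W_mod W_mod h Wbr_bilin c] character_zero[OF W_mod h] .
 qed
qed

end

theorem theorem1p1:
  fixes R :: "'k ring"
    and L :: "('k, 'l) module"
    and br :: "'l \<Rightarrow> 'l \<Rightarrow> 'l"
    and \<delta> :: "'l \<Rightarrow> ('k, 'l, 'l) tensor"
    and I :: "'i set"
    and P :: "'i \<times> 'i \<Rightarrow> ('k, 'p) module"
    and \<rho> :: "'i \<times> 'i \<Rightarrow> 'l \<Rightarrow> 'p \<Rightarrow> 'p"
    and \<sigma> :: "'i \<times> 'i \<Rightarrow> 'p \<Rightarrow> ('k, 'l, 'p) tensor"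
    and D :: "('k, 'i, 'p) dbl"
  assumes "cring R"
    and "double_lie_bimodule R L br \<delta> I P \<rho> \<sigma> D"
  shows "lie_bialgebra R (W_mod R L I P)
           (W_bracket R L br I P \<rho> D) (W_cobracket R L \<delta> I P \<sigma> D) \<and>
         (involutive_double_lie_bimodule R L br \<delta> I P \<rho> \<sigma> D \<longrightarrow>
          involutive_lie_bialgebra R (W_mod R L I P)
            (W_bracket R L br I P \<rho> D) (W_cobracket R L \<delta> I P \<sigma> D))"
proof -
 interpret double_lie_data R L br \<delta> I P \<rho> \<sigma> D
  by (rule double_lie_data.intro[OF assms])
 show ?thesis using W_lie_bialgebra W_involutive by blast
qed

end
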